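(* Let $n\ge 1$ and let $q:\mathbb{R}^n_x\times\mathbb{R}^n_\xi\to\mathbb{C}$ be a complex-valued quadratic form with $\mathrm{Re}\,q\ge 0$ on $\mathbb{R}^{2n}$ and with zero singular space $S=\{0\}$. Let $F$ be the Hamilton map of $q$, for $\lambda\in\sigma(F)$ let $r_\lambda$ be the dimension of the space of generalized eigenvectors of $F$ in $\mathbb{C}^{2n}$ belonging to $\lambda$, and set $$\mu_0=\sum_{\lambda\in\sigma(F),\ \mathrm{Im}\,\lambda>0} -i\lambda\, r_\lambda,\qquad \tau_0=2\min_{\lambda\in\sigma(F),\ \mathrm{Im}\,\lambda>0}\mathrm{Im}\,\lambda ,\qquad Q=q^w(x,D_x)-\mu_0 .$$ Assume that the operator $q^w(x,D_x)$ is real, i.e. $q^w(x,D_x)u$ is real-valued whenever $u$ is real-valued, and that $$\mathrm{Ker}\big(q^w(x,D_x)-\mu_0\big)=\mathrm{Ker}\big(q^w(x,D_x)^*-\mu_0\big)=\mathbb{C}u_0\subset\mathscr{S}(\mathbb{R}^n),$$ where $u_0(x)=e^{-a(x)}$, $x\in\mathbb{R}^n$, with $a$ a positive definite quadratic form on $\mathbb{R}^n$. Then for every $0\le\tau<\tau_0$ there exists a constant $C>0$ such that $$\forall t\ge 0,\ \forall u\in L^2(\mathbb{R}^n),\qquad \|e^{-tQ}u-c_u u_0\|_{L^2(\mathbb{R}^n)}\le C e^{-\tau t}\|u\|_{L^2(\mathbb{R}^n)},$$ where $c_u=\|u_0\|_{L^2(\mathbb{R}^n)}^{-2}\,(u,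u_0)_{L^2(\mathbb{R}^n)}$.
   Context: Weyl quantization: for a complex-valued quadratic form $q$ on $\mathbb{R}^{2n}$, $$q^w(x,D_x)u(x)=\frac{1}{(2\pi)^n}\int_{\mathbb{R}^{2n}}e^{i(x-y)\cdot\xi}\,q\Big(\frac{x+y}{2},\xi\Big)u(y)\,dy\,d\xi .$$ Equivalently, it is the differential operator obtained by linearity from the rule that $x^\alpha\xi^\beta$ with $|\alpha+\beta|=2$ is quantized as $\tfrac12(x^\alpha D_x^\beta+D_x^\beta x^\alpha)$, $D_x=i^{-1}\partial_x$. It is considered as an unbounded operator on $L^2(\mathbb{R}^n)$ with the maximal domain $D(q)=\{u\in L^2(\mathbb{R}^n): q^w(x,D_x)u\in L^2(\mathbb{R}^n)\}$ (where $q^w(x,D_x)u$ is taken in the sense of distributions). When $\mathrm{Re}\,q\ge0$ this operator is maximally accretive, so $-q^w(x,D_x)$ generates a contraction semigroup $e^{-tq^w(x,D_x)}$, $t\ge0$, and $e^{-tQ}=e^{\mu_0 t}e^{-tq^w(x,D_x)}$. The $L^2$-adjoint $q^w(x,D_x)^*$ is the operator $\overline{q}^w(x,D_x)$ with its maximal domain. The scalar product is $(u,v)_{L^2}=\int_{\mathbb{R}^n}u\,\overline{v}\,dx$, and $\mathscr{S}(\mathbb{R}^n)$ is the Schwartz space. Hamilton map: $\sigma\big((x,\xi),(y,\eta)\big)=\xi\cdot y-x\cdot\eta$ is the canonical symplectic form on $\mathbb{R}^{2n}$, and $F\in M_{2n}(\mathbb{C})$ is the unique matrix with $q(X;Y)=\sigma(X,FY)$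 for all $X,Y\in\mathbb{R}^{2n}$, where $q(\cdot\,;\cdot)$ is the symmetric bilinear polarized form of $q$ (so $q(X;X)=q(X)$). $\sigma(F)$ denotes the spectrum of $F$. Write $\mathrm{Re}\,F=\frac12(F+\overline F)$ and $\mathrm{Im}\,F=\frac1{2i}(F-\overline F)$. Singular space: $S=\Big(\bigcap_{j=0}^{2n-1}\mathrm{Ker}\big[\mathrm{Re}\,F\,(\mathrm{Im}\,F)^j\big]\Big)\cap\mathbb{R}^{2n}$. When $\mathrm{Re}\,q\ge0$ and $S=\{0\}$, the set $\{\lambda\in\sigma(F):\mathrm{Im}\,\lambda>0\}$ is non-empty, so $\tau_0>0$ is well defined, and $\mu_0$ is an eigenvalue of $q^w(x,D_x)$ of algebraic multiplicity one; when moreover the operator is real, $\mu_0\in\mathbb{R}$. *)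

theory Defs
  imports "HOL-Analysis.Analysis"
begin

section \<open>Quadratic forms and Hamilton maps\<close>

definition quadratic_form :: "('a::real_vector \<Rightarrow> 'b::real_vector) \<Rightarrow> bool" where
  "quadratic_form q \<longleftrightarrow> (\<exists>B. bilinear B \<and> (\<forall>X Y. B X Y = B Y X) \<and> (\<forall>X. q X = B X X))"

definition polar :: "('a::ab_group_add \<Rightarrow> complex) \<Rightarrow> 'a \<Rightarrow> 'a \<Rightarrow> complex" where
  "polar q X Y = (q (X + Y) - q X - q Y) / 2"

text \<open>Phase space is the space of vectors indexed by the sum type \<open>'n + 'n\<close>: the components
  at \<open>Inl j\<close> are the positions \<open>x\<^sub>j\<close>, those at \<open>Inr j\<close> the momenta \<open>\<xi>\<^sub>j\<close>.\<close>

definition symp :: "'a::comm_ring_1 ^ ('n::finite + 'n) \<Rightarrow> 'a ^ ('n + 'n) \<Rightarrow> 'a" where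
  "symp X Y = (\<Sum>j\<in>UNIV. X $ Inr j * Y $ Inl j - X $ Inl j * Y $ Inr j)"

definition cvec :: "real ^ 'm \<Rightarrow> complex ^ 'm" where
  "cvec X = (\<chi> i. complex_of_real (X $ i))"

definition hamilton_map ::
    "(real ^ ('n::finite + 'n) \<Rightarrow> complex) \<Rightarrow> complex ^ ('n + 'n) ^ ('n + 'n)" where
  "hamilton_map q = (THE F. \<forall>X Y. polar q X Y = symp (cvec X) (F *v cvec Y))"

definition spectrum :: "complex ^ 'm ^ 'm \<Rightarrow> complex set" where
  "spectrum F = {z. \<exists>v. v \<noteq> 0 \<and> F *v v = z *s v}"

definition gen_eigenspace :: "complex ^ 'm ^ 'm \<Rightarrow> complex \<Rightarrow> (complex ^ 'm) set" where
  "gen_eigenspace F z = {v. \<exists>k. ((\<lambda>w. F *v w - z *s w) ^^ k) v = 0}"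

definition re_matrix :: "complex ^ 'm ^ 'm \<Rightarrow> complex ^ 'm ^ 'm" where
  "re_matrix F = (\<chi> i j. (F $ i $ j + cnj (F $ i $ j)) / 2)"

definition im_matrix :: "complex ^ 'm ^ 'm \<Rightarrow> complex ^ 'm ^ 'm" where
  "im_matrix F = (\<chi> i j. (F $ i $ j - cnj (F $ i $ j)) / (2 * \<i>))"

definition singular_space ::
    "(real ^ ('n::finite + 'n) \<Rightarrow> complex) \<Rightarrow> (real ^ ('n + 'n)) set" where
  "singular_space q =
    (let F = hamilton_map q in
      {X. \<forall>j < 2 * CARD('n). re_matrix F *v (((*v) (im_matrix F) ^^ j) (cvec X)) = 0})"

definition mu0 :: "(real ^ ('n::finite + 'n) \<Rightarrow> complex) \<Rightarrow> complex" where
  "mu0 q = (let F = hamilton_map q in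
    \<Sum>z | z \<in> spectrum F \<and> Im z > 0. - \<i> * z * of_nat (vec.dim (gen_eigenspace F z)))"

definition tau0 :: "(real ^ ('n::finite + 'n) \<Rightarrow> complex) \<Rightarrow> real" where
  "tau0 q = 2 * Min (Im ` {z \<in> spectrum (hamilton_map q). Im z > 0})"


section \<open>Smooth functions, test functions, Schwartz functions\<close>

definition pderiv_at :: "'n::finite \<Rightarrow> (real ^ 'n \<Rightarrow> complex) \<Rightarrow> real ^ 'n \<Rightarrow> complex" where
  "pderiv_at j f = (\<lambda>x. frechet_derivative f (at x) (axis j 1))"

definition smooth_fun :: "(real ^ 'n::finite \<Rightarrow> complex) \<Rightarrow> bool" where
  "smooth_fun f \<longleftrightarrow> (\<forall>js x. foldr pderiv_at js f differentiable (at x))"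

definition test_fun :: "(real ^ 'n::finite \<Rightarrow> complex) \<Rightarrow> bool" where
  "test_fun \<phi> \<longleftrightarrow> smooth_fun \<phi> \<and> compact (closure {x. \<phi> x \<noteq> 0})"

definition schwartz :: "(real ^ 'n::finite \<Rightarrow> complex) \<Rightarrow> bool" where
  "schwartz f \<longleftrightarrow> smooth_fun f \<and>
    (\<forall>k js. bounded (range (\<lambda>x. norm x ^ k *\<^sub>R foldr pderiv_at js f x)))"


section \<open>The Weyl quantization acting on distributions\<close>

text \<open>A distribution is represented by its action on functions; only its values on test
  functions matter. The pairing is bilinear (no complex conjugation).\<close>

type_synonym 'n distr = "(real ^ 'n \<Rightarrow> complex) \<Rightarrow> complex"

definition distr_of :: "(real ^ 'n::finite \<Rightarrow> complex) \<Rightarrow> 'n distr" where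
  "distr_of u = (\<lambda>\<phi>. LINT x|lborel. u x * \<phi> x)"

definition coord_distr :: "'n::finite \<Rightarrow> 'n distr \<Rightarrow> 'n distr" where
  "coord_distr j T = (\<lambda>\<phi>. T (\<lambda>x. complex_of_real (x $ j) * \<phi> x))"

text \<open>\<open>D\<^sub>j = -\<i> \<partial>\<^sub>j\<close>, with \<open>\<langle>\<partial>\<^sub>j T, \<phi>\<rangle> = -\<langle>T, \<partial>\<^sub>j \<phi>\<rangle>\<close>.\<close>

definition D_distr :: "'n::finite \<Rightarrow> 'n distr \<Rightarrow> 'n distr" where
  "D_distr j T = (\<lambda>\<phi>. (1 / \<i>) * - T (pderiv_at j \<phi>))"

text \<open>The monomials of \<open>q\<close> are \<open>x\<^sub>j x\<^sub>k\<close>, \<open>x\<^sub>j \<xi>\<^sub>k\<close> and \<open>\<xi>\<^sub>j \<xi>\<^sub>k\<close>; in the double sum over \<open>j\<close> and \<open>k\<close>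
  the mixed one has coefficient \<open>2 q(e\<^sub>j; \<epsilon>\<^sub>k)\<close> and is quantized as
  \<open>(x\<^sub>j D\<^sub>k + D\<^sub>k x\<^sub>j) / 2\<close>.\<close>

definition weyl_distr ::
    "(real ^ ('n::finite + 'n) \<Rightarrow> complex) \<Rightarrow> 'n distr \<Rightarrow> 'n distr" where
  "weyl_distr q T = (\<lambda>\<phi>. \<Sum>j\<in>UNIV. \<Sum>k\<in>UNIV.
      polar q (axis (Inl j) 1) (axis (Inl k) 1) * coord_distr j (coord_distr k T) \<phi>
    + 2 * polar q (axis (Inl j) 1) (axis (Inr k) 1)
        * ((coord_distr j (D_distr k T) \<phi> + D_distr k (coord_distr j T) \<phi>) / 2)
    + polar q (axis (Inr j) 1) (axis (Inr k) 1) * D_distr j (D_distr k T) \<phi>)"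


section \<open>Unbounded operators on the space of square integrable functions\<close>

text \<open>Elements of \<open>L\<^sup>2\<close> are represented by functions; equality in \<open>L\<^sup>2\<close> is equality almost
  everywhere. An unbounded operator is represented by its graph, a set of pairs of functions
  which is closed under almost everywhere equality in both components.\<close>

definition L2 :: "(real ^ 'n::finite \<Rightarrow> complex) set" where
  "L2 = {u. u \<in> borel_measurable lborel \<and> integrable lborel (\<lambda>x. (norm (u x))\<^sup>2)}"

definition L2_inner :: "(real ^ 'n::finite \<Rightarrow> complex) \<Rightarrow> (real ^ 'n \<Rightarrow> complex) \<Rightarrow> complex" where
  "L2_inner u v = (LINT x|lborel. u x * cnj (v x))"

definition L2_norm :: "(real ^ 'n::finite \<Rightarrow> complex) \<Rightarrow> real" where
  "L2_norm u = sqrt (LINT x|lborel. (norm (u x))\<^sup>2)"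

type_synonym 'n l2_op = "((real ^ 'n \<Rightarrow> complex) \<times> (real ^ 'n \<Rightarrow> complex)) set"

text \<open>\<open>q\<^sup>w(x, D\<^sub>x)\<close> with its maximal domain.\<close>

definition weyl_op :: "(real ^ ('n::finite + 'n) \<Rightarrow> complex) \<Rightarrow> 'n l2_op" where
  "weyl_op q = {(u, v). u \<in> L2 \<and> v \<in> L2 \<and>
    (\<forall>\<phi>. test_fun \<phi> \<longrightarrow> weyl_distr q (distr_of u) \<phi> = distr_of v \<phi>)}"

definition adjoint_op :: "'n::finite l2_op \<Rightarrow> 'n l2_op" where
  "adjoint_op A = {(v, w). v \<in> L2 \<and> w \<in> L2 \<and> (\<forall>(u, z)\<in>A. L2_inner z v = L2_inner u w)}"

definition ker_op_minus :: "'n::finite l2_op \<Rightarrow> complex \<Rightarrow> (real ^ 'n \<Rightarrow> complex) set" where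
  "ker_op_minus A \<mu> = {u. (u, \<lambda>x. \<mu> * u x) \<in> A}"

definition L2_line :: "(real ^ 'n::finite \<Rightarrow> complex) \<Rightarrow> (real ^ 'n \<Rightarrow> complex) set" where
  "L2_line u\<^sub>0 = {u \<in> L2. \<exists>c. AE x in lborel. u x = c * u\<^sub>0 x}"

definition real_op :: "'n::finite l2_op \<Rightarrow> bool" where
  "real_op A \<longleftrightarrow> (\<forall>(u, v)\<in>A. (AE x in lborel. u x \<in> \<real>) \<longrightarrow> (AE x in lborel. v x \<in> \<real>))"


section \<open>Contraction semigroups\<close>

definition contraction_semigroup ::
    "(real \<Rightarrow> (real ^ 'n::finite \<Rightarrow> complex) \<Rightarrow> (real ^ 'n \<Rightarrow> complex)) \<Rightarrow> bool" where
  "contraction_semigroup T \<longleftrightarrow>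
    (\<forall>t\<ge>0. \<forall>u\<in>L2. T t u \<in> L2 \<and> L2_norm (T t u) \<le> L2_norm u) \<and>
    (\<forall>t\<ge>0. \<forall>u\<in>L2. \<forall>v\<in>L2. \<forall>a b. AE x in lborel.
        T t (\<lambda>y. a * u y + b * v y) x = a * T t u x + b * T t v x) \<and>
    (\<forall>u\<in>L2. AE x in lborel. T 0 u x = u x) \<and>
    (\<forall>s\<ge>0. \<forall>t\<ge>0. \<forall>u\<in>L2. AE x in lborel. T (s + t) u x = T s (T t u) x) \<and>
    (\<forall>u\<in>L2. ((\<lambda>t. L2_norm (\<lambda>x. T t u x - u x)) \<longlongrightarrow> 0) (at_right 0))"

definition generator ::
    "(real \<Rightarrow> (real ^ 'n::finite \<Rightarrow> complex) \<Rightarrow> (real ^ 'n \<Rightarrow> complex)) \<Rightarrow> 'n l2_op" where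
  "generator T = {(u, v). u \<in> L2 \<and> v \<in> L2 \<and>
    ((\<lambda>h. L2_norm (\<lambda>x. (T h u x - u x) / complex_of_real h - v x)) \<longlongrightarrow> 0) (at_right 0)}"

text \<open>\<open>exp_minus A t\<close> is \<open>e\<^bsup>-tA\<^esup>\<close>, the contraction semigroup generated by \<open>-A\<close>. Its values are
  determined up to null sets only, hence the choice operator.\<close>

definition exp_minus ::
    "'n::finite l2_op \<Rightarrow> real \<Rightarrow> (real ^ 'n \<Rightarrow> complex) \<Rightarrow> (real ^ 'n \<Rightarrow> complex)" where
  "exp_minus A = (SOME T. contraction_semigroup T \<and>
    generator T = {(u, \<lambda>x. - v x) |u v. (u, v) \<in> A})"

end

theory Submission
  imports Defs "HOL-Probability.Probability" "HOL-Computational_Algebra.Fundamental_Theorem_Algebra"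
begin

text \<open>
  Write \<open>u\<^sub>0 = e\<^bsup>-x\<bullet>Gx/2\<^esup>\<close> and \<open>K = (2G)\<^sup>-\<^sup>1\<close>. As the operator is real and has the same Gaussian ground state as its
  adjoint, its symbol is \<open>x \<bullet> a x + 2 \<i> x \<bullet> \<beta> \<xi> + \<xi> \<bullet> c \<xi>\<close> with real \<open>a\<close>, \<open>\<beta>\<close>, \<open>c\<close>, where \<open>a = G c G\<close> and \<open>K \<beta>\<close> is
  antisymmetric. Conjugation by \<open>u\<^sub>0\<close> then turns \<open>-Q\<close> into an Ornstein--Uhlenbeck operator whose invariant
  measure is Gaussian of covariance \<open>K\<close>, and the semigroup is given by an explicit formula of Mehler type: it
  sends \<open>u\<^sub>0 e\<^bsup>\<i>\<xi>\<bullet>x\<^esup>\<close> to a multiple of \<open>u\<^sub>0 e\<^bsup>\<i> r\<^sub>t\<xi>\<bullet>x\<^esup>\<close>, with \<open>r\<^sub>t = e\<^bsup>-tN\<^esup>\<close> and \<open>N = 2 G c + 2 \<beta>\<close>. The functions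
  \<open>u\<^sub>0 e\<^bsup>\<i>\<xi>\<bullet>x\<^esup>\<close> span a dense subspace; testing against them identifies the generator with the maximal operator, and
  a contraction semigroup is determined by its generator.

  The Mehler operators are multiplicative, \<open>\<Gamma>(r) = \<Gamma>(\<rho>) \<Gamma>(r / \<rho>)\<close>, and \<open>\<Gamma>(r / \<rho>)\<close> is a contraction as soon as
  \<open>\<rho>\<close> dominates the norm of \<open>r\<close> in the metric \<open>K\<close>. Off the ground state \<open>\<Gamma>(\<rho>)\<close> has norm at most \<open>\<rho>\<close>, so the rate of
  convergence is that of \<open>r\<^sub>t\<close>. The eigenvalues of the \<open>K\<close>-adjoint of \<open>N\<close> have the form \<open>-2 \<i> \<lambda>\<close> with \<open>\<lambda>\<close> in the
  spectrum of \<open>F\<close> and \<open>Im \<lambda> \<ge> 0\<close>, and \<open>S = {0}\<close> excludes the real \<open>\<lambda>\<close>: a real eigenvalue gives a subspace of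
  \<open>Ker c\<close> invariant under \<open>\<beta>\<close>.
\<close>


section \<open>Square integrable functions\<close>

text \<open>\<open>exp_minus\<close> is a chosen semigroup with a prescribed generator, so a formula
  for it requires existence, the exact domain of the generator, and uniqueness. The obstacle is the
  domain: the maximal operator is known only against test functions, and no core is used.
  Transposition under the bilinear pairing, which replaces \<beta> by - \<beta> and N by its
  K-adjoint, moves every such question onto Gaussian waves. There the transposed semigroup is
  explicit and the maximal operator may be applied after a cutoff. This is why semigroups come in
  pairs.

  Reality is tested on real Gaussians with a linear term: the imaginary part of a polynomial in two
  free vectors has to vanish. The eigenvalue equations of the operator and of its adjoint differ
  only in the sign of \<beta>, so they split into an even and an odd part, and they identify the
  eigenvalue with the trace of c G.

  The strict inequality \<tau> < \<tau>_0 leaves room for the polynomial factors of Jordan blocks,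
  so no Jordan form is needed; the norm in which the flow decays only affects the constant.\<close>

lemma L2D:
  assumes "u \<in> L2"
  shows "u \<in> borel_measurable borel" "integrable lborel (\<lambda>x. (norm (u x))\<^sup>2)"
  using assms by (auto simp: L2_def)

lemma L2_measurable [measurable_dest]: "u \<in> L2 \<Longrightarrow> u \<in> borel_measurable borel"
  by (rule L2D)

lemma L2_norm_nonneg [simp]: "L2_norm u \<ge> 0"
  by (simp add: L2_norm_def)

lemma L2_norm_power2: "(L2_norm u)\<^sup>2 = (LINT x|lborel. (norm (u x))\<^sup>2)"
  unfolding L2_norm_def by (subst real_sqrt_pow2) auto

lemma L2_norm_cong_AE:
  assumes "AE x in lborel. u x = v x" "u \<in> borel_measurable borel" "v \<in> borel_measurable borel"
  shows "L2_norm u = L2_norm v"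
  unfolding L2_norm_def
  by (intro arg_cong[where f=sqrt] integral_cong_AE) (use assms in auto)

lemma L2_bound:
  assumes "u \<in> L2" "v \<in> borel_measurable borel" "AE x in lborel. norm (v x) \<le> norm (u x)"
  shows "v \<in> L2" "L2_norm v \<le> L2_norm u"
proof -
  have ae: "AE x in lborel. (norm (v x))\<^sup>2 \<le> (norm (u x))\<^sup>2"
    using assms(3) by (auto intro: power_mono)
  have i: "integrable lborel (\<lambda>x. (norm (v x))\<^sup>2)"
    by (rule Bochner_Integration.integrable_bound[OF L2D(2)[OF assms(1)]]) (use assms ae in auto)
  then show "v \<in> L2" using assms by (auto simp: L2_def)
  show "L2_norm v \<le> L2_norm u" unfolding L2_norm_def
    by (intro real_sqrt_le_mono integral_mono_AE i L2D(2)[OF assms(1)] ae)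
qed

lemma L2_scale: "u \<in> L2 \<Longrightarrow> (\<lambda>x. c * u x) \<in> L2"
  by (auto simp: L2_def norm_mult power_mult_distrib)

lemma L2_norm_scale: "L2_norm (\<lambda>x. c * u x) = norm c * L2_norm u"
  by (simp add: L2_norm_def norm_mult power_mult_distrib real_sqrt_mult)

lemma L2_add:
  assumes "u \<in> L2" "v \<in> L2"
  shows "(\<lambda>x. u x + v x) \<in> L2"
proof -
  have "integrable lborel (\<lambda>x. 2 * (norm (u x))\<^sup>2 + 2 * (norm (v x))\<^sup>2)"
    using assms by (auto simp: L2_def)
  then have "integrable lborel (\<lambda>x. (norm (u x + v x))\<^sup>2)"
  proof (rule Bochner_Integration.integrable_bound)
    show "(\<lambda>x. (norm (u x + v x))\<^sup>2) \<in> borel_measurable lborel"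
      using assms by (auto simp: L2_def)
    have "(norm (u x + v x))\<^sup>2 \<le> 2 * (norm (u x))\<^sup>2 + 2 * (norm (v x))\<^sup>2" for x
    proof -
      have "(norm (u x + v x))\<^sup>2 \<le> (norm (u x) + norm (v x))\<^sup>2"
        by (intro power_mono norm_triangle_ineq) auto
      also have "\<dots> \<le> 2 * (norm (u x))\<^sup>2 + 2 * (norm (v x))\<^sup>2"
        using sum_squares_bound[of "norm (u x)" "norm (v x)"] by (simp add: power2_sum)
      finally show ?thesis .
    qed
    then show "AE x in lborel. norm ((norm (u x + v x))\<^sup>2) \<le> norm (2 * (norm (u x))\<^sup>2 + 2 * (norm (v x))\<^sup>2)"
      by (intro AE_I2) (simp add: abs_of_nonneg)
  qed
  then show ?thesis using assms by (auto simp: L2_def)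
qed

lemma L2_zero [simp]: "(\<lambda>x. 0) \<in> L2" "L2_norm (\<lambda>x. 0) = 0"
  by (auto simp: L2_def L2_norm_def)

lemma L2_lincomb: "u \<in> L2 \<Longrightarrow> v \<in> L2 \<Longrightarrow> (\<lambda>x. a * u x + b * v x) \<in> L2"
  by (intro L2_add L2_scale)

lemma L2_diff: "u \<in> L2 \<Longrightarrow> v \<in> L2 \<Longrightarrow> (\<lambda>x. u x - v x) \<in> L2"
  using L2_lincomb[of u v 1 "-1"] by simp

lemma L2_uminus: "u \<in> L2 \<Longrightarrow> (\<lambda>x. - u x) \<in> L2"
  using L2_scale[of u "-1"] by simp

lemma L2_divide: "u \<in> L2 \<Longrightarrow> (\<lambda>x. u x / c) \<in> L2"
  using L2_scale[of u "inverse c"] by (simp add: field_simps)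

lemma L2_cnj: "u \<in> L2 \<Longrightarrow> (\<lambda>x. cnj (u x)) \<in> L2"
  by (rule L2_bound[of u])
    (auto intro!: measurable_compose[OF _ borel_measurable_continuous_onI[of cnj]] continuous_intros dest: L2D)

lemma L2_norm_cnj [simp]: "L2_norm (\<lambda>x. cnj (u x)) = L2_norm u"
  by (simp add: L2_norm_def)

lemma L2_norm_uminus [simp]: "L2_norm (\<lambda>x. - u x) = L2_norm u"
  by (simp add: L2_norm_def)

lemma L2_norm_minus_commute: "L2_norm (\<lambda>x. u x - v x) = L2_norm (\<lambda>x. v x - u x)"
  by (simp add: L2_norm_def norm_minus_commute)

lemma L2_sum: "finite I \<Longrightarrow> (\<And>i. i \<in> I \<Longrightarrow> u i \<in> L2) \<Longrightarrow> (\<lambda>x. \<Sum>i\<in>I. u i x) \<in> L2"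
  by (induction I rule: finite_induct) (auto intro: L2_add)

lemma L2_integrable_mult:
  assumes "u \<in> L2" "v \<in> L2"
  shows "integrable lborel (\<lambda>x. u x * v x)"
proof -
  have "integrable lborel (\<lambda>x. (norm (u x))\<^sup>2 + (norm (v x))\<^sup>2)"
    using assms by (auto simp: L2_def)
  then show ?thesis
  proof (rule Bochner_Integration.integrable_bound)
    show "(\<lambda>x. u x * v x) \<in> borel_measurable lborel" using assms by (auto simp: L2_def)
    have "norm (u x * v x) \<le> (norm (u x))\<^sup>2 + (norm (v x))\<^sup>2" for x
    proof -
      have "2 * norm (u x) * norm (v x) \<le> (norm (u x))\<^sup>2 + (norm (v x))\<^sup>2"
        by (rule sum_squares_bound)
      moreover have "0 \<le> norm (u x) * norm (v x)" by simp
      ultimately show ?thesis unfolding norm_mult by linarith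
    qed
    then show "AE x in lborel. norm (u x * v x) \<le> norm ((norm (u x))\<^sup>2 + (norm (v x))\<^sup>2)"
      by (intro AE_I2) (simp add: abs_of_nonneg)
  qed
qed

text \<open>The choice \<open>s = c\<close>, \<open>t = a\<close> gives
  \<open>a * c * (a * c - b) \<ge> 0\<close>, which is void when \<open>a\<close> or
  \<open>c\<close> vanishes. Shifting both by a small positive number keeps the factor in front
  positive.\<close>

lemma quadratic_form_discriminant:
  fixes a b c :: real
  assumes quad: "\<And>s t. 0 \<le> s\<^sup>2 * a\<^sup>2 - 2 * s * t * b + t\<^sup>2 * c\<^sup>2" and "a \<ge> 0" "c \<ge> 0"
  shows "b \<le> a * c"
proof -
  have pos: "b \<le> a * c + e" if e: "e > 0" for e
  proof -
    \<comment> \<open>A shift by \<open>d \<le> 1\<close> costs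
      \<open>(a + d) * (c + d) - a * c \<le> d * (a + c + 1)\<close>. This fixes \<open>d\<close>,
      and \<open>min d 1\<close> enforces the restriction.\<close>
    define d where "d = e / (a + c + 1)"
    have "a + c + 1 > 0" using assms(2,3) by linarith
    then have d: "d > 0" "d * (a + c + 1) = e" using e by (simp_all add: d_def)
    define x y where "x = min d 1 + c" and "y = min d 1 + a"
    have xy: "x > 0" "y > 0" using d assms(2,3) by (auto simp: x_def y_def)
    have "a\<^sup>2 \<le> y\<^sup>2" "c\<^sup>2 \<le> x\<^sup>2" using d assms(2,3) by (auto simp: x_def y_def intro!: power_mono)
    then have "x\<^sup>2 * a\<^sup>2 \<le> x\<^sup>2 * y\<^sup>2" "y\<^sup>2 * c\<^sup>2 \<le> x\<^sup>2 * y\<^sup>2"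
      using mult_left_mono[of "a\<^sup>2" "y\<^sup>2" "x\<^sup>2"] mult_left_mono[of "c\<^sup>2" "x\<^sup>2" "y\<^sup>2"]
      by (auto simp: mult.commute)
    then have "0 \<le> 2 * (x * y) * (x * y - b)" using quad[of x y] by (simp add: power2_eq_square algebra_simps)
    then have "b \<le> x * y" using xy by (simp add: zero_le_mult_iff) (smt (verit) mult_pos_pos)
    also have "x * y = min d 1 * min d 1 + min d 1 * (a + c) + a * c"
      by (simp add: x_def y_def algebra_simps)
    also have "\<dots> \<le> min d 1 * 1 + min d 1 * (a + c) + a * c"
      using d assms(2,3) by (intro add_mono mult_left_mono) auto
    also have "\<dots> = min d 1 * (a + c + 1) + a * c" by (simp add: algebra_simps)
    also have "\<dots> \<le> d * (a + c + 1) + a * c" using assms(2,3) by (intro add_mono mult_right_mono) auto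
    finally show ?thesis using d by (simp add: add.commute)
  qed
  show ?thesis by (rule field_le_epsilon) (rule pos)
qed

lemma L2_Cauchy_Schwarz_norm:
  assumes "u \<in> L2" "v \<in> L2"
  shows "(LINT x|lborel. norm (u x) * norm (v x)) \<le> L2_norm u * L2_norm v"
proof -
  have int: "integrable lborel (\<lambda>x. norm (u x) * norm (v x))"
    using integrable_norm[OF L2_integrable_mult[OF assms]] by (simp add: norm_mult)
  let ?b = "LINT x|lborel. norm (u x) * norm (v x)"
  let ?a = "L2_norm u" and ?c = "L2_norm v"
  have quad: "0 \<le> s\<^sup>2 * ?a\<^sup>2 - 2 * s * t * ?b + t\<^sup>2 * ?c\<^sup>2" for s t :: real
  proof -
    have "0 \<le> (LINT x|lborel. (s * norm (u x) - t * norm (v x))\<^sup>2)" by simp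
    also have "\<dots> = (LINT x|lborel. s\<^sup>2 * (norm (u x))\<^sup>2 - 2 * s * t * (norm (u x) * norm (v x)) + t\<^sup>2 * (norm (v x))\<^sup>2)"
      by (intro Bochner_Integration.integral_cong) (auto simp: power2_eq_square algebra_simps)
    also have "\<dots> = s\<^sup>2 * ?a\<^sup>2 - 2 * s * t * ?b + t\<^sup>2 * ?c\<^sup>2"
      unfolding L2_norm_power2 using int assms by (subst Bochner_Integration.integral_add integral_diff; auto simp: L2_def)+
    finally show ?thesis .
  qed
  show ?thesis by (rule quadratic_form_discriminant[OF quad]) auto
qed

lemma distr_of_bound:
  assumes "u \<in> L2" "v \<in> L2"
  shows "norm (distr_of u v) \<le> L2_norm u * L2_norm v"
proof -
  have "norm (distr_of u v) \<le> (LINT x|lborel. norm (u x * v x))"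
    unfolding distr_of_def by (rule integral_norm_bound)
  then show ?thesis using L2_Cauchy_Schwarz_norm[OF assms] by (simp add: norm_mult)
qed

lemma L2_norm_triangle:
  assumes "u \<in> L2" "v \<in> L2"
  shows "L2_norm (\<lambda>x. u x + v x) \<le> L2_norm u + L2_norm v"
proof -
  have int: "integrable lborel (\<lambda>x. norm (u x) * norm (v x))"
    using integrable_norm[OF L2_integrable_mult[OF assms]] by (simp add: norm_mult)
  have "(L2_norm (\<lambda>x. u x + v x))\<^sup>2 \<le> (LINT x|lborel. (norm (u x))\<^sup>2 + 2 * (norm (u x) * norm (v x)) + (norm (v x))\<^sup>2)"
    unfolding L2_norm_power2
  proof (rule integral_mono)
    show "integrable lborel (\<lambda>x. (norm (u x + v x))\<^sup>2)" by (rule L2D(2)[OF L2_add[OF assms]])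
    show "integrable lborel (\<lambda>x. (norm (u x))\<^sup>2 + 2 * (norm (u x) * norm (v x)) + (norm (v x))\<^sup>2)"
      using int assms by (auto simp: L2_def)
    fix x
    have "(norm (u x + v x))\<^sup>2 \<le> (norm (u x) + norm (v x))\<^sup>2"
      by (intro power_mono norm_triangle_ineq) auto
    then show "(norm (u x + v x))\<^sup>2 \<le> (norm (u x))\<^sup>2 + 2 * (norm (u x) * norm (v x)) + (norm (v x))\<^sup>2"
      by (simp add: power2_sum algebra_simps)
  qed
  also have "\<dots> = (L2_norm u)\<^sup>2 + 2 * (LINT x|lborel. norm (u x) * norm (v x)) + (L2_norm v)\<^sup>2"
    unfolding L2_norm_power2 using int assms by (simp add: L2_def)
  also have "\<dots> \<le> (L2_norm u + L2_norm v)\<^sup>2"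
    using L2_Cauchy_Schwarz_norm[OF assms] by (simp add: power2_sum)
  finally show ?thesis by (rule power2_le_imp_le) simp
qed

lemma L2_norm_triangle_diff:
  assumes "u \<in> L2" "v \<in> L2" "w \<in> L2"
  shows "L2_norm (\<lambda>x. u x - w x) \<le> L2_norm (\<lambda>x. u x - v x) + L2_norm (\<lambda>x. v x - w x)"
  using L2_norm_triangle[OF L2_diff[OF assms(1,2)] L2_diff[OF assms(2,3)]] by simp

lemma L2_norm_triangle_minus:
  assumes "u \<in> L2" "v \<in> L2"
  shows "L2_norm (\<lambda>x. u x - v x) \<le> L2_norm u + L2_norm v"
  using L2_norm_triangle[OF assms(1) L2_uminus[OF assms(2)]] by simp

lemma L2_norm_lincomb:
  assumes "u \<in> L2" "v \<in> L2"
  shows "L2_norm (\<lambda>x. a * u x + b * v x) \<le> norm a * L2_norm u + norm b * L2_norm v"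
  using L2_norm_triangle[OF L2_scale[OF assms(1), of a] L2_scale[OF assms(2), of b]]
  by (simp add: L2_norm_scale)

lemma L2_norm_triangle_rev:
  assumes "u \<in> L2" "v \<in> L2"
  shows "\<bar>L2_norm u - L2_norm v\<bar> \<le> L2_norm (\<lambda>x. u x - v x)"
  using L2_norm_triangle[OF L2_diff[OF assms] assms(2)]
    L2_norm_triangle[OF L2_diff[OF assms(2,1)] assms(1)] L2_norm_minus_commute[of u v]
  by simp

lemma L2_norm_eq_0_AE:
  assumes "u \<in> L2" "L2_norm u = 0"
  shows "AE x in lborel. u x = 0"
proof -
  have "(LINT x|lborel. (norm (u x))\<^sup>2) = 0" using assms(2) L2_norm_power2[of u] by simp
  then have "AE x in lborel. (norm (u x))\<^sup>2 = 0"
    by (subst (asm) integral_nonneg_eq_0_iff_AE) (use L2D[OF assms(1)] in auto)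
  then show ?thesis by auto
qed

lemma L2_norm_diff_0_AE:
  assumes "u \<in> L2" "v \<in> L2" "\<And>e. e > 0 \<Longrightarrow> L2_norm (\<lambda>x. u x - v x) \<le> e"
  shows "AE x in lborel. u x = v x"
proof -
  have "L2_norm (\<lambda>x. u x - v x) \<le> 0" by (rule field_le_epsilon) (use assms(3) in auto)
  then have "L2_norm (\<lambda>x. u x - v x) = 0" using L2_norm_nonneg[of "\<lambda>x. u x - v x"] by linarith
  from L2_norm_eq_0_AE[OF L2_diff[OF assms(1,2)] this] show ?thesis by auto
qed

lemma distr_of_cong_AE:
  assumes "AE x in lborel. u x = u' x" "AE x in lborel. v x = v' x"
    "u \<in> L2" "u' \<in> L2" "v \<in> L2" "v' \<in> L2"
  shows "distr_of u v = distr_of u' v'"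
  unfolding distr_of_def by (rule integral_cong_AE) (use assms in \<open>auto dest: L2D\<close>)

lemma distr_of_commute: "distr_of u v = distr_of v u"
  by (simp add: distr_of_def mult.commute)

lemma distr_of_lincomb_left:
  assumes "u \<in> L2" "v \<in> L2" "w \<in> L2"
  shows "distr_of (\<lambda>x. a * u x + b * v x) w = a * distr_of u w + b * distr_of v w"
proof -
  have "distr_of (\<lambda>x. a * u x + b * v x) w
    = (LINT x|lborel. a * (u x * w x) + b * (v x * w x))"
    unfolding distr_of_def by (simp add: algebra_simps)
  also have "\<dots> = a * distr_of u w + b * distr_of v w" unfolding distr_of_def
    by (subst Bochner_Integration.integral_add) (auto intro!: integrable_mult_right L2_integrable_mult assms)
  finally show ?thesis .
qed

lemma distr_of_lincomb_right:
  assumes "u \<in> L2" "v \<in> L2" "w \<in> L2"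
  shows "distr_of w (\<lambda>x. a * u x + b * v x) = a * distr_of w u + b * distr_of w v"
  using distr_of_lincomb_left[OF assms] by (simp add: distr_of_commute)

lemma distr_of_diff_left:
  "u \<in> L2 \<Longrightarrow> v \<in> L2 \<Longrightarrow> w \<in> L2 \<Longrightarrow> distr_of (\<lambda>x. u x - v x) w = distr_of u w - distr_of v w"
  using distr_of_lincomb_left[of u v w 1 "-1"] by simp

lemma distr_of_diff_right:
  "u \<in> L2 \<Longrightarrow> v \<in> L2 \<Longrightarrow> w \<in> L2 \<Longrightarrow> distr_of w (\<lambda>x. u x - v x) = distr_of w u - distr_of w v"
  using distr_of_lincomb_right[of u v w 1 "-1"] by simp

lemma distr_of_scale_left: "distr_of (\<lambda>x. a * u x) w = a * distr_of u w"
  by (simp add: distr_of_def mult.assoc)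

lemma distr_of_scale_right: "distr_of w (\<lambda>x. a * u x) = a * distr_of w u"
  by (simp add: distr_of_def mult.left_commute)

lemma distr_of_cnj_self: "distr_of u (\<lambda>x. cnj (u x)) = of_real ((L2_norm u)\<^sup>2)"
  unfolding L2_norm_power2 distr_of_def complex_norm_square[symmetric] of_real_power[symmetric]
  by (rule integral_complex_of_real)

lemma L2_inner_eq_distr_of: "L2_inner u v = distr_of u (\<lambda>x. cnj (v x))"
  by (simp add: L2_inner_def distr_of_def)

section \<open>Dense subspaces of L2 and extension from them by continuity\<close>

definition L2_dense :: "(real ^ 'n::finite \<Rightarrow> complex) set \<Rightarrow> bool" where
  "L2_dense D \<longleftrightarrow> D \<subseteq> L2 \<and> (\<forall>u\<in>L2. \<forall>e>0. \<exists>v\<in>D. L2_norm (\<lambda>x. u x - v x) < e)"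

lemma L2_denseD:
  assumes "L2_dense D"
  shows "v \<in> D \<Longrightarrow> v \<in> L2" "u \<in> L2 \<Longrightarrow> e > 0 \<Longrightarrow> \<exists>v\<in>D. L2_norm (\<lambda>x. u x - v x) < e"
  using assms by (auto simp: L2_dense_def)

text \<open>The pairing is bilinear, so the square of the norm is the pairing of \<open>u\<close>
  with its conjugate. It is the conjugate that is approximated from \<open>D\<close>, so
  \<open>D\<close> may fail to be closed under conjugation.\<close>

lemma L2_norm_le_of_pairing:
  assumes D: "L2_dense D" and u: "u \<in> L2" and b: "\<And>v. v \<in> D \<Longrightarrow> norm (distr_of u v) \<le> c * L2_norm v"
    and c: "c \<ge> 0"
  shows "L2_norm u \<le> c"
proof -
  have step: "(L2_norm u)\<^sup>2 \<le> c * L2_norm u + e * (c + L2_norm u)" if e: "e > 0" for e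
  proof -
    obtain v where v: "v \<in> D" and d: "L2_norm (\<lambda>x. cnj (u x) - v x) < e"
      using L2_denseD(2)[OF D L2_cnj[OF u] e] by auto
    have vL: "v \<in> L2" using L2_denseD(1)[OF D v] .
    have "distr_of u (\<lambda>x. cnj (u x)) = distr_of u v + distr_of u (\<lambda>x. cnj (u x) - v x)"
      by (simp add: distr_of_diff_right L2_cnj u vL)
    then have "(L2_norm u)\<^sup>2 = norm (distr_of u v + distr_of u (\<lambda>x. cnj (u x) - v x))"
      by (metis distr_of_cnj_self norm_of_real abs_of_nonneg zero_le_power2)
    also have "\<dots> \<le> c * L2_norm v + L2_norm u * e"
    proof (rule norm_triangle_le[OF add_mono])
      show "norm (distr_of u v) \<le> c * L2_norm v" by (rule b[OF v])
      have "norm (distr_of u (\<lambda>x. cnj (u x) - v x)) \<le> L2_norm u * L2_norm (\<lambda>x. cnj (u x) - v x)"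
        by (intro distr_of_bound u L2_diff L2_cnj vL)
      also have "\<dots> \<le> L2_norm u * e" by (intro mult_left_mono) (use d in auto)
      finally show "norm (distr_of u (\<lambda>x. cnj (u x) - v x)) \<le> L2_norm u * e" .
    qed
    also have "c * L2_norm v \<le> c * (L2_norm u + e)"
      using L2_norm_triangle_rev[OF L2_cnj[OF u] vL] d by (intro mult_left_mono c) auto
    finally show ?thesis by (simp add: algebra_simps)
  qed
  have "(L2_norm u)\<^sup>2 \<le> c * L2_norm u + e" if e: "e > 0" for e
  proof (cases "c + L2_norm u = 0")
    case True then show ?thesis using step[of 1] e by simp
  next
    case False
    then have p: "c + L2_norm u > 0" using c L2_norm_nonneg[of u] by linarith
    show ?thesis using step[of "e / (c + L2_norm u)"] p e by simp
  qed
  then have "(L2_norm u)\<^sup>2 \<le> c * L2_norm u" by (rule field_le_epsilon)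
  then show ?thesis using c L2_norm_nonneg[of u]
    by (cases "L2_norm u = 0") (auto simp: power2_eq_square)
qed

lemma L2_contractions_eq_AE:
  assumes D: "L2_dense D"
    and T: "\<And>u. u \<in> L2 \<Longrightarrow> T u \<in> L2" "\<And>u v. u \<in> L2 \<Longrightarrow> v \<in> L2 \<Longrightarrow> L2_norm (\<lambda>x. T u x - T v x) \<le> L2_norm (\<lambda>x. u x - v x)"
    and S: "\<And>u. u \<in> L2 \<Longrightarrow> S u \<in> L2" "\<And>u v. u \<in> L2 \<Longrightarrow> v \<in> L2 \<Longrightarrow> L2_norm (\<lambda>x. S u x - S v x) \<le> L2_norm (\<lambda>x. u x - v x)"
    and eq: "\<And>u. u \<in> D \<Longrightarrow> AE x in lborel. T u x = S u x"
    and u: "u \<in> L2"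
  shows "AE x in lborel. T u x = S u x"
proof (rule L2_norm_diff_0_AE)
  show "T u \<in> L2" "S u \<in> L2" using T S u by auto
  fix e :: real assume "e > 0"
  then obtain v where v: "v \<in> D" and d: "L2_norm (\<lambda>x. u x - v x) < e / 2"
    using L2_denseD(2)[OF D u, of "e/2"] by auto
  have vL: "v \<in> L2" using L2_denseD(1)[OF D v] .
  have z: "L2_norm (\<lambda>x. T v x - S v x) = 0"
    using L2_norm_cong_AE[of "\<lambda>x. T v x - S v x" "\<lambda>x. 0"] eq[OF v] L2D(1)[OF T(1)[OF vL]] L2D(1)[OF S(1)[OF vL]]
    by auto
  have "L2_norm (\<lambda>x. T u x - S u x) \<le> L2_norm (\<lambda>x. T u x - T v x) + L2_norm (\<lambda>x. T v x - S u x)"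
    by (intro L2_norm_triangle_diff T S u vL)
  also have "L2_norm (\<lambda>x. T v x - S u x) \<le> L2_norm (\<lambda>x. T v x - S v x) + L2_norm (\<lambda>x. S v x - S u x)"
    by (intro L2_norm_triangle_diff T S u vL)
  also have "L2_norm (\<lambda>x. S v x - S u x) \<le> L2_norm (\<lambda>x. u x - v x)"
    using S(2)[OF vL u] by (simp add: L2_norm_minus_commute[of u v])
  finally show "L2_norm (\<lambda>x. T u x - S u x) \<le> e" using T(2)[OF u vL] d z by linarith
qed

lemma L2_norm_dominated_convergence:
  fixes v :: "real ^ 'n::finite \<Rightarrow> complex"
  assumes g: "g \<in> L2" and m: "\<And>k. V k \<in> borel_measurable borel" "v \<in> borel_measurable borel"
    and lim: "\<And>x. (\<lambda>k. V k x) \<longlonglongrightarrow> v x" and b: "\<And>k x. norm (V k x) \<le> norm (g x)"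
  shows "(\<lambda>k. L2_norm (\<lambda>x. V k x - v x)) \<longlonglongrightarrow> 0"
proof -
  have bv: "norm (v x) \<le> norm (g x)" for x
    by (rule LIMSEQ_le_const2[OF tendsto_norm[OF lim]]) (use b in auto)
  have "(\<lambda>k. LINT x|lborel. (norm (V k x - v x))\<^sup>2) \<longlonglongrightarrow> (LINT x::real^'n|lborel. (0::real))"
  proof (rule integral_dominated_convergence[where w="\<lambda>x. 4 * (norm (g x))\<^sup>2"])
    show "integrable lborel (\<lambda>x. 4 * (norm (g x))\<^sup>2)" using L2D[OF g] by simp
    show "AE x in lborel. (\<lambda>k. (norm (V k x - v x))\<^sup>2) \<longlonglongrightarrow> 0"
    proof (rule AE_I2)
      fix x
      have "(\<lambda>k. (norm (V k x - v x))\<^sup>2) \<longlonglongrightarrow> (norm (v x - v x))\<^sup>2"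
        by (intro tendsto_intros lim)
      then show "(\<lambda>k. (norm (V k x - v x))\<^sup>2) \<longlonglongrightarrow> 0" by simp
    qed
    fix k
    show "AE x in lborel. norm ((norm (V k x - v x))\<^sup>2) \<le> 4 * (norm (g x))\<^sup>2"
    proof (rule AE_I2)
      fix x
      have "norm (V k x - v x) \<le> 2 * norm (g x)"
        using norm_triangle_ineq4[of "V k x" "v x"] b[of k x] bv[of x] by linarith
      then have "(norm (V k x - v x))\<^sup>2 \<le> (2 * norm (g x))\<^sup>2" by (intro power_mono) auto
      then show "norm ((norm (V k x - v x))\<^sup>2) \<le> 4 * (norm (g x))\<^sup>2" by (simp add: power_mult_distrib)
    qed
  qed (use m in auto)
  then show ?thesis unfolding L2_norm_def using tendsto_real_sqrt by fastforce
qed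

section \<open>Bounded limits of trigonometric polynomials\<close>

definition wave :: "real ^ 'n::finite \<Rightarrow> real ^ 'n \<Rightarrow> complex" where
  "wave \<xi> x = cis (\<xi> \<bullet> x)"

lemma norm_wave [simp]: "norm (wave \<xi> x) = 1" by (simp add: wave_def)
lemma wave_0 [simp]: "wave 0 x = 1" by (simp add: wave_def)
lemma wave_add: "wave (\<xi> + \<eta>) x = wave \<xi> x * wave \<eta> x"
  by (simp add: wave_def inner_add_left cis_mult)
lemma continuous_wave [continuous_intros]: "continuous_on A (wave \<xi>)"
  unfolding wave_def cis_conv_exp by (intro continuous_intros)
lemma wave_measurable [measurable]: "wave \<xi> \<in> borel_measurable borel"
  by (intro borel_measurable_continuous_onI continuous_intros)

inductive_set trig_closure :: "(real ^ 'n::finite \<Rightarrow> complex) set" where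
  wave: "wave \<xi> \<in> trig_closure"
| lincomb: "f \<in> trig_closure \<Longrightarrow> g \<in> trig_closure \<Longrightarrow> (\<lambda>x. a * f x + b * g x) \<in> trig_closure"
| lim: "(\<And>k. F k \<in> trig_closure) \<Longrightarrow> (\<And>x. (\<lambda>k. F k x) \<longlonglongrightarrow> f x) \<Longrightarrow> (\<And>k x. norm (F k x) \<le> c)
    \<Longrightarrow> f \<in> trig_closure"

lemma trig_closure_measurable: "f \<in> trig_closure \<Longrightarrow> f \<in> borel_measurable borel"
proof (induction rule: trig_closure.induct)
  case (lim F f c) then show ?case by (intro borel_measurable_LIMSEQ_metric[of F borel f]) auto
qed auto

lemma trig_closure_bounded: "f \<in> trig_closure \<Longrightarrow> \<exists>c. \<forall>x. norm (f x) \<le> c"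
proof (induction rule: trig_closure.induct)
  case (wave \<xi>) then show ?case by (intro exI[of _ 1]) auto
next
  case (lincomb f g a b)
  then obtain c d where "\<And>x. norm (f x) \<le> c" "\<And>x. norm (g x) \<le> d" by auto
  then have "norm (a * f x + b * g x) \<le> norm a * c + norm b * d" for x
    by (intro norm_triangle_le add_mono) (auto simp: norm_mult intro!: mult_left_mono)
  then show ?case by blast
next
  case (lim F f c)
  have "norm (f x) \<le> c" for x
    by (rule LIMSEQ_le_const2[OF tendsto_norm[OF lim(2)]]) (use lim in auto)
  then show ?case by blast
qed

lemma trig_closure_scale: "f \<in> trig_closure \<Longrightarrow> (\<lambda>x. a * f x) \<in> trig_closure"
  using trig_closure.lincomb[of f f a 0] by simp
lemma trig_closure_add: "f \<in> trig_closure \<Longrightarrow> g \<in> trig_closure \<Longrightarrow> (\<lambda>x. f x + g x) \<in> trig_closure"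
  using trig_closure.lincomb[of f g 1 1] by simp
lemma trig_closure_const: "(\<lambda>x. a) \<in> trig_closure"
  using trig_closure_scale[OF trig_closure.wave[of 0], of a] by simp
lemma trig_closure_sum: "finite I \<Longrightarrow> (\<And>i. i \<in> I \<Longrightarrow> f i \<in> trig_closure) \<Longrightarrow> (\<lambda>x. \<Sum>i\<in>I. f i x) \<in> trig_closure"
  by (induction I rule: finite_induct) (auto intro: trig_closure_add trig_closure_const)

lemma trig_closure_mult_wave: "f \<in> trig_closure \<Longrightarrow> (\<lambda>x. f x * wave \<eta> x) \<in> trig_closure"
proof (induction rule: trig_closure.induct)
  case (wave \<xi>)
  then show ?case using trig_closure.wave[of "\<xi> + \<eta>"] by (simp add: wave_add[abs_def])
next
  case (lincomb f g a b)
  then show ?case using trig_closure.lincomb[OF lincomb(3,4), of a b] by (simp add: algebra_simps)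
next
  case (lim F f c)
  show ?case
    by (rule trig_closure.lim[where F="\<lambda>k x. F k x * wave \<eta> x" and c=c])
      (use lim in \<open>auto simp: norm_mult intro!: tendsto_intros\<close>)
qed

text \<open>Two nested inductions: the one over \<open>g\<close> meets a single wave at its base,
  and that case is the induction over \<open>f\<close> in \<open>trig_closure_mult_wave\<close>. The
  limit case needs a bound on \<open>f\<close>, which every member of the closure has.\<close>

lemma trig_closure_mult: "g \<in> trig_closure \<Longrightarrow> f \<in> trig_closure \<Longrightarrow> (\<lambda>x. f x * g x) \<in> trig_closure"
proof (induction rule: trig_closure.induct)
  case (wave \<xi>) then show ?case by (rule trig_closure_mult_wave)
next
  case (lincomb g h a b)
  then show ?case using trig_closure.lincomb[OF lincomb(3,4), of a b] by (simp add: algebra_simps)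
next
  case (lim F g c)
  obtain d where d: "\<And>x. norm (f x) \<le> d" using trig_closure_bounded[OF lim.prems] by auto
  have c: "c \<ge> 0" using lim(3)[of 0 0] norm_ge_zero order_trans by blast
  show ?case
  proof (rule trig_closure.lim[where F="\<lambda>k x. f x * F k x" and c="d * c"])
    show "norm (f x * F k x) \<le> d * c" for k x
      unfolding norm_mult using d[of x] lim(3)[of k x] norm_ge_zero[of "f x"] norm_ge_zero[of "F k x"]
      by (intro mult_mono) linarith+
  qed (use lim in \<open>auto intro!: tendsto_intros\<close>)
qed

lemma trig_closure_prod: "finite I \<Longrightarrow> (\<And>i. i \<in> I \<Longrightarrow> f i \<in> trig_closure) \<Longrightarrow> (\<lambda>x. \<Prod>i\<in>I. f i x) \<in> trig_closure"
proof (induction I rule: finite_induct)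
  case (insert i I)
  then show ?case using trig_closure_mult[of "\<lambda>x. \<Prod>i\<in>I. f i x" "f i"] by simp
qed (auto intro: trig_closure_const)

lemma trig_closure_polynomial:
  assumes "real_polynomial_function p" "(\<lambda>x. complex_of_real (g x)) \<in> trig_closure"
  shows "(\<lambda>x. complex_of_real (p (g x :: real))) \<in> trig_closure"
  using assms(1)
proof (induction rule: real_polynomial_function.induct)
  case (linear f)
  then have "f y = y * f 1" for y using linear_scale[of f y 1] by (auto simp: bounded_linear.linear)
  then have "(\<lambda>x. complex_of_real (f (g x))) = (\<lambda>x. of_real (f 1) * of_real (g x))"
    by (metis mult.commute of_real_mult)
  then show ?case using trig_closure_scale[OF assms(2)] by simp
next
  case (const c) show ?case by (rule trig_closure_const)
next
  case (add f h) then show ?case using trig_closure_add[OF add(3,4)] by simp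
next
  case (mult f h) then show ?case using trig_closure_mult[OF mult(4,3)] by simp
qed

text \<open>The values of \<open>g\<close> lie in a compact interval, and there \<psi> is a uniform
  limit of polynomials by Weierstrass; polynomials in \<open>g\<close> are available since the
  closure is an algebra.\<close>

lemma trig_closure_continuous:
  fixes \<psi> :: "real \<Rightarrow> real"
  assumes \<psi>: "continuous_on UNIV \<psi>" and g: "(\<lambda>x. complex_of_real (g x)) \<in> trig_closure"
  shows "(\<lambda>x. complex_of_real (\<psi> (g x))) \<in> trig_closure"
proof -
  obtain c where c: "\<And>x. \<bar>g x\<bar> \<le> c" using trig_closure_bounded[OF g] by auto
  have "\<exists>p. real_polynomial_function p \<and> (\<forall>y\<in>{-c..c}. \<bar>\<psi> y - p y\<bar> < inverse (real (Suc k)))" for k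
  proof -
    have "continuous_on {-c..c} \<psi>" using \<psi> by (rule continuous_on_subset) auto
    then obtain p where "real_polynomial_function p" "\<And>y. y \<in> {-c..c} \<Longrightarrow> \<bar>\<psi> y - p y\<bar> < inverse (real (Suc k))"
      using Stone_Weierstrass_real_polynomial_function[OF compact_Icc, of "-c" c \<psi> "inverse (real (Suc k))"]
      by (metis inverse_positive_iff_positive of_nat_0_less_iff zero_less_Suc)
    then show ?thesis by blast
  qed
  then obtain p where p: "\<And>k. real_polynomial_function (p k)"
      "\<And>k y. y \<in> {-c..c} \<Longrightarrow> \<bar>\<psi> y - p k y\<bar> < inverse (real (Suc k))" by metis
  have close: "\<bar>\<psi> (g x) - p k (g x)\<bar> \<le> inverse (real (Suc k))" for x k
    using p(2)[of "g x" k] c[of x] by (auto simp: abs_le_iff)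
  have "compact (\<psi> ` {-c..c})"
    by (intro compact_continuous_image continuous_on_subset[OF \<psi>]) auto
  then obtain d where d: "\<And>y. y \<in> {-c..c} \<Longrightarrow> \<bar>\<psi> y\<bar> \<le> d"
    by (force dest!: compact_imp_bounded simp: bounded_iff)
  show ?thesis
  proof (rule trig_closure.lim[where F="\<lambda>k x. complex_of_real (p k (g x))" and c="d + 1"])
    show "(\<lambda>x. complex_of_real (p k (g x))) \<in> trig_closure" for k
      by (rule trig_closure_polynomial[OF p(1) g])
    show "norm (complex_of_real (p k (g x))) \<le> d + 1" for k x
    proof -
      have "inverse (real (Suc k)) \<le> 1" by (simp add: field_simps)
      then show ?thesis using close[of x k] d[of "g x"] c[of x] by (auto simp: abs_le_iff)
    qed
    show "(\<lambda>k. complex_of_real (p k (g x))) \<longlonglongrightarrow> complex_of_real (\<psi> (g x))" for x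
    proof -
      have "(\<lambda>k. p k (g x)) \<longlonglongrightarrow> \<psi> (g x)"
      proof (rule LIM_zero_cancel, rule Lim_null_comparison)
        show "(\<lambda>k. inverse (real (Suc k))) \<longlonglongrightarrow> 0" by (rule LIMSEQ_inverse_real_of_nat)
        show "eventually (\<lambda>k. norm (p k (g x) - \<psi> (g x)) \<le> inverse (real (Suc k))) sequentially"
          using close[of x] by (intro always_eventually) (auto simp: abs_minus_commute)
      qed
      then show ?thesis by (intro tendsto_of_real)
    qed
  qed
qed

text \<open>A coordinate is unbounded and therefore outside the closure. The trigonometric
  polynomials \<open>(k + 1) * sin (x $ j / (k + 1))\<close> converge to it, and composing with a
  bounded \<psi> makes the convergence bounded.\<close>

lemma trig_closure_coord:
  fixes \<psi> :: "real \<Rightarrow> real"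
  assumes \<psi>: "continuous_on UNIV \<psi>" and b: "\<And>y. \<bar>\<psi> y\<bar> \<le> d"
  shows "(\<lambda>x::real^'n::finite. complex_of_real (\<psi> (x $ j))) \<in> trig_closure"
proof (rule trig_closure.lim[where c=d and
      F="\<lambda>k x. complex_of_real (\<psi> (real (Suc k) * sin (x $ j / real (Suc k))))"])
  fix k
  have sin: "complex_of_real (sin t) = (cis t - cis (- t)) / (2 * \<i>)" for t
    by (simp add: complex_eq_iff)
  have waves: "wave (axis j (inverse (real (Suc k)))) x = cis (x $ j / real (Suc k))"
    "wave (axis j (- inverse (real (Suc k)))) x = cis (- (x $ j / real (Suc k)))" for x :: "real^'n"
    by (simp_all add: wave_def inner_axis' divide_inverse mult.commute)
  have "complex_of_real (real (Suc k) * sin (x $ j / real (Suc k)))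
    = (real (Suc k) / (2*\<i>)) * wave (axis j (inverse (real (Suc k)))) x
      + (- real (Suc k) / (2*\<i>)) * wave (axis j (- inverse (real (Suc k)))) x" for x :: "real^'n"
    unfolding waves of_real_mult sin by (simp add: field_simps del: of_nat_Suc)
  then have "(\<lambda>x::real^'n. complex_of_real (real (Suc k) * sin (x $ j / real (Suc k)))) \<in> trig_closure"
    by (simp only:) (intro trig_closure.lincomb trig_closure.wave)
  from trig_closure_continuous[OF \<psi> this]
  show "(\<lambda>x::real^'n. complex_of_real (\<psi> (real (Suc k) * sin (x $ j / real (Suc k))))) \<in> trig_closure" .
  show "norm (complex_of_real (\<psi> (real (Suc k) * sin (x $ j / real (Suc k))))) \<le> d" for x :: "real^'n"
    using b by simp
next
  fix x :: "real^'n"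
  have "(\<lambda>k. real (Suc k) * sin (x $ j / real (Suc k))) \<longlonglongrightarrow> x $ j"
    by real_asymp
  then show "(\<lambda>k. complex_of_real (\<psi> (real (Suc k) * sin (x $ j / real (Suc k))))) \<longlonglongrightarrow> complex_of_real (\<psi> (x $ j))"
    using \<psi> by (intro tendsto_of_real continuous_on_tendsto_compose[OF \<psi>]) auto
qed

lemma trig_closure_halfspace: "(indicator {x::real^'n::finite. x $ j \<le> c} :: _ \<Rightarrow> complex) \<in> trig_closure"
proof (rule trig_closure.lim[where c=1 and
      F="\<lambda>k x. complex_of_real (max 0 (min 1 (1 - real k * (x $ j - c))))"])
  show "(\<lambda>x. complex_of_real (max 0 (min 1 (1 - real k * (x $ j - c))))) \<in> trig_closure" for k
    by (rule trig_closure_coord[where d=1], intro continuous_intros) (auto simp: max_def min_def)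
  fix x :: "real^'n"
  show "(\<lambda>k. complex_of_real (max 0 (min 1 (1 - real k * (x $ j - c))))) \<longlonglongrightarrow> indicator {x. x $ j \<le> c} x"
  proof (cases "x $ j \<le> c")
    case True
    then have "max 0 (min 1 (1 - real k * (x $ j - c))) = 1" for k
      by (simp add: mult_nonneg_nonpos)
    then show ?thesis using True by simp
  next
    case False
    obtain K :: nat where K: "real K > 1 / (x $ j - c)" using reals_Archimedean2 by blast
    have "eventually (\<lambda>k. complex_of_real (max 0 (min 1 (1 - real k * (x $ j - c)))) = 0) sequentially"
      using eventually_ge_at_top[of K]
    proof eventually_elim
      case (elim k)
      then have "real k > 1 / (x $ j - c)" using K by linarith
      then have "1 - real k * (x $ j - c) \<le> 0" using False by (simp add: field_simps)
      then show ?case by simp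
    qed
    then show ?thesis using False by (simp add: tendsto_eventually)
  qed
qed (auto simp: max_def min_def)

text \<open>A \<pi>-\<lambda> argument. The lower orthants generate the Borel sets and are stable
  under intersection, and the indicator of an orthant is a product of indicators of half-spaces,
  which are limits of continuous ramps in one coordinate.\<close>

lemma trig_closure_indicator:
  assumes "A \<in> sets (borel :: (real^'n::finite) measure)"
  shows "(indicator A :: _ \<Rightarrow> complex) \<in> trig_closure"
proof -
  have s: "sets (borel :: (real^'n) measure) = sigma_sets UNIV (range (\<lambda>a. {..a}))"
    by (subst borel_eq_atMost) (simp add: sets_measure_of)
  have stable: "Int_stable (range (\<lambda>a::real^'n. {..a}))"
  proof (rule Int_stableI_image)
    show "\<exists>c\<in>UNIV. {..a} \<inter> {..b} = {..c}" for a b :: "real^'n"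
      by (intro bexI[of _ "inf a b"]) auto
  qed
  from stable subset_UNIV[of "range (\<lambda>a::real^'n. {..a})", folded Pow_UNIV] assms[unfolded s] show ?thesis
  proof (induction rule: sigma_sets_induct_disjoint)
    case (basic A)
    then obtain a where A: "A = {..a}" by auto
    have "indicator A = (\<lambda>x. \<Prod>j\<in>UNIV. indicator {x. x $ j \<le> a $ j} x :: complex)"
      by (auto simp: A fun_eq_iff indicator_def less_eq_vec_def prod_zero_iff)
    then show ?case by (simp only:) (intro trig_closure_prod trig_closure_halfspace finite)
  next
    case empty show ?case using trig_closure_const[of 0] by (simp add: indicator_def[abs_def])
  next
    case (compl A)
    have "(indicator (UNIV - A) :: _ \<Rightarrow> complex) = (\<lambda>x. 1 * 1 + (-1) * indicator A x)"
      by (auto simp: indicator_def)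
    then show ?case using trig_closure.lincomb[OF trig_closure_const[of 1] compl(2), of 1 "-1"] by simp
  next
    case (union A)
    show ?case
    proof (rule trig_closure.lim[where c=1 and F="\<lambda>k. indicator (\<Union>i<k. A i)"])
      fix k
      have "(indicator (\<Union>i<k. A i) :: _ \<Rightarrow> complex) = (\<lambda>x. \<Sum>i<k. indicator (A i) x)"
        by (rule ext, rule indicator_UN_disjoint)
          (use union in \<open>auto simp: disjoint_family_on_def\<close>)
      then show "(indicator (\<Union>i<k. A i) :: _ \<Rightarrow> complex) \<in> trig_closure"
        using union by (simp only:) (intro trig_closure_sum, auto)
    next
      show "(\<lambda>k. indicator (\<Union>i<k. A i) x) \<longlonglongrightarrow> (indicator (\<Union>i. A i) x :: complex)" for x
        by (rule LIMSEQ_indicator_UN)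
    qed (auto simp: indicator_def)
  qed
qed

lemma trig_closure_bounded_measurable:
  fixes f :: "real^'n::finite \<Rightarrow> complex"
  assumes f: "f \<in> borel_measurable borel" and b: "\<And>x. norm (f x) \<le> c"
  shows "f \<in> trig_closure"
proof -
  from borel_measurable_implies_sequence_metric[OF f, of 0]
  obtain s where s: "\<And>i. simple_function borel (s i)" "\<And>x. (\<lambda>i. s i x) \<longlonglongrightarrow> f x"
    "\<And>i x. dist (s i x) 0 \<le> 2 * dist (f x) 0" by (auto simp: space_borel)
  show ?thesis
  proof (rule trig_closure.lim[where F=s and c="2*c"])
    show "(\<lambda>i. s i x) \<longlonglongrightarrow> f x" for x by (rule s)
    show "norm (s i x) \<le> 2 * c" for i x using s(3)[of i x] b[of x] by simp
    fix i
    have fin: "finite (range (s i))" using s(1)[of i] by (auto simp: simple_function_def space_borel)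
    have "s i = (\<lambda>x. \<Sum>y\<in>range (s i). y * indicator (s i -` {y}) x)"
    proof
      fix x
      have "(\<Sum>y\<in>range (s i). y * indicator (s i -` {y}) x) = (\<Sum>y\<in>range (s i). if y = s i x then y else 0)"
        by (intro sum.cong) (auto simp: indicator_def)
      then show "s i x = (\<Sum>y\<in>range (s i). y * indicator (s i -` {y}) x)" using fin by simp
    qed
    moreover have "(\<lambda>x. \<Sum>y\<in>range (s i). y * indicator (s i -` {y}) x) \<in> trig_closure"
    proof (intro trig_closure_sum fin trig_closure_scale trig_closure_indicator)
      fix y assume "y \<in> range (s i)"
      then show "s i -` {y} \<in> sets borel" using s(1)[of i] by (auto simp: simple_function_def space_borel)
    qed
    ultimately show "s i \<in> trig_closure" by simp
  qed
qed

text \<open>The uniqueness theorem for characteristic functions in several variables, obtained by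
  induction over \<open>trig_closure\<close> instead of an inversion formula: equality of integrals
  is preserved by bounded limits, and indicators lie in the closure.\<close>

lemma finite_measure_eqI_wave:
  fixes M N :: "(real^'n::finite) measure"
  assumes M: "finite_measure M" "sets M = sets borel" and N: "finite_measure N" "sets N = sets borel"
    and eq: "\<And>\<xi>. (LINT x|M. wave \<xi> x) = (LINT x|N. wave \<xi> x)"
  shows "M = N"
proof -
  interpret M: finite_measure M by fact
  interpret N: finite_measure N by fact
  note [measurable_cong] = M(2) N(2)
  have int: "integrable M f" "integrable N f" if f: "f \<in> trig_closure" for f
  proof -
    obtain c where "\<And>x. norm (f x) \<le> c" using trig_closure_bounded[OF f] by auto
    then show "integrable M f" "integrable N f"
      using trig_closure_measurable[OF f] by (auto intro!: M.integrable_const_bound N.integrable_const_bound)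
  qed
  have "integral\<^sup>L M f = integral\<^sup>L N f" if "f \<in> trig_closure" for f
    using that
  proof (induction rule: trig_closure.induct)
    case (wave \<xi>) show ?case by (rule eq)
  next
    case (lincomb f g a b)
    then show ?case using int[OF lincomb(1)] int[OF lincomb(2)] by simp
  next
    case (lim F f c)
    have fm: "f \<in> borel_measurable borel"
      by (rule trig_closure_measurable[OF trig_closure.lim]) (use lim in auto)
    have Fm: "F k \<in> borel_measurable borel" for k by (rule trig_closure_measurable[OF lim(1)])
    have "(\<lambda>k. integral\<^sup>L M (F k)) \<longlonglongrightarrow> integral\<^sup>L M f"
      by (rule integral_dominated_convergence[where w="\<lambda>_. c"]) (use lim fm Fm in auto)
    moreover have "(\<lambda>k. integral\<^sup>L N (F k)) \<longlonglongrightarrow> integral\<^sup>L N f"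
      by (rule integral_dominated_convergence[where w="\<lambda>_. c"]) (use lim fm Fm in auto)
    ultimately show ?case using lim(4) LIMSEQ_unique by (metis (no_types, lifting) LIMSEQ_unique ext)
  qed
  note eqT = this
  show ?thesis
  proof (rule measure_eqI)
    show "sets M = sets N" using M N by simp
    fix A assume A: "A \<in> sets M"
    have "(LINT x|M. indicator A x :: complex) = (LINT x|N. indicator A x)"
      by (rule eqT[OF trig_closure_indicator]) (use A M in auto)
    then have "(LINT x|M. complex_of_real (indicator A x)) = (LINT x|N. complex_of_real (indicator A x))"
      by (simp only: of_real_indicator)
    then have "measure M A = measure N A" unfolding integral_complex_of_real of_real_eq_iff
      using A M(2) N(2) by simp
    then show "emeasure M A = emeasure N A" by (simp add: M.emeasure_eq_measure N.emeasure_eq_measure)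
  qed
qed

section \<open>Density of weighted trigonometric polynomials in L2\<close>

inductive_set trig_span :: "(real ^ 'n::finite \<Rightarrow> complex) \<Rightarrow> (real ^ 'n \<Rightarrow> complex) set"
  for w :: "real ^ 'n \<Rightarrow> complex" where
  wave: "(\<lambda>x. w x * wave \<xi> x) \<in> trig_span w"
| lincomb: "f \<in> trig_span w \<Longrightarrow> g \<in> trig_span w \<Longrightarrow> (\<lambda>x. a * f x + b * g x) \<in> trig_span w"

text \<open>The L2-closure \<open>C\<close> of the span contains \<open>w * f\<close> for every
  \<open>f\<close> in the trigonometric closure, hence for every bounded Borel \<open>f\<close>:
  bounded pointwise limits become L2 limits because \<open>w\<close> is square integrable. A general
  \<open>u\<close> is the limit of \<open>w\<close> times truncations of the quotient
  \<open>u / w\<close>, which is where \<open>w\<close> must not vanish.\<close>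

lemma L2_dense_trig_span:
  fixes w :: "real ^ 'n::finite \<Rightarrow> complex"
  assumes w: "w \<in> L2" and nz: "\<And>x. w x \<noteq> 0"
  shows "L2_dense (trig_span w)"
proof -
  have sub: "v \<in> L2" if "v \<in> trig_span w" for v using that
  proof (induction rule: trig_span.induct)
    case (wave \<xi>)
    show ?case by (rule L2_bound[OF w]) (use L2D[OF w] in \<open>auto simp: norm_mult\<close>)
  qed (rule L2_lincomb)
  define C where "C = {u \<in> L2. \<forall>e>0. \<exists>v\<in>trig_span w. L2_norm (\<lambda>x. u x - v x) < e}"
  have closed: "u \<in> C" if u: "u \<in> L2" and V: "\<And>k. V k \<in> C" and l: "(\<lambda>k. L2_norm (\<lambda>x. V k x - u x)) \<longlonglongrightarrow> 0" for u V
  proof -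
    have "\<exists>v\<in>trig_span w. L2_norm (\<lambda>x. u x - v x) < e" if e: "e > 0" for e
    proof -
      from order_tendstoD(2)[OF l, of "e/2"] e obtain k where k: "L2_norm (\<lambda>x. V k x - u x) < e/2"
        by (auto simp: eventually_sequentially)
      obtain v where v: "v \<in> trig_span w" "L2_norm (\<lambda>x. V k x - v x) < e/2"
        using V[of k] e unfolding C_def by (auto dest!: spec[of _ "e/2"])
      have VL: "V k \<in> L2" using V by (auto simp: C_def)
      have "L2_norm (\<lambda>x. u x - v x) \<le> L2_norm (\<lambda>x. u x - V k x) + L2_norm (\<lambda>x. V k x - v x)"
        by (rule L2_norm_triangle_diff[OF u VL sub[OF v(1)]])
      then show ?thesis using v k by (intro bexI[OF _ v(1)]) (simp add: L2_norm_minus_commute[of u])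
    qed
    then show ?thesis using u by (auto simp: C_def)
  qed
  have main: "(\<lambda>x. w x * f x) \<in> C" if "f \<in> trig_closure" for f
    using that
  proof (induction rule: trig_closure.induct)
    case (wave \<xi>)
    have v: "(\<lambda>x. w x * wave \<xi> x) \<in> trig_span w" by (rule trig_span.wave)
    show ?case unfolding C_def using v sub[OF v] by (auto intro!: bexI[OF _ v])
  next
    case (lincomb f g a b)
    have fg: "(\<lambda>x. w x * f x) \<in> L2" "(\<lambda>x. w x * g x) \<in> L2" using lincomb by (auto simp: C_def)
    have "\<exists>v\<in>trig_span w. L2_norm (\<lambda>x. w x * (a * f x + b * g x) - v x) < e" if e: "e > 0" for e
    proof -
      define d where "d = e / (norm a + norm b + 1)"
      have pos: "norm a + norm b + 1 > 0" by (smt (verit) norm_ge_zero)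
      have d: "d > 0" using e pos by (simp add: d_def)
      obtain v where v: "v \<in> trig_span w" "L2_norm (\<lambda>x. w x * f x - v x) < d"
        using lincomb(3) d unfolding C_def by blast
      obtain z where z: "z \<in> trig_span w" "L2_norm (\<lambda>x. w x * g x - z x) < d"
        using lincomb(4) d unfolding C_def by blast
      have "L2_norm (\<lambda>x. w x * (a * f x + b * g x) - (a * v x + b * z x))
         = L2_norm (\<lambda>x. a * (w x * f x - v x) + b * (w x * g x - z x))" by (simp add: algebra_simps)
      also have "\<dots> \<le> norm a * L2_norm (\<lambda>x. w x * f x - v x) + norm b * L2_norm (\<lambda>x. w x * g x - z x)"
        by (intro L2_norm_lincomb L2_diff fg sub v z)
      also have "\<dots> \<le> norm a * d + norm b * d" using v z by (intro add_mono mult_left_mono) auto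
      also have "\<dots> < (norm a + norm b + 1) * d" using d by (simp add: algebra_simps)
      also have "\<dots> = e" using pos by (simp add: d_def)
      finally show ?thesis by (intro bexI[OF _ trig_span.lincomb[OF v(1) z(1)]])
    qed
    then show ?case using L2_lincomb[OF fg, of a b] by (auto simp: C_def algebra_simps)
  next
    case (lim F f c)
    have f: "f \<in> trig_closure" by (rule trig_closure.lim) (use lim in auto)
    have b: "norm (w x * F k x) \<le> norm (of_real c * w x)" for k x
    proof -
      have "norm (w x) * norm (F k x) \<le> norm (w x) * c" by (intro mult_left_mono lim) auto
      moreover have "c \<ge> 0" using lim(3)[of k x] norm_ge_zero[of "F k x"] by linarith
      ultimately show ?thesis by (simp add: norm_mult mult.commute)
    qed
    have bf: "norm (w x * f x) \<le> norm (of_real c * w x)" for x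
      by (rule LIMSEQ_le_const2[OF tendsto_norm[OF tendsto_mult_left[OF lim(2)]]]) (use b in auto)
    have fL: "(\<lambda>x. w x * f x) \<in> L2"
      by (rule L2_bound[OF L2_scale[OF w, of "of_real c"]])
        (use bf L2D[OF w] trig_closure_measurable[OF f] in auto)
    show ?case
    proof (rule closed[OF fL lim(4)])
      show "(\<lambda>k. L2_norm (\<lambda>x. w x * F k x - w x * f x)) \<longlonglongrightarrow> 0"
        by (rule L2_norm_dominated_convergence[OF L2_scale[OF w, of "of_real c"]])
         (use b lim L2D[OF w] trig_closure_measurable[OF f] trig_closure_measurable[OF lim(1)] in
            \<open>auto intro!: tendsto_intros\<close>)
    qed
  qed
  have "u \<in> C" if u: "u \<in> L2" for u
  proof (rule closed[OF u])
    note [measurable] = L2D(1)[OF u] L2D(1)[OF w]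
    define F where "F = (\<lambda>(k::nat) x. indicator {x. norm (u x / w x) \<le> real k} x * (u x / w x))"
    have m[measurable]: "F k \<in> borel_measurable borel" for k unfolding F_def by measurable
    show "(\<lambda>x. w x * F k x) \<in> C" for k
      by (intro main trig_closure_bounded_measurable[where c="real k"] m) (auto simp: F_def indicator_def)
    show "(\<lambda>k. L2_norm (\<lambda>x. w x * F k x - u x)) \<longlonglongrightarrow> 0"
    proof (rule L2_norm_dominated_convergence[OF u])
      fix x
      obtain K :: nat where K: "real K > norm (u x / w x)" using reals_Archimedean2 by blast
      have "eventually (\<lambda>k. w x * F k x = u x) sequentially"
        using eventually_ge_at_top[of K]
      proof eventually_elim
        case (elim k)
        then have "norm (u x / w x) \<le> real k" using K by linarith
        then show ?case using nz[of x] by (simp add: F_def)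
      qed
      then show "(\<lambda>k. w x * F k x) \<longlonglongrightarrow> u x" by (rule tendsto_eventually)
      show "norm (w x * F k x) \<le> norm (u x)" for k using nz[of x] by (auto simp: F_def indicator_def)
    qed measurable
  qed
  then show ?thesis using sub by (auto simp: L2_dense_def C_def)
qed

section \<open>Gaussian integrals\<close>

lemma integrable_exp_norm_square:
  assumes c: "c > 0"
  shows "integrable lborel (\<lambda>x::real^'n::finite. exp (- c * (norm x)\<^sup>2))"
proof (rule integrableI_nonneg)
  \<comment> \<open>Chosen so that \<open>1 / (2 * \<sigma>\<^sup>2) = c\<close>: the
    one-dimensional factor is a multiple of a normal density, whose integrability is known.\<close>
  let ?\<sigma> = "sqrt (1 / (2 * c))"
  have s: "?\<sigma> > 0" using c by simp
  have eq: "exp (- c * t\<^sup>2) = sqrt (2 * pi * ?\<sigma>\<^sup>2) * normal_density 0 ?\<sigma> t" for t :: real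
    using c by (simp add: normal_density_def field_simps real_sqrt_divide)
  have "integrable lborel (\<lambda>t::real. exp (- c * t\<^sup>2))"
    unfolding eq by (intro integrable_mult_right integrable_normal_density s)
  from integrableD(2)[OF this]
  have fin: "(\<integral>\<^sup>+t. ennreal (exp (- c * t\<^sup>2)) \<partial>lborel) < \<infinity>" by (simp add: less_top)
  have "(\<integral>\<^sup>+x. ennreal (exp (- c * (norm (x::real^'n))\<^sup>2)) \<partial>lborel)
      = (\<integral>\<^sup>+x. (\<Prod>b\<in>Basis. ennreal (exp (- c * ((x::real^'n) \<bullet> b)\<^sup>2))) \<partial>lborel)"
  proof (rule nn_integral_cong)
    fix x :: "real^'n"
    have "(norm x)\<^sup>2 = (\<Sum>b\<in>Basis. (x \<bullet> b)\<^sup>2)"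
      unfolding power2_norm_eq_inner by (subst euclidean_inner) (simp add: power2_eq_square)
    then have "exp (- c * (norm x)\<^sup>2) = (\<Prod>b\<in>Basis. exp (- c * (x \<bullet> b)\<^sup>2))"
      by (simp add: exp_sum[symmetric] sum_distrib_left sum_negf)
    then show "ennreal (exp (- c * (norm x)\<^sup>2)) = (\<Prod>b\<in>Basis. ennreal (exp (- c * (x \<bullet> b)\<^sup>2)))"
      by (simp add: prod_ennreal)
  qed
  also have "\<dots> = (\<Prod>b\<in>(Basis::(real^'n) set). \<integral>\<^sup>+t. ennreal (exp (- c * t\<^sup>2)) \<partial>lborel)"
    by (rule nn_integral_lborel_prod) auto
  also have "\<dots> < \<infinity>" using fin by (simp add: power_less_top_ennreal)
  finally show "(\<integral>\<^sup>+x. ennreal (exp (- c * (norm (x::real^'n))\<^sup>2)) \<partial>lborel) < \<infinity>" .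
qed auto

definition pos_def_map :: "(real^'n::finite \<Rightarrow> real^'n) \<Rightarrow> bool" where
  "pos_def_map G \<longleftrightarrow> linear G \<and> (\<forall>x y. G x \<bullet> y = x \<bullet> G y) \<and> (\<forall>x. x \<noteq> 0 \<longrightarrow> x \<bullet> G x > 0)"

lemma pos_def_mapD:
  assumes "pos_def_map G"
  shows "linear G" "G x \<bullet> y = x \<bullet> G y" "x \<noteq> 0 \<Longrightarrow> x \<bullet> G x > 0" "x \<bullet> G x \<ge> 0"
    "bounded_linear G" "continuous_on A G"
  using assms linear_conv_bounded_linear[of G] linear_continuous_on[of G A]
  by (auto simp: pos_def_map_def, cases "x = 0", auto simp: less_imp_le)

lemma pos_def_map_coercive:
  fixes G :: "real^'n::finite \<Rightarrow> real^'n"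
  assumes G: "pos_def_map G"
  shows "\<exists>c>0. \<forall>x. c * (norm x)\<^sup>2 \<le> x \<bullet> G x"
proof -
  have "continuous_on (sphere 0 1) (\<lambda>x. x \<bullet> G x)"
    by (intro continuous_intros pos_def_mapD(6)[OF G])
  moreover have "axis undefined 1 \<in> sphere (0::real^'n) 1" by (simp add: norm_axis_1)
  ultimately obtain x0 where x0: "x0 \<in> sphere (0::real^'n) 1" "\<And>x. x \<in> sphere 0 1 \<Longrightarrow> x0 \<bullet> G x0 \<le> x \<bullet> G x"
    using continuous_attains_inf[OF compact_sphere[of "0::real^'n" 1]] by blast
  have "(x0 \<bullet> G x0) * (norm x)\<^sup>2 \<le> x \<bullet> G x" for x
  proof (cases "x = 0")
    case False
    have "x0 \<bullet> G x0 \<le> (x /\<^sub>R norm x) \<bullet> G (x /\<^sub>R norm x)" using False by (intro x0) auto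
    also have "\<dots> = (x \<bullet> G x) / (norm x)\<^sup>2"
      by (simp add: linear_scale[OF pos_def_mapD(1)[OF G]] power2_eq_square divide_inverse)
    finally show ?thesis using False by (simp add: field_simps)
  qed (use linear_0[OF pos_def_mapD(1)[OF G]] in auto)
  moreover have "x0 \<bullet> G x0 > 0" using x0(1) by (intro pos_def_mapD(3)[OF G]) auto
  ultimately show ?thesis by blast
qed

lemma pos_def_map_inverse:
  fixes G :: "real^'n::finite \<Rightarrow> real^'n"
  assumes G: "pos_def_map G"
  shows "G (inv G x) = x" "inv G (G x) = x" "pos_def_map (inv G)"
proof -
  have inj: "inj G"
    unfolding linear_injective_0[OF pos_def_mapD(1)[OF G]] using pos_def_mapD(3)[OF G] by force
  have bij: "bij G" using linear_inj_imp_surj[OF pos_def_mapD(1)[OF G] inj] inj by (simp add: bij_def)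
  show r: "G (inv G x) = x" for x using bij by (simp add: bij_is_surj surj_f_inv_f)
  show l: "inv G (G x) = x" for x using inj by simp
  have lin: "linear (inv G)"
    by (rule linearI) (metis l r linear_add[OF pos_def_mapD(1)[OF G]], metis l r linear_scale[OF pos_def_mapD(1)[OF G]])
  have sym: "inv G x \<bullet> y = x \<bullet> inv G y" for x y
    using pos_def_mapD(2)[OF G, of "inv G x" "inv G y"] by (simp add: r)
  have "x \<bullet> inv G x > 0" if "x \<noteq> 0" for x
  proof -
    have "inv G x \<noteq> 0" using that r[of x] linear_0[OF pos_def_mapD(1)[OF G]] by auto
    from pos_def_mapD(3)[OF G this] show ?thesis by (simp add: r sym)
  qed
  then show "pos_def_map (inv G)" using lin sym by (auto simp: pos_def_map_def)
qed

text \<open>With the factor 1/2 the Fourier transform of \<open>gauss G\<close> is a multiple of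
  \<open>gauss (inv G)\<close>, so no constants have to be carried through the covariances.\<close>

definition gauss :: "(real^'n::finite \<Rightarrow> real^'n) \<Rightarrow> real^'n \<Rightarrow> real" where
  "gauss G x = exp (- (x \<bullet> G x) / 2)"

lemma gauss_pos [simp]: "gauss G x > 0" "gauss G x \<noteq> 0" "gauss G x \<ge> 0" "\<bar>gauss G x\<bar> = gauss G x"
  by (auto simp: gauss_def)

lemma gauss_poly_integrable:
  fixes f :: "real^'n::finite \<Rightarrow> 'b::{banach,second_countable_topology}"
  assumes G: "pos_def_map G" and f: "f \<in> borel_measurable borel"
    and b: "\<And>x. norm (f x) \<le> C * (1 + norm x) ^ m * gauss G x"
  shows "integrable lborel f"
proof -
  obtain c where c: "c > 0" "\<And>x. c * (norm x)\<^sup>2 \<le> x \<bullet> G x" using pos_def_map_coercive[OF G] by auto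
  \<comment> \<open>After \<open>(1 + norm x) ^ m \<le> exp (m * norm x)\<close>, completing the
    square bounds the exponent \<open>m * norm x - c * (norm x)\<^sup>2 / 2\<close> by
    \<open>m\<^sup>2 / c - (c / 4) * (norm x)\<^sup>2\<close>: half of the Gaussian decay is spent
    on the polynomial.\<close>
  define D where "D = exp ((real m)\<^sup>2 / c)"
  have key: "(1 + norm x) ^ m * gauss G x \<le> D * exp (- (c/4) * (norm x)\<^sup>2)" for x
  proof -
    have "(1 + norm x) ^ m \<le> exp (norm x) ^ m" by (intro power_mono) auto
    also have "\<dots> = exp (real m * norm x)" by (simp add: exp_of_nat_mult)
    finally have "(1 + norm x) ^ m * gauss G x \<le> exp (real m * norm x) * exp (- (c * (norm x)\<^sup>2) / 2)"
      unfolding gauss_def using c(2)[of x] by (intro mult_mono) auto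
    also have "\<dots> = exp (real m * norm x - c * (norm x)\<^sup>2 / 2)" by (simp add: exp_add[symmetric])
    also have "\<dots> \<le> exp ((real m)\<^sup>2 / c + - (c/4) * (norm x)\<^sup>2)"
    proof -
      have "0 \<le> (2 * real m - c * norm x)\<^sup>2 / (4 * c)" using c by simp
      also have "\<dots> = (real m)\<^sup>2 / c - real m * norm x + (c/4) * (norm x)\<^sup>2"
        using c by (simp add: power2_eq_square field_simps)
      finally show ?thesis by simp
    qed
    finally show ?thesis by (simp only: D_def exp_add)
  qed
  have "integrable lborel (\<lambda>x::real^'n. \<bar>C\<bar> * (D * exp (- (c/4) * (norm x)\<^sup>2)))"
    by (intro integrable_mult_right integrable_exp_norm_square) (use c in auto)
  then show ?thesis
  proof (rule Bochner_Integration.integrable_bound)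
    have "norm (f x) \<le> norm (\<bar>C\<bar> * (D * exp (- (c/4) * (norm x)\<^sup>2)))" for x
    proof -
      have "norm (f x) \<le> C * ((1 + norm x) ^ m * gauss G x)" using b[of x] by (simp add: mult.assoc)
      also have "\<dots> \<le> \<bar>C\<bar> * ((1 + norm x) ^ m * gauss G x)" by (intro mult_right_mono) auto
      also have "\<dots> \<le> \<bar>C\<bar> * (D * exp (- (c/4) * (norm x)\<^sup>2))" by (intro mult_left_mono key) auto
      also have "\<dots> \<le> norm (\<bar>C\<bar> * (D * exp (- (c/4) * (norm x)\<^sup>2)))" by simp
      finally show ?thesis .
    qed
    then show "AE x in lborel. norm (f x) \<le> norm (\<bar>C\<bar> * (D * exp (- (c/4) * (norm x)\<^sup>2)))" by simp
  qed (use f in auto)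
qed

lemma gauss_has_derivative:
  assumes G: "pos_def_map G"
  shows "(gauss G has_derivative (\<lambda>h. - (G x \<bullet> h) * gauss G x)) (at x)"
proof -
  have "((\<lambda>x. x \<bullet> G x) has_derivative (\<lambda>h. x \<bullet> G h + h \<bullet> G x)) (at x)"
    by (rule has_derivative_inner[OF has_derivative_ident bounded_linear_imp_has_derivative[OF pos_def_mapD(5)[OF G]]])
  moreover have "x \<bullet> G h + h \<bullet> G x = 2 * (G x \<bullet> h)" for h
    using pos_def_mapD(2)[OF G, of x h] by (simp add: inner_commute)
  ultimately have "((\<lambda>x. x \<bullet> G x) has_derivative (\<lambda>h. 2 * (G x \<bullet> h))) (at x)" by simp
  from has_derivative_mult_right[OF this, of "-1/2"]
  have "((\<lambda>x. - (x \<bullet> G x) / 2) has_derivative (\<lambda>h. - (G x \<bullet> h))) (at x)" by simp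
  from has_derivative_compose[OF this DERIV_exp[unfolded has_field_derivative_def]]
  show ?thesis by (simp add: gauss_def[abs_def] mult.commute)
qed

lemma continuous_gauss [continuous_intros]: "pos_def_map G \<Longrightarrow> continuous_on A (gauss G)"
  by (rule continuous_at_imp_continuous_on) (auto intro: has_derivative_continuous gauss_has_derivative)

lemma gauss_measurable: "pos_def_map G \<Longrightarrow> gauss G \<in> borel_measurable borel"
  by (intro borel_measurable_continuous_onI continuous_intros)

lemma gauss_integrable: "pos_def_map G \<Longrightarrow> integrable lborel (gauss G)"
  by (rule gauss_poly_integrable[where C=1 and m=0]) (auto intro: gauss_measurable)

section \<open>Differentiation of Fourier integrals and the transform of a Gaussian\<close>

lemma wave_has_derivative:
  "(wave \<xi> has_derivative (\<lambda>h. \<i> * of_real (\<xi> \<bullet> h) * wave \<xi> x)) (at x)"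
proof -
  have "((\<lambda>x. \<i> * of_real (\<xi> \<bullet> x)) has_derivative (\<lambda>h. \<i> * of_real (\<xi> \<bullet> h))) (at x)"
    by (auto intro!: derivative_eq_intros)
  from has_derivative_compose[OF this DERIV_exp[unfolded has_field_derivative_def]]
  show ?thesis by (simp add: wave_def[abs_def] cis_conv_exp mult.commute)
qed

lemma integral_translate:
  fixes f :: "real^'n::finite \<Rightarrow> 'b::{banach,second_countable_topology}"
  assumes f: "f \<in> borel_measurable borel"
  shows "(LINT x|lborel. f (x + v)) = (LINT x|lborel. f x)"
    and "integrable lborel (\<lambda>x. f (x + v)) \<longleftrightarrow> integrable lborel f"
proof -
  have "(LINT x|distr lborel borel ((+) v). f x) = (LINT x|lborel. f (v + x))"
    by (rule integral_distr) (use f in auto)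
  then show "(LINT x|lborel. f (x + v)) = (LINT x|lborel. f x)"
    by (simp add: lborel_distr_plus add.commute)
  have "integrable (distr lborel borel ((+) v)) f \<longleftrightarrow> integrable lborel (\<lambda>x. f (v + x))"
    by (rule integrable_distr_eq) (use f in auto)
  then show "integrable lborel (\<lambda>x. f (x + v)) \<longleftrightarrow> integrable lborel f"
    by (simp add: lborel_distr_plus add.commute)
qed

text \<open>Write \<open>f (x + e) - f x\<close> as the integral of the derivative over the segment
  and integrate over \<open>x\<close>. Translation invariance makes the left side vanish and, after
  Fubini, turns the right side into the integral of the derivative. Integrability replaces any
  pointwise decay of \<open>f\<close> at infinity.\<close>

lemma integral_derivative_eq_0:
  fixes f :: "real^'n::finite \<Rightarrow> complex"
  assumes d: "\<And>x. (f has_derivative f' x) (at x)" and c: "continuous_on UNIV (\<lambda>x. f' x e)"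
    and i: "integrable lborel f" "integrable lborel (\<lambda>x. f' x e)"
  shows "(LINT x|lborel. f' x e) = 0"
proof -
  define g where "g = (\<lambda>x. f' x e)"
  have gm [measurable]: "g \<in> borel_measurable borel" using c unfolding g_def by (rule borel_measurable_continuous_onI)
  have gi: "integrable lborel g" using i by (simp add: g_def)
  have "continuous_on UNIV f"
    by (rule continuous_at_imp_continuous_on) (auto intro: has_derivative_continuous d)
  then have fm [measurable]: "f \<in> borel_measurable borel" by (rule borel_measurable_continuous_onI)
  have gis: "integrable lborel (\<lambda>x. g (x + s *\<^sub>R e))" for s
    using integral_translate(2)[OF gm] gi by blast
  have fis: "integrable lborel (\<lambda>x. f (x + e))"
    using integral_translate(2)[OF fm] i(1) by blast
  have ftc: "has_bochner_integral lborel (\<lambda>s. indicator {0..1} s *\<^sub>R g (x + s *\<^sub>R e)) (f (x + e) - f x)" for x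
  proof -
    have "has_bochner_integral lborel (\<lambda>s. indicator {0..1} s *\<^sub>R g (x + s *\<^sub>R e)) (f (x + 1 *\<^sub>R e) - f (x + 0 *\<^sub>R e))"
    proof (rule has_bochner_integral_FTC_Icc)
      fix s :: real
      have "((\<lambda>s. f (x + s *\<^sub>R e)) has_derivative (\<lambda>h. f' (x + s *\<^sub>R e) (h *\<^sub>R e))) (at s within {0..1})"
        by (rule has_derivative_compose[where f="\<lambda>s. x + s *\<^sub>R e", OF _ d]) (auto intro!: derivative_eq_intros)
      moreover have "f' (x + s *\<^sub>R e) (h *\<^sub>R e) = h *\<^sub>R g (x + s *\<^sub>R e)" for h
        using has_derivative_linear[OF d[of "x + s *\<^sub>R e"]] by (simp add: linear_scale g_def)
      ultimately show "((\<lambda>s. f (x + s *\<^sub>R e)) has_vector_derivative g (x + s *\<^sub>R e)) (at s within {0..1})"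
        by (simp add: has_vector_derivative_def)
    next
      have "continuous_on UNIV g" using c by (simp add: g_def)
      then show "continuous_on {0..1} (\<lambda>s. g (x + s *\<^sub>R e))"
        by (rule continuous_on_compose2) (auto intro!: continuous_intros)
    qed auto
    then show ?thesis by simp
  qed
  let ?h = "\<lambda>(s::real, x::real^'n). indicator {0..1} s *\<^sub>R g (x + s *\<^sub>R e)"
  have int: "integrable (lborel \<Otimes>\<^sub>M lborel) ?h"
  proof (rule lborel_pair.Fubini_integrable)
    show "?h \<in> borel_measurable (lborel \<Otimes>\<^sub>M lborel)" by measurable
    have "(LINT x|lborel. norm (g (x + s *\<^sub>R e))) = (LINT x|lborel. norm (g x))" for s
      using integral_translate(1)[of "\<lambda>x. norm (g x)" "s *\<^sub>R e"] by simp
    then show "integrable lborel (\<lambda>s. LINT x|lborel. norm (?h (s, x)))" by simp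
    show "AE s in lborel. integrable lborel (\<lambda>x. ?h (s, x))" using gis by simp
  qed
  have "(LINT x|lborel. (LINT s|lborel. ?h (s, x))) = (LINT s|lborel. (LINT x|lborel. ?h (s, x)))"
    using lborel_pair.Fubini_integral[OF int] by simp
  moreover have "(LINT s|lborel. ?h (s, x)) = f (x + e) - f x" for x
    using has_bochner_integral_integral_eq[OF ftc[of x]] by simp
  moreover have "(LINT x|lborel. f (x + e) - f x) = 0"
    using i fis integral_translate(1)[OF fm, of e] by simp
  ultimately have "(LINT s::real|lborel. indicator {0..1} s *\<^sub>R (LINT x|lborel. g (x + s *\<^sub>R e))) = 0" by simp
  then have "(LINT s::real|lborel. indicator {0..1} s *\<^sub>R (LINT x|lborel. g x)) = 0"
    unfolding integral_translate(1)[OF gm] .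
  moreover have "(LINT s::real|lborel. indicator {0..1} s *\<^sub>R (LINT x|lborel. g x)) = (LINT x|lborel. g x)"
    by (subst integral_scaleR_left) auto
  ultimately show ?thesis by (simp add: g_def)
qed

text \<open>The pointwise estimate \<open>norm (cis t - 1 - \<i> * t) \<le> t\<^sup>2 / 2\<close>
  integrates to an explicit quadratic remainder whose constant is the second moment of
  \<open>w\<close>. This yields the full derivative at once, without differentiating under the
  integral direction by direction.\<close>

lemma integral_wave_has_derivative:
  fixes w :: "real^'n::finite \<Rightarrow> complex"
  assumes w: "w \<in> borel_measurable borel" and i0: "integrable lborel w"
    and i2: "integrable lborel (\<lambda>x. (norm x)\<^sup>2 * norm (w x))"
  shows "((\<lambda>\<xi>. LINT x|lborel. w x * wave \<xi> x) has_derivative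
    (\<lambda>h. LINT x|lborel. w x * (\<i> * of_real (h \<bullet> x) * wave \<xi> x))) (at \<xi>)"
proof -
  note [measurable] = w
  have iw: "integrable lborel (\<lambda>x. w x * wave \<eta> x)" for \<eta>
    by (rule Bochner_Integration.integrable_bound[OF i0]) (auto simp: norm_mult)
  have i1: "integrable lborel (\<lambda>x. w x * (\<i> * of_real (h \<bullet> x) * wave \<eta> x))" for h \<eta>
  proof (rule Bochner_Integration.integrable_bound)
    show "integrable lborel (\<lambda>x. norm h * (norm (w x) + (norm x)\<^sup>2 * norm (w x)))"
      using i0 i2 by (intro integrable_mult_right Bochner_Integration.integrable_add integrable_norm)
    have "norm (w x * (\<i> * of_real (h \<bullet> x) * wave \<eta> x)) \<le> norm h * (norm (w x) + (norm x)\<^sup>2 * norm (w x))" for x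
    proof -
      have "\<bar>h \<bullet> x\<bar> \<le> norm h * norm x" by (rule Cauchy_Schwarz_ineq2)
      also have "norm h * norm x \<le> norm h * (1 + (norm x)\<^sup>2)"
        using sum_squares_bound[of 1 "norm x"] by (intro mult_left_mono) (auto intro: order_trans[of _ "2 * norm x"])
      finally have "norm (w x) * \<bar>h \<bullet> x\<bar> \<le> norm (w x) * (norm h * (1 + (norm x)\<^sup>2))" by (intro mult_left_mono) auto
      then show ?thesis by (simp add: norm_mult algebra_simps)
    qed
    then show "AE x in lborel. norm (w x * (\<i> * of_real (h \<bullet> x) * wave \<eta> x)) \<le> norm (norm h * (norm (w x) + (norm x)\<^sup>2 * norm (w x)))"
      by (intro AE_I2) (smt (verit) real_norm_def)
  qed measurable
  have lin: "linear (\<lambda>h. LINT x|lborel. w x * (\<i> * of_real (h \<bullet> x) * wave \<xi> x))"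
  proof (rule linearI)
    show "(LINT x|lborel. w x * (\<i> * of_real ((h + k) \<bullet> x) * wave \<xi> x)) =
      (LINT x|lborel. w x * (\<i> * of_real (h \<bullet> x) * wave \<xi> x)) + (LINT x|lborel. w x * (\<i> * of_real (k \<bullet> x) * wave \<xi> x))" for h k
      by (subst Bochner_Integration.integral_add[symmetric], rule i1, rule i1, rule Bochner_Integration.integral_cong)
        (auto simp: inner_add_left algebra_simps)
    show "(LINT x|lborel. w x * (\<i> * of_real ((c *\<^sub>R h) \<bullet> x) * wave \<xi> x)) =
      c *\<^sub>R (LINT x|lborel. w x * (\<i> * of_real (h \<bullet> x) * wave \<xi> x))" for h c
    proof -
      have "w x * (\<i> * of_real ((c *\<^sub>R h) \<bullet> x) * wave \<xi> x) = c *\<^sub>R (w x * (\<i> * of_real (h \<bullet> x) * wave \<xi> x))" for x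
        by (simp add: scaleR_conv_of_real[where 'a=complex])
      then show ?thesis by (simp only: integral_scaleR_right)
    qed
  qed
  define D where "D = (LINT x|lborel. (norm x)\<^sup>2 * norm (w x))"
  have D: "D \<ge> 0" by (simp add: D_def)
  have est: "norm ((LINT x|lborel. w x * wave \<eta> x) - (LINT x|lborel. w x * wave \<xi> x)
    - (LINT x|lborel. w x * (\<i> * of_real ((\<eta> - \<xi>) \<bullet> x) * wave \<xi> x))) \<le> D * (norm (\<eta> - \<xi>))\<^sup>2" for \<eta>
  proof -
    have eq: "(LINT x|lborel. w x * wave \<eta> x) - (LINT x|lborel. w x * wave \<xi> x)
      - (LINT x|lborel. w x * (\<i> * of_real ((\<eta> - \<xi>) \<bullet> x) * wave \<xi> x))
      = (LINT x|lborel. w x * wave \<eta> x - w x * wave \<xi> x - w x * (\<i> * of_real ((\<eta> - \<xi>) \<bullet> x) * wave \<xi> x))"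
      by (simp add: iw i1)
    have "norm (LINT x|lborel. w x * wave \<eta> x - w x * wave \<xi> x - w x * (\<i> * of_real ((\<eta> - \<xi>) \<bullet> x) * wave \<xi> x))
      \<le> (LINT x|lborel. norm (w x * wave \<eta> x - w x * wave \<xi> x - w x * (\<i> * of_real ((\<eta> - \<xi>) \<bullet> x) * wave \<xi> x)))"
      by (rule integral_norm_bound)
    also have "\<dots> \<le> (LINT x|lborel. (norm (\<eta> - \<xi>))\<^sup>2 * ((norm x)\<^sup>2 * norm (w x)))"
    proof (rule integral_mono)
      fix x
      define t where "t = (\<eta> - \<xi>) \<bullet> x"
      have wv: "wave \<eta> x = wave \<xi> x * cis t" by (simp add: t_def wave_def cis_mult inner_diff_left)
      have "w x * wave \<eta> x - w x * wave \<xi> x - w x * (\<i> * of_real ((\<eta> - \<xi>) \<bullet> x) * wave \<xi> x)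
        = w x * wave \<xi> x * (cis t - 1 - \<i> * of_real t)" unfolding wv t_def by (simp add: algebra_simps)
      then have "norm (w x * wave \<eta> x - w x * wave \<xi> x - w x * (\<i> * of_real ((\<eta> - \<xi>) \<bullet> x) * wave \<xi> x))
        = norm (w x) * norm (cis t - 1 - \<i> * of_real t)" by (simp add: norm_mult)
      moreover have "norm (cis t - 1 - \<i> * of_real t) \<le> t\<^sup>2 / 2"
        using iexp_approx1[of t 1] by (simp add: cis_conv_exp algebra_simps power2_eq_square)
      moreover have "t\<^sup>2 / 2 \<le> (norm (\<eta> - \<xi>) * norm x)\<^sup>2"
      proof -
        have "\<bar>t\<bar> \<le> norm (\<eta> - \<xi>) * norm x" unfolding t_def by (rule Cauchy_Schwarz_ineq2)
        then have "\<bar>t\<bar>\<^sup>2 \<le> (norm (\<eta> - \<xi>) * norm x)\<^sup>2" by (rule power_mono) simp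
        then show ?thesis unfolding power2_abs using zero_le_power2[of t] by linarith
      qed
      ultimately have "norm (w x * wave \<eta> x - w x * wave \<xi> x - w x * (\<i> * of_real ((\<eta> - \<xi>) \<bullet> x) * wave \<xi> x))
        \<le> norm (w x) * (norm (\<eta> - \<xi>) * norm x)\<^sup>2" by (simp add: mult_left_mono)
      then show "norm (w x * wave \<eta> x - w x * wave \<xi> x - w x * (\<i> * of_real ((\<eta> - \<xi>) \<bullet> x) * wave \<xi> x))
        \<le> (norm (\<eta> - \<xi>))\<^sup>2 * ((norm x)\<^sup>2 * norm (w x))"
        by (simp only: power_mult_distrib mult_ac)
    qed (use iw i1 i2 in \<open>auto intro!: integrable_norm\<close>)
    also have "\<dots> = D * (norm (\<eta> - \<xi>))\<^sup>2" by (simp add: D_def)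
    finally show ?thesis unfolding eq .
  qed
  show ?thesis unfolding has_derivative_at_alt
  proof (intro conjI allI impI)
    show "bounded_linear (\<lambda>h. LINT x|lborel. w x * (\<i> * of_real (h \<bullet> x) * wave \<xi> x))"
      using lin by (simp add: linear_conv_bounded_linear)
    fix e :: real assume e: "0 < e"
    show "\<exists>d>0. \<forall>y. norm (y - \<xi>) < d \<longrightarrow>
      norm ((LINT x|lborel. w x * wave y x) - (LINT x|lborel. w x * wave \<xi> x)
        - (LINT x|lborel. w x * (\<i> * of_real ((y - \<xi>) \<bullet> x) * wave \<xi> x))) \<le> e * norm (y - \<xi>)"
    proof (intro exI[of _ "e / (D + 1)"] conjI allI impI)
      show "0 < e / (D + 1)" using e D by simp
      fix y assume "norm (y - \<xi>) < e / (D + 1)"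
      then have "norm (y - \<xi>) * (D + 1) \<le> e" using D by (simp add: field_simps)
      then have "(norm (y - \<xi>) * (D + 1)) * norm (y - \<xi>) \<le> e * norm (y - \<xi>)" by (rule mult_right_mono) simp
      moreover have "D * (norm (y - \<xi>))\<^sup>2 \<le> (norm (y - \<xi>) * (D + 1)) * norm (y - \<xi>)"
        by (simp add: power2_eq_square algebra_simps)
      ultimately show "norm ((LINT x|lborel. w x * wave y x) - (LINT x|lborel. w x * wave \<xi> x)
        - (LINT x|lborel. w x * (\<i> * of_real ((y - \<xi>) \<bullet> x) * wave \<xi> x))) \<le> e * norm (y - \<xi>)"
        using est[of y] by linarith
    qed
  qed
qed

lemma gauss_wave_integrable:
  fixes G :: "real^'n::finite \<Rightarrow> real^'n"
  assumes G: "pos_def_map G"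
  shows "integrable lborel (\<lambda>x. of_real (gauss G x) * wave \<xi> x)"
    "integrable lborel (\<lambda>x. of_real (x \<bullet> e) * of_real (gauss G x) * wave \<xi> x)"
    "integrable lborel (\<lambda>x. (norm x)\<^sup>2 * norm (complex_of_real (gauss G x)))"
proof -
  note [measurable] = gauss_measurable[OF G]
  show "integrable lborel (\<lambda>x. of_real (gauss G x) * wave \<xi> x)"
    by (rule gauss_poly_integrable[OF G, where C=1 and m=0]) (auto simp: norm_mult)
  show "integrable lborel (\<lambda>x. of_real (x \<bullet> e) * of_real (gauss G x) * wave \<xi> x)"
  proof (rule gauss_poly_integrable[OF G, where C="norm e" and m=1])
    fix x
    have "\<bar>x \<bullet> e\<bar> \<le> norm x * norm e" by (rule Cauchy_Schwarz_ineq2)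
    also have "\<dots> \<le> norm e * (1 + norm x)" by (simp add: algebra_simps)
    finally show "norm (of_real (x \<bullet> e) * of_real (gauss G x) * wave \<xi> x) \<le> norm e * (1 + norm x) ^ 1 * gauss G x"
      by (simp add: norm_mult mult_right_mono)
  qed measurable
  show "integrable lborel (\<lambda>x. (norm x)\<^sup>2 * norm (complex_of_real (gauss G x)))"
  proof (rule gauss_poly_integrable[OF G, where C=1 and m=2])
    fix x :: "real^'n"
    have "(norm x)\<^sup>2 \<le> (1 + norm x)\<^sup>2" by (intro power_mono) auto
    then show "norm ((norm x)\<^sup>2 * norm (complex_of_real (gauss G x))) \<le> 1 * (1 + norm x) ^ 2 * gauss G x"
      by (simp add: mult_right_mono)
  qed measurable
qed

text \<open>Along the ray \<open>t *\<^sub>R \<xi>\<close> the transform satisfies a scalar linear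
  differential equation. It comes from integrating a derivative of Gaussian times wave in the
  direction \<open>inv G \<xi>\<close>, chosen because
  \<open>G x \<bullet> inv G \<xi> = x \<bullet> \<xi>\<close>: this expresses the first moment,
  which is the derivative of the transform, by the transform itself.\<close>

lemma gauss_char_function:
  fixes G :: "real^'n::finite \<Rightarrow> real^'n"
  assumes G: "pos_def_map G"
  shows "(LINT x|lborel. of_real (gauss G x) * wave \<xi> x)
    = of_real (LINT x|lborel. gauss G x) * of_real (gauss (inv G) \<xi>)"
proof -
  define \<Phi> where "\<Phi> = (\<lambda>\<eta>. LINT x|lborel. complex_of_real (gauss G x) * wave \<eta> x)"
  define k where "k = \<xi> \<bullet> inv G \<xi>"
  have moment: "(LINT x|lborel. complex_of_real (x \<bullet> \<xi>) * of_real (gauss G x) * wave \<eta> x) = \<i> * of_real (\<eta> \<bullet> inv G \<xi>) * \<Phi> \<eta>" for \<eta>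
  proof -
    define f' where "f' = (\<lambda>x h. of_real (gauss G x) * (\<i> * of_real (\<eta> \<bullet> h) * wave \<eta> x) + of_real (- (G x \<bullet> h) * gauss G x) * wave \<eta> x)"
    have eq: "f' x (inv G \<xi>) = \<i> * of_real (\<eta> \<bullet> inv G \<xi>) * (of_real (gauss G x) * wave \<eta> x)
       - of_real (x \<bullet> \<xi>) * of_real (gauss G x) * wave \<eta> x" for x
      by (simp add: f'_def pos_def_mapD(2)[OF G] pos_def_map_inverse[OF G] algebra_simps)
    have "(LINT x|lborel. f' x (inv G \<xi>)) = 0"
    proof (rule integral_derivative_eq_0)
      show "((\<lambda>x. complex_of_real (gauss G x) * wave \<eta> x) has_derivative f' x) (at x)" for x
        unfolding f'_def
        by (intro has_derivative_mult has_derivative_of_real gauss_has_derivative[OF G] wave_has_derivative)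
      show "continuous_on UNIV (\<lambda>x. f' x (inv G \<xi>))" unfolding eq by (intro continuous_intros G)
      show "integrable lborel (\<lambda>x. f' x (inv G \<xi>))" unfolding eq
        by (intro Bochner_Integration.integrable_diff integrable_mult_right gauss_wave_integrable[OF G])
    qed (rule gauss_wave_integrable[OF G])
    then show ?thesis unfolding eq
      by (subst (asm) Bochner_Integration.integral_diff)
        (auto intro!: integrable_mult_right gauss_wave_integrable[OF G] simp: \<Phi>_def)
  qed
  have der: "((\<lambda>t. \<Phi> (t *\<^sub>R \<xi>)) has_vector_derivative - of_real (t * k) * \<Phi> (t *\<^sub>R \<xi>)) (at t)" for t :: real
  proof -
    have "((\<lambda>t. \<Phi> (t *\<^sub>R \<xi>)) has_derivative (\<lambda>h. LINT x|lborel. complex_of_real (gauss G x) * (\<i> * of_real ((h *\<^sub>R \<xi>) \<bullet> x) * wave (t *\<^sub>R \<xi>) x))) (at t)"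
      unfolding \<Phi>_def
      by (rule has_derivative_compose[where f="\<lambda>t. t *\<^sub>R \<xi>", OF _ integral_wave_has_derivative])
         (use gauss_wave_integrable(1)[OF G, of 0] gauss_wave_integrable(3)[OF G] gauss_measurable[OF G] in
            \<open>auto intro!: derivative_eq_intros\<close>)
    moreover have "(LINT x|lborel. complex_of_real (gauss G x) * (\<i> * of_real ((h *\<^sub>R \<xi>) \<bullet> x) * wave (t *\<^sub>R \<xi>) x))
       = h *\<^sub>R (- of_real (t * k) * \<Phi> (t *\<^sub>R \<xi>))" for h
    proof -
      have "(LINT x|lborel. complex_of_real (gauss G x) * (\<i> * of_real ((h *\<^sub>R \<xi>) \<bullet> x) * wave (t *\<^sub>R \<xi>) x))
        = (LINT x|lborel. \<i> * of_real h * (of_real (x \<bullet> \<xi>) * of_real (gauss G x) * wave (t *\<^sub>R \<xi>) x))"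
        by (simp add: inner_commute mult_ac)
      also have "\<dots> = \<i> * of_real h * (\<i> * of_real ((t *\<^sub>R \<xi>) \<bullet> inv G \<xi>) * \<Phi> (t *\<^sub>R \<xi>))"
        by (simp only: integral_mult_right_zero moment)
      finally show ?thesis by (simp add: k_def scaleR_conv_of_real[where 'a=complex] algebra_simps)
    qed
    ultimately show ?thesis by (simp add: has_vector_derivative_def)
  qed
  have "\<exists>c. \<forall>t\<in>UNIV. of_real (exp (t\<^sup>2 * k / 2)) * \<Phi> (t *\<^sub>R \<xi>) = c"
  proof (rule has_vector_derivative_zero_constant)
    fix t :: real
    have "((\<lambda>t. exp (t\<^sup>2 * k / 2)) has_real_derivative (t * k * exp (t\<^sup>2 * k / 2))) (at t)"
      by (auto intro!: derivative_eq_intros)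
    then have "((\<lambda>t. complex_of_real (exp (t\<^sup>2 * k / 2))) has_vector_derivative of_real (t * k * exp (t\<^sup>2 * k / 2))) (at t)"
      by (intro bounded_linear.has_vector_derivative[OF bounded_linear_of_real])
        (simp add: has_real_derivative_iff_has_vector_derivative)
    from has_vector_derivative_mult[OF this der[of t]]
    show "((\<lambda>t. complex_of_real (exp (t\<^sup>2 * k / 2)) * \<Phi> (t *\<^sub>R \<xi>)) has_vector_derivative 0) (at t within UNIV)"
      by (simp add: algebra_simps)
  qed auto
  then obtain c where c: "\<And>t. complex_of_real (exp (t\<^sup>2 * k / 2)) * \<Phi> (t *\<^sub>R \<xi>) = c" by auto
  have "complex_of_real (exp (k / 2)) * \<Phi> \<xi> = \<Phi> 0" using c[of 1] c[of 0] by simp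
  then have "\<Phi> \<xi> = \<Phi> 0 * exp (- complex_of_real (k / 2))"
    by (simp add: exp_minus field_simps flip: exp_of_real)
  moreover have "\<Phi> 0 = of_real (LINT x|lborel. gauss G x)" by (simp add: \<Phi>_def)
  moreover have "exp (- complex_of_real (k / 2)) = of_real (gauss (inv G) \<xi>)"
    by (simp add: gauss_def k_def flip: exp_of_real)
  ultimately show ?thesis by (simp add: \<Phi>_def)
qed

section \<open>Contractions determined by their values on waves\<close>

text \<open>Linearity is only demanded up to null sets: \<open>mehler\<close> is an integral that
  exists for almost every point, and \<open>exp_minus\<close> is determined up to null sets.\<close>

definition contraction_op :: "((real^'n::finite \<Rightarrow> complex) \<Rightarrow> (real^'n \<Rightarrow> complex)) \<Rightarrow> bool" where
  "contraction_op T \<longleftrightarrow> (\<forall>u\<in>L2. T u \<in> L2 \<and> L2_norm (T u) \<le> L2_norm u) \<and>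
    (\<forall>u\<in>L2. \<forall>v\<in>L2. \<forall>a b. AE x in lborel. T (\<lambda>y. a * u y + b * v y) x = a * T u x + b * T v x)"

lemma contraction_opD:
  assumes "contraction_op T"
  shows "u \<in> L2 \<Longrightarrow> T u \<in> L2" "u \<in> L2 \<Longrightarrow> L2_norm (T u) \<le> L2_norm u"
    "u \<in> L2 \<Longrightarrow> v \<in> L2 \<Longrightarrow> AE x in lborel. T (\<lambda>y. a * u y + b * v y) x = a * T u x + b * T v x"
  using assms by (auto simp: contraction_op_def)

lemma contraction_op_diff:
  assumes T: "contraction_op T" and u: "u \<in> L2" "v \<in> L2"
  shows "L2_norm (\<lambda>x. T u x - T v x) \<le> L2_norm (\<lambda>x. u x - v x)"
proof -
  have "L2_norm (\<lambda>x. T u x - T v x) = L2_norm (T (\<lambda>x. u x - v x))"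
    by (rule L2_norm_cong_AE)
      (use contraction_opD(3)[OF T u, of 1 "-1"] L2D(1)[OF L2_diff[OF contraction_opD(1)[OF T u(1)] contraction_opD(1)[OF T u(2)]]]
        L2D(1)[OF contraction_opD(1)[OF T L2_diff[OF u]]] in auto)
  then show ?thesis using contraction_opD(2)[OF T L2_diff[OF u]] by simp
qed

lemma contraction_op_cong_AE:
  assumes T: "contraction_op T" and u: "u \<in> L2" "v \<in> L2" "AE x in lborel. u x = v x"
  shows "AE x in lborel. T u x = T v x"
proof (rule L2_norm_diff_0_AE)
  have "L2_norm (\<lambda>x. u x - v x) = 0"
    using L2_norm_cong_AE[of "\<lambda>x. u x - v x" "\<lambda>x. 0"] u(3) L2D(1)[OF L2_diff[OF u(1,2)]] by auto
  then show "L2_norm (\<lambda>x. T u x - T v x) \<le> e" if "e > 0" for e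
    using contraction_op_diff[OF T u(1,2)] that by simp
qed (use contraction_opD(1)[OF T] u in auto)

lemma contraction_op_compose:
  fixes S T :: "(real^'n::finite \<Rightarrow> complex) \<Rightarrow> (real^'n \<Rightarrow> complex)"
  assumes S: "contraction_op S" and T: "contraction_op T"
  shows "contraction_op (\<lambda>u. S (T u))"
  unfolding contraction_op_def
proof (intro conjI ballI allI)
  fix u :: "real^'n \<Rightarrow> complex" assume u: "u \<in> L2"
  show "S (T u) \<in> L2" by (intro contraction_opD(1)[OF S] contraction_opD(1)[OF T] u)
  show "L2_norm (S (T u)) \<le> L2_norm u"
    using contraction_opD(2)[OF S contraction_opD(1)[OF T u]] contraction_opD(2)[OF T u] by simp
  fix v :: "real^'n \<Rightarrow> complex" and a b assume v: "v \<in> L2"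
  have "AE x in lborel. S (T (\<lambda>y. a * u y + b * v y)) x = S (\<lambda>y. a * T u y + b * T v y) x"
    by (rule contraction_op_cong_AE[OF S _ _ contraction_opD(3)[OF T u v]])
      (intro contraction_opD(1)[OF T] L2_lincomb u v)+
  with contraction_opD(3)[OF S contraction_opD(1)[OF T u] contraction_opD(1)[OF T v], of a b]
  show "AE x in lborel. S (T (\<lambda>y. a * u y + b * v y)) x = a * S (T u) x + b * S (T v) x"
    by eventually_elim simp
qed

lemma contraction_op_scale:
  fixes T :: "(real^'n::finite \<Rightarrow> complex) \<Rightarrow> (real^'n \<Rightarrow> complex)"
  assumes T: "contraction_op T" and c: "norm c \<le> 1"
  shows "contraction_op (\<lambda>u x. c * T u x)"
  unfolding contraction_op_def
proof (intro conjI ballI allI)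
  fix u :: "real^'n \<Rightarrow> complex" assume u: "u \<in> L2"
  show "(\<lambda>x. c * T u x) \<in> L2" by (intro L2_scale contraction_opD(1)[OF T] u)
  have "norm c * L2_norm (T u) \<le> 1 * L2_norm u"
    by (intro mult_mono c contraction_opD(2)[OF T u]) auto
  then show "L2_norm (\<lambda>x. c * T u x) \<le> L2_norm u" by (simp add: L2_norm_scale)
  fix v :: "real^'n \<Rightarrow> complex" and a b assume v: "v \<in> L2"
  show "AE x in lborel. c * T (\<lambda>y. a * u y + b * v y) x = a * (c * T u x) + b * (c * T v x)"
    using contraction_opD(3)[OF T u v, of a b] by eventually_elim (simp add: algebra_simps)
qed

lemma trig_span_lincomb_AE:
  assumes T: "contraction_op T" and S: "contraction_op S"
    and eq: "\<And>\<xi>. AE x in lborel. T (\<lambda>y. w y * wave \<xi> y) x = S (\<lambda>y. w y * wave \<xi> y) x"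
    and L: "L2_dense (trig_span w)"
  shows "u \<in> trig_span w \<Longrightarrow> AE x in lborel. T u x = S u x"
proof (induction rule: trig_span.induct)
  case (wave \<xi>) show ?case by (rule eq)
next
  case (lincomb f g a b)
  have fg: "f \<in> L2" "g \<in> L2" using lincomb L2_denseD(1)[OF L] by auto
  from contraction_opD(3)[OF T fg, of a b] contraction_opD(3)[OF S fg, of a b] lincomb(3,4)
  show ?case by eventually_elim simp
qed

lemma contraction_op_eqI:
  assumes w: "w \<in> L2" "\<And>x. w x \<noteq> 0" and T: "contraction_op T" and S: "contraction_op S"
    and eq: "\<And>\<xi>. AE x in lborel. T (\<lambda>y. w y * wave \<xi> y) x = S (\<lambda>y. w y * wave \<xi> y) x"
    and u: "u \<in> L2"
  shows "AE x in lborel. T u x = S u x"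
proof (rule L2_contractions_eq_AE[OF L2_dense_trig_span[OF w], of T S])
  show "\<And>u. u \<in> trig_span w \<Longrightarrow> AE x in lborel. T u x = S u x"
    using trig_span_lincomb_AE[OF T S eq L2_dense_trig_span[OF w]] .
qed (use contraction_opD[OF T] contraction_opD[OF S] contraction_op_diff[OF T] contraction_op_diff[OF S] u in auto)

lemma distr_of_norm_diff:
  assumes "u \<in> L2" "v \<in> L2" "w \<in> L2"
  shows "norm (distr_of u w - distr_of v w) \<le> L2_norm (\<lambda>x. u x - v x) * L2_norm w"
  using distr_of_bound[OF L2_diff[OF assms(1,2)] assms(3)] by (simp add: distr_of_diff_left assms)

lemma contraction_op_transpose_dense:
  assumes D: "L2_dense D" and T: "contraction_op T" and S: "contraction_op S"
    and eq: "\<And>u. u \<in> D \<Longrightarrow> distr_of (S u) v = distr_of u (T v)"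
    and u: "u \<in> L2" and v: "v \<in> L2"
  shows "distr_of (S u) v = distr_of u (T v)"
proof -
  have "norm (distr_of (S u) v - distr_of u (T v)) \<le> e" if e: "e > 0" for e
  proof -
    define N where "N = 2 * L2_norm v + 1"
    have N: "N > 0" using L2_norm_nonneg[of v] by (simp add: N_def add_nonneg_pos)
    obtain z where z: "z \<in> D" "L2_norm (\<lambda>x. u x - z x) < e / N"
      using L2_denseD(2)[OF D u, of "e / N"] e N by auto
    have zL: "z \<in> L2" using L2_denseD(1)[OF D z(1)] .
    note SL = contraction_opD(1)[OF S] and TL = contraction_opD(1)[OF T]
    have "distr_of (S u) v - distr_of u (T v) = (distr_of (S u) v - distr_of (S z) v) - (distr_of u (T v) - distr_of z (T v))"
      using eq[OF z(1)] by simp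
    also have "norm \<dots> \<le> L2_norm (\<lambda>x. S u x - S z x) * L2_norm v + L2_norm (\<lambda>x. u x - z x) * L2_norm (T v)"
      by (intro order_trans[OF norm_triangle_ineq4] add_mono distr_of_norm_diff SL TL u v zL)
    also have "\<dots> \<le> L2_norm (\<lambda>x. u x - z x) * L2_norm v + L2_norm (\<lambda>x. u x - z x) * L2_norm v"
      by (intro add_mono mult_mono contraction_op_diff[OF S u zL] contraction_opD(2)[OF T v]) auto
    also have "\<dots> \<le> L2_norm (\<lambda>x. u x - z x) * N"
      by (simp add: N_def algebra_simps)
    also have "\<dots> \<le> (e / N) * N" using z N by (intro mult_right_mono) auto
    finally show ?thesis using N by simp
  qed
  then have "norm (distr_of (S u) v - distr_of u (T v)) \<le> 0" by (rule field_le_epsilon) simp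
  then show ?thesis by simp
qed

text \<open>Each use of \<open>contraction_op_transpose_dense\<close> frees one argument. For a
  fixed wave on one side, linearity and density extend the identity to all functions on the other;
  the pairing is symmetric, so the second pass repeats this with \<open>S\<close> and
  \<open>T\<close> exchanged.\<close>

lemma contraction_op_transposeI:
  fixes S T :: "(real^'n::finite \<Rightarrow> complex) \<Rightarrow> (real^'n \<Rightarrow> complex)"
  assumes w: "w \<in> L2" "\<And>x. w x \<noteq> 0" and T: "contraction_op T" and S: "contraction_op S"
    and eq: "\<And>\<xi> \<eta>. distr_of (S (\<lambda>y. w y * wave \<xi> y)) (\<lambda>y. w y * wave \<eta> y)
      = distr_of (\<lambda>y. w y * wave \<xi> y) (T (\<lambda>y. w y * wave \<eta> y))"
    and u: "u \<in> L2" and v: "v \<in> L2"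
  shows "distr_of (S u) v = distr_of u (T v)"
proof -
  note D = L2_dense_trig_span[OF w]
  have wL: "(\<lambda>y. w y * wave \<xi> y) \<in> L2" for \<xi> by (rule L2_denseD(1)[OF D trig_span.wave])
  have SL: "\<And>u. u \<in> L2 \<Longrightarrow> S u \<in> L2" and TL: "\<And>u. u \<in> L2 \<Longrightarrow> T u \<in> L2" using S T contraction_opD(1) by auto
  have lin: "distr_of (S (\<lambda>x. a * f x + b * g x)) z = distr_of (\<lambda>x. a * f x + b * g x) (T z)"
    if "contraction_op S" "contraction_op T" and fg: "f \<in> L2" "g \<in> L2" and z: "z \<in> L2" and "distr_of (S f) z = distr_of f (T z)" "distr_of (S g) z = distr_of g (T z)"
    for S T :: "(real^'n \<Rightarrow> complex) \<Rightarrow> real^'n \<Rightarrow> complex" and f g z a b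
  proof -
    note SL = contraction_opD(1)[OF that(1)] and TL = contraction_opD(1)[OF that(2)]
    have "distr_of (S (\<lambda>x. a * f x + b * g x)) z = distr_of (\<lambda>x. a * S f x + b * S g x) z"
      by (rule distr_of_cong_AE[OF contraction_opD(3)[OF that(1) fg]]) (auto intro!: SL L2_lincomb fg z)
    also have "\<dots> = a * distr_of (S f) z + b * distr_of (S g) z" by (intro distr_of_lincomb_left SL fg z)
    also have "\<dots> = distr_of (\<lambda>x. a * f x + b * g x) (T z)"
      by (simp add: that distr_of_lincomb_left TL fg z)
    finally show ?thesis .
  qed
  have 1: "distr_of (S (\<lambda>y. w y * wave \<xi> y)) v = distr_of (\<lambda>y. w y * wave \<xi> y) (T v)" if v: "v \<in> L2" for \<xi> v
  proof -
    have "distr_of (T v) (\<lambda>y. w y * wave \<xi> y) = distr_of v (S (\<lambda>y. w y * wave \<xi> y))"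
    proof (rule contraction_op_transpose_dense[OF D S T _ v wL])
      fix z assume "z \<in> trig_span w"
      then show "distr_of (T z) (\<lambda>y. w y * wave \<xi> y) = distr_of z (S (\<lambda>y. w y * wave \<xi> y))"
      proof (induction rule: trig_span.induct)
        case (wave \<eta>) then show ?case using eq[of \<xi> \<eta>] by (simp add: distr_of_commute)
      next
        case (lincomb f g a b)
        show ?case by (rule lin[OF T S _ _ wL lincomb(3,4)]) (use lincomb L2_denseD(1)[OF D] in auto)
      qed
    qed
    then show ?thesis by (simp add: distr_of_commute)
  qed
  show ?thesis
  proof (rule contraction_op_transpose_dense[OF D T S _ u v])
    fix z assume "z \<in> trig_span w"
    then show "distr_of (S z) v = distr_of z (T v)"
    proof (induction rule: trig_span.induct)
      case (wave \<eta>) then show ?case by (rule 1[OF v])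
    next
      case (lincomb f g a b)
      show ?case by (rule lin[OF S T _ _ v lincomb(3,4)]) (use lincomb L2_denseD(1)[OF D] in auto)
    qed
  qed
qed

lemma contraction_op_tendsto_ident:
  fixes T :: "real \<Rightarrow> (real^'n::finite \<Rightarrow> complex) \<Rightarrow> (real^'n \<Rightarrow> complex)"
  assumes w: "w \<in> L2" "\<And>x. w x \<noteq> 0" and T: "\<And>t. t \<ge> 0 \<Longrightarrow> contraction_op (T t)"
    and lim: "\<And>\<xi>. ((\<lambda>t. L2_norm (\<lambda>x. T t (\<lambda>y. w y * wave \<xi> y) x - w x * wave \<xi> x)) \<longlongrightarrow> 0) (at_right 0)"
    and u: "u \<in> L2"
  shows "((\<lambda>t. L2_norm (\<lambda>x. T t u x - u x)) \<longlongrightarrow> 0) (at_right 0)"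
proof -
  note D = L2_dense_trig_span[OF w]
  have ev: "eventually (\<lambda>t. t \<ge> (0::real)) (at_right 0)" by (auto simp: eventually_at_filter)
  have span: "((\<lambda>t. L2_norm (\<lambda>x. T t z x - z x)) \<longlongrightarrow> 0) (at_right 0)" if "z \<in> trig_span w" for z
    using that
  proof (induction rule: trig_span.induct)
    case (wave \<xi>) show ?case by (rule lim)
  next
    case (lincomb f g a b)
    have fg: "f \<in> L2" "g \<in> L2" using lincomb L2_denseD(1)[OF D] by auto
    show ?case
    proof (rule Lim_null_comparison)
      show "eventually (\<lambda>t. norm (L2_norm (\<lambda>x. T t (\<lambda>x. a * f x + b * g x) x - (a * f x + b * g x)))
         \<le> norm a * L2_norm (\<lambda>x. T t f x - f x) + norm b * L2_norm (\<lambda>x. T t g x - g x)) (at_right 0)"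
        using ev
      proof eventually_elim
        case (elim t)
        note TL = contraction_opD(1)[OF T[OF elim]]
        have "L2_norm (\<lambda>x. T t (\<lambda>x. a * f x + b * g x) x - (a * f x + b * g x))
          = L2_norm (\<lambda>x. a * (T t f x - f x) + b * (T t g x - g x))"
        proof (rule L2_norm_cong_AE)
          show "AE x in lborel. T t (\<lambda>x. a * f x + b * g x) x - (a * f x + b * g x) = a * (T t f x - f x) + b * (T t g x - g x)"
            using contraction_opD(3)[OF T[OF elim] fg, of a b] by eventually_elim (simp add: algebra_simps)
        qed (intro L2D(1) L2_lincomb L2_diff TL fg)+
        also have "\<dots> \<le> norm a * L2_norm (\<lambda>x. T t f x - f x) + norm b * L2_norm (\<lambda>x. T t g x - g x)"
          by (intro L2_norm_lincomb L2_diff TL fg)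
        finally show ?case by simp
      qed
      have "((\<lambda>t. norm a * L2_norm (\<lambda>x. T t f x - f x) + norm b * L2_norm (\<lambda>x. T t g x - g x)) \<longlongrightarrow> norm a * 0 + norm b * 0) (at_right 0)"
        by (intro tendsto_intros lincomb)
      then show "((\<lambda>t. norm a * L2_norm (\<lambda>x. T t f x - f x) + norm b * L2_norm (\<lambda>x. T t g x - g x)) \<longlongrightarrow> 0) (at_right 0)"
        by simp
    qed
  qed
  show ?thesis
  proof (rule tendstoI)
    fix e :: real assume e: "e > 0"
    obtain z where z: "z \<in> trig_span w" "L2_norm (\<lambda>x. u x - z x) < e / 3"
      using L2_denseD(2)[OF D u, of "e/3"] e by auto
    have zL: "z \<in> L2" using L2_denseD(1)[OF D z(1)] .
    from order_tendstoD(2)[OF span[OF z(1)], of "e/3"] e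
    have "eventually (\<lambda>t. L2_norm (\<lambda>x. T t z x - z x) < e/3) (at_right 0)" by simp
    with ev show "eventually (\<lambda>t. dist (L2_norm (\<lambda>x. T t u x - u x)) 0 < e) (at_right 0)"
    proof eventually_elim
      case (elim t)
      note TL = contraction_opD(1)[OF T[OF elim(1)]]
      have "L2_norm (\<lambda>x. T t u x - u x) \<le> L2_norm (\<lambda>x. T t u x - T t z x) + L2_norm (\<lambda>x. T t z x - u x)"
        by (intro L2_norm_triangle_diff TL u zL)
      also have "L2_norm (\<lambda>x. T t z x - u x) \<le> L2_norm (\<lambda>x. T t z x - z x) + L2_norm (\<lambda>x. z x - u x)"
        by (intro L2_norm_triangle_diff TL u zL)
      finally show ?case using contraction_op_diff[OF T[OF elim(1)] u zL] z elim(2)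
        by (simp add: L2_norm_minus_commute[of z u])
    qed
  qed
qed

section \<open>Square roots of quadratic forms\<close>

text \<open>Lagrange's reduction by completing squares, one coordinate at a time; \<open>S\<close>
  holds the coordinates on which the form may still depend. A positive pivot \<open>d\<close> is
  removed by passing to the Schur complement \<open>Q'\<close>, which is again positive semidefinite
  and has \<open>e\<close> in its kernel. A zero pivot forces \<open>Q e = 0\<close>.\<close>

lemma psd_sum_of_squares:
  fixes Q :: "real^'n::finite \<Rightarrow> real^'n"
  assumes "finite S" "linear Q" "\<And>x y. Q x \<bullet> y = x \<bullet> Q y" "\<And>x. x \<bullet> Q x \<ge> 0" "\<And>i. i \<notin> S \<Longrightarrow> Q (axis i 1) = 0"
  shows "\<exists>v. \<forall>x. x \<bullet> Q x = (\<Sum>j\<in>S. (v j \<bullet> x)\<^sup>2)"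
  using assms
proof (induction S arbitrary: Q rule: finite_induct)
  case empty
  have "Q x = 0" for x
  proof -
    have "Q x = Q (\<Sum>i\<in>UNIV. x $ i *\<^sub>R axis i 1)" by (simp add: basis_expansion flip: scalar_mult_eq_scaleR)
    also have "\<dots> = 0" using empty by (simp add: linear_sum linear_scale)
    finally show ?thesis .
  qed
  then show ?case by simp
next
  case (insert i S)
  define e where "e = (axis i 1 :: real^'n)"
  define d where "d = e \<bullet> Q e"
  note lin = linear_add[OF insert(4)] linear_scale[OF insert(4)] linear_diff[OF insert(4)] linear_0[OF insert(4)]
  have exp: "(x + t *\<^sub>R e) \<bullet> Q (x + t *\<^sub>R e) = x \<bullet> Q x + 2 * t * (x \<bullet> Q e) + t\<^sup>2 * d" for x t
    using insert(5)[of e x] by (simp add: lin inner_add_left inner_add_right d_def power2_eq_square inner_commute algebra_simps)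
  show ?case
  proof (cases "d = 0")
    case True
    have "y \<bullet> Q e = 0" for y
    proof (rule ccontr)
      assume ne: "y \<bullet> Q e \<noteq> 0"
      \<comment> \<open>With \<open>d = 0\<close> the form is affine along \<open>e\<close>, and
        this coefficient of \<open>e\<close> would bring its value down to -1.\<close>
      have "0 \<le> y \<bullet> Q y + 2 * (- (y \<bullet> Q y + 1) / (2 * (y \<bullet> Q e))) * (y \<bullet> Q e)"
        using insert(6)[of "y + (- (y \<bullet> Q y + 1) / (2 * (y \<bullet> Q e))) *\<^sub>R e"] unfolding exp True by simp
      also have "\<dots> = -1" using ne by (simp add: field_simps)
      finally show False by simp
    qed
    then have "Q e = 0" using inner_eq_zero_iff by blast
    then have "Q (axis j 1) = 0" if "j \<notin> S" for j using insert(7)[of j] that by (cases "j = i") (auto simp: e_def)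
    from insert(3)[OF insert(4-6) this]
    obtain v where v: "\<forall>x. x \<bullet> Q x = (\<Sum>j\<in>S. (v j \<bullet> x)\<^sup>2)" by blast
    have "x \<bullet> Q x = (\<Sum>j\<in>insert i S. ((v(i := 0)) j \<bullet> x)\<^sup>2)" for x
      using insert(1,2) v by (simp add: sum.insert) (intro sum.cong, auto)
    then show ?thesis by blast
  next
    case False
    then have d: "d > 0" using insert(6)[of e] by (simp add: d_def less_le)
    define Q' where "Q' = (\<lambda>x. Q x - ((x \<bullet> Q e) / d) *\<^sub>R Q e)"
    have form: "x \<bullet> Q' x = x \<bullet> Q x - (x \<bullet> Q e)\<^sup>2 / d" for x
      by (simp add: Q'_def inner_diff_right power2_eq_square)
    have "\<exists>v. \<forall>x. x \<bullet> Q' x = (\<Sum>j\<in>S. (v j \<bullet> x)\<^sup>2)"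
    proof (rule insert(3))
      show "linear Q'" unfolding Q'_def
        by (rule linearI) (simp_all add: lin inner_add_left algebra_simps add_divide_distrib)
      show "Q' x \<bullet> y = x \<bullet> Q' y" for x y
        using insert(5)[of x y] by (simp add: Q'_def inner_diff_left inner_diff_right inner_commute)
      show "0 \<le> x \<bullet> Q' x" for x
      proof -
        have "0 \<le> x \<bullet> Q x + 2 * (- (x \<bullet> Q e) / d) * (x \<bullet> Q e) + (- (x \<bullet> Q e) / d)\<^sup>2 * d"
          using insert(6)[of "x + (- (x \<bullet> Q e) / d) *\<^sub>R e"] unfolding exp .
        also have "\<dots> = x \<bullet> Q' x" using d by (simp add: form power2_eq_square field_simps)
        finally show ?thesis .
      qed
      show "Q' (axis j 1) = 0" if "j \<notin> S" for j
      proof (cases "j = i")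
        case True then show ?thesis using d by (simp add: Q'_def d_def flip: e_def)
      next
        case False
        then have q: "Q (axis j 1) = 0" using that insert(7) by auto
        then have "axis j 1 \<bullet> Q e = 0" using insert(5)[of "axis j 1" e] by simp
        then show ?thesis by (simp add: Q'_def q)
      qed
    qed
    then obtain v where v: "\<And>x. x \<bullet> Q' x = (\<Sum>j\<in>S. (v j \<bullet> x)\<^sup>2)" by blast
    have "x \<bullet> Q x = (\<Sum>j\<in>insert i S. ((v(i := (1 / sqrt d) *\<^sub>R Q e)) j \<bullet> x)\<^sup>2)" for x
    proof -
      have "(\<Sum>j\<in>S. ((v(i := (1 / sqrt d) *\<^sub>R Q e)) j \<bullet> x)\<^sup>2) = (\<Sum>j\<in>S. (v j \<bullet> x)\<^sup>2)"
        using insert(2) by (intro sum.cong) auto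
      moreover have "(((1 / sqrt d) *\<^sub>R Q e) \<bullet> x)\<^sup>2 = (x \<bullet> Q e)\<^sup>2 / d"
        using d by (simp add: power_divide inner_commute)
      ultimately show ?thesis using insert(1,2) v[of x] form[of x] by simp
    qed
    then show ?thesis by blast
  qed
qed

lemma psd_factor:
  fixes Q :: "real^'n::finite \<Rightarrow> real^'n"
  assumes "linear Q" "\<And>x y. Q x \<bullet> y = x \<bullet> Q y" "\<And>x. x \<bullet> Q x \<ge> 0"
  shows "\<exists>L::real^'n \<Rightarrow> real^'n. linear L \<and> (\<forall>x. L x \<bullet> L x = x \<bullet> Q x)"
proof -
  have "\<exists>v. \<forall>x. x \<bullet> Q x = (\<Sum>j\<in>(UNIV::'n set). (v j \<bullet> x)\<^sup>2)"
    using assms by (intro psd_sum_of_squares) auto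
  then obtain v where v: "\<And>x. x \<bullet> Q x = (\<Sum>j\<in>(UNIV::'n set). (v j \<bullet> x)\<^sup>2)" by blast
  define L where "L = (\<lambda>x. \<chi> j. v j \<bullet> x)"
  have "linear L" by (rule linearI) (auto simp: L_def vec_eq_iff inner_add_right)
  moreover have "L x \<bullet> L x = x \<bullet> Q x" for x
    unfolding v by (subst inner_vec_def) (simp add: L_def power2_eq_square)
  ultimately show ?thesis by blast
qed

section \<open>Mehler operators\<close>

lemma L2_iff_nn_integral:
  "u \<in> L2 \<longleftrightarrow> u \<in> borel_measurable borel \<and> (\<integral>\<^sup>+x. ennreal ((norm (u x))\<^sup>2) \<partial>lborel) < \<infinity>"
  by (auto simp: L2_def integrable_iff_bounded)

lemma nn_integral_L2_norm:
  assumes "u \<in> L2"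
  shows "(\<integral>\<^sup>+x. ennreal ((norm (u x))\<^sup>2) \<partial>lborel) = ennreal ((L2_norm u)\<^sup>2)"
  unfolding L2_norm_power2 by (rule nn_integral_eq_integral[OF L2D(2)[OF assms]]) simp

lemma L2_nn_integral_leI:
  assumes u: "u \<in> L2" and v: "v \<in> borel_measurable borel"
    and le: "(\<integral>\<^sup>+x. ennreal ((norm (v x))\<^sup>2) \<partial>lborel) \<le> (\<integral>\<^sup>+x. ennreal ((norm (u x))\<^sup>2) \<partial>lborel)"
  shows "v \<in> L2" "L2_norm v \<le> L2_norm u"
proof -
  show vL: "v \<in> L2" unfolding L2_iff_nn_integral
    using u v le by (auto simp: L2_iff_nn_integral intro: le_less_trans)
  have "ennreal ((L2_norm v)\<^sup>2) \<le> ennreal ((L2_norm u)\<^sup>2)"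
    using le by (simp add: nn_integral_L2_norm u vL)
  then have "(L2_norm v)\<^sup>2 \<le> (L2_norm u)\<^sup>2" by simp
  then show "L2_norm v \<le> L2_norm u" by (rule power2_le_imp_le) simp
qed

text \<open>Jensen's inequality for the square, for every measurable \<open>h\<close>: if
  \<open>h\<close> is not integrable its integral has the default value 0, and if the square is not
  integrable the right side is infinite.\<close>

lemma (in prob_space) norm_integral_power2_le:
  fixes h :: "'a \<Rightarrow> complex"
  assumes h: "h \<in> borel_measurable M"
  shows "ennreal ((norm (LINT x|M. h x))\<^sup>2) \<le> (\<integral>\<^sup>+x. ennreal ((norm (h x))\<^sup>2) \<partial>M)"
proof (cases "integrable M h \<and> integrable M (\<lambda>x. (norm (h x))\<^sup>2)")
  case True
  define c where "c = (LINT x|M. norm (h x))"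
  have i: "integrable M (\<lambda>x. norm (h x))" "integrable M (\<lambda>x. (norm (h x))\<^sup>2)" using True by auto
  have "0 \<le> (LINT x|M. (norm (h x) - c)\<^sup>2)" by simp
  also have "\<dots> = (LINT x|M. (norm (h x))\<^sup>2 - 2 * c * norm (h x) + c\<^sup>2)"
    by (simp add: power2_eq_square algebra_simps)
  also have "\<dots> = (LINT x|M. (norm (h x))\<^sup>2) - 2 * c * c + c\<^sup>2"
    using i by (simp add: prob_space c_def)
  finally have "c\<^sup>2 \<le> (LINT x|M. (norm (h x))\<^sup>2)" by (simp add: power2_eq_square)
  moreover have "(norm (LINT x|M. h x))\<^sup>2 \<le> c\<^sup>2"
    unfolding c_def by (intro power_mono integral_norm_bound) simp
  ultimately have "(norm (LINT x|M. h x))\<^sup>2 \<le> (LINT x|M. (norm (h x))\<^sup>2)" by linarith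
  then show ?thesis using nn_integral_eq_integral[OF i(2)] by simp
next
  case False
  then consider "\<not> integrable M h" | "\<not> integrable M (\<lambda>x. (norm (h x))\<^sup>2)" by blast
  then show ?thesis
  proof cases
    case 1 then show ?thesis by (simp add: not_integrable_integral_eq)
  next
    case 2
    then have "(\<integral>\<^sup>+x. ennreal ((norm (h x))\<^sup>2) \<partial>M) = \<infinity>"
      using h by (auto simp: integrable_iff_bounded not_less top_unique)
    then show ?thesis by simp
  qed
qed

lemma (in finite_measure) integrable_of_power2:
  fixes h :: "'a \<Rightarrow> complex"
  assumes h: "h \<in> borel_measurable M" and fin: "(\<integral>\<^sup>+x. ennreal ((norm (h x))\<^sup>2) \<partial>M) < \<infinity>"
  shows "integrable M h"
proof -
  have "integrable M (\<lambda>x. (norm (h x))\<^sup>2)" using h fin by (auto simp: integrable_iff_bounded)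
  then have "integrable M (\<lambda>x. 1 + (norm (h x))\<^sup>2)" by auto
  then show ?thesis
  proof (rule Bochner_Integration.integrable_bound[OF _ h])
    have "norm (h x) \<le> norm (1 + (norm (h x))\<^sup>2)" for x
    proof -
      have "2 * norm (h x) \<le> 1 + (norm (h x))\<^sup>2" using sum_squares_bound[of 1 "norm (h x)"] by simp
      then have "norm (h x) \<le> 1 + (norm (h x))\<^sup>2" using norm_ge_zero[of "h x"] by linarith
      then show ?thesis unfolding real_norm_def by linarith
    qed
    then show "AE x in M. norm (h x) \<le> norm (1 + (norm (h x))\<^sup>2)" by simp
  qed
qed

locale gauss_weight =
  fixes G :: "real^'n::finite \<Rightarrow> real^'n"
  assumes G: "pos_def_map G"
begin

definition u0 :: "real^'n \<Rightarrow> complex" where "u0 x = of_real (gauss G x)"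
definition G2 :: "real^'n \<Rightarrow> real^'n" where "G2 x = 2 *\<^sub>R G x"
definition K :: "real^'n \<Rightarrow> real^'n" where "K = inv G2"
definition Z :: real where "Z = (LINT x|lborel. gauss G2 x)"
definition m0 :: "(real^'n) measure" where "m0 = density lborel (\<lambda>x. ennreal (gauss G2 x / Z))"

lemma G2: "pos_def_map G2"
  using G linear_compose_scale_right[of G 2] by (auto simp: pos_def_map_def G2_def[abs_def])

lemma K: "pos_def_map K" and G2_K: "G2 (K x) = x" and K_G2: "K (G2 x) = x"
  unfolding K_def using pos_def_map_inverse[OF G2] by auto

lemmas K_simps = linear_add[OF pos_def_mapD(1)[OF K]] linear_scale[OF pos_def_mapD(1)[OF K]]
  linear_diff[OF pos_def_mapD(1)[OF K]] linear_0[OF pos_def_mapD(1)[OF K]] linear_neg[OF pos_def_mapD(1)[OF K]]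

lemma K_commute: "\<xi> \<bullet> K \<eta> = \<eta> \<bullet> K \<xi>"
  using pos_def_mapD(2)[OF K, of \<xi> \<eta>] by (simp add: inner_commute)

lemma u0_nz [simp]: "u0 x \<noteq> 0" by (simp add: u0_def)
lemma u0_cnj [simp]: "cnj (u0 x) = u0 x" by (simp add: u0_def)
lemma norm_u0: "norm (u0 x) = gauss G x" by (simp add: u0_def)

lemma gauss_square: "(gauss G x)\<^sup>2 = gauss G2 x"
  by (simp add: gauss_def G2_def exp_double[symmetric] power2_eq_square flip: exp_add)

lemma u0_square: "u0 x * u0 x = of_real (gauss G2 x)"
  by (simp add: u0_def gauss_square[symmetric] power2_eq_square)

lemma u0_measurable [measurable]: "u0 \<in> borel_measurable borel"
  unfolding u0_def[abs_def] using gauss_measurable[OF G] by measurable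

lemmas gauss_G2_measurable [measurable] = gauss_measurable[OF G2]

lemma u0_L2: "u0 \<in> L2"
  unfolding L2_def using gauss_integrable[OF G2] by (auto simp: norm_u0 gauss_square)

lemma wave_L2: "(\<lambda>x. u0 x * wave \<xi> x) \<in> L2"
  by (rule L2_bound[OF u0_L2]) (auto simp: norm_mult)

lemma Z_pos: "Z > 0"
proof -
  have "Z \<noteq> 0"
  proof
    assume "Z = 0"
    then have "AE x in lborel. gauss G2 x = 0"
      unfolding Z_def by (subst (asm) integral_nonneg_eq_0_iff_AE[OF gauss_integrable[OF G2]]) auto
    then have "AE x::real^'n in lborel. False" by simp
    then show False by (simp add: AE_iff_measurable[OF _ refl])
  qed
  moreover have "Z \<ge> 0" unfolding Z_def by simp
  ultimately show ?thesis by simp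
qed

lemma sets_m0 [measurable_cong, simp]: "sets m0 = sets borel" by (simp add: m0_def)
lemma space_m0 [simp]: "space m0 = UNIV" by (simp add: m0_def)

lemma nn_integral_m0:
  assumes [measurable]: "f \<in> borel_measurable borel"
  shows "(\<integral>\<^sup>+x. f x \<partial>m0) = (\<integral>\<^sup>+x. ennreal (gauss G2 x / Z) * f x \<partial>lborel)"
  unfolding m0_def by (subst nn_integral_density) auto

lemma integral_m0:
  fixes f :: "real^'n \<Rightarrow> complex"
  assumes [measurable]: "f \<in> borel_measurable borel"
  shows "(LINT x|m0. f x) = (LINT x|lborel. of_real (gauss G2 x / Z) * f x)"
  unfolding m0_def by (subst integral_density) (use Z_pos in \<open>auto simp: scaleR_conv_of_real\<close>)

lemma prob_m0: "prob_space m0"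
proof
  have "emeasure m0 (space m0) = (\<integral>\<^sup>+x. ennreal (gauss G2 x / Z) \<partial>lborel)"
    by (simp add: m0_def emeasure_density)
  also have "\<dots> = ennreal (LINT x|lborel. gauss G2 x / Z)"
    by (rule nn_integral_eq_integral) (use gauss_integrable[OF G2] Z_pos in auto)
  also have "(LINT x|lborel. gauss G2 x / Z) = 1" using Z_pos by (simp add: Z_def[symmetric])
  finally show "emeasure m0 (space m0) = 1" by simp
qed

sublocale m0: prob_space m0 by (rule prob_m0)

lemma char_m0: "(LINT x|m0. wave \<xi> x) = of_real (gauss K \<xi>)"
proof -
  have "(LINT x|m0. wave \<xi> x) = (LINT x|lborel. (1 / of_real Z) * (of_real (gauss G2 x) * wave \<xi> x))"
    by (subst integral_m0) (auto simp: field_simps)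
  also have "\<dots> = (1 / of_real Z) * (of_real Z * of_real (gauss K \<xi>))"
    by (simp only: integral_mult_right_zero gauss_char_function[OF G2] Z_def K_def)
  finally show ?thesis using Z_pos by simp
qed

lemma pairing_wave:
  "distr_of (\<lambda>x. u0 x * wave \<xi> x) (\<lambda>x. u0 x * wave \<eta> x) = of_real (Z * gauss K (\<xi> + \<eta>))"
proof -
  have "u0 x * wave \<xi> x * (u0 x * wave \<eta> x) = of_real (gauss G2 x) * wave (\<xi> + \<eta>) x" for x
    by (simp add: wave_add u0_square[symmetric])
  then show ?thesis by (simp add: distr_of_def gauss_char_function[OF G2] Z_def K_def)
qed

section \<open>Contractions in the metric K and Mehler's formula\<close>

definition K_contraction :: "(real^'n \<Rightarrow> real^'n) \<Rightarrow> bool" where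
  "K_contraction r \<longleftrightarrow> linear r \<and> (\<forall>\<xi>. r \<xi> \<bullet> K (r \<xi>) \<le> \<xi> \<bullet> K \<xi>)"

text \<open>Independent \<open>x\<close> and \<open>y\<close> of law \<open>m0\<close> combine to a
  vector whose covariance form is the sum of those of \<open>r\<close> and of the noise, so the
  noise has to make up the difference to \<open>K\<close>. Only this covariance enters the law,
  hence any choice serves.\<close>

definition noise :: "(real^'n \<Rightarrow> real^'n) \<Rightarrow> real^'n \<Rightarrow> real^'n" where
  "noise r = (SOME N. linear N \<and> (\<forall>\<xi>. N \<xi> \<bullet> K (N \<xi>) = \<xi> \<bullet> K \<xi> - r \<xi> \<bullet> K (r \<xi>)))"

text \<open>\<open>K\<close> minus the form pulled back by \<open>r\<close> is positive
  semidefinite, so it is the square of a map \<open>L1\<close>; likewise \<open>K\<close> is the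
  square of an injective, hence invertible, \<open>L0\<close>. The noise is \<open>L1\<close>
  followed by the inverse of \<open>L0\<close>, which translates the Euclidean norm into the metric
  \<open>K\<close>.\<close>

lemma noise:
  assumes r: "K_contraction r"
  shows "linear (noise r)" "noise r \<xi> \<bullet> K (noise r \<xi>) = \<xi> \<bullet> K \<xi> - r \<xi> \<bullet> K (r \<xi>)"
proof -
  have lr: "linear r" using r by (simp add: K_contraction_def)
  have la: "linear (adjoint r)" by (rule adjoint_linear[OF lr])
  have ad: "x \<bullet> adjoint r y = r x \<bullet> y" for x y by (rule adjoint_works[OF lr])
  have ad': "adjoint r x \<bullet> y = x \<bullet> r y" for x y by (metis ad inner_commute)
  define Q where "Q = (\<lambda>x. K x - adjoint r (K (r x)))"
  have Qf: "x \<bullet> Q x = x \<bullet> K x - r x \<bullet> K (r x)" for x by (simp add: Q_def inner_diff_right ad)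
  have "\<exists>L1::real^'n \<Rightarrow> real^'n. linear L1 \<and> (\<forall>x. L1 x \<bullet> L1 x = x \<bullet> Q x)"
  proof (rule psd_factor)
    show "linear Q" unfolding Q_def
      using linear_compose[OF linear_compose[OF lr pos_def_mapD(1)[OF K]] la] pos_def_mapD(1)[OF K]
      by (intro linear_compose_sub) (auto simp: o_def)
    show "Q x \<bullet> y = x \<bullet> Q y" for x y
      by (simp add: Q_def inner_diff_left inner_diff_right ad ad' pos_def_mapD(2)[OF K])
    show "0 \<le> x \<bullet> Q x" for x using r by (simp add: Qf K_contraction_def)
  qed
  then obtain L1 :: "real^'n \<Rightarrow> real^'n" where L1: "linear L1" "\<And>x. L1 x \<bullet> L1 x = x \<bullet> Q x" by blast
  obtain L0 :: "real^'n \<Rightarrow> real^'n" where L0: "linear L0" "\<And>x. L0 x \<bullet> L0 x = x \<bullet> K x"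
    using psd_factor[of K] pos_def_mapD[OF K] by blast
  have "inj L0" unfolding linear_injective_0[OF L0(1)]
    using pos_def_mapD(3)[OF K] L0(2) by (metis inner_eq_zero_iff less_irrefl inner_zero_left)
  then obtain L where L: "linear L" "L0 \<circ> L = id"
    using linear_surjective_right_inverse[OF L0(1)] linear_injective_imp_surjective[OF L0(1)] by blast
  have "linear (L \<circ> L1)" using linear_compose[OF L1(1) L(1)] .
  moreover have "(L \<circ> L1) \<xi> \<bullet> K ((L \<circ> L1) \<xi>) = \<xi> \<bullet> K \<xi> - r \<xi> \<bullet> K (r \<xi>)" for \<xi>
  proof -
    have "(L \<circ> L1) \<xi> \<bullet> K ((L \<circ> L1) \<xi>) = L0 (L (L1 \<xi>)) \<bullet> L0 (L (L1 \<xi>))" by (simp add: L0(2))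
    also have "\<dots> = L1 \<xi> \<bullet> L1 \<xi>" using L(2) by (simp add: fun_eq_iff)
    finally show ?thesis by (simp add: L1(2) Qf)
  qed
  ultimately have "\<exists>N. linear N \<and> (\<forall>\<xi>. N \<xi> \<bullet> K (N \<xi>) = \<xi> \<bullet> K \<xi> - r \<xi> \<bullet> K (r \<xi>))" by blast
  from someI_ex[OF this] show "linear (noise r)" "noise r \<xi> \<bullet> K (noise r \<xi>) = \<xi> \<bullet> K \<xi> - r \<xi> \<bullet> K (r \<xi>)"
    unfolding noise_def by auto
qed

definition mix :: "(real^'n \<Rightarrow> real^'n) \<Rightarrow> real^'n \<Rightarrow> real^'n \<Rightarrow> real^'n" where
  "mix r x y = adjoint r x + adjoint (noise r) y"

text \<open>Conjugation by \<open>u0\<close> of \<open>f \<mapsto> (\<lambda>x. E f (r\<^sup>T x + N\<^sup>T y))\<close>, where \<open>y\<close> has the law \<open>m0\<close> and \<open>N = noise r\<close> makes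
  \<open>m0\<close> invariant; \<open>noise r\<close> is junk unless \<open>K_contraction r\<close>.\<close>

definition mehler :: "(real^'n \<Rightarrow> real^'n) \<Rightarrow> (real^'n \<Rightarrow> complex) \<Rightarrow> (real^'n \<Rightarrow> complex)" where
  "mehler r u = (\<lambda>x. u0 x * (LINT y|m0. u (mix r x y) / u0 (mix r x y)))"

lemma wave_mix:
  assumes r: "K_contraction r"
  shows "wave \<xi> (mix r x y) = wave (r \<xi>) x * wave (noise r \<xi>) y"
  using r noise[OF r]
  by (simp add: wave_def mix_def K_contraction_def inner_add_right adjoint_works cis_mult)

lemma mix_measurable [measurable]:
  assumes r: "K_contraction r"
  shows "(\<lambda>p. mix r (fst p) (snd p)) \<in> borel_measurable (m0 \<Otimes>\<^sub>M m0)"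
    "(\<lambda>p. mix r (fst p) (snd p)) \<in> borel_measurable (lborel \<Otimes>\<^sub>M m0)"
    "(\<lambda>y. mix r x y) \<in> borel_measurable borel"
proof -
  have "adjoint r \<in> borel_measurable borel" "adjoint (noise r) \<in> borel_measurable borel"
    using r noise[OF r] by (auto simp: K_contraction_def intro!: borel_measurable_continuous_onI linear_continuous_on
        adjoint_linear simp: linear_conv_bounded_linear[symmetric])
  note [measurable] = this
  show "(\<lambda>p. mix r (fst p) (snd p)) \<in> borel_measurable (m0 \<Otimes>\<^sub>M m0)"
    "(\<lambda>p. mix r (fst p) (snd p)) \<in> borel_measurable (lborel \<Otimes>\<^sub>M m0)"
    "(\<lambda>y. mix r x y) \<in> borel_measurable borel"
    unfolding mix_def by measurable
qed

text \<open>Invariance of \<open>m0\<close>, by characteristic functions: they factor over the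
  independent variables, and the two exponents add up to \<open>\<xi> \<bullet> K \<xi>\<close> by
  the choice of the noise.\<close>

lemma distr_mix:
  assumes r: "K_contraction r"
  shows "distr (m0 \<Otimes>\<^sub>M m0) borel (\<lambda>p. mix r (fst p) (snd p)) = m0"
proof (rule finite_measure_eqI_wave)
  interpret mm: pair_prob_space m0 m0 ..
  note [measurable] = mix_measurable[OF r]
  show "finite_measure (distr (m0 \<Otimes>\<^sub>M m0) borel (\<lambda>p. mix r (fst p) (snd p)))"
    by (rule mm.finite_measure_distr) measurable
  show "finite_measure m0" by unfold_locales
  fix \<xi>
  have "(LINT x|distr (m0 \<Otimes>\<^sub>M m0) borel (\<lambda>p. mix r (fst p) (snd p)). wave \<xi> x)
     = (LINT p|(m0 \<Otimes>\<^sub>M m0). wave (r \<xi>) (fst p) * wave (noise r \<xi>) (snd p))"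
    by (subst integral_distr) (auto simp: wave_mix[OF r])
  also have "\<dots> = (LINT x|m0. LINT y|m0. wave (r \<xi>) x * wave (noise r \<xi>) y)"
  proof (subst mm.integral_fst'[symmetric])
    show "integrable (m0 \<Otimes>\<^sub>M m0) (\<lambda>p. wave (r \<xi>) (fst p) * wave (noise r \<xi>) (snd p))"
      by (rule mm.integrable_const_bound[of _ 1]) (auto simp: norm_mult)
  qed simp
  also have "\<dots> = of_real (gauss K (r \<xi>)) * of_real (gauss K (noise r \<xi>))"
    by (simp add: char_m0)
  also have "\<dots> = of_real (gauss K \<xi>)"
    by (simp add: gauss_def noise(2)[OF r] flip: of_real_mult exp_add) (simp add: diff_divide_distrib)
  finally show "(LINT x|distr (m0 \<Otimes>\<^sub>M m0) borel (\<lambda>p. mix r (fst p) (snd p)). wave \<xi> x) = (LINT x|m0. wave \<xi> x)"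
    by (simp add: char_m0)
qed auto

lemma nn_integral_mix:
  assumes r: "K_contraction r" and f [measurable]: "f \<in> borel_measurable borel"
  shows "(\<integral>\<^sup>+x. \<integral>\<^sup>+y. f (mix r x y) \<partial>m0 \<partial>m0) = (\<integral>\<^sup>+x. f x \<partial>m0)"
proof -
  note [measurable] = mix_measurable[OF r]
  have "(\<integral>\<^sup>+x. f x \<partial>m0) = (\<integral>\<^sup>+x. f x \<partial>distr (m0 \<Otimes>\<^sub>M m0) borel (\<lambda>p. mix r (fst p) (snd p)))"
    by (simp add: distr_mix[OF r])
  also have "\<dots> = (\<integral>\<^sup>+p. f (mix r (fst p) (snd p)) \<partial>(m0 \<Otimes>\<^sub>M m0))"
    by (subst nn_integral_distr) auto
  also have "\<dots> = (\<integral>\<^sup>+x. \<integral>\<^sup>+y. f (mix r x y) \<partial>m0 \<partial>m0)"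
    by (subst m0.nn_integral_fst[symmetric]) auto
  finally show ?thesis by simp
qed

text \<open>Multiplication by \<open>u0\<close> is, up to the factor \<open>sqrt Z\<close>, an
  isometry from the square integrable functions of \<open>m0\<close> to those of Lebesgue measure.
  It reduces the contraction property to a statement about the probability measure
  \<open>m0\<close>.\<close>

lemma nn_integral_u0:
  assumes [measurable]: "f \<in> borel_measurable borel"
  shows "(\<integral>\<^sup>+x. ennreal ((norm (u0 x * f x))\<^sup>2) \<partial>lborel) = ennreal Z * (\<integral>\<^sup>+x. ennreal ((norm (f x))\<^sup>2) \<partial>m0)"
proof -
  have "ennreal ((norm (u0 x * f x))\<^sup>2) = ennreal Z * (ennreal (gauss G2 x / Z) * ennreal ((norm (f x))\<^sup>2))" for x
    using Z_pos by (simp add: norm_mult power_mult_distrib norm_u0 gauss_square flip: ennreal_mult')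
  then show ?thesis by (simp add: nn_integral_m0 nn_integral_cmult)
qed

lemma AE_m0: "(AE x in m0. P x) \<longleftrightarrow> (AE x in lborel. P x)"
  unfolding m0_def by (subst AE_density) (use Z_pos in auto)

text \<open>Invariance bounds the double integral of the square, and a finite double integral has
  finite inner integrals only almost everywhere. On the exceptional set \<open>mehler r u\<close>
  takes the default value 0, so its linearity holds off null sets.\<close>

lemma mehler_integrable:
  assumes r: "K_contraction r" and u: "u \<in> L2"
  shows "AE x in lborel. integrable m0 (\<lambda>y. u (mix r x y) / u0 (mix r x y))"
proof -
  note [measurable] = mix_measurable[OF r] L2D(1)[OF u]
  define f where "f = (\<lambda>x. u x / u0 x)"
  have [measurable]: "f \<in> borel_measurable borel" unfolding f_def by measurable
  have "(\<integral>\<^sup>+x. ennreal ((norm (u0 x * f x))\<^sup>2) \<partial>lborel) < \<infinity>"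
    using u by (simp add: f_def L2_iff_nn_integral)
  then have "(\<integral>\<^sup>+x. ennreal ((norm (f x))\<^sup>2) \<partial>m0) < \<infinity>"
    using Z_pos by (auto simp: nn_integral_u0 ennreal_mult_less_top)
  then have fin: "(\<integral>\<^sup>+x. \<integral>\<^sup>+y. ennreal ((norm (f (mix r x y)))\<^sup>2) \<partial>m0 \<partial>m0) < \<infinity>"
    by (subst nn_integral_mix[OF r]) auto
  have "AE x in m0. (\<integral>\<^sup>+y. ennreal ((norm (f (mix r x y)))\<^sup>2) \<partial>m0) \<noteq> \<infinity>"
  proof (rule nn_integral_PInf_AE)
    have "(\<lambda>x. \<integral>\<^sup>+y. (\<lambda>p. ennreal ((norm (f (mix r (fst p) (snd p))))\<^sup>2)) (x, y) \<partial>m0) \<in> borel_measurable m0"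
      by (rule m0.borel_measurable_nn_integral_fst) measurable
    then show "(\<lambda>x. \<integral>\<^sup>+y. ennreal ((norm (f (mix r x y)))\<^sup>2) \<partial>m0) \<in> borel_measurable m0" by simp
  qed (use fin in auto)
  then show ?thesis unfolding AE_m0
  proof eventually_elim
    case (elim x)
    have "(\<lambda>y. f (mix r x y)) \<in> borel_measurable m0" by measurable
    then have "integrable m0 (\<lambda>y. f (mix r x y))"
      using elim by (intro m0.integrable_of_power2) (auto simp: less_top)
    then show ?case by (simp add: f_def)
  qed
qed

text \<open>Jensen in the noise variable, then invariance of \<open>m0\<close> under mixing.\<close>

lemma mehler_bound:
  assumes r: "K_contraction r" and u: "u \<in> L2"
  shows "mehler r u \<in> L2" "L2_norm (mehler r u) \<le> L2_norm u"
proof -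
  note [measurable] = mix_measurable[OF r] L2D(1)[OF u]
  define f where "f = (\<lambda>x. u x / u0 x)"
  have [measurable]: "f \<in> borel_measurable borel" unfolding f_def by measurable
  define F where "F = (\<lambda>x. LINT y|m0. f (mix r x y))"
  have "(\<lambda>x. LINT y|m0. (\<lambda>p. f (mix r (fst p) (snd p))) (x, y)) \<in> borel_measurable lborel"
    by (rule m0.borel_measurable_lebesgue_integral) (simp add: case_prod_unfold)
  then have F [measurable]: "F \<in> borel_measurable borel" by (simp add: F_def)
  have m: "mehler r u = (\<lambda>x. u0 x * F x)" by (simp add: mehler_def F_def f_def)
  have mm: "mehler r u \<in> borel_measurable borel" unfolding m by measurable
  have "(\<integral>\<^sup>+x. ennreal ((norm (F x))\<^sup>2) \<partial>m0) \<le> (\<integral>\<^sup>+x. \<integral>\<^sup>+y. ennreal ((norm (f (mix r x y)))\<^sup>2) \<partial>m0 \<partial>m0)"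
    unfolding F_def by (intro nn_integral_mono m0.norm_integral_power2_le) measurable
  also have "\<dots> = (\<integral>\<^sup>+x. ennreal ((norm (f x))\<^sup>2) \<partial>m0)" by (rule nn_integral_mix[OF r]) measurable
  finally have "ennreal Z * (\<integral>\<^sup>+x. ennreal ((norm (F x))\<^sup>2) \<partial>m0) \<le> ennreal Z * (\<integral>\<^sup>+x. ennreal ((norm (f x))\<^sup>2) \<partial>m0)"
    by (rule mult_left_mono) simp
  then have le: "(\<integral>\<^sup>+x. ennreal ((norm (mehler r u x))\<^sup>2) \<partial>lborel) \<le> (\<integral>\<^sup>+x. ennreal ((norm (u x))\<^sup>2) \<partial>lborel)"
    unfolding m by (simp only: nn_integral_u0[OF F, symmetric] nn_integral_u0[OF \<open>f \<in> _\<close>, symmetric]) (simp add: f_def)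
  show "mehler r u \<in> L2" "L2_norm (mehler r u) \<le> L2_norm u"
    using L2_nn_integral_leI[OF u mm le] by auto
qed

lemma contraction_op_mehler:
  assumes r: "K_contraction r"
  shows "contraction_op (mehler r)"
  unfolding contraction_op_def
proof (intro conjI ballI allI)
  fix u v :: "real^'n \<Rightarrow> complex" and a b assume u: "u \<in> L2" and v: "v \<in> L2"
  show "AE x in lborel. mehler r (\<lambda>y. a * u y + b * v y) x = a * mehler r u x + b * mehler r v x"
    using mehler_integrable[OF r u] mehler_integrable[OF r v]
  proof eventually_elim
    case (elim x)
    have "(LINT y|m0. (a * u (mix r x y) + b * v (mix r x y)) / u0 (mix r x y))
      = (LINT y|m0. a * (u (mix r x y) / u0 (mix r x y)) + b * (v (mix r x y) / u0 (mix r x y)))"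
      by (simp add: add_divide_distrib)
    also have "\<dots> = a * (LINT y|m0. u (mix r x y) / u0 (mix r x y)) + b * (LINT y|m0. v (mix r x y) / u0 (mix r x y))"
      using elim by (subst Bochner_Integration.integral_add) (auto intro!: integrable_mult_right simp only: integral_mult_right_zero)
    finally show ?case by (simp add: mehler_def algebra_simps)
  qed
qed (use mehler_bound[OF r] in auto)

lemma mehler_wave:
  assumes r: "K_contraction r"
  shows "mehler r (\<lambda>x. u0 x * wave \<xi> x)
    = (\<lambda>x. of_real (exp (- (\<xi> \<bullet> K \<xi> - r \<xi> \<bullet> K (r \<xi>)) / 2)) * (u0 x * wave (r \<xi>) x))"
  by (simp add: mehler_def wave_mix[OF r] char_m0 gauss_def noise(2)[OF r] mult_ac)

lemma mehler_cnj: "mehler r (\<lambda>x. cnj (u x)) = (\<lambda>x. cnj (mehler r u x))"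
proof -
  have "(LINT y|m0. cnj (u (mix r x y)) / u0 (mix r x y)) = (LINT y|m0. cnj (u (mix r x y) / u0 (mix r x y)))" for x
    by simp
  also have "\<dots> x = cnj (LINT y|m0. u (mix r x y) / u0 (mix r x y))" for x
    by (rule Bochner_Integration.integral_cnj)
  finally show ?thesis by (simp add: mehler_def)
qed

end

section \<open>Linear flows and their decay\<close>

definition flow :: "('a::euclidean_space \<Rightarrow> 'a) \<Rightarrow> real \<Rightarrow> 'a \<Rightarrow> 'a" where
  "flow A t v = (\<Sum>k. (t ^ k / fact k) *\<^sub>R (A ^^ k) v)"

lemma linear_funpow:
  fixes A :: "'a::real_vector \<Rightarrow> 'a"
  shows "linear A \<Longrightarrow> linear (A ^^ k)"
proof (induction k)
  case (Suc k) then show ?case using linear_compose[of "A ^^ k" A] by (simp add: o_def)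
qed (simp add: linear_id)

lemma flow_summable:
  fixes A :: "'a::euclidean_space \<Rightarrow> 'a"
  assumes A: "linear A"
  shows "summable (\<lambda>k. (t ^ k / fact k) *\<^sub>R (A ^^ k) v)"
proof -
  obtain B where B: "B > 0" "\<And>x. norm (A x) \<le> B * norm x" using linear_bounded_pos[OF A] by auto
  have p: "norm ((A ^^ k) v) \<le> B ^ k * norm v" for k
  proof (induction k)
    case (Suc k)
    have "norm ((A ^^ Suc k) v) \<le> B * norm ((A ^^ k) v)" using B(2) by simp
    also have "\<dots> \<le> B * (B ^ k * norm v)" using Suc B(1) by (intro mult_left_mono) auto
    finally show ?case by simp
  qed simp
  show ?thesis
  proof (rule summable_comparison_test')
    show "summable (\<lambda>k. norm v * (inverse (fact k) * (\<bar>t\<bar> * B) ^ k))"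
      by (intro summable_mult summable_exp)
    fix k :: nat
    have "norm ((t ^ k / fact k) *\<^sub>R (A ^^ k) v) = (\<bar>t\<bar> ^ k / fact k) * norm ((A ^^ k) v)"
      by (simp add: power_abs)
    also have "\<dots> \<le> (\<bar>t\<bar> ^ k / fact k) * (B ^ k * norm v)" by (intro mult_left_mono p) auto
    also have "\<dots> = norm v * (inverse (fact k) * (\<bar>t\<bar> * B) ^ k)" by (simp add: power_mult_distrib field_simps)
    finally show "norm ((t ^ k / fact k) *\<^sub>R (A ^^ k) v) \<le> norm v * (inverse (fact k) * (\<bar>t\<bar> * B) ^ k)" .
  qed
qed

lemma flow_0 [simp]: "flow A 0 v = v"
proof -
  have "flow A 0 v = (\<Sum>k\<in>{0::nat}. (0 ^ k / fact k) *\<^sub>R (A ^^ k) v)"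
    unfolding flow_def by (rule suminf_finite) auto
  then show ?thesis by simp
qed

lemma flow_linear:
  assumes A: "linear A"
  shows "linear (flow A t)"
proof (rule linearI)
  note S = flow_summable[OF A] and l = linear_funpow[OF A]
  show "flow A t (u + v) = flow A t u + flow A t v" for u v
    unfolding flow_def by (subst suminf_add[OF S S]) (simp add: linear_add[OF l] scaleR_add_right)
  show "flow A t (c *\<^sub>R u) = c *\<^sub>R flow A t u" for c u
    unfolding flow_def by (subst suminf_scaleR_right[OF S]) (simp add: linear_scale[OF l] mult.commute)
qed

lemma flow_commute:
  fixes A :: "'a::euclidean_space \<Rightarrow> 'a"
  assumes A: "linear A"
  shows "A (flow A t v) = flow A t (A v)"
proof -
  have "A (flow A t v) = (\<Sum>k. A ((t ^ k / fact k) *\<^sub>R (A ^^ k) v))"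
    unfolding flow_def using A by (intro bounded_linear.suminf flow_summable) (simp add: linear_conv_bounded_linear)
  then show ?thesis by (simp add: flow_def linear_scale[OF A] funpow_swap1)
qed

lemma flow_has_vector_derivative:
  fixes A :: "'a::euclidean_space \<Rightarrow> 'a"
  assumes A: "linear A"
  shows "((\<lambda>t. flow A t v) has_vector_derivative A (flow A t v)) (at t)"
  unfolding has_vector_derivative_def
proof (subst has_derivative_componentwise_within, intro ballI)
  fix b :: 'a assume "b \<in> Basis"
  \<comment> \<open>Each coordinate is a scalar power series in \<open>t\<close>, which may be
    differentiated term by term.\<close>
  have comp: "flow A t v \<bullet> b = (\<Sum>k. ((A ^^ k) v \<bullet> b / fact k) * t ^ k)" for t v
  proof -
    have "flow A t v \<bullet> b = (\<Sum>k. ((t ^ k / fact k) *\<^sub>R (A ^^ k) v) \<bullet> b)"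
      unfolding flow_def by (rule bounded_linear.suminf[OF bounded_linear_inner_left flow_summable[OF A]])
    then show ?thesis by (simp add: mult.commute)
  qed
  have sm: "summable (\<lambda>k. ((A ^^ k) v \<bullet> b / fact k) * t ^ k)" for t v
    using bounded_linear.summable[OF bounded_linear_inner_left[of b] flow_summable[OF A, of t v]]
    by (simp add: mult.commute)
  have "((\<lambda>t. \<Sum>k. ((A ^^ k) v \<bullet> b / fact k) * t ^ k) has_field_derivative
    (\<Sum>k. diffs (\<lambda>k. (A ^^ k) v \<bullet> b / fact k) k * t ^ k)) (at t)"
    by (rule termdiffs_strong_converges_everywhere[OF sm])
  moreover have "diffs (\<lambda>k. (A ^^ k) v \<bullet> b / fact k) k = (A ^^ k) (A v) \<bullet> b / fact k" for k
    unfolding diffs_def by (simp add: funpow_swap1 del: of_nat_Suc)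
  ultimately have "((\<lambda>t. flow A t v \<bullet> b) has_field_derivative (A (flow A t v) \<bullet> b)) (at t)"
    unfolding comp[symmetric] flow_commute[OF A] by (simp add: comp)
  then show "((\<lambda>t. flow A t v \<bullet> b) has_derivative (\<lambda>h. (h *\<^sub>R A (flow A t v)) \<bullet> b)) (at t)"
    by (simp add: has_field_derivative_def mult.commute[of _ "A (flow A t v) \<bullet> b"])
qed

text \<open>Gronwall: \<open>exp (- 2 * B * t)\<close> times the squared norm does not increase,
  where \<open>B\<close> bounds \<open>A\<close>. It starts at 0 and is nonnegative.\<close>

lemma linear_ode_zero:
  fixes A :: "'a::euclidean_space \<Rightarrow> 'a"
  assumes A: "linear A" and y: "\<And>t. (y has_vector_derivative A (y t)) (at t)" and y0: "y 0 = 0" and t: "t \<ge> 0"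
  shows "y t = 0"
proof -
  obtain B where B: "B > 0" "\<And>x. norm (A x) \<le> B * norm x" using linear_bounded_pos[OF A] by auto
  define \<phi> where "\<phi> = (\<lambda>t. exp (- 2 * B * t) * (y t \<bullet> y t))"
  have d: "(\<phi> has_real_derivative exp (- 2 * B * s) * (2 * (y s \<bullet> A (y s)) - 2 * B * (y s \<bullet> y s))) (at s)" for s
  proof -
    have "((\<lambda>t. y t \<bullet> y t) has_derivative (\<lambda>h. y s \<bullet> (h *\<^sub>R A (y s)) + (h *\<^sub>R A (y s)) \<bullet> y s)) (at s)"
      by (rule has_derivative_inner) (use y[of s] in \<open>auto simp: has_vector_derivative_def\<close>)
    moreover have "(\<lambda>h. y s \<bullet> (h *\<^sub>R A (y s)) + (h *\<^sub>R A (y s)) \<bullet> y s) = (*) (2 * (y s \<bullet> A (y s)))"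
      by (auto simp: inner_commute)
    ultimately have "((\<lambda>t. y t \<bullet> y t) has_real_derivative 2 * (y s \<bullet> A (y s))) (at s)"
      by (simp only: has_field_derivative_def)
    moreover have "((\<lambda>t. exp (- 2 * B * t)) has_real_derivative - 2 * B * exp (- 2 * B * s)) (at s)"
      by (auto intro!: derivative_eq_intros)
    ultimately
    have "((\<lambda>t. exp (- 2 * B * t) * (y t \<bullet> y t)) has_real_derivative
       - 2 * B * exp (- 2 * B * s) * (y s \<bullet> y s) + 2 * (y s \<bullet> A (y s)) * exp (- 2 * B * s)) (at s)"
      by (rule DERIV_mult[rotated])
    then show ?thesis unfolding \<phi>_def by (simp add: algebra_simps)
  qed
  have "\<phi> t \<le> \<phi> 0"
  proof (rule DERIV_nonpos_imp_nonincreasing[OF t])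
    fix s
    have "y s \<bullet> A (y s) \<le> norm (y s) * norm (A (y s))" by (rule norm_cauchy_schwarz)
    also have "\<dots> \<le> norm (y s) * (B * norm (y s))" by (intro mult_left_mono B) auto
    also have "\<dots> = B * (y s \<bullet> y s)" by (simp add: power2_norm_eq_inner[symmetric] power2_eq_square)
    finally have "2 * (y s \<bullet> A (y s)) - 2 * B * (y s \<bullet> y s) \<le> 0" by simp
    then have "exp (- 2 * B * s) * (2 * (y s \<bullet> A (y s)) - 2 * B * (y s \<bullet> y s)) \<le> 0"
      by (simp add: mult_le_0_iff)
    with d[of s] show "\<exists>l. (\<phi> has_real_derivative l) (at s) \<and> l \<le> 0" by blast
  qed
  then have "y t \<bullet> y t \<le> 0" using y0 by (simp add: \<phi>_def mult_le_0_iff)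
  then show ?thesis by (metis inner_eq_zero_iff inner_ge_zero order_antisym)
qed

lemma linear_ode_unique:
  fixes A :: "'a::euclidean_space \<Rightarrow> 'a"
  assumes A: "linear A" and y: "\<And>t. (y has_vector_derivative A (y t)) (at t)"
    and z: "\<And>t. (z has_vector_derivative A (z t)) (at t)" and "y 0 = z 0" and t: "t \<ge> 0"
  shows "y t = z t"
proof -
  have "y t - z t = 0"
  proof (rule linear_ode_zero[OF A _ _ t, of "\<lambda>t. y t - z t"])
    show "((\<lambda>t. y t - z t) has_vector_derivative A (y t - z t)) (at t)" for t
      using has_vector_derivative_diff[OF y z] by (simp add: linear_diff[OF A])
  qed (use assms in auto)
  then show ?thesis by simp
qed

text \<open>Both sides solve the same equation in \<open>s\<close> with the same initial value,
  which spares a Cauchy product of the series. Uniqueness is proved forward in time, hence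
  \<open>s \<ge> 0\<close>.\<close>

lemma flow_add:
  fixes A :: "'a::euclidean_space \<Rightarrow> 'a"
  assumes A: "linear A" and s: "s \<ge> 0"
  shows "flow A (s + t) v = flow A s (flow A t v)"
proof (rule linear_ode_unique[OF A _ flow_has_vector_derivative[OF A] _ s])
  fix r
  have "((\<lambda>t. flow A t v) \<circ> (\<lambda>r. r + t) has_vector_derivative 1 *\<^sub>R A (flow A (r + t) v)) (at r)"
    by (rule vector_diff_chain_at[OF _ flow_has_vector_derivative[OF A]]) (auto intro!: derivative_eq_intros)
  then show "((\<lambda>s. flow A (s + t) v) has_vector_derivative A (flow A (r + t) v)) (at r)"
    by (simp add: o_def)
qed auto

section \<open>Decay of a matrix flow from the real parts of its eigenvalues\<close>

definition poly_apply :: "complex poly \<Rightarrow> complex^'n::finite^'n \<Rightarrow> complex^'n \<Rightarrow> complex^'n" where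
  "poly_apply p W v = (\<Sum>k\<le>degree p. coeff p k *s (((*v) W) ^^ k) v)"

lemma poly_apply_bound:
  assumes "degree p \<le> N"
  shows "poly_apply p W v = (\<Sum>k\<le>N. coeff p k *s (((*v) W) ^^ k) v)"
  unfolding poly_apply_def
  by (rule sum.mono_neutral_left) (use assms in \<open>auto simp: coeff_eq_0\<close>)

lemma matrix_vector_mult_sum_right: "W *v (\<Sum>k\<in>I. f k) = (\<Sum>k\<in>I. W *v f k)"
  by (induction I rule: infinite_finite_induct) (auto simp: matrix_vector_right_distrib)

lemma poly_apply_linear_factor:
  "poly_apply ([:- z, 1:] * q) W v = W *v poly_apply q W v - z *s poly_apply q W v"
proof -
  let ?N = "degree q"
  let ?P = "\<lambda>k. (((*v) W) ^^ k) v"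
  have "degree ([:- z, 1:] * q) \<le> Suc ?N" using degree_mult_le[of "[:- z, 1:]" q] by simp
  then have "poly_apply ([:- z, 1:] * q) W v = (\<Sum>k\<le>Suc ?N. coeff ([:- z, 1:] * q) k *s ?P k)"
    by (rule poly_apply_bound)
  also have "\<dots> = (\<Sum>k\<le>Suc ?N. (case k of 0 \<Rightarrow> 0 | Suc m \<Rightarrow> coeff q m) *s ?P k) - z *s (\<Sum>k\<le>Suc ?N. coeff q k *s ?P k)"
    by (simp add: sum_subtractf[symmetric] vec.scale_sum_right coeff_pCons vector_sub_rdistrib
        vector_smult_assoc del: sum.atMost_Suc funpow.simps)
  also have "(\<Sum>k\<le>Suc ?N. (case k of 0 \<Rightarrow> 0 | Suc m \<Rightarrow> coeff q m) *s ?P k) = (\<Sum>k\<le>?N. coeff q k *s ?P (Suc k))"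
    by (subst sum.atMost_Suc_shift) simp
  also have "\<dots> = W *v poly_apply q W v"
    by (simp add: poly_apply_def matrix_vector_mult_sum_right vector_scalar_commute)
  also have "(\<Sum>k\<le>Suc ?N. coeff q k *s ?P k) = poly_apply q W v"
    by (rule poly_apply_bound[symmetric]) simp
  finally show ?thesis .
qed

definition root_apply :: "complex^'n::finite^'n \<Rightarrow> complex list \<Rightarrow> complex^'n \<Rightarrow> complex^'n" where
  "root_apply W zs v = foldr (\<lambda>z w. W *v w - z *s w) zs v"

lemma poly_apply_roots:
  "poly_apply (smult c (\<Prod>z\<leftarrow>zs. [:- z, 1:])) W v = c *s root_apply W zs v"
proof (induction zs)
  case Nil
  then show ?case by (simp add: poly_apply_def root_apply_def)
next
  case (Cons z zs)
  have "smult c (\<Prod>z\<leftarrow>z # zs. [:- z, 1:]) = [:- z, 1:] * smult c (\<Prod>z\<leftarrow>zs. [:- z, 1:])"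
    by (simp only: list.map prod_list.Cons mult_smult_right)
  then show ?case
    by (simp only: poly_apply_linear_factor Cons) (simp add: root_apply_def vector_scalar_commute
        vector_smult_assoc vec.scale_right_diff_distrib mult.commute)
qed

text \<open>The iterates of \<open>v\<close> under \<open>W\<close> up to the dimension are one too
  many to be independent, so a nonzero polynomial in \<open>W\<close> kills \<open>v\<close>; over
  the complex numbers it splits into linear factors. The list depends on \<open>v\<close> and may
  contain numbers that are not eigenvalues.\<close>

lemma matrix_annihilating_roots:
  fixes W :: "complex^'n::finite^'n"
  shows "\<exists>zs. root_apply W zs v = 0"
proof -
  let ?P = "\<lambda>k. (((*v) W) ^^ k) v"
  let ?N = "CARD('n)"
  have "\<exists>p. p \<noteq> 0 \<and> poly_apply p W v = 0"
  \<comment> \<open>Dependence is a notion for sets, so a repetition among the iterates would be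
    lost in the image. It is treated first, with a difference of two monomials.\<close>
  proof (cases "inj_on ?P {..?N}")
    case False
    then obtain i j where ij: "i \<noteq> j" "?P i = ?P j" by (auto simp: inj_on_def)
    define p where "p = monom (1::complex) i - monom 1 j"
    have "coeff p i = 1" using ij by (simp add: p_def)
    then have "p \<noteq> 0" by auto
    moreover have "poly_apply p W v = (\<Sum>k\<le>max i j. coeff p k *s ?P k)"
      by (rule poly_apply_bound) (simp add: p_def degree_monom_eq degree_diff_le)
    moreover have "\<dots> = (\<Sum>k\<le>max i j. (if k = i then ?P k else 0) - (if k = j then ?P k else 0))"
      by (intro sum.cong) (auto simp: p_def vector_sub_rdistrib)
    moreover have "\<dots> = 0" using ij by (simp add: sum_subtractf sum.delta)
    ultimately show ?thesis by auto
  next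
    case True
    have "card (?P ` {..?N}) > CARD('n)" using card_image[OF True] by simp
    then have "vec.dependent (?P ` {..?N})"
      using vec.independent_card_le_dim[of "?P ` {..?N}" UNIV] dim_subset_UNIV_cart_gen[of "UNIV :: (complex^'n) set"] by fastforce
    then obtain u where u: "\<exists>x\<in>?P ` {..?N}. u x \<noteq> 0" "(\<Sum>x\<in>?P ` {..?N}. u x *s x) = 0"
      using vec.dependent_finite[of "?P ` {..?N}"] by auto
    define p where "p = (\<Sum>k\<le>?N. monom (u (?P k)) k)"
    have c: "coeff p k = (if k \<le> ?N then u (?P k) else 0)" for k
      by (simp add: p_def coeff_sum sum.delta)
    have "p \<noteq> 0" using u(1) c by (metis (no_types, lifting) atMost_iff coeff_0 imageE)
    moreover have "poly_apply p W v = (\<Sum>k\<le>?N. coeff p k *s ?P k)"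
      by (rule poly_apply_bound) (auto intro: degree_le simp: c)
    moreover have "\<dots> = (\<Sum>k\<le>?N. u (?P k) *s ?P k)" by (intro sum.cong) (auto simp: c)
    moreover have "\<dots> = 0" using u(2) by (simp add: sum.reindex[OF True])
    ultimately show ?thesis by auto
  qed
  then obtain p where p: "p \<noteq> 0" "poly_apply p W v = 0" by blast
  obtain zs where zs: "smult (lead_coeff p) (\<Prod>z\<leftarrow>zs. [:- z, 1:]) = p"
  proof -
    obtain A where A: "p = smult (lead_coeff p) (\<Prod>x\<in>#A. [:- x, 1:])"
      using alg_closed_imp_factorization[OF p(1)] by blast
    obtain zs where "mset zs = A" using ex_mset by blast
    then have "(\<Prod>x\<in>#A. [:- x, 1:]) = (\<Prod>z\<leftarrow>zs. [:- z, 1:])"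
      by (metis mset_map prod_mset_prod_list)
    with A that show ?thesis by metis
  qed
  have "lead_coeff p *s root_apply W zs v = 0"
    using p(2) zs poly_apply_roots[of "lead_coeff p" zs W v] by simp
  then have "root_apply W zs v = 0" using p(1) by (simp add: vec.scale_eq_0_iff)
  then show ?thesis by blast
qed

lemma root_apply_commute:
  "root_apply W zs (W *v v - z *s v) = W *v root_apply W zs v - z *s root_apply W zs v"
proof (induction zs)
  case (Cons a zs)
  have "root_apply W (a # zs) (W *v v - z *s v) = W *v (W *v root_apply W zs v - z *s root_apply W zs v)
      - a *s (W *v root_apply W zs v - z *s root_apply W zs v)"
    using Cons by (simp add: root_apply_def)
  then show ?case
    by (simp add: root_apply_def matrix_vector_mult_diff_distrib vector_scalar_commute vec.scale_right_diff_distrib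
        vector_smult_assoc mult.commute algebra_simps)
qed (simp add: root_apply_def)

lemma matrix_linear_real: "linear (\<lambda>v. - (W *v v :: complex^'n::finite))"
  by (rule linearI) (simp_all add: matrix_vector_right_distrib vec_eq_iff matrix_vector_mult_def
      sum.distrib algebra_simps scaleR_sum_right)

lemma complex_flow_decay:
  fixes W :: "complex^'n::finite^'n"
  assumes eig: "\<And>z. z \<in> spectrum W \<Longrightarrow> Re z > \<tau>"
  shows "\<exists>C. \<forall>t\<ge>0. norm (flow (\<lambda>v. - (W *v v)) t v) \<le> C * exp (- \<tau> * t)"
proof -
  define A where "A = (\<lambda>v. - (W *v v))"
  have A: "linear A" unfolding A_def by (rule matrix_linear_real)
  have "\<exists>C. \<forall>t\<ge>0. norm (flow A t v) \<le> C * exp (- \<tau> * t)" if "root_apply W zs v = 0" for zs v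
    using that
  proof (induction zs arbitrary: v)
    case Nil
    then have "v = 0" by (simp add: root_apply_def)
    then show ?case using linear_0[OF flow_linear[OF A]] by (intro exI[of _ 0]) auto
  next
    case (Cons z zs)
    have zero: "W *v root_apply W zs v - z *s root_apply W zs v = 0" using Cons(2) by (simp add: root_apply_def)
    show ?case
    proof (cases "z \<in> spectrum W")
      case False
      then have "root_apply W zs v = 0" using zero by (auto simp: spectrum_def)
      then show ?thesis by (rule Cons(1))
    next
      case True
      define \<delta> where "\<delta> = Re z - \<tau>"
      have \<delta>: "\<delta> > 0" using eig[OF True] by (simp add: \<delta>_def)
      define w where "w = W *v v - z *s v"
      have "root_apply W zs w = 0" unfolding w_def root_apply_commute by (rule zero)
      from Cons(1)[OF this] obtain C0 where C0: "\<And>t. t \<ge> 0 \<Longrightarrow> norm (flow A t w) \<le> C0 * exp (- \<tau> * t)" by blast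
      define C where "C = max C0 0"
      have C: "C \<ge> 0" "\<And>t. t \<ge> 0 \<Longrightarrow> norm (flow A t w) \<le> C * exp (- \<tau> * t)"
        using C0 by (auto simp: C_def intro: order_trans[OF _ mult_right_mono[of C0 "max C0 0"]])
      define y where "y = (\<lambda>t. flow A t v)"
      have fw: "flow A t w = W *v y t - z *s y t" for t
      proof -
        have "flow A t w = flow A t (- A v) - flow A t (z *s v)"
          unfolding w_def linear_diff[OF flow_linear[OF A], symmetric] by (simp add: A_def)
        moreover have "flow A t (- A v) = W *v y t"
          by (simp add: linear_neg[OF flow_linear[OF A]] flow_commute[OF A, symmetric]) (simp add: A_def y_def)
        moreover have "flow A t (z *s v) = z *s y t"
        proof -
          have pw: "(A ^^ k) (z *s v) = z *s (A ^^ k) v" for k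
            by (induction k) (simp_all add: A_def vector_scalar_commute)
          have "bounded_linear (\<lambda>v::complex^'n. z *s v)"
            unfolding linear_conv_bounded_linear[symmetric]
            by (rule linearI) (auto simp: vec_eq_iff algebra_simps)
          from bounded_linear.suminf[OF this flow_summable[OF A, of t v]]
          have "z *s y t = (\<Sum>k. z *s ((t ^ k / fact k) *\<^sub>R (A ^^ k) v))" by (simp add: y_def flow_def)
          also have "\<dots> = flow A t (z *s v)" unfolding flow_def pw
            by (intro suminf_cong) (auto simp: vec_eq_iff)
          finally show ?thesis by simp
        qed
        ultimately show ?thesis by simp
      qed
      have yc: "norm (y t $ i) \<le> (norm v + C / \<delta>) * exp (- \<tau> * t)" if t: "t \<ge> 0" for t i
      proof (cases "t = 0")
        case True
        then show ?thesis using Finite_Cartesian_Product.norm_nth_le[of v i] C \<delta> by (simp add: y_def add_increasing2)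
      next
        case False
        then have t: "t > 0" using t by simp
        \<comment> \<open>Integrating factor: the term with \<open>z\<close> cancels in the
          derivative, which leaves only the flow of \<open>w\<close>. Working with one coordinate
          keeps the product scalar.\<close>
        define g where "g = (\<lambda>s. exp (z * of_real s) * y s $ i)"
        have dg: "(g has_vector_derivative - exp (z * of_real s) * flow A s w $ i) (at s)" for s
        proof -
          have "((\<lambda>s. exp (z * of_real s)) has_vector_derivative z * exp (z * of_real s)) (at s)"
            by (rule has_vector_derivative_real_field) (auto intro!: derivative_eq_intros)
          moreover have "((\<lambda>s. y s $ i) has_vector_derivative A (y s) $ i) (at s)"
            unfolding y_def
            by (rule bounded_linear.has_vector_derivative[OF bounded_linear_vec_nth flow_has_vector_derivative[OF A]])
          ultimately have "(g has_vector_derivative exp (z * of_real s) * A (y s) $ i + z * exp (z * of_real s) * y s $ i) (at s)"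
            unfolding g_def by (rule has_vector_derivative_mult)
          then show ?thesis unfolding fw by (simp add: A_def algebra_simps)
        qed
        \<comment> \<open>The comparison function is the primitive of the bound
          \<open>C * exp (\<delta> * s)\<close> on the derivative.\<close>
        have "norm (g t - g 0) \<le> C / \<delta> * exp (\<delta> * t) - C / \<delta> * exp (\<delta> * 0)"
        proof (rule differentiable_bound_general[OF t])
          show "continuous_on {0..t} g"
            by (rule continuous_at_imp_continuous_on) (auto intro: has_vector_derivative_continuous dg)
          show "continuous_on {0..t} (\<lambda>s. C / \<delta> * exp (\<delta> * s))" by (intro continuous_intros)
          show "(g has_vector_derivative - exp (z * of_real s) * flow A s w $ i) (at s)" for s by (rule dg)
          show "((\<lambda>s. C / \<delta> * exp (\<delta> * s)) has_vector_derivative C * exp (\<delta> * s)) (at s)" for s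
            unfolding has_real_derivative_iff_has_vector_derivative[symmetric]
            using \<delta> by (auto intro!: derivative_eq_intros)
          fix s assume s: "0 < s" "s < t"
          have "norm (- exp (z * of_real s) * flow A s w $ i) \<le> exp (Re z * s) * norm (flow A s w)"
            by (simp add: norm_mult mult_left_mono Finite_Cartesian_Product.norm_nth_le)
          also have "\<dots> \<le> exp (Re z * s) * (C * exp (- \<tau> * s))" using s by (intro mult_left_mono C) auto
          also have "\<dots> = C * exp (\<delta> * s)" by (simp add: \<delta>_def left_diff_distrib exp_diff exp_minus field_simps)
          finally show "norm (- exp (z * of_real s) * flow A s w $ i) \<le> C * exp (\<delta> * s)" .
        qed
        then have "norm (g t) \<le> norm (g 0) + C / \<delta> * exp (\<delta> * t) - C / \<delta>"
          using norm_triangle_ineq2[of "g t" "g 0"] by simp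
        also have "\<dots> \<le> norm v * exp (\<delta> * t) + C / \<delta> * exp (\<delta> * t)"
        proof -
          have "norm (g 0) \<le> norm v * 1" by (simp add: g_def y_def Finite_Cartesian_Product.norm_nth_le)
          also have "\<dots> \<le> norm v * exp (\<delta> * t)" using \<delta> t by (intro mult_left_mono) auto
          finally show ?thesis using C \<delta> by (smt (verit) divide_nonneg_pos)
        qed
        finally have "exp (Re z * t) * norm (y t $ i) \<le> (norm v + C / \<delta>) * exp (\<delta> * t)"
          by (simp add: g_def norm_mult algebra_simps)
        then have "exp (- Re z * t) * (exp (Re z * t) * norm (y t $ i)) \<le> exp (- Re z * t) * ((norm v + C / \<delta>) * exp (\<delta> * t))"
          by (rule mult_left_mono) simp
        moreover have "exp (- Re z * t) * (exp (Re z * t) * norm (y t $ i)) = norm (y t $ i)"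
          by (simp add: exp_minus)
        moreover have "exp (- Re z * t) * ((norm v + C / \<delta>) * exp (\<delta> * t)) = (norm v + C / \<delta>) * exp (- \<tau> * t)"
        proof -
          have "exp (- Re z * t) * exp (\<delta> * t) = exp (- \<tau> * t)"
            unfolding exp_add[symmetric] by (simp add: \<delta>_def algebra_simps)
          then show ?thesis by (metis mult.left_commute)
        qed
        ultimately show ?thesis by (simp only:)
      qed
      have "norm (flow A t v) \<le> (real CARD('n) * (norm v + C / \<delta>)) * exp (- \<tau> * t)" if t: "t \<ge> 0" for t
      proof -
        have "norm (flow A t v) \<le> (\<Sum>i\<in>UNIV. norm (y t $ i))"
          unfolding y_def norm_vec_def by (rule L2_set_le_sum) simp
        also have "\<dots> \<le> (\<Sum>i\<in>(UNIV::'n set). (norm v + C / \<delta>) * exp (- \<tau> * t))" by (intro sum_mono yc t)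
        finally show ?thesis by simp
      qed
      then show ?thesis by blast
    qed
  qed
  with matrix_annihilating_roots[of W v] show ?thesis unfolding A_def by blast
qed

definition complexify :: "(real^'n::finite \<Rightarrow> real^'n) \<Rightarrow> complex^'n^'n" where
  "complexify B = (\<chi> i j. of_real (B (axis j 1) $ i))"

lemma complexify_cvec:
  assumes B: "linear B"
  shows "complexify B *v cvec x = cvec (B x)"
proof -
  have "B x = B (\<Sum>j\<in>UNIV. x $ j *\<^sub>R axis j 1)" by (simp add: basis_expansion flip: scalar_mult_eq_scaleR)
  also have "\<dots> = (\<Sum>j\<in>UNIV. x $ j *\<^sub>R B (axis j 1))" by (simp add: linear_sum[OF B] linear_scale[OF B])
  finally have "B x $ i = (\<Sum>j\<in>UNIV. x $ j * B (axis j 1) $ i)" for i by simp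
  then show ?thesis by (simp add: vec_eq_iff complexify_def cvec_def matrix_vector_mult_def mult.commute)
qed

text \<open>The embedding \<open>cvec\<close> intertwines the real and the complex flow, by
  uniqueness for the complex equation. The complex estimate has a constant depending on the vector;
  applying it to the finitely many basis vectors makes it uniform.\<close>

lemma real_flow_decay:
  fixes B :: "real^'n::finite \<Rightarrow> real^'n"
  assumes B: "linear B" and eig: "\<And>z. z \<in> spectrum (complexify B) \<Longrightarrow> Re z > \<tau>"
  shows "\<exists>C>0. \<forall>t\<ge>0. \<forall>x. norm (flow (\<lambda>v. - B v) t x) \<le> C * exp (- \<tau> * t) * norm x"
proof -
  define b where "b = (\<lambda>v. - B v)"
  have b: "linear b" unfolding b_def using B by (rule linear_compose_neg)
  have cv: "bounded_linear (cvec :: real^'n \<Rightarrow> complex^'n)"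
    unfolding linear_conv_bounded_linear[symmetric]
    by (rule linearI) (auto simp: cvec_def vec_eq_iff scaleR_conv_of_real[where 'a=complex])
  have nc: "norm x \<le> norm (cvec x)" for x :: "real^'n"
    by (simp add: norm_vec_def cvec_def)
  have eq: "cvec (flow b t x) = flow (\<lambda>v. - (complexify B *v v)) t (cvec x)" if t: "t \<ge> 0" for t x
  proof (rule linear_ode_unique[OF matrix_linear_real _ flow_has_vector_derivative[OF matrix_linear_real] _ t])
    fix s
    have "((\<lambda>t. cvec (flow b t x)) has_vector_derivative cvec (b (flow b s x))) (at s)"
      by (rule bounded_linear.has_vector_derivative[OF cv flow_has_vector_derivative[OF b]])
    then show "((\<lambda>t. cvec (flow b t x)) has_vector_derivative - (complexify B *v cvec (flow b s x))) (at s)"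
      by (simp add: complexify_cvec[OF B] b_def linear_neg[OF bounded_linear.linear[OF cv]])
  qed simp
  have "\<exists>C. \<forall>t\<ge>0. norm (flow b t (axis i 1)) \<le> C * exp (- \<tau> * t)" for i
  proof -
    obtain C where C: "\<And>t. t \<ge> 0 \<Longrightarrow> norm (flow (\<lambda>v. - (complexify B *v v)) t (cvec (axis i 1))) \<le> C * exp (- \<tau> * t)"
      using complex_flow_decay[OF eig] by blast
    have "norm (flow b t (axis i 1)) \<le> C * exp (- \<tau> * t)" if "t \<ge> 0" for t
      using order_trans[OF nc C[OF that, folded eq[OF that]]] .
    then show ?thesis by blast
  qed
  then obtain C where C: "\<And>i t. t \<ge> 0 \<Longrightarrow> norm (flow b t (axis i 1)) \<le> C i * exp (- \<tau> * t)" by metis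
  define D where "D = (\<Sum>i\<in>UNIV. \<bar>C i\<bar>) + 1"
  have D: "D > 0" by (simp add: D_def add_nonneg_pos sum_nonneg)
  have "norm (flow b t x) \<le> D * exp (- \<tau> * t) * norm x" if t: "t \<ge> 0" for t x
  proof -
    note L = flow_linear[OF b, of t]
    have "flow b t x = flow b t (\<Sum>j\<in>UNIV. x $ j *\<^sub>R axis j 1)" by (simp add: basis_expansion flip: scalar_mult_eq_scaleR)
    also have "\<dots> = (\<Sum>j\<in>UNIV. x $ j *\<^sub>R flow b t (axis j 1))" by (simp add: linear_sum[OF L] linear_scale[OF L])
    also have "norm \<dots> \<le> (\<Sum>j\<in>UNIV. norm x * (\<bar>C j\<bar> * exp (- \<tau> * t)))"
    proof (rule sum_norm_le)
      fix j
      have "norm (flow b t (axis j 1)) \<le> \<bar>C j\<bar> * exp (- \<tau> * t)"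
        using C[OF t, of j] by (smt (verit) mult_right_mono exp_gt_zero)
      then show "norm (x $ j *\<^sub>R flow b t (axis j 1)) \<le> norm x * (\<bar>C j\<bar> * exp (- \<tau> * t))"
        using component_le_norm_cart[of x j] by (simp add: mult_mono)
    qed
    also have "\<dots> = (\<Sum>i\<in>UNIV. \<bar>C i\<bar>) * exp (- \<tau> * t) * norm x" by (simp add: sum_distrib_left sum_distrib_right mult_ac)
    also have "\<dots> \<le> D * exp (- \<tau> * t) * norm x" by (intro mult_right_mono) (auto simp: D_def)
    finally show ?thesis .
  qed
  then show ?thesis using D unfolding b_def by blast
qed

section \<open>Smooth functions, cutoffs and integration by parts\<close>

lemma pderiv_at_eqI: "(f has_derivative f') (at x) \<Longrightarrow> pderiv_at j f x = f' (axis j 1)"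
  unfolding pderiv_at_def by (metis frechet_derivative_at)

lemma differentiable_has_derivative:
  "f differentiable (at x) \<Longrightarrow> (f has_derivative (frechet_derivative f (at x))) (at x)"
  by (simp add: frechet_derivative_works)

lemma pderiv_at_add:
  assumes "\<And>x. f differentiable (at x)" "\<And>x. g differentiable (at x)"
  shows "pderiv_at j (\<lambda>x. f x + g x) = (\<lambda>x. pderiv_at j f x + pderiv_at j g x)"
proof
  fix x
  from pderiv_at_eqI[OF has_derivative_add[OF differentiable_has_derivative[OF assms(1)] differentiable_has_derivative[OF assms(2)]]]
  show "pderiv_at j (\<lambda>x. f x + g x) x = pderiv_at j f x + pderiv_at j g x" by (simp add: pderiv_at_def)
qed

lemma pderiv_at_mult:
  assumes "\<And>x. f differentiable (at x)" "\<And>x. g differentiable (at x)"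
  shows "pderiv_at j (\<lambda>x. f x * g x) = (\<lambda>x. pderiv_at j f x * g x + f x * pderiv_at j g x)"
proof
  fix x
  from pderiv_at_eqI[OF has_derivative_mult[OF differentiable_has_derivative[OF assms(1)] differentiable_has_derivative[OF assms(2)]]]
  show "pderiv_at j (\<lambda>x. f x * g x) x = pderiv_at j f x * g x + f x * pderiv_at j g x"
    by (simp add: pderiv_at_def)
qed

inductive_set fun_alg :: "(real^'n::finite \<Rightarrow> complex) set \<Rightarrow> (real^'n \<Rightarrow> complex) set" for B where
  base: "f \<in> B \<Longrightarrow> f \<in> fun_alg B"
| add: "f \<in> fun_alg B \<Longrightarrow> g \<in> fun_alg B \<Longrightarrow> (\<lambda>x. f x + g x) \<in> fun_alg B"
| mult: "f \<in> fun_alg B \<Longrightarrow> g \<in> fun_alg B \<Longrightarrow> (\<lambda>x. f x * g x) \<in> fun_alg B"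

text \<open>Smoothness involves all iterated derivatives at once. It suffices to find generators
  whose partial derivatives lie in the algebra they generate; the product rule then keeps every
  iterate inside the algebra.\<close>

lemma smooth_fun_alg:
  assumes d: "\<And>b x. b \<in> B \<Longrightarrow> b differentiable (at x)" and p: "\<And>b j. b \<in> B \<Longrightarrow> pderiv_at j b \<in> fun_alg B"
    and f: "f \<in> fun_alg B"
  shows "smooth_fun f"
proof -
  have diff: "f differentiable (at x)" if "f \<in> fun_alg B" for f x
    using that by (induction rule: fun_alg.induct) (auto intro: d differentiable_add differentiable_mult)
  have pd: "pderiv_at j f \<in> fun_alg B" if "f \<in> fun_alg B" for f j
    using that
    by (induction rule: fun_alg.induct)
      (auto intro: p fun_alg.intros simp: pderiv_at_add pderiv_at_mult diff)
  have "foldr pderiv_at js f \<in> fun_alg B" for js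
    by (induction js) (auto intro: f pd)
  then show ?thesis unfolding smooth_fun_def using diff by blast
qed

lemma smooth_fun_differentiable: "smooth_fun f \<Longrightarrow> f differentiable (at x)"
  unfolding smooth_fun_def by (metis foldr_Nil id_apply)

lemma smooth_fun_pderiv: "smooth_fun f \<Longrightarrow> smooth_fun (pderiv_at j f)"
  unfolding smooth_fun_def
proof (intro allI)
  fix js x assume "\<forall>js x. foldr pderiv_at js f differentiable at x"
  then have "foldr pderiv_at (js @ [j]) f differentiable at x" by blast
  then show "foldr pderiv_at js (pderiv_at j f) differentiable at x" by simp
qed

lemma smooth_fun_continuous: "smooth_fun f \<Longrightarrow> continuous_on A f"
  by (intro continuous_at_imp_continuous_on ballI differentiable_imp_continuous_within smooth_fun_differentiable)

lemma smooth_fun_measurable: "smooth_fun f \<Longrightarrow> f \<in> borel_measurable borel"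
  by (intro borel_measurable_continuous_onI smooth_fun_continuous)

lemma smooth_fun_add: "smooth_fun f \<Longrightarrow> smooth_fun g \<Longrightarrow> smooth_fun (\<lambda>x. f x + g x)"
  by (rule smooth_fun_alg[of "Collect smooth_fun"])
    (auto intro: fun_alg.intros smooth_fun_differentiable smooth_fun_pderiv)

lemma smooth_fun_mult: "smooth_fun f \<Longrightarrow> smooth_fun g \<Longrightarrow> smooth_fun (\<lambda>x. f x * g x)"
  by (rule smooth_fun_alg[of "Collect smooth_fun"])
    (auto intro: fun_alg.intros smooth_fun_differentiable smooth_fun_pderiv)

lemma pderiv_at_const: "pderiv_at j (\<lambda>x. c) = (\<lambda>x. 0)"
  by (rule ext, rule pderiv_at_eqI[THEN trans], rule has_derivative_const) simp

lemma coord_has_derivative: "((\<lambda>x. complex_of_real (x $ k)) has_derivative (\<lambda>h. of_real (h $ k))) (at x)"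
  by (intro has_derivative_of_real bounded_linear_imp_has_derivative bounded_linear_vec_nth)

lemma pderiv_at_coord: "pderiv_at j (\<lambda>x. complex_of_real (x $ k)) = (\<lambda>x. if j = k then 1 else 0)"
  by (rule ext, rule pderiv_at_eqI[THEN trans], rule coord_has_derivative) (simp add: axis_def)

definition poly_gens :: "(real^'n::finite \<Rightarrow> complex) set" where
  "poly_gens = range (\<lambda>c x. c) \<union> range (\<lambda>k x. of_real (x $ k))"

lemma poly_gens_alg:
  assumes "poly_gens \<subseteq> B" and b: "b \<in> poly_gens"
  shows "b differentiable (at x)" "pderiv_at j b \<in> fun_alg B"
proof -
  have c: "(\<lambda>x. c) \<in> B" for c using assms by (auto simp: poly_gens_def)
  show "b differentiable (at x)"
    using b differentiableI[OF coord_has_derivative] by (auto simp: poly_gens_def)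
  show "pderiv_at j b \<in> fun_alg B"
    using b by (auto simp: poly_gens_def pderiv_at_const pderiv_at_coord intro!: fun_alg.base c)
qed

lemma smooth_fun_const: "smooth_fun (\<lambda>x. c)"
  by (rule smooth_fun_alg[of poly_gens]) (auto intro: poly_gens_alg fun_alg.base simp: poly_gens_def)

lemma smooth_fun_coord: "smooth_fun (\<lambda>x. complex_of_real (x $ k))"
  by (rule smooth_fun_alg[of poly_gens]) (auto intro: poly_gens_alg fun_alg.base simp: poly_gens_def)

lemma fun_alg_sum: "finite I \<Longrightarrow> (\<lambda>x. 0) \<in> B \<Longrightarrow> (\<And>i. i \<in> I \<Longrightarrow> f i \<in> fun_alg B) \<Longrightarrow> (\<lambda>x. \<Sum>i\<in>I. f i x) \<in> fun_alg B"
  by (induction I rule: finite_induct) (auto intro: fun_alg.intros)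

lemma smooth_fun_sum: "(\<And>i. i \<in> I \<Longrightarrow> smooth_fun (f i)) \<Longrightarrow> smooth_fun (\<lambda>x. \<Sum>i\<in>I. f i x)"
  by (induction I rule: infinite_finite_induct) (auto intro: smooth_fun_add smooth_fun_const)

lemma smooth_fun_scale: "smooth_fun f \<Longrightarrow> smooth_fun (\<lambda>x. c * f x)"
  by (rule smooth_fun_mult[OF smooth_fun_const])

lemma smooth_fun_uminus: "smooth_fun f \<Longrightarrow> smooth_fun (\<lambda>x. - f x)"
  using smooth_fun_scale[of f "-1"] by simp

lemma smooth_fun_diff: "smooth_fun f \<Longrightarrow> smooth_fun g \<Longrightarrow> smooth_fun (\<lambda>x. f x - g x)"
  using smooth_fun_add[OF _ smooth_fun_uminus, of f g] by simp

section \<open>Gaussian exponentials with a complex linear term\<close>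

definition cdot :: "complex^'n::finite \<Rightarrow> real^'n \<Rightarrow> complex" where
  "cdot \<zeta> x = (\<Sum>j\<in>UNIV. \<zeta> $ j * of_real (x $ j))"

text \<open>One family for three purposes: \<zeta> = 0 is the ground state, real \<zeta> gives the
  real functions that detect non-real coefficients, and imaginary \<zeta> gives the Gaussian waves
  on which the semigroup is explicit.\<close>

definition gexp :: "(real^'n::finite \<Rightarrow> real^'n) \<Rightarrow> complex^'n \<Rightarrow> real^'n \<Rightarrow> complex" where
  "gexp G \<zeta> x = of_real (gauss G x) * exp (cdot \<zeta> x)"

lemma cdot_axis: "cdot \<zeta> (axis j 1) = \<zeta> $ j"
proof -
  have "cdot \<zeta> (axis j 1) = (\<Sum>i\<in>UNIV. if i = j then \<zeta> $ i else 0)"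
    unfolding cdot_def by (intro sum.cong) (auto simp: axis_def)
  then show ?thesis by simp
qed

lemma cdot_bounded_linear: "bounded_linear (cdot \<zeta>)"
  unfolding linear_conv_bounded_linear[symmetric]
  by (rule linearI) (simp_all add: cdot_def sum.distrib algebra_simps scaleR_conv_of_real[where 'a=complex] sum_distrib_left)

lemma gexp_has_derivative:
  assumes G: "pos_def_map G"
  shows "(gexp G \<zeta> has_derivative (\<lambda>h. (cdot \<zeta> h - of_real (G x \<bullet> h)) * gexp G \<zeta> x)) (at x)"
proof -
  have "((\<lambda>x. exp (cdot \<zeta> x)) has_derivative (\<lambda>h. exp (cdot \<zeta> x) * cdot \<zeta> h)) (at x)"
    by (rule has_derivative_compose[OF bounded_linear_imp_has_derivative[OF cdot_bounded_linear]
          DERIV_exp[unfolded has_field_derivative_def]])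
  from has_derivative_mult[OF has_derivative_of_real[OF gauss_has_derivative[OF G]] this]
  show ?thesis unfolding gexp_def by (rule has_derivative_eq_rhs) (auto simp: algebra_simps)
qed

lemma pderiv_gexp:
  assumes G: "pos_def_map G"
  shows "pderiv_at j (gexp G \<zeta>) = (\<lambda>x. (\<zeta> $ j - of_real (G x $ j)) * gexp G \<zeta> x)"
  by (rule ext, rule pderiv_at_eqI[OF gexp_has_derivative[OF G], THEN trans])
    (simp add: cdot_axis cart_eq_inner_axis inner_commute)

lemma linear_coord_expansion:
  fixes B :: "real^'n::finite \<Rightarrow> real^'n"
  assumes "linear B"
  shows "B x $ i = (\<Sum>k\<in>UNIV. x $ k * B (axis k 1) $ i)"
proof -
  have "B x = B (\<Sum>k\<in>UNIV. x $ k *\<^sub>R axis k 1)" by (simp add: basis_expansion flip: scalar_mult_eq_scaleR)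
  also have "\<dots> = (\<Sum>k\<in>UNIV. x $ k *\<^sub>R B (axis k 1))" by (simp add: linear_sum[OF assms] linear_scale[OF assms])
  finally show ?thesis by simp
qed

lemma smooth_gexp:
  assumes G: "pos_def_map G"
  shows "smooth_fun (gexp G \<zeta>)"
proof (rule smooth_fun_alg)
  let ?B = "insert (gexp G \<zeta>) poly_gens"
  show "gexp G \<zeta> \<in> fun_alg ?B" by (rule fun_alg.base) simp
  fix b assume b: "b \<in> ?B"
  show "b differentiable at x" for x
    using b poly_gens_alg(1)[of ?B b] gexp_has_derivative[OF G] by (auto simp: differentiable_def)
  have pg: "f \<in> fun_alg ?B" if "f \<in> poly_gens" for f using that by (intro fun_alg.base) simp
  have "(\<lambda>x. (\<zeta> $ j + (\<Sum>k\<in>UNIV. of_real (x $ k) * of_real (- (G (axis k 1) $ j)))) * gexp G \<zeta> x) \<in> fun_alg ?B" for j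
    by (intro fun_alg.mult fun_alg.add fun_alg_sum pg fun_alg.base[of "gexp G \<zeta>"]) (auto simp: poly_gens_def)
  moreover have "\<zeta> $ j + (\<Sum>k\<in>UNIV. of_real (x $ k) * of_real (- (G (axis k 1) $ j))) = \<zeta> $ j - of_real (G x $ j)" for j x
    unfolding linear_coord_expansion[OF pos_def_mapD(1)[OF G], of x] by (simp add: sum_negf)
  ultimately show "pderiv_at j b \<in> fun_alg ?B" for j
    using b poly_gens_alg(2)[of ?B b] by (auto simp: pderiv_gexp[OF G])
qed

section \<open>Smooth bump functions\<close>

definition flat :: "nat \<Rightarrow> real \<Rightarrow> real" where
  "flat m s = (if s > 0 then inverse s ^ m * exp (- inverse s) else 0)"

lemma flat_nonneg: "flat m s \<ge> 0" by (simp add: flat_def)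

lemma power_le_fact_exp:
  fixes x :: real assumes "x \<ge> 0"
  shows "x ^ k \<le> fact k * exp x"
proof -
  have "(\<Sum>n\<in>{k}. x ^ n /\<^sub>R fact n) \<le> (\<Sum>n. x ^ n /\<^sub>R fact n)"
    by (rule sum_le_suminf) (use exp_converges[of x] assms in \<open>auto simp: sums_iff\<close>)
  then show ?thesis using exp_converges[of x] by (simp add: sums_iff field_simps)
qed

text \<open>A single term of the exponential series, evaluated at \<open>1 / s\<close>. With
  \<open>k = 2\<close> it gives the derivative at 0, with \<open>k = 0\<close> the uniform bound on
  bumps.\<close>

lemma flat_le: "flat m s \<le> fact (m + k) * \<bar>s\<bar> ^ k"
proof (cases "s > 0")
  case True
  have "inverse s ^ (m + k) \<le> fact (m + k) * exp (inverse s)" by (rule power_le_fact_exp) (use True in simp)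
  then have "inverse s ^ (m + k) * (s ^ k * exp (- inverse s)) \<le> fact (m + k) * exp (inverse s) * (s ^ k * exp (- inverse s))"
    by (rule mult_right_mono) (use True in simp)
  then show ?thesis using True by (simp add: flat_def power_add exp_minus field_simps)
qed (simp add: flat_def)

text \<open>The power of \<open>1 / s\<close> is carried along as an index so that differentiation
  stays inside the family; smoothness of the bumps then needs no separate induction on the
  order.\<close>

lemma flat_has_derivative: "(flat m has_real_derivative flat (m + 2) s - real m * flat (m + 1) s) (at s)"
proof -
  consider "s > 0" | "s < 0" | "s = 0" by linarith
  then show ?thesis
  proof cases
    case 1
    have "((\<lambda>s. inverse s ^ m * exp (- inverse s)) has_real_derivative flat (m + 2) s - real m * flat (m + 1) s) (at s)"
    proof -
      have di: "(inverse has_real_derivative - (inverse s)\<^sup>2) (at s)"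
        using DERIV_inverse[of s UNIV] 1 by (simp add: numeral_2_eq_2)
      have "((\<lambda>s. exp (- inverse s)) has_real_derivative exp (- inverse s) * (inverse s)\<^sup>2) (at s)"
        using DERIV_fun_exp[OF DERIV_minus[OF di]] by simp
      moreover have "((\<lambda>s. inverse s ^ m) has_real_derivative - real m * inverse s ^ (m + 1)) (at s)"
      proof (cases m)
        case (Suc l)
        from DERIV_power_Suc[OF di, of l] show ?thesis
          unfolding Suc by (simp add: power2_eq_square algebra_simps)
      qed simp
      ultimately have "((\<lambda>s. inverse s ^ m * exp (- inverse s)) has_real_derivative
          - real m * inverse s ^ (m + 1) * exp (- inverse s) + exp (- inverse s) * (inverse s)\<^sup>2 * inverse s ^ m) (at s)"
        by (rule DERIV_mult[rotated])
      then show ?thesis using 1 by (simp add: flat_def power2_eq_square algebra_simps)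
    qed
    then show ?thesis
      by (rule has_field_derivative_transform_within[of _ _ _ _ s]) (use 1 in \<open>auto simp: flat_def dist_real_def\<close>)
  next
    case 2
    have "((\<lambda>s. 0) has_real_derivative 0) (at s)" by simp
    then have "(flat m has_real_derivative 0) (at s)"
      by (rule has_field_derivative_transform_within[of _ _ _ _ "-s"]) (use 2 in \<open>auto simp: flat_def dist_real_def\<close>)
    then show ?thesis using 2 by (simp add: flat_def)
  next
    case 3
    have "((\<lambda>h. (flat m (0 + h) - flat m 0) / h) \<longlongrightarrow> 0) (at 0)"
    proof (rule Lim_null_comparison)
      have "norm ((flat m (0 + h) - flat m 0) / h) \<le> fact (m + 2) * \<bar>h\<bar>" if "h \<noteq> 0" for h
      proof -
        have "norm ((flat m (0 + h) - flat m 0) / h) = flat m h / \<bar>h\<bar>" using flat_nonneg[of m h] by (simp add: flat_def[of m 0])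
        also have "\<dots> \<le> (fact (m + 2) * \<bar>h\<bar> ^ 2) / \<bar>h\<bar>" by (intro divide_right_mono flat_le) simp
        also have "\<dots> = fact (m + 2) * \<bar>h\<bar>" using that by (simp add: power2_eq_square del: abs_mult_self_eq fact_Suc)
        finally show ?thesis .
      qed
      then show "eventually (\<lambda>h. norm ((flat m (0 + h) - flat m 0) / h) \<le> fact (m + 2) * \<bar>h\<bar>) (at 0)"
        by (auto simp: eventually_at_filter)
      have "((\<lambda>h. fact (m + 2) * \<bar>h::real\<bar>) \<longlongrightarrow> fact (m + 2) * \<bar>0\<bar>) (at 0)" by (intro tendsto_intros)
      then show "((\<lambda>h. fact (m + 2) * \<bar>h::real\<bar>) \<longlongrightarrow> 0) (at 0)" by simp
    qed
    then show ?thesis unfolding 3 DERIV_def by (simp add: flat_def)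
  qed
qed

text \<open>For \<open>c > 0\<close> it is supported in the ball of radius \<open>1 / sqrt c\<close>
  about \<open>y\<close>. The functions with \<open>m = 0\<close> serve as test functions; higher
  \<open>m\<close> occur in their derivatives.\<close>

definition bump :: "nat \<Rightarrow> real \<Rightarrow> real^'n::finite \<Rightarrow> real^'n \<Rightarrow> complex" where
  "bump m c y x = of_real (flat m (1 - c * ((x - y) \<bullet> (x - y))))"

lemma bump_has_derivative:
  "(bump m c y has_derivative (\<lambda>h. (bump (m + 2) c y x - of_nat m * bump (m + 1) c y x) * of_real (- 2 * c * ((x - y) \<bullet> h)))) (at x)"
proof -
  have "((\<lambda>x. (x - y) \<bullet> (x - y)) has_derivative (\<lambda>h. (x - y) \<bullet> h + h \<bullet> (x - y))) (at x)"
    by (rule has_derivative_inner) (auto intro!: derivative_eq_intros)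
  from has_derivative_diff[OF has_derivative_const[of 1] has_derivative_mult_right[OF this, of c]]
  have "((\<lambda>x. 1 - c * ((x - y) \<bullet> (x - y))) has_derivative (\<lambda>h. 0 - c * ((x - y) \<bullet> h + h \<bullet> (x - y)))) (at x)" .
  from has_derivative_of_real[OF has_derivative_compose[OF this flat_has_derivative[unfolded has_field_derivative_def]]]
  have "(bump m c y has_derivative (\<lambda>h. complex_of_real ((flat (m + 2) (1 - c * ((x - y) \<bullet> (x - y)))
      - real m * flat (m + 1) (1 - c * ((x - y) \<bullet> (x - y)))) * (0 - c * ((x - y) \<bullet> h + h \<bullet> (x - y)))))) (at x)"
    unfolding bump_def[abs_def] .
  then show ?thesis by (rule has_derivative_eq_rhs) (auto simp: bump_def inner_commute)
qed

lemma pderiv_bump: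
  "pderiv_at j (bump m c y) = (\<lambda>x. (bump (m + 2) c y x - of_nat m * bump (m + 1) c y x) * of_real (- 2 * c * (x $ j - y $ j)))"
  by (rule ext, rule pderiv_at_eqI[OF bump_has_derivative, THEN trans]) (simp add: inner_axis)

lemma smooth_bump: "smooth_fun (bump m c y)"
proof (rule smooth_fun_alg)
  let ?B = "range (\<lambda>m. bump m c y) \<union> poly_gens"
  show "bump m c y \<in> fun_alg ?B" by (rule fun_alg.base) simp
  have bd: "bump m c y differentiable at x" for m x
    unfolding differentiable_def using bump_has_derivative by blast
  fix b assume b: "b \<in> ?B"
  show "b differentiable at x" for x
    using b poly_gens_alg(1)[of ?B b] bd by auto
  have pg: "f \<in> fun_alg ?B" if "f \<in> poly_gens" for f using that by (intro fun_alg.base) simp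
  have bm: "bump m c y \<in> fun_alg ?B" for m by (intro fun_alg.base) simp
  have pc: "(\<lambda>x. a) \<in> fun_alg ?B" for a by (rule pg) (simp add: poly_gens_def)
  have pk: "(\<lambda>x. of_real (x $ j)) \<in> fun_alg ?B" for j by (rule pg) (simp add: poly_gens_def)
  have "(\<lambda>x. (bump (m + 2) c y x + (- of_nat m) * bump (m + 1) c y x) * ((- 2 * complex_of_real c) * (complex_of_real (x $ j) + (- complex_of_real (y $ j))))) \<in> fun_alg ?B" for m j
    by (intro fun_alg.mult fun_alg.add bm pc pk)
  then have "pderiv_at j (bump m c y) \<in> fun_alg ?B" for m j by (simp add: pderiv_bump)
  then show "pderiv_at j b \<in> fun_alg ?B" for j
    using b poly_gens_alg(2)[of ?B b] by auto
qed

lemma bump_support: "c > 0 \<Longrightarrow> bump m c y x \<noteq> 0 \<Longrightarrow> c * (norm (x - y))\<^sup>2 < 1"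
  by (auto simp: bump_def flat_def power2_norm_eq_inner split: if_splits)

lemma test_fun_bump:
  assumes c: "c > 0" shows "test_fun (bump m c y)"
proof -
  have "{x. bump m c y x \<noteq> 0} \<subseteq> cball y (sqrt (1 / c))"
  proof
    fix x assume "x \<in> {x. bump m c y x \<noteq> 0}"
    then have "(norm (x - y))\<^sup>2 \<le> 1 / c" using bump_support[OF c, of m y x] c by (simp add: field_simps)
    then have "norm (x - y) \<le> sqrt (1 / c)" by (rule real_le_rsqrt)
    then show "x \<in> cball y (sqrt (1 / c))" by (simp add: dist_norm norm_minus_commute)
  qed
  then have "bounded {x. bump m c y x \<noteq> 0}" by (rule bounded_subset[OF bounded_cball])
  then show ?thesis by (simp add: test_fun_def smooth_bump compact_closure)
qed

section \<open>Operations on test functions and integration by parts\<close>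

lemma test_fun_smooth: "test_fun \<phi> \<Longrightarrow> smooth_fun \<phi>" by (simp add: test_fun_def)

lemma test_fun_bounded_support: "test_fun \<phi> \<longleftrightarrow> smooth_fun \<phi> \<and> bounded {x. \<phi> x \<noteq> 0}"
  by (simp add: test_fun_def compact_closure)

lemma test_fun_mult: "test_fun \<phi> \<Longrightarrow> smooth_fun f \<Longrightarrow> test_fun (\<lambda>x. \<phi> x * f x)"
  unfolding test_fun_bounded_support
  by (auto intro: smooth_fun_mult elim: bounded_subset)

lemma test_fun_mult2: "test_fun \<phi> \<Longrightarrow> smooth_fun f \<Longrightarrow> test_fun (\<lambda>x. f x * \<phi> x)"
  using test_fun_mult[of \<phi> f] by (simp add: mult.commute)

lemma test_fun_pderiv:
  assumes "test_fun \<phi>" shows "test_fun (pderiv_at j \<phi>)"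
proof -
  have "x \<in> closure {x. \<phi> x \<noteq> 0}" if "pderiv_at j \<phi> x \<noteq> 0" for x
  proof (rule ccontr)
    assume n: "x \<notin> closure {x. \<phi> x \<noteq> 0}"
    have "((\<lambda>x. 0) has_derivative (\<lambda>h. 0)) (at x)" by simp
    then have "(\<phi> has_derivative (\<lambda>h. 0)) (at x)"
      by (rule has_derivative_transform_within_open[of _ _ _ _ "- closure {x. \<phi> x \<noteq> 0}"])
        (use n closure_subset[of "{x. \<phi> x \<noteq> 0}"] in auto)
    then show False using pderiv_at_eqI that by force
  qed
  then have "{x. pderiv_at j \<phi> x \<noteq> 0} \<subseteq> closure {x. \<phi> x \<noteq> 0}" by auto
  then have "bounded {x. pderiv_at j \<phi> x \<noteq> 0}"
    using assms by (intro bounded_subset[OF compact_imp_bounded]) (auto simp: test_fun_def)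
  then show ?thesis using assms by (simp add: test_fun_bounded_support smooth_fun_pderiv)
qed

lemma test_fun_add:
  assumes "test_fun \<phi>" "test_fun \<psi>"
  shows "test_fun (\<lambda>x. \<phi> x + \<psi> x)"
proof -
  have "bounded ({x. \<phi> x \<noteq> 0} \<union> {x. \<psi> x \<noteq> 0})" using assms by (simp add: test_fun_bounded_support)
  then have "bounded {x. \<phi> x + \<psi> x \<noteq> 0}" by (rule bounded_subset) auto
  then show ?thesis using assms by (simp add: test_fun_bounded_support smooth_fun_add)
qed

lemma test_fun_scale: "test_fun \<phi> \<Longrightarrow> test_fun (\<lambda>x. c * \<phi> x)"
  by (rule test_fun_mult2[OF _ smooth_fun_const])

lemma test_fun_integrable:
  assumes "test_fun \<phi>" shows "integrable lborel \<phi>"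
proof -
  let ?S = "closure {x. \<phi> x \<noteq> 0}"
  have "integrable lborel (\<lambda>x. indicator ?S x *\<^sub>R \<phi> x)"
    by (rule borel_integrable_compact) (use assms in \<open>auto simp: test_fun_def intro: smooth_fun_continuous\<close>)
  moreover have "indicator ?S x *\<^sub>R \<phi> x = \<phi> x" for x
    using closure_subset[of "{x. \<phi> x \<noteq> 0}"] by (auto simp: indicator_def)
  ultimately show ?thesis by simp
qed

lemma test_fun_bounded: 
  assumes "test_fun \<phi>" shows "\<exists>b. \<forall>x. norm (\<phi> x) \<le> b"
proof -
  have "compact (\<phi> ` closure {x. \<phi> x \<noteq> 0})"
    using assms by (intro compact_continuous_image smooth_fun_continuous) (auto simp: test_fun_def)
  then obtain b where b: "\<And>x. x \<in> closure {x. \<phi> x \<noteq> 0} \<Longrightarrow> norm (\<phi> x) \<le> b"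
    by (force dest!: compact_imp_bounded simp: bounded_iff)
  have "norm (\<phi> x) \<le> max b 0" for x
    using b[of x] closure_subset[of "{x. \<phi> x \<noteq> 0}"] by (cases "\<phi> x = 0") auto
  then show ?thesis by blast
qed

lemma test_fun_L2:
  assumes t: "test_fun \<phi>" shows "\<phi> \<in> L2"
proof -
  have "integrable lborel (\<lambda>x. (norm (\<phi> x))\<^sup>2)"
  proof -
    obtain b where b: "\<And>x. norm (\<phi> x) \<le> b" using test_fun_bounded[OF t] by auto
    have "integrable lborel (\<lambda>x. b * norm (\<phi> x))"
      by (intro integrable_mult_right integrable_norm test_fun_integrable t)
    then show ?thesis
    proof (rule Bochner_Integration.integrable_bound)
      have "(norm (\<phi> x))\<^sup>2 \<le> b * norm (\<phi> x)" for x
        unfolding power2_eq_square by (intro mult_right_mono b) simp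
      then show "AE x in lborel. norm ((norm (\<phi> x))\<^sup>2) \<le> norm (b * norm (\<phi> x))"
        by (intro AE_I2) (simp add: abs_of_nonneg order_trans[OF _ abs_ge_self])
    qed (use smooth_fun_measurable[OF test_fun_smooth[OF t]] in auto)
  qed
  then show ?thesis using smooth_fun_measurable[OF test_fun_smooth[OF t]] by (simp add: L2_def)
qed

lemma integration_by_parts:
  assumes \<phi>: "test_fun \<phi>" and f: "smooth_fun f"
  shows "(LINT x|lborel. pderiv_at j \<phi> x * f x) = - (LINT x|lborel. \<phi> x * pderiv_at j f x)"
proof -
  note t = test_fun_mult[OF \<phi> f]
  have "(LINT x|lborel. frechet_derivative (\<lambda>x. \<phi> x * f x) (at x) (axis j 1)) = 0"
  proof (rule integral_derivative_eq_0)
    show "((\<lambda>x. \<phi> x * f x) has_derivative frechet_derivative (\<lambda>x. \<phi> x * f x) (at x)) (at x)" for x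
      by (intro differentiable_has_derivative smooth_fun_differentiable test_fun_smooth t)
    have "smooth_fun (pderiv_at j (\<lambda>x. \<phi> x * f x))" by (intro smooth_fun_pderiv test_fun_smooth t)
    then show "continuous_on UNIV (\<lambda>x. frechet_derivative (\<lambda>x. \<phi> x * f x) (at x) (axis j 1))"
      using smooth_fun_continuous unfolding pderiv_at_def by blast
    show "integrable lborel (\<lambda>x. frechet_derivative (\<lambda>x. \<phi> x * f x) (at x) (axis j 1))"
      using test_fun_integrable[OF test_fun_pderiv[OF t, of j]] unfolding pderiv_at_def .
  qed (rule test_fun_integrable[OF t])
  then have "(LINT x|lborel. pderiv_at j (\<lambda>x. \<phi> x * f x) x) = 0" by (simp add: pderiv_at_def)
  then have "(LINT x|lborel. pderiv_at j \<phi> x * f x + \<phi> x * pderiv_at j f x) = 0"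
    by (simp add: pderiv_at_mult smooth_fun_differentiable test_fun_smooth[OF \<phi>] f)
  then show ?thesis
    by (subst (asm) Bochner_Integration.integral_add)
      (auto intro!: test_fun_integrable test_fun_mult test_fun_pderiv smooth_fun_pderiv \<phi> f simp: eq_neg_iff_add_eq_0)
qed

lemma continuous_eq_0_of_bump:
  fixes g :: "real^'n::finite \<Rightarrow> real"
  assumes g: "continuous_on UNIV g" and z: "\<And>c y. c > 0 \<Longrightarrow> (LINT x|lborel. bump 0 c y x * of_real (g x)) = 0"
  shows "g y = 0"
proof (rule ccontr)
  assume ne: "g y \<noteq> 0"
  define s where "s = sgn (g y)"
  have s: "s * g y > 0" using ne by (simp add: s_def sgn_if)
  have "isCont (\<lambda>x. s * g x) y" using g by (intro continuous_intros) (simp add: continuous_on_eq_continuous_at)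
  then have "eventually (\<lambda>x. s * g x > 0) (at y)" using s by (auto simp: isCont_def dest: order_tendstoD(1))
  then obtain d where d: "d > 0" "\<And>x. x \<noteq> y \<Longrightarrow> dist x y < d \<Longrightarrow> s * g x > 0"
    by (auto simp: eventually_at)
  \<comment> \<open>The bump at \<open>y\<close> then lives in the ball of radius \<open>d\<close>,
    where \<open>s * g\<close> is positive, so the integrand has a constant sign.\<close>
  define c where "c = 1 / d\<^sup>2"
  have c: "c > 0" using d by (simp add: c_def)
  define F where "F = (\<lambda>x. flat 0 (1 - c * ((x - y) \<bullet> (x - y))) * (s * g x))"
  have Fpos: "F x \<ge> 0" for x
  proof (cases "c * (norm (x - y))\<^sup>2 < 1")
    case True
    then have "(norm (x - y))\<^sup>2 < d\<^sup>2" using d by (simp add: c_def field_simps)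
    then have "norm (x - y) < d" using d by (simp add: power2_less_imp_less)
    then have "s * g x > 0" using d(2)[of x] s by (cases "x = y") (auto simp: dist_norm)
    then show ?thesis unfolding F_def by (rule mult_nonneg_nonneg[OF flat_nonneg less_imp_le])
  qed (simp add: F_def flat_def power2_norm_eq_inner)
  have cF: "continuous_on UNIV F" unfolding F_def
    by (intro continuous_intros g continuous_on_compose2[of UNIV "flat 0", OF DERIV_continuous_on[OF flat_has_derivative[THEN has_field_derivative_at_within]]]) auto
  have Fsupp: "indicator (cball y d) x *\<^sub>R F x = F x" for x
  proof (cases "x \<in> cball y d")
    case False
    then have "d\<^sup>2 < (norm (x - y))\<^sup>2" using d by (intro power_strict_mono) (auto simp: dist_norm norm_minus_commute)
    then have "1 - c * ((x - y) \<bullet> (x - y)) < 0" using d by (simp add: c_def power2_norm_eq_inner field_simps)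
    then show ?thesis by (simp add: F_def flat_def)
  qed simp
  have iF: "integrable lborel F"
    using borel_integrable_compact[OF compact_cball continuous_on_subset[OF cF subset_UNIV], of y d] unfolding Fsupp .
  have "(LINT x|lborel. complex_of_real (F x)) = of_real s * (LINT x|lborel. bump 0 c y x * of_real (g x))"
    by (subst integral_mult_right_zero[symmetric]) (simp add: F_def bump_def mult_ac)
  then have "(LINT x|lborel. F x) = 0" using z[OF c, of y] by simp
  then have "AE x in lborel. F x = 0" by (subst (asm) integral_nonneg_eq_0_iff_AE[OF iF]) (use Fpos in auto)
  moreover have op: "open {x. F x \<noteq> 0}" using cF by (intro open_Collect_neq continuous_on_const)
  ultimately have "{x. F x \<noteq> 0} \<in> null_sets lborel"
    using AE_iff_null_sets[of "{x. F x \<noteq> 0}" lborel] by simp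
  then have "negligible {x. F x \<noteq> 0}" by (simp add: negligible_iff_null_sets null_sets_completionI)
  then have "{x. F x \<noteq> 0} = {}" using open_not_negligible[OF op] by blast
  moreover have "F y > 0" using s by (simp add: F_def flat_def)
  ultimately show False by force
qed

section \<open>The Weyl quantization as a differential operator\<close>

text \<open>With the coefficients of \<open>q\<close> this is the formal transpose of the Weyl
  operator, the expression that falls on test functions. Transposition under the bilinear pairing
  reverses the sign of each derivative, so the operator itself is \<open>diff_op\<close> with
  \<open>b\<close> replaced by \<open>- b\<close>.\<close>

definition diff_op :: "('n::finite \<Rightarrow> 'n \<Rightarrow> complex) \<Rightarrow> ('n \<Rightarrow> 'n \<Rightarrow> complex) \<Rightarrow> ('n \<Rightarrow> 'n \<Rightarrow> complex) \<Rightarrow>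
    (real^'n \<Rightarrow> complex) \<Rightarrow> real^'n \<Rightarrow> complex" where
  "diff_op a b c f x = (\<Sum>j\<in>UNIV. \<Sum>k\<in>UNIV.
      a j k * (of_real (x $ j) * (of_real (x $ k) * f x))
    + \<i> * b j k * ((if j = k then f x else 0) + 2 * (of_real (x $ j) * pderiv_at k f x))
    - c j k * pderiv_at k (pderiv_at j f) x)"

definition coef_xx :: "(real ^ ('n::finite + 'n) \<Rightarrow> complex) \<Rightarrow> 'n \<Rightarrow> 'n \<Rightarrow> complex" where
  "coef_xx q j k = polar q (axis (Inl j) 1) (axis (Inl k) 1)"
definition coef_xd :: "(real ^ ('n::finite + 'n) \<Rightarrow> complex) \<Rightarrow> 'n \<Rightarrow> 'n \<Rightarrow> complex" where
  "coef_xd q j k = polar q (axis (Inl j) 1) (axis (Inr k) 1)"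
definition coef_dd :: "(real ^ ('n::finite + 'n) \<Rightarrow> complex) \<Rightarrow> 'n \<Rightarrow> 'n \<Rightarrow> complex" where
  "coef_dd q j k = polar q (axis (Inr j) 1) (axis (Inr k) 1)"

lemma polar_commute: "polar q X Y = polar q Y X"
  by (simp add: polar_def add.commute)

lemma distr_of_add_right: "u \<in> L2 \<Longrightarrow> v \<in> L2 \<Longrightarrow> w \<in> L2 \<Longrightarrow> distr_of w (\<lambda>x. u x + v x) = distr_of w u + distr_of w v"
  using distr_of_lincomb_right[of u v w 1 1] by simp

lemma distr_of_sum_right:
  assumes "w \<in> L2" "\<And>i. i \<in> I \<Longrightarrow> f i \<in> L2"
  shows "distr_of w (\<lambda>x. \<Sum>i\<in>I. f i x) = (\<Sum>i\<in>I. distr_of w (f i))"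
  using assms
proof (induction I rule: infinite_finite_induct)
  case (insert i I)
  then show ?case by (simp add: distr_of_add_right L2_sum)
qed (simp_all add: distr_of_def)

lemma pderiv_coord_mult:
  assumes f: "smooth_fun f"
  shows "pderiv_at k (\<lambda>x. of_real (x $ j) * f x) = (\<lambda>x. (if j = k then f x else 0) + of_real (x $ j) * pderiv_at k f x)"
  by (subst pderiv_at_mult) (auto simp: pderiv_at_coord smooth_fun_differentiable smooth_fun_coord f fun_eq_iff)

lemmas smooth_intros = smooth_fun_add smooth_fun_mult smooth_fun_const smooth_fun_coord smooth_fun_pderiv smooth_fun_sum
  smooth_fun_diff

lemma smooth_if: "smooth_fun f \<Longrightarrow> smooth_fun (\<lambda>x. if P then f x else 0)"
  by (cases P) (auto intro: smooth_fun_const)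

lemma smooth_diff_op: "smooth_fun f \<Longrightarrow> smooth_fun (diff_op a b c f)"
  unfolding diff_op_def[abs_def] by (intro smooth_intros smooth_if)

lemma test_if: "test_fun f \<Longrightarrow> test_fun (\<lambda>x. if P then f x else 0)"
  using test_fun_scale[of f 0] by (cases P) auto

lemma test_fun_sum: "finite I \<Longrightarrow> (\<And>i. i \<in> I \<Longrightarrow> test_fun (f i)) \<Longrightarrow> test_fun (\<lambda>x. \<Sum>i\<in>I. f i x)"
proof (induction I rule: finite_induct)
  case empty
  have "{x::real^'n. (0::complex) \<noteq> 0} = {}" by simp
  then show ?case by (simp add: test_fun_def smooth_fun_const)
qed (auto intro: test_fun_add)

lemma test_fun_diff: "test_fun f \<Longrightarrow> test_fun g \<Longrightarrow> test_fun (\<lambda>x. f x - g x)"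
  using test_fun_add[of f "\<lambda>x. -1 * g x"] test_fun_scale[of g "-1"] by simp

lemmas test_intros = test_fun_add test_fun_diff test_fun_scale test_fun_mult2[OF _ smooth_fun_coord] test_fun_pderiv test_if

lemma test_diff_op: "test_fun f \<Longrightarrow> test_fun (diff_op a b c f)"
  unfolding diff_op_def[abs_def]
  by (intro test_fun_sum finite test_intros)

lemma weyl_distr_eq_diff_op:
  fixes q :: "real ^ ('n::finite + 'n) \<Rightarrow> complex"
  assumes u: "u \<in> L2" and \<phi>: "test_fun \<phi>"
  shows "weyl_distr q (distr_of u) \<phi> = distr_of u (diff_op (coef_xx q) (coef_xd q) (coef_dd q) \<phi>)"
proof -
  note s = test_fun_smooth[OF \<phi>]
  have T: "test_fun (\<lambda>x. coef_xx q j k * (of_real (x $ j) * (of_real (x $ k) * \<phi> x)))"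
    "test_fun (\<lambda>x. \<i> * coef_xd q j k * ((if j = k then \<phi> x else 0) + 2 * (of_real (x $ j) * pderiv_at k \<phi> x)))"
    "test_fun (\<lambda>x. coef_dd q j k * pderiv_at k (pderiv_at j \<phi>) x)"
    "test_fun (\<lambda>x. (if j = k then \<phi> x else 0) + of_real (x $ j) * pderiv_at k \<phi> x)"
    "test_fun (\<lambda>x. of_real (x $ j) * pderiv_at k \<phi> x)" for j k
    by (intro test_intros \<phi>)+
  note T = T[THEN test_fun_L2]
  have "distr_of u (diff_op (coef_xx q) (coef_xd q) (coef_dd q) \<phi>) = (\<Sum>j\<in>UNIV. \<Sum>k\<in>UNIV. distr_of u (\<lambda>x.
      coef_xx q j k * (of_real (x $ j) * (of_real (x $ k) * \<phi> x))
    + \<i> * coef_xd q j k * ((if j = k then \<phi> x else 0) + 2 * (of_real (x $ j) * pderiv_at k \<phi> x))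
    - coef_dd q j k * pderiv_at k (pderiv_at j \<phi>) x))"
    unfolding diff_op_def[abs_def] by (simp add: distr_of_sum_right u L2_sum L2_diff L2_add T)
  also have "\<dots> = (\<Sum>j\<in>UNIV. \<Sum>k\<in>UNIV.
      polar q (axis (Inl j) 1) (axis (Inl k) 1) * coord_distr j (coord_distr k (distr_of u)) \<phi>
    + 2 * polar q (axis (Inl j) 1) (axis (Inr k) 1)
        * ((coord_distr j (D_distr k (distr_of u)) \<phi> + D_distr k (coord_distr j (distr_of u)) \<phi>) / 2)
    + polar q (axis (Inr j) 1) (axis (Inr k) 1) * D_distr j (D_distr k (distr_of u)) \<phi>)"
  proof (intro sum.cong refl)
    fix j k
    have "distr_of u (\<lambda>x. \<i> * coef_xd q j k * ((if j = k then \<phi> x else 0) + 2 * (of_real (x $ j) * pderiv_at k \<phi> x)))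
      = \<i> * coef_xd q j k * distr_of u (\<lambda>x. ((if j = k then \<phi> x else 0) + of_real (x $ j) * pderiv_at k \<phi> x)
          + of_real (x $ j) * pderiv_at k \<phi> x)"
      by (simp only: distr_of_scale_right mult_2 add.assoc)
    also have "\<dots> = \<i> * coef_xd q j k * (distr_of u (pderiv_at k (\<lambda>x. of_real (x $ j) * \<phi> x))
          + distr_of u (\<lambda>x. of_real (x $ j) * pderiv_at k \<phi> x))"
      unfolding pderiv_coord_mult[OF s] by (subst distr_of_add_right[OF T(4) T(5) u]) (rule refl)
    finally have mid: "distr_of u (\<lambda>x. \<i> * coef_xd q j k * ((if j = k then \<phi> x else 0) + 2 * (of_real (x $ j) * pderiv_at k \<phi> x)))
      = 2 * polar q (axis (Inl j) 1) (axis (Inr k) 1)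
        * ((coord_distr j (D_distr k (distr_of u)) \<phi> + D_distr k (coord_distr j (distr_of u)) \<phi>) / 2)"
      by (simp add: coef_xd_def coord_distr_def D_distr_def algebra_simps)
    show "distr_of u (\<lambda>x.
      coef_xx q j k * (of_real (x $ j) * (of_real (x $ k) * \<phi> x))
    + \<i> * coef_xd q j k * ((if j = k then \<phi> x else 0) + 2 * (of_real (x $ j) * pderiv_at k \<phi> x))
    - coef_dd q j k * pderiv_at k (pderiv_at j \<phi>) x) =
      polar q (axis (Inl j) 1) (axis (Inl k) 1) * coord_distr j (coord_distr k (distr_of u)) \<phi>
    + 2 * polar q (axis (Inl j) 1) (axis (Inr k) 1)
        * ((coord_distr j (D_distr k (distr_of u)) \<phi> + D_distr k (coord_distr j (distr_of u)) \<phi>) / 2)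
    + polar q (axis (Inr j) 1) (axis (Inr k) 1) * D_distr j (D_distr k (distr_of u)) \<phi>"
      unfolding mid[symmetric]
      by (subst distr_of_diff_right, intro L2_add T, rule T, rule u, subst distr_of_add_right, rule T, rule T, rule u)
        (simp only: distr_of_scale_right coef_xx_def coef_dd_def, simp add: coord_distr_def D_distr_def mult.left_commute)
  qed
  finally show ?thesis by (simp add: weyl_distr_def)
qed

definition max_op :: "('n::finite \<Rightarrow> 'n \<Rightarrow> complex) \<Rightarrow> ('n \<Rightarrow> 'n \<Rightarrow> complex) \<Rightarrow> ('n \<Rightarrow> 'n \<Rightarrow> complex) \<Rightarrow>
    ((real^'n \<Rightarrow> complex) \<times> (real^'n \<Rightarrow> complex)) set" where
  "max_op a b c = {(u, v). u \<in> L2 \<and> v \<in> L2 \<and> (\<forall>\<phi>. test_fun \<phi> \<longrightarrow> distr_of u (diff_op a b c \<phi>) = distr_of v \<phi>)}"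

lemma weyl_op_eq_max_op: "weyl_op q = max_op (coef_xx q) (coef_xd q) (coef_dd q)"
  unfolding weyl_op_def max_op_def by (auto simp: weyl_distr_eq_diff_op)

lemma LINT_test_add:
  "test_fun f \<Longrightarrow> test_fun g \<Longrightarrow> (LINT x|lborel. f x + g x) = (LINT x|lborel. f x) + (LINT x|lborel. g x)"
  by (rule Bochner_Integration.integral_add) (rule test_fun_integrable, assumption)+

lemma diff_op_transpose:
  assumes \<phi>: "test_fun \<phi>" and f: "smooth_fun f" and c: "\<And>j k. c j k = c k j"
  shows "(LINT x|lborel. diff_op a b c \<phi> x * f x) = (LINT x|lborel. \<phi> x * diff_op a (\<lambda>j k. - b j k) c f x)"
proof -
  note s = test_fun_smooth[OF \<phi>]
  define L1 where "L1 j k x = a j k * (of_real (x $ j) * (of_real (x $ k) * \<phi> x)) * f x" for j k x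
  define L2 where "L2 j k x = \<i> * b j k * ((if j = k then \<phi> x else 0) + 2 * (of_real (x $ j) * pderiv_at k \<phi> x)) * f x" for j k x
  define L3 where "L3 j k x = - c j k * pderiv_at k (pderiv_at j \<phi>) x * f x" for j k x
  define R2 where "R2 j k x = \<phi> x * (\<i> * - b j k * ((if j = k then f x else 0) + 2 * (of_real (x $ j) * pderiv_at k f x)))" for j k x
  define R3 where "R3 j k x = \<phi> x * (- c j k * pderiv_at k (pderiv_at j f) x)" for j k x
  have tL: "test_fun (L1 j k)" "test_fun (L2 j k)" "test_fun (L3 j k)" for j k
    unfolding L1_def[abs_def] L2_def[abs_def] L3_def[abs_def] by (intro test_fun_mult[OF _ f] test_intros \<phi>)+
  have tR: "test_fun (R2 j k)" "test_fun (R3 j k)" for j k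
    unfolding R2_def[abs_def] R3_def[abs_def] by (intro test_fun_mult[OF \<phi>] smooth_intros smooth_if f)+
  have int: "(LINT x|lborel. (\<Sum>j\<in>UNIV. \<Sum>k\<in>UNIV. A j k x + B j k x + C j k x))
      = (\<Sum>j\<in>UNIV. \<Sum>k\<in>UNIV. (LINT x|lborel. A j k x) + (LINT x|lborel. B j k x) + (LINT x|lborel. C j k x))"
    if t: "\<And>j k. test_fun (A j k)" "\<And>j k. test_fun (B j k)" "\<And>j k. test_fun (C j k)"
    for A B C :: "'n \<Rightarrow> 'n \<Rightarrow> real^'n \<Rightarrow> complex"
    by (simp add: t test_fun_integrable)
  have e1: "diff_op a b c \<phi> x * f x = (\<Sum>j\<in>UNIV. \<Sum>k\<in>UNIV. L1 j k x + L2 j k x + L3 j k x)" for x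
    unfolding diff_op_def L1_def L2_def L3_def sum_distrib_right by (intro sum.cong refl) (simp add: algebra_simps)
  have e2: "\<phi> x * diff_op a (\<lambda>j k. - b j k) c f x = (\<Sum>j\<in>UNIV. \<Sum>k\<in>UNIV. L1 j k x + R2 j k x + R3 j k x)" for x
    unfolding diff_op_def L1_def R2_def R3_def sum_distrib_left by (intro sum.cong refl) (simp add: algebra_simps)
  have i2: "(LINT x|lborel. L2 j k x) = (LINT x|lborel. R2 j k x)" for j k
  proof -
    have sx: "smooth_fun (\<lambda>x. of_real (x $ j) * f x)" by (intro smooth_intros f)
    have "(LINT x|lborel. L2 j k x) - (LINT x|lborel. R2 j k x) = (LINT x|lborel. L2 j k x - R2 j k x)"
      by (simp add: tL tR test_fun_integrable)
    also have "\<dots> = (LINT x|lborel. (2 * \<i> * b j k) * (pderiv_at k \<phi> x * (of_real (x $ j) * f x) + \<phi> x * pderiv_at k (\<lambda>x. of_real (x $ j) * f x) x))"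
      unfolding L2_def R2_def pderiv_coord_mult[OF f] by (intro Bochner_Integration.integral_cong refl) (auto simp: algebra_simps)
    also have "\<dots> = (2 * \<i> * b j k) * ((LINT x|lborel. pderiv_at k \<phi> x * (of_real (x $ j) * f x)) + (LINT x|lborel. \<phi> x * pderiv_at k (\<lambda>x. of_real (x $ j) * f x) x))"
      by (subst integral_mult_right_zero, subst LINT_test_add) (auto intro!: test_fun_mult test_fun_pderiv \<phi> sx smooth_fun_pderiv)
    also have "\<dots> = 0" by (simp add: integration_by_parts[OF \<phi> sx])
    finally show ?thesis by simp
  qed
  \<comment> \<open>Two integrations by parts reverse the order of the derivatives. The matching
    term is therefore the one with indices exchanged: symmetry of \<open>c\<close> and exchange of
    the sums are used instead of symmetry of second derivatives.\<close>
  have i3: "(LINT x|lborel. L3 j k x) = (LINT x|lborel. R3 k j x)" for j k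
  proof -
    have "(LINT x|lborel. L3 j k x) = - c j k * (LINT x|lborel. pderiv_at k (pderiv_at j \<phi>) x * f x)"
      unfolding L3_def by (subst integral_mult_right_zero[symmetric]) (simp add: mult.assoc)
    also have "\<dots> = - c j k * (LINT x|lborel. \<phi> x * pderiv_at j (pderiv_at k f) x)"
      by (simp add: integration_by_parts[OF test_fun_pderiv[OF \<phi>] f] integration_by_parts[OF \<phi> smooth_fun_pderiv[OF f]])
    also have "\<dots> = (LINT x|lborel. R3 k j x)"
      unfolding R3_def by (subst integral_mult_right_zero[symmetric]) (simp add: mult_ac c[of k j])
    finally show ?thesis .
  qed
  have "(\<Sum>j\<in>UNIV. \<Sum>k\<in>UNIV. (LINT x|lborel. L3 j k x)) = (\<Sum>j\<in>UNIV. \<Sum>k\<in>UNIV. (LINT x|lborel. R3 j k x))"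
    unfolding i3 by (rule sum.swap)
  then show ?thesis unfolding e1 e2 int[OF tL] int[OF tL(1) tR] by (simp add: i2 sum.distrib)
qed

lemma test_fun_max_op:
  assumes \<phi>: "test_fun \<phi>" and c: "\<And>j k. c j k = c k j"
  shows "(\<phi>, diff_op a (\<lambda>j k. - b j k) c \<phi>) \<in> max_op a b c"
proof -
  have "distr_of \<phi> (diff_op a b c \<psi>) = distr_of (diff_op a (\<lambda>j k. - b j k) c \<phi>) \<psi>" if "test_fun \<psi>" for \<psi>
    using diff_op_transpose[OF that test_fun_smooth[OF \<phi>], of c a b] c by (simp add: distr_of_def mult.commute)
  then show ?thesis using \<phi> by (auto simp: max_op_def intro!: test_fun_L2 test_diff_op)
qed

section \<open>The action on Gaussian exponentials\<close>

definition gexp_symbol where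
  "gexp_symbol G a b c \<zeta> x = (\<Sum>j\<in>UNIV. \<Sum>k\<in>UNIV.
      a j k * (of_real (x $ j) * of_real (x $ k))
    + \<i> * b j k * ((if j = k then 1 else 0) + 2 * (of_real (x $ j) * (\<zeta> $ k - of_real (G x $ k))))
    - c j k * ((\<zeta> $ j - of_real (G x $ j)) * (\<zeta> $ k - of_real (G x $ k)) - of_real (G (axis k 1) $ j)))"

lemma pderiv_pderiv_gexp:
  assumes G: "pos_def_map G"
  shows "pderiv_at k (pderiv_at j (gexp G \<zeta>)) = (\<lambda>x.
    ((\<zeta> $ j - of_real (G x $ j)) * (\<zeta> $ k - of_real (G x $ k)) - of_real (G (axis k 1) $ j)) * gexp G \<zeta> x)"
proof
  fix x
  have "((\<lambda>x. complex_of_real (G x $ j)) has_derivative (\<lambda>h. of_real (G h $ j))) (at x)"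
    by (intro has_derivative_of_real bounded_linear_imp_has_derivative
        bounded_linear_compose[OF bounded_linear_vec_nth pos_def_mapD(5)[OF G]])
  from has_derivative_mult[OF has_derivative_diff[OF has_derivative_const[of "\<zeta> $ j"] this] gexp_has_derivative[OF G]]
  have "((\<lambda>x. (\<zeta> $ j - of_real (G x $ j)) * gexp G \<zeta> x) has_derivative
    (\<lambda>h. (\<zeta> $ j - of_real (G x $ j)) * ((cdot \<zeta> h - of_real (G x \<bullet> h)) * gexp G \<zeta> x) + (0 - of_real (G h $ j)) * gexp G \<zeta> x)) (at x)" .
  from pderiv_at_eqI[OF this, of k]
  show "pderiv_at k (pderiv_at j (gexp G \<zeta>)) x =
    ((\<zeta> $ j - of_real (G x $ j)) * (\<zeta> $ k - of_real (G x $ k)) - of_real (G (axis k 1) $ j)) * gexp G \<zeta> x"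
    unfolding pderiv_gexp[OF G] by (simp add: cdot_axis inner_axis algebra_simps)
qed

text \<open>Differentiation acts on a Gaussian exponential as multiplication by
  \<open>\<zeta> - G x\<close>, up to a constant in second order. The hypotheses on the operator
  thereby become identities between polynomials in \<open>x\<close> and \<zeta>, from which the
  coefficients are read off.\<close>

lemma diff_op_gexp:
  assumes G: "pos_def_map G"
  shows "diff_op a b c (gexp G \<zeta>) x = gexp_symbol G a b c \<zeta> x * gexp G \<zeta> x"
  unfolding diff_op_def gexp_symbol_def sum_distrib_right
  unfolding pderiv_pderiv_gexp[OF G] unfolding pderiv_gexp[OF G]
  by (intro sum.cong refl) (simp add: algebra_simps)

section \<open>Functions dominated by a polynomial times the Gaussian\<close>

definition poly_gauss :: "(real^'n::finite \<Rightarrow> real^'n) \<Rightarrow> (real^'n \<Rightarrow> complex) \<Rightarrow> bool" where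
  "poly_gauss G f \<longleftrightarrow> f \<in> borel_measurable borel \<and> (\<exists>C m. \<forall>x. norm (f x) \<le> C * (1 + norm x) ^ m * gauss G x)"

lemma poly_gauss_L2:
  assumes G: "pos_def_map G" and f: "poly_gauss G f"
  shows "f \<in> L2"
proof -
  obtain C m where C: "\<And>x. norm (f x) \<le> C * (1 + norm x) ^ m * gauss G x" using f by (auto simp: poly_gauss_def)
  have fm[measurable]: "f \<in> borel_measurable borel" using f by (simp add: poly_gauss_def)
  let ?G2 = "\<lambda>x. 2 *\<^sub>R G x"
  have G2: "pos_def_map ?G2" using G linear_compose_scale_right[of G 2] by (auto simp: pos_def_map_def)
  have "integrable lborel (\<lambda>x. (norm (f x))\<^sup>2)"
  proof (rule gauss_poly_integrable[OF G2])
    fix x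
    have "(norm (f x))\<^sup>2 \<le> (C * (1 + norm x) ^ m * gauss G x)\<^sup>2" by (intro power_mono C) simp
    also have "\<dots> = C\<^sup>2 * (1 + norm x) ^ (2 * m) * (gauss G x)\<^sup>2" by (simp add: power_mult_distrib power_mult[symmetric] mult.commute)
    also have "(gauss G x)\<^sup>2 = gauss ?G2 x" by (simp add: gauss_def power2_eq_square flip: exp_add)
    finally show "norm ((norm (f x))\<^sup>2) \<le> C\<^sup>2 * (1 + norm x) ^ (2 * m) * gauss ?G2 x" by simp
  qed measurable
  then show ?thesis by (simp add: L2_def)
qed

lemma poly_gauss_add:
  assumes "poly_gauss G f" "poly_gauss G g"
  shows "poly_gauss G (\<lambda>x. f x + g x)"
proof -
  obtain C m where C: "\<And>x. norm (f x) \<le> C * (1 + norm x) ^ m * gauss G x" using assms(1) by (auto simp: poly_gauss_def)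
  obtain D l where D: "\<And>x. norm (g x) \<le> D * (1 + norm x) ^ l * gauss G x" using assms(2) by (auto simp: poly_gauss_def)
  have *: "C * (1 + norm x) ^ m * gauss G x \<le> \<bar>C\<bar> * (1 + norm x) ^ (m + l) * gauss G x" for C m l and x :: "real^'a"
    by (intro mult_right_mono mult_mono power_increasing) auto
  have "norm (f x + g x) \<le> (\<bar>C\<bar> + \<bar>D\<bar>) * (1 + norm x) ^ (m + l) * gauss G x" for x
    using norm_triangle_ineq[of "f x" "g x"] C[of x] D[of x] *[of C x m l] *[of D x l m, unfolded add.commute[of l m]]
    unfolding distrib_right by linarith
  then show ?thesis using assms by (auto simp: poly_gauss_def)
qed

lemma poly_gauss_scale:
  assumes "poly_gauss G f"
  shows "poly_gauss G (\<lambda>x. c * f x)"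
proof -
  obtain C m where C: "\<And>x. norm (f x) \<le> C * (1 + norm x) ^ m * gauss G x" using assms(1) by (auto simp: poly_gauss_def)
  have "norm (c * f x) \<le> (norm c * C) * (1 + norm x) ^ m * gauss G x" for x
    using mult_left_mono[OF C[of x], of "norm c"] by (simp add: norm_mult mult.assoc)
  then show ?thesis using assms by (auto simp: poly_gauss_def)
qed

lemma poly_gauss_coord:
  assumes "poly_gauss G f"
  shows "poly_gauss G (\<lambda>x. of_real (x $ j) * f x)"
proof -
  obtain C m where C: "\<And>x. norm (f x) \<le> C * (1 + norm x) ^ m * gauss G x" using assms(1) by (auto simp: poly_gauss_def)
  have "norm (of_real (x $ j) * f x) \<le> C * (1 + norm x) ^ Suc m * gauss G x" for x
  proof -
    have "norm (of_real (x $ j) * f x) = \<bar>x $ j\<bar> * norm (f x)" by (simp add: norm_mult)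
    also have "\<dots> \<le> (1 + norm x) * norm (f x)"
      using component_le_norm_cart[of x j] by (intro mult_right_mono) auto
    also have "\<dots> \<le> (1 + norm x) * (C * (1 + norm x) ^ m * gauss G x)" by (intro mult_left_mono C) auto
    finally show ?thesis by (simp add: mult_ac)
  qed
  then show ?thesis using assms smooth_fun_measurable[OF smooth_fun_coord[of j]] unfolding poly_gauss_def
    by (intro conjI borel_measurable_times exI[of _ C] exI[of _ "Suc m"]) auto
qed

lemma poly_gauss_sum: "finite I \<Longrightarrow> poly_gauss G f \<Longrightarrow> (\<And>i. i \<in> I \<Longrightarrow> poly_gauss G (g i)) \<Longrightarrow> poly_gauss G (\<lambda>x. \<Sum>i\<in>I. g i x)"
  by (induction I rule: finite_induct) (auto intro: poly_gauss_add poly_gauss_scale[of G f 0, simplified])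

lemma poly_gauss_diff: "poly_gauss G f \<Longrightarrow> poly_gauss G g \<Longrightarrow> poly_gauss G (\<lambda>x. f x - g x)"
  using poly_gauss_add[of G f "\<lambda>x. -1 * g x"] poly_gauss_scale[of G g "-1"] by simp

lemma poly_gauss_if: "poly_gauss G f \<Longrightarrow> poly_gauss G (\<lambda>x. if P then f x else 0)"
  using poly_gauss_scale[of G f 0] by (cases P) auto

lemma poly_gauss_linear:
  assumes G: "pos_def_map G" and f: "poly_gauss G f"
  shows "poly_gauss G (\<lambda>x. of_real (G x $ j) * f x)"
proof -
  have "poly_gauss G (\<lambda>x. \<Sum>k\<in>UNIV. of_real (x $ k) * (of_real (G (axis k 1) $ j) * f x))"
    by (intro poly_gauss_sum[OF _ f] poly_gauss_coord poly_gauss_scale f) simp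
  moreover have "of_real (G x $ j) * f x = (\<Sum>k\<in>UNIV. of_real (x $ k) * (of_real (G (axis k 1) $ j) * f x))" for x
    by (subst linear_coord_expansion[OF pos_def_mapD(1)[OF G]]) (simp add: sum_distrib_left sum_distrib_right mult_ac)
  ultimately show ?thesis by simp
qed

context gauss_weight
begin

abbreviation ivec :: "real^'n \<Rightarrow> complex^'n" where "ivec \<xi> \<equiv> (\<chi> j. \<i> * of_real (\<xi> $ j))"

lemma gexp_ivec: "gexp G (ivec \<xi>) x = u0 x * wave \<xi> x"
proof -
  have "cdot (ivec \<xi>) x = \<i> * of_real (\<xi> \<bullet> x)"
    by (simp add: cdot_def inner_vec_def sum_distrib_left mult.assoc)
  then show ?thesis by (simp add: gexp_def u0_def wave_def cis_conv_exp)
qed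

lemma poly_gauss_wave: "poly_gauss G (gexp G (ivec \<xi>))"
  unfolding poly_gauss_def
proof (intro conjI exI allI)
  show "gexp G (ivec \<xi>) \<in> borel_measurable borel" by (rule smooth_fun_measurable[OF smooth_gexp[OF G]])
  show "norm (gexp G (ivec \<xi>) x) \<le> 1 * (1 + norm x) ^ 0 * gauss G x" for x
    by (simp add: gexp_ivec norm_mult norm_u0)
qed

lemma poly_gauss_pderiv: "poly_gauss G (pderiv_at j (gexp G (ivec \<xi>)))"
  unfolding pderiv_gexp[OF G] left_diff_distrib
  by (intro poly_gauss_diff poly_gauss_scale poly_gauss_linear[OF G] poly_gauss_wave)

lemma poly_gauss_pderiv2: "poly_gauss G (pderiv_at k (pderiv_at j (gexp G (ivec \<xi>))))"
  unfolding pderiv_pderiv_gexp[OF G] left_diff_distrib mult.assoc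
  by (intro poly_gauss_diff poly_gauss_scale poly_gauss_linear[OF G] poly_gauss_wave)

lemma poly_gauss_diff_op: "poly_gauss G (diff_op a b c (gexp G (ivec \<xi>)))"
  unfolding diff_op_def[abs_def]
  by (intro poly_gauss_sum[OF _ poly_gauss_wave] poly_gauss_diff poly_gauss_add poly_gauss_scale poly_gauss_if poly_gauss_coord
      poly_gauss_wave poly_gauss_pderiv poly_gauss_pderiv2 finite)

end

lemma pderiv_at_scale: "smooth_fun f \<Longrightarrow> pderiv_at j (\<lambda>x. c * f x) = (\<lambda>x. c * pderiv_at j f x)"
  by (subst pderiv_at_mult) (auto simp: pderiv_at_const smooth_fun_differentiable smooth_fun_const)

text \<open>Leibniz's rule arranged for cutoffs: apart from the leading term, every summand contains
  a derivative of \<kappa>.\<close>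

lemma diff_op_product:
  assumes \<kappa>: "smooth_fun \<kappa>" and f: "smooth_fun f"
  shows "diff_op a b c (\<lambda>x. \<kappa> x * f x) x = \<kappa> x * diff_op a b c f x
    + (\<Sum>j\<in>UNIV. \<Sum>k\<in>UNIV. 2 * \<i> * b j k * (pderiv_at k \<kappa> x * (of_real (x $ j) * f x))
       - c j k * (pderiv_at k (pderiv_at j \<kappa>) x * f x)
       - c j k * (pderiv_at j \<kappa> x * pderiv_at k f x) - c j k * (pderiv_at k \<kappa> x * pderiv_at j f x))"
proof -
  note d = smooth_fun_differentiable[OF \<kappa>] smooth_fun_differentiable[OF f]
    smooth_fun_differentiable[OF smooth_fun_pderiv[OF \<kappa>]] smooth_fun_differentiable[OF smooth_fun_pderiv[OF f]]
  have 1: "pderiv_at k (\<lambda>x. \<kappa> x * f x) = (\<lambda>x. pderiv_at k \<kappa> x * f x + \<kappa> x * pderiv_at k f x)" for k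
    by (rule pderiv_at_mult) (rule d)+
  have 2: "pderiv_at k (pderiv_at j (\<lambda>x. \<kappa> x * f x)) = (\<lambda>x. (pderiv_at k (pderiv_at j \<kappa>) x * f x
      + pderiv_at j \<kappa> x * pderiv_at k f x) + (pderiv_at k \<kappa> x * pderiv_at j f x + \<kappa> x * pderiv_at k (pderiv_at j f) x))" for j k
  proof -
    have "smooth_fun (\<lambda>x. pderiv_at j \<kappa> x * f x)" "smooth_fun (\<lambda>x. \<kappa> x * pderiv_at j f x)"
      by (intro smooth_intros \<kappa> f)+
    then have "pderiv_at k (\<lambda>x. pderiv_at j \<kappa> x * f x + \<kappa> x * pderiv_at j f x)
      = (\<lambda>x. pderiv_at k (\<lambda>x. pderiv_at j \<kappa> x * f x) x + pderiv_at k (\<lambda>x. \<kappa> x * pderiv_at j f x) x)"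
      by (intro pderiv_at_add smooth_fun_differentiable)
    also have "pderiv_at k (\<lambda>x. pderiv_at j \<kappa> x * f x) = (\<lambda>x. pderiv_at k (pderiv_at j \<kappa>) x * f x + pderiv_at j \<kappa> x * pderiv_at k f x)"
      by (rule pderiv_at_mult) (rule d)+
    also have "pderiv_at k (\<lambda>x. \<kappa> x * pderiv_at j f x) = (\<lambda>x. pderiv_at k \<kappa> x * pderiv_at j f x + \<kappa> x * pderiv_at k (pderiv_at j f) x)"
      by (rule pderiv_at_mult) (rule d)+
    finally show ?thesis by (simp only: 1)
  qed
  show ?thesis unfolding diff_op_def 2 unfolding 1 sum_distrib_left sum.distrib[symmetric]
    by (intro sum.cong refl) (simp add: algebra_simps)
qed

section \<open>Cutoffs with small derivatives\<close>

lemma pderiv_bump_0: "pderiv_at j (bump 0 c y) = (\<lambda>x. bump 2 c y x * of_real (- 2 * c * (x $ j - y $ j)))"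
  using pderiv_bump[of j 0 c y] by (simp add: numeral_2_eq_2)

lemma pderiv_bump_2: "pderiv_at j (bump 2 c y) = (\<lambda>x. (bump 4 c y x - 2 * bump 3 c y x) * of_real (- 2 * c * (x $ j - y $ j)))"
  using pderiv_bump[of j 2 c y] unfolding numeral_Bit0 numeral_Bit1 by (simp add: numeral_eq_Suc)

text \<open>\<open>bump 0\<close> has the value \<open>exp (- 1)\<close> at its centre, hence the
  factor \<open>exp 1\<close>; the support lies in the ball of radius \<open>k + 1\<close>.\<close>

definition cutoff :: "nat \<Rightarrow> real^'n::finite \<Rightarrow> complex" where
  "cutoff k = (\<lambda>x. of_real (exp 1) * bump 0 ((inverse (real (Suc k)))\<^sup>2) 0 x)"

lemma norm_bump_le: "norm (bump m c y x) \<le> fact m"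
  using flat_le[of m _ 0] flat_nonneg[of m] by (simp add: bump_def)

text \<open>On the support \<open>s * norm x < 1\<close>, so the factor
  \<open>s\<^sup>2 * x $ j\<close> produced by differentiating the cutoff is at most
  \<open>s\<close>. Each such factor gains one power of the inverse radius.\<close>

lemma norm_bump_coord_le:
  assumes s: "s > 0"
  shows "norm (bump m (s\<^sup>2) 0 x * of_real (s\<^sup>2 * x $ j)) \<le> fact m * s"
proof (cases "bump m (s\<^sup>2) 0 x = 0")
  case False
  then have "(s * norm x)\<^sup>2 < 1\<^sup>2" using bump_support[of "s\<^sup>2" m 0 x] s by (simp add: power_mult_distrib)
  then have lt: "s * norm x < 1" by (rule power2_less_imp_less) simp
  have "norm (complex_of_real (s\<^sup>2 * x $ j)) = s * (s * \<bar>x $ j\<bar>)"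
    using s by (simp add: norm_mult power2_eq_square)
  also have "\<dots> \<le> s * (s * norm x)" using s component_le_norm_cart[of x j] by (intro mult_left_mono) auto
  also have "\<dots> \<le> s * 1" using s lt by (intro mult_left_mono) auto
  finally show ?thesis unfolding norm_mult[of "bump m (s\<^sup>2) 0 x"] using s by (intro mult_mono norm_bump_le) auto
qed (use s in simp)

lemma test_fun_cutoff: "test_fun (cutoff k)"
  unfolding cutoff_def by (intro test_fun_scale test_fun_bump) simp

lemma norm_cutoff_le: "norm (cutoff k x) \<le> exp 1"
  using norm_bump_le[of 0 "(inverse (real (Suc k)))\<^sup>2" 0 x] by (simp add: cutoff_def norm_mult)

lemma cutoff_tendsto: "(\<lambda>k. cutoff k x) \<longlonglongrightarrow> 1"
proof -
  have "(\<lambda>k. 1 - (inverse (real (Suc k)))\<^sup>2 * (x \<bullet> x)) \<longlonglongrightarrow> 1 - 0\<^sup>2 * (x \<bullet> x)"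
    by (intro tendsto_intros LIMSEQ_inverse_real_of_nat)
  then have "(\<lambda>k. flat 0 (1 - (inverse (real (Suc k)))\<^sup>2 * (x \<bullet> x))) \<longlonglongrightarrow> flat 0 1"
    using DERIV_isCont[OF flat_has_derivative[of 0 1]] by (intro isCont_tendsto_compose[of 1 "flat 0"]) auto
  then have "(\<lambda>k. of_real (exp 1) * complex_of_real (flat 0 (1 - (inverse (real (Suc k)))\<^sup>2 * (x \<bullet> x)))) \<longlonglongrightarrow> of_real (exp 1) * of_real (flat 0 1)"
    by (intro tendsto_intros)
  moreover have "complex_of_real (exp 1) * of_real (flat 0 1) = 1"
    by (simp add: flat_def exp_minus flip: of_real_mult)
  ultimately show ?thesis by (simp add: cutoff_def bump_def)
qed

lemma pderiv_cutoff:
  "pderiv_at j (cutoff k) = (\<lambda>x. of_real (exp 1) * (- 2 * (bump 2 ((inverse (real (Suc k)))\<^sup>2) 0 x * of_real ((inverse (real (Suc k)))\<^sup>2 * x $ j))))"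
  unfolding cutoff_def pderiv_at_scale[OF smooth_bump] pderiv_bump_0 by (simp add: fun_eq_iff del: of_nat_Suc)

lemma norm_pderiv_cutoff_le: "norm (pderiv_at j (cutoff k) x) \<le> 4 * exp 1 * inverse (real (Suc k))"
  using norm_bump_coord_le[of "inverse (real (Suc k))" 2 x j]
  by (simp add: pderiv_cutoff norm_mult[of 2] norm_mult[of "of_real (exp 1)"] del: of_nat_Suc)

text \<open>The three terms of the second derivative contribute \<open>2 * 4!\<close>,
  \<open>4 * 3!\<close> and \<open>2!\<close> by the bound \<open>fact m\<close> on
  \<open>bump m\<close>, in total 74; the first differentiation supplies another factor 2. Since
  \<open>s \<le> 1\<close>, one power of \<open>s\<close> is enough for all of them.\<close>

lemma norm_pderiv2_cutoff_le:
  "norm (pderiv_at i (pderiv_at j (cutoff k)) x) \<le> 148 * exp 1 * inverse (real (Suc k))"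
proof -
  define s where "s = inverse (real (Suc k))"
  have s: "s > 0" "s \<le> 1" by (auto simp: s_def field_simps)
  have ss: "s\<^sup>2 \<le> s" using s by (simp add: power2_eq_square mult_left_le)
  define D where "D = pderiv_at i (\<lambda>x. bump 2 (s\<^sup>2) 0 x * of_real (s\<^sup>2 * x $ j)) x"
  have eq: "pderiv_at i (pderiv_at j (cutoff k)) x = of_real (exp 1) * (- 2 * D)"
  proof -
    have sm: "smooth_fun (\<lambda>x. bump 2 (s\<^sup>2) 0 x * of_real (s\<^sup>2 * x $ j))"
      unfolding of_real_mult by (intro smooth_fun_mult smooth_bump smooth_fun_const smooth_fun_coord)
    show ?thesis unfolding pderiv_cutoff D_def s_def[symmetric]
      by (subst pderiv_at_scale, intro smooth_fun_scale sm, subst pderiv_at_scale, rule sm) simp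
  qed
  have "D = (- 2 * (bump 4 (s\<^sup>2) 0 x * of_real (s\<^sup>2 * x $ i)) + 4 * (bump 3 (s\<^sup>2) 0 x * of_real (s\<^sup>2 * x $ i))) * of_real (s\<^sup>2 * x $ j)
      + bump 2 (s\<^sup>2) 0 x * of_real (s\<^sup>2 * (if i = j then 1 else 0))"
  proof -
    have "pderiv_at i (\<lambda>x. complex_of_real (s\<^sup>2) * of_real (x $ j)) = (\<lambda>x. of_real (s\<^sup>2) * (if i = j then 1 else 0))"
      by (simp add: pderiv_at_scale[OF smooth_fun_coord] pderiv_at_coord)
    then show ?thesis unfolding D_def of_real_mult
      by (subst pderiv_at_mult) (auto simp: pderiv_bump_2 smooth_fun_differentiable smooth_bump smooth_fun_mult smooth_fun_const
          smooth_fun_coord algebra_simps simp del: of_real_power)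
  qed
  moreover have "norm \<dots> \<le> 74 * s"
  proof -
    have b: "norm (bump m (s\<^sup>2) 0 x * of_real (s\<^sup>2 * x $ i) * of_real (s\<^sup>2 * x $ j)) \<le> fact m * s" if "m = 3 \<or> m = 4" for m
    proof (cases "bump m (s\<^sup>2) 0 x = 0")
      case False
      then have "(s * norm x)\<^sup>2 < 1\<^sup>2" using bump_support[of "s\<^sup>2" m 0 x] s by (simp add: power_mult_distrib)
      then have lt: "s * norm x < 1" by (rule power2_less_imp_less) simp
      have "norm (complex_of_real (s\<^sup>2 * x $ j)) = s * (s * \<bar>x $ j\<bar>)" using s by (simp add: norm_mult power2_eq_square)
      also have "\<dots> \<le> s * (s * norm x)" using s component_le_norm_cart[of x j] by (intro mult_left_mono) auto
      also have "\<dots> \<le> 1 * 1" using s lt by (intro mult_mono) auto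
      finally have "norm (complex_of_real (s\<^sup>2 * x $ j)) \<le> 1" by simp
      then have "norm (bump m (s\<^sup>2) 0 x * of_real (s\<^sup>2 * x $ i)) * norm (complex_of_real (s\<^sup>2 * x $ j)) \<le> (fact m * s) * 1"
        using s by (intro mult_mono norm_bump_coord_le) auto
      then show ?thesis by (simp add: norm_mult)
    qed (use s in simp)
    have "norm (bump 2 (s\<^sup>2) 0 x * complex_of_real (s\<^sup>2 * (if i = j then 1 else 0))) \<le> fact 2 * s\<^sup>2"
      unfolding norm_mult[of "bump 2 (s\<^sup>2) 0 x"] by (intro mult_mono norm_bump_le) (auto simp: norm_power)
    then have 3: "norm (bump 2 (s\<^sup>2) 0 x * complex_of_real (s\<^sup>2 * (if i = j then 1 else 0))) \<le> 2 * s"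
      using ss by (simp add: fact_numeral)
    have "norm (- 2 * (bump 4 (s\<^sup>2) 0 x * of_real (s\<^sup>2 * x $ i) * of_real (s\<^sup>2 * x $ j))) \<le> 48 * s"
      using b[of 4] by (simp add: norm_mult[of "- 2 :: complex"] fact_numeral)
    moreover have "norm (4 * (bump 3 (s\<^sup>2) 0 x * of_real (s\<^sup>2 * x $ i) * of_real (s\<^sup>2 * x $ j))) \<le> 24 * s"
      using b[of 3] by (simp add: norm_mult[of "4 :: complex"] fact_numeral)
    ultimately have "norm ((- 2 * (bump 4 (s\<^sup>2) 0 x * of_real (s\<^sup>2 * x $ i) * of_real (s\<^sup>2 * x $ j)))
       + 4 * (bump 3 (s\<^sup>2) 0 x * of_real (s\<^sup>2 * x $ i) * of_real (s\<^sup>2 * x $ j))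
       + bump 2 (s\<^sup>2) 0 x * complex_of_real (s\<^sup>2 * (if i = j then 1 else 0))) \<le> 48 * s + 24 * s + 2 * s"
      using 3 by (intro norm_triangle_le add_mono) auto
    moreover have "48 * s + 24 * s + 2 * s = 74 * s" by simp
    ultimately show ?thesis by (simp only: distrib_right mult.assoc)
  qed
  ultimately have "norm D \<le> 74 * s" by simp
  then show ?thesis unfolding eq by (simp add: norm_mult s_def del: of_nat_Suc)
qed

lemma distr_of_small_tendsto:
  assumes u: "u \<in> L2" and h: "h \<in> L2" and D: "\<And>k. smooth_fun (D k)"
    and b: "\<And>k x. norm (D k x) \<le> C * inverse (real (Suc k))"
  shows "(\<lambda>k. distr_of u (\<lambda>x. D k x * h x)) \<longlonglongrightarrow> 0"
proof (rule Lim_null_comparison)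
  show "eventually (\<lambda>k. norm (distr_of u (\<lambda>x. D k x * h x)) \<le> L2_norm u * (\<bar>C\<bar> * inverse (real (Suc k)) * L2_norm h)) sequentially"
  proof (intro always_eventually allI)
    fix k
    let ?e = "of_real (\<bar>C\<bar> * inverse (real (Suc k))) :: complex"
    have ne: "norm ?e = \<bar>C\<bar> * inverse (real (Suc k))"
      by (subst norm_of_real) (simp add: abs_mult)
    have le: "norm (D k x * h x) \<le> norm (?e * h x)" for x
    proof -
      have "norm (D k x) \<le> \<bar>C\<bar> * inverse (real (Suc k))"
        using b[of k x] by (smt (verit) mult_right_mono inverse_nonnegative_iff_nonnegative of_nat_0_le_iff)
      then show ?thesis unfolding norm_mult ne by (rule mult_right_mono) simp
    qed
    have m: "(\<lambda>x. D k x * h x) \<in> borel_measurable borel"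
      using smooth_fun_measurable[OF D] L2D(1)[OF h] by auto
    note B = L2_bound[OF L2_scale[OF h, of ?e] m AE_I2[OF le]]
    have "norm (distr_of u (\<lambda>x. D k x * h x)) \<le> L2_norm u * L2_norm (\<lambda>x. D k x * h x)"
      by (rule distr_of_bound[OF u B(1)])
    also have "\<dots> \<le> L2_norm u * L2_norm (\<lambda>x. ?e * h x)" by (intro mult_left_mono B) auto
    also have "L2_norm (\<lambda>x. ?e * h x) = \<bar>C\<bar> * inverse (real (Suc k)) * L2_norm h"
      unfolding L2_norm_scale ne ..
    finally show "norm (distr_of u (\<lambda>x. D k x * h x)) \<le> L2_norm u * (\<bar>C\<bar> * inverse (real (Suc k)) * L2_norm h)" .
  qed
  have "(\<lambda>k. L2_norm u * (\<bar>C\<bar> * inverse (real (Suc k)) * L2_norm h)) \<longlonglongrightarrow> L2_norm u * (\<bar>C\<bar> * 0 * L2_norm h)"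
    by (intro tendsto_intros LIMSEQ_inverse_real_of_nat)
  then show "(\<lambda>k. L2_norm u * (\<bar>C\<bar> * inverse (real (Suc k)) * L2_norm h)) \<longlonglongrightarrow> 0" by simp
qed

lemma distr_of_cutoff_tendsto:
  assumes u: "u \<in> L2" and h: "h \<in> L2"
  shows "(\<lambda>k. distr_of u (\<lambda>x. cutoff k x * h x)) \<longlonglongrightarrow> distr_of u h"
proof -
  have m: "(\<lambda>x. cutoff k x * h x) \<in> borel_measurable borel" for k
    by (intro borel_measurable_times smooth_fun_measurable[OF test_fun_smooth[OF test_fun_cutoff]] L2D(1)[OF h])
  have le: "norm (cutoff k x * h x) \<le> norm (of_real (exp 1) * h x)" for k x
    using norm_cutoff_le[of k x] by (simp add: norm_mult mult_right_mono)
  have L: "(\<lambda>x. cutoff k x * h x) \<in> L2" for k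
    by (rule L2_bound[OF L2_scale[OF h, of "of_real (exp 1)"] m]) (use le in simp)
  have "(\<lambda>k. L2_norm (\<lambda>x. cutoff k x * h x - h x)) \<longlonglongrightarrow> 0"
  proof (rule L2_norm_dominated_convergence[OF L2_scale[OF h, of "of_real (exp 1)"] m L2D(1)[OF h] _ le])
    show "(\<lambda>k. cutoff k x * h x) \<longlonglongrightarrow> h x" for x
      using tendsto_mult_right[OF cutoff_tendsto[of x], of "h x"] by simp
  qed
  from tendsto_mult_left[OF this, of "L2_norm u"]
  have t: "(\<lambda>k. L2_norm u * L2_norm (\<lambda>x. cutoff k x * h x - h x)) \<longlonglongrightarrow> 0" by simp
  have "norm (distr_of u (\<lambda>x. cutoff k x * h x) - distr_of u h) \<le> L2_norm u * L2_norm (\<lambda>x. cutoff k x * h x - h x)" for k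
    using distr_of_bound[OF u L2_diff[OF L h], of k] by (simp add: distr_of_diff_right L h u)
  then have "(\<lambda>k. distr_of u (\<lambda>x. cutoff k x * h x) - distr_of u h) \<longlonglongrightarrow> 0"
    by (intro Lim_null_comparison[OF always_eventually t]) auto
  then show ?thesis by (rule LIM_zero_cancel)
qed

context gauss_weight
begin

text \<open>A Gaussian wave has no compact support, so the maximal operator cannot be tested on it
  directly. Cutting it off leaves error terms with derivatives of the cutoff, which tend to 0 in L2,
  while the leading term converges by domination.\<close>

lemma max_op_gexp:
  assumes uv: "(u, v) \<in> max_op a b c"
  shows "distr_of u (diff_op a b c (gexp G (ivec \<xi>))) = distr_of v (gexp G (ivec \<xi>))"
proof -
  let ?E = "gexp G (ivec \<xi>)"
  have u: "u \<in> L2" and v: "v \<in> L2" using uv by (auto simp: max_op_def)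
  note sE = smooth_gexp[OF G, of "ivec \<xi>"]
  note sc = test_fun_smooth[OF test_fun_cutoff]
  note PL = poly_gauss_L2[OF G]
  have "(\<lambda>k. distr_of v (\<lambda>x. cutoff k x * ?E x)) \<longlonglongrightarrow> distr_of v ?E"
    by (rule distr_of_cutoff_tendsto[OF v PL[OF poly_gauss_wave]])
  moreover have "distr_of v (\<lambda>x. cutoff k x * ?E x) = distr_of u (diff_op a b c (\<lambda>x. cutoff k x * ?E x))" for k
    using uv test_fun_mult[OF test_fun_cutoff sE, of k] by (simp add: max_op_def)
  moreover have "(\<lambda>k. distr_of u (diff_op a b c (\<lambda>x. cutoff k x * ?E x))) \<longlonglongrightarrow> distr_of u (diff_op a b c ?E)"
  proof -
    define R1 where "R1 n j k x = pderiv_at k (cutoff n) x * (of_real (x $ j) * ?E x)" for n j k x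
    define R2 where "R2 n j k x = pderiv_at k (pderiv_at j (cutoff n)) x * ?E x" for n j k x
    define R3 where "R3 n j k x = pderiv_at j (cutoff n) x * pderiv_at k ?E x" for n j k x
    have tL: "R1 n j k \<in> L2" "R2 n j k \<in> L2" "R3 n j k \<in> L2" for n j k
      unfolding R1_def[abs_def] R2_def[abs_def] R3_def[abs_def]
      by (intro test_fun_L2 test_fun_mult test_fun_pderiv test_fun_cutoff smooth_intros sE)+
    have tc: "(\<lambda>x. cutoff n x * diff_op a b c ?E x) \<in> L2" for n
      by (intro test_fun_L2 test_fun_mult test_fun_cutoff smooth_diff_op sE)
    have eq: "distr_of u (diff_op a b c (\<lambda>x. cutoff n x * ?E x)) = distr_of u (\<lambda>x. cutoff n x * diff_op a b c ?E x)
      + (\<Sum>j\<in>UNIV. \<Sum>k\<in>UNIV. 2 * \<i> * b j k * distr_of u (R1 n j k) - c j k * distr_of u (R2 n j k)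
        - c j k * distr_of u (R3 n j k) - c j k * distr_of u (R3 n k j))" for n
    proof -
      have "diff_op a b c (\<lambda>x. cutoff n x * ?E x) = (\<lambda>x. cutoff n x * diff_op a b c ?E x
        + (\<Sum>j\<in>UNIV. \<Sum>k\<in>UNIV. 2 * \<i> * b j k * R1 n j k x - c j k * R2 n j k x - c j k * R3 n j k x - c j k * R3 n k j x))"
        by (rule ext, subst diff_op_product[OF sc sE]) (simp add: R1_def R2_def R3_def)
      then show ?thesis
        by (simp add: distr_of_add_right distr_of_sum_right distr_of_diff_right distr_of_scale_right u tc tL L2_sum L2_diff L2_scale)
    qed
    have l1: "(\<lambda>n. distr_of u (R1 n j k)) \<longlonglongrightarrow> 0" for j k
      unfolding R1_def[abs_def]
      by (rule distr_of_small_tendsto[OF u PL[OF poly_gauss_coord[OF poly_gauss_wave]], where C="4 * exp 1"])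
        (intro smooth_intros sc, rule norm_pderiv_cutoff_le)
    have l2: "(\<lambda>n. distr_of u (R2 n j k)) \<longlonglongrightarrow> 0" for j k
      unfolding R2_def[abs_def]
      by (rule distr_of_small_tendsto[OF u PL[OF poly_gauss_wave], where C="148 * exp 1"])
        (intro smooth_intros sc, rule norm_pderiv2_cutoff_le)
    have l3: "(\<lambda>n. distr_of u (R3 n j k)) \<longlonglongrightarrow> 0" for j k
      unfolding R3_def[abs_def]
      by (rule distr_of_small_tendsto[OF u PL[OF poly_gauss_pderiv], where C="4 * exp 1"])
        (intro smooth_intros sc, rule norm_pderiv_cutoff_le)
    have "(\<lambda>n. distr_of u (\<lambda>x. cutoff n x * diff_op a b c ?E x)
      + (\<Sum>j\<in>UNIV. \<Sum>k\<in>UNIV. 2 * \<i> * b j k * distr_of u (R1 n j k) - c j k * distr_of u (R2 n j k)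
        - c j k * distr_of u (R3 n j k) - c j k * distr_of u (R3 n k j)))
      \<longlonglongrightarrow> distr_of u (diff_op a b c ?E) + (\<Sum>j\<in>UNIV. \<Sum>k\<in>UNIV. 2 * \<i> * b j k * 0 - c j k * 0 - c j k * 0 - c j k * 0)"
      by (intro tendsto_intros l1 l2 l3 distr_of_cutoff_tendsto[OF u PL[OF poly_gauss_diff_op]])
    then show ?thesis unfolding eq by simp
  qed
  ultimately show ?thesis using LIMSEQ_unique by (metis (no_types, lifting) LIMSEQ_unique ext)
qed

end

section \<open>Ornstein--Uhlenbeck semigroups conjugated by a Gaussian\<close>

text \<open>The symbol condition makes the operator of first order in the frequency: multiplying a
  wave by \<open>\<i> * (N \<zeta> \<bullet> x)\<close> is the same as differentiating it in \<zeta>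
  along \<open>N \<zeta>\<close>. The evolution therefore moves the frequency by the flow of
  \<open>- N\<close> and multiplies by a scalar whose logarithmic derivative is
  \<open>- (\<mu> + \<zeta> \<bullet> K (N \<zeta>))\<close>.\<close>

locale ou = gauss_weight G for G :: "real^'n::finite \<Rightarrow> real^'n" +
  fixes N :: "real^'n \<Rightarrow> real^'n" and \<mu> :: real
    and a b c :: "'n \<Rightarrow> 'n \<Rightarrow> complex"
  assumes N: "linear N" and \<mu>: "\<mu> \<ge> 0"
    and dissipative: "\<zeta> \<bullet> K (N \<zeta>) \<ge> 0"
    and symbol: "gexp_symbol G a b c (ivec \<zeta>) x = of_real (\<mu> + \<zeta> \<bullet> K (N \<zeta>)) + \<i> * of_real (N \<zeta> \<bullet> x)"
begin

definition r :: "real \<Rightarrow> real^'n \<Rightarrow> real^'n" where "r t = flow (\<lambda>v. - N v) t"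

lemma mN: "linear (\<lambda>v. - N v)" using N by (rule linear_compose_neg)

lemma r_linear: "linear (r t)" unfolding r_def by (rule flow_linear[OF mN])

lemma r_0 [simp]: "r 0 \<xi> = \<xi>" by (simp add: r_def)

lemma r_derivative: "((\<lambda>t. r t \<xi>) has_vector_derivative - N (r t \<xi>)) (at t)"
  unfolding r_def by (rule flow_has_vector_derivative[OF mN])

lemma r_add: "s \<ge> 0 \<Longrightarrow> r (s + t) \<xi> = r s (r t \<xi>)"
  unfolding r_def by (rule flow_add[OF mN])

lemma r_energy: "((\<lambda>t. r t \<xi> \<bullet> K (r t \<xi>)) has_real_derivative - 2 * (r t \<xi> \<bullet> K (N (r t \<xi>)))) (at t)"
proof -
  have d: "((\<lambda>t. r t \<xi>) has_derivative (\<lambda>h. h *\<^sub>R - N (r t \<xi>))) (at t)"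
    using r_derivative[of \<xi> t] by (simp add: has_vector_derivative_def)
  from has_derivative_inner[OF d bounded_linear.has_derivative[OF pos_def_mapD(5)[OF K] d]]
  have "((\<lambda>t. r t \<xi> \<bullet> K (r t \<xi>)) has_derivative
     (\<lambda>h. r t \<xi> \<bullet> K (h *\<^sub>R - N (r t \<xi>)) + (h *\<^sub>R - N (r t \<xi>)) \<bullet> K (r t \<xi>))) (at t)" .
  moreover have "r t \<xi> \<bullet> K (h *\<^sub>R - N (r t \<xi>)) + (h *\<^sub>R - N (r t \<xi>)) \<bullet> K (r t \<xi>) = (- 2 * (r t \<xi> \<bullet> K (N (r t \<xi>)))) * h" for h
    using K_commute[of "N (r t \<xi>)" "r t \<xi>"] by (simp add: K_simps)
  ultimately have "((\<lambda>t. r t \<xi> \<bullet> K (r t \<xi>)) has_derivative (\<lambda>h. (- 2 * (r t \<xi> \<bullet> K (N (r t \<xi>)))) * h)) (at t)"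
    by (simp only:)
  then show ?thesis by (simp only: has_field_derivative_def)
qed

lemma r_K_contraction: "t \<ge> 0 \<Longrightarrow> K_contraction (r t)"
  unfolding K_contraction_def
proof (intro conjI allI r_linear)
  fix \<xi> assume t: "t \<ge> 0"
  have "r t \<xi> \<bullet> K (r t \<xi>) \<le> r 0 \<xi> \<bullet> K (r 0 \<xi>)"
  proof (rule DERIV_nonpos_imp_nonincreasing[OF t])
    fix x show "\<exists>y. ((\<lambda>t. r t \<xi> \<bullet> K (r t \<xi>)) has_real_derivative y) (at x) \<and> y \<le> 0"
      using r_energy[of \<xi> x] dissipative[of "r x \<xi>"] by (intro exI conjI) auto
  qed
  then show "r t \<xi> \<bullet> K (r t \<xi>) \<le> \<xi> \<bullet> K \<xi>" by simp
qed

definition T :: "real \<Rightarrow> (real^'n \<Rightarrow> complex) \<Rightarrow> (real^'n \<Rightarrow> complex)" where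
  "T t u = (\<lambda>x. of_real (exp (- \<mu> * t)) * mehler (r t) u x)"

definition E :: "real^'n \<Rightarrow> real^'n \<Rightarrow> complex" where "E \<xi> = (\<lambda>x. u0 x * wave \<xi> x)"

definition e :: "real^'n \<Rightarrow> real \<Rightarrow> real" where
  "e \<xi> t = exp (- \<mu> * t - (\<xi> \<bullet> K \<xi> - r t \<xi> \<bullet> K (r t \<xi>)) / 2)"

lemma E_gexp: "E \<xi> = gexp G (ivec \<xi>)" by (simp add: E_def gexp_ivec fun_eq_iff)

lemma E_L2: "E \<xi> \<in> L2" unfolding E_def by (rule wave_L2)

lemma T_contraction: "t \<ge> 0 \<Longrightarrow> contraction_op (T t)"
  unfolding T_def using \<mu> by (intro contraction_op_scale contraction_op_mehler r_K_contraction) auto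

lemma T_E: "t \<ge> 0 \<Longrightarrow> T t (E \<xi>) = (\<lambda>x. of_real (e \<xi> t) * E (r t \<xi>) x)"
proof -
  assume t: "t \<ge> 0"
  have "e \<xi> t = exp (- \<mu> * t) * exp (- (\<xi> \<bullet> K \<xi> - r t \<xi> \<bullet> K (r t \<xi>)) / 2)"
    unfolding e_def exp_add[symmetric] by (simp add: field_simps)
  then show ?thesis
    unfolding T_def E_def by (subst mehler_wave[OF r_K_contraction[OF t]]) (simp add: mult.assoc)
qed

lemma e_0 [simp]: "e \<xi> 0 = 1" by (simp add: e_def)

lemma E_poly_gauss: "poly_gauss G (E \<xi>)" unfolding E_gexp by (rule poly_gauss_wave)

text \<open>The evolution equation for a single wave, tested against an arbitrary square integrable
  \<open>u\<close>. Pairing with \<open>u\<close> turns the path of waves into a Fourier transform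
  with weight \<open>u * u0\<close>, whose second moment is finite, evaluated along the
  flow.\<close>

lemma pairing_path_derivative:
  assumes u: "u \<in> L2"
  shows "((\<lambda>t. distr_of u (\<lambda>x. of_real (e \<xi> t) * E (r t \<xi>) x)) has_vector_derivative
    - distr_of u (\<lambda>x. of_real (e \<xi> t) * diff_op a b c (E (r t \<xi>)) x)) (at t)"
proof -
  let ?\<zeta> = "r t \<xi>"
  define w where "w = (\<lambda>x. u x * u0 x)"
  define k where "k = ?\<zeta> \<bullet> K (N ?\<zeta>)"
  have wm: "w \<in> borel_measurable borel" unfolding w_def using L2D(1)[OF u] by measurable
  have wi: "integrable lborel w" unfolding w_def by (rule L2_integrable_mult[OF u u0_L2])
  have nx: "(\<lambda>x. of_real ((norm x)\<^sup>2) * u0 x) \<in> L2"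
  proof (rule poly_gauss_L2[OF G], unfold poly_gauss_def, intro conjI exI allI)
    show "norm (of_real ((norm x)\<^sup>2) * u0 x) \<le> 1 * (1 + norm x) ^ 2 * gauss G x" for x
    proof -
      have "(norm x)\<^sup>2 \<le> (1 + norm x)\<^sup>2" by (intro power_mono) auto
      then show ?thesis by (simp add: norm_mult norm_u0 norm_power mult_right_mono)
    qed
  qed measurable
  have w2: "integrable lborel (\<lambda>x. (norm x)\<^sup>2 * norm (w x))"
    using integrable_norm[OF L2_integrable_mult[OF u nx]] by (simp add: w_def norm_mult norm_power mult_ac)
  have pE: "distr_of u (E \<eta>) = (LINT x|lborel. w x * wave \<eta> x)" for \<eta>
    by (simp add: distr_of_def E_def w_def mult.assoc)
  have "((\<lambda>t. LINT x|lborel. w x * wave (r t \<xi>) x) has_derivative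
    (\<lambda>h. LINT x|lborel. w x * (\<i> * of_real ((h *\<^sub>R - N ?\<zeta>) \<bullet> x) * wave ?\<zeta> x))) (at t)"
    by (rule has_derivative_compose[where f="\<lambda>t. r t \<xi>", OF _ integral_wave_has_derivative[OF wm wi w2]])
      (use r_derivative[of \<xi> t] in \<open>simp add: has_vector_derivative_def\<close>)
  moreover have "(LINT x|lborel. w x * (\<i> * of_real ((h *\<^sub>R - N ?\<zeta>) \<bullet> x) * wave ?\<zeta> x))
     = h *\<^sub>R (- distr_of u (\<lambda>x. \<i> * of_real (N ?\<zeta> \<bullet> x) * E ?\<zeta> x))" for h :: real
  proof -
    have "h *\<^sub>R (- distr_of u (\<lambda>x. \<i> * of_real (N ?\<zeta> \<bullet> x) * E ?\<zeta> x))
      = (LINT x|lborel. (- of_real h) * (u x * (\<i> * of_real (N ?\<zeta> \<bullet> x) * E ?\<zeta> x)))"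
      by (subst integral_mult_right_zero) (simp add: distr_of_def scaleR_conv_of_real)
    also have "\<dots> = (LINT x|lborel. w x * (\<i> * of_real ((h *\<^sub>R - N ?\<zeta>) \<bullet> x) * wave ?\<zeta> x))"
      by (intro Bochner_Integration.integral_cong refl) (simp add: w_def E_def algebra_simps)
    finally show ?thesis by simp
  qed
  ultimately have d1: "((\<lambda>t. distr_of u (E (r t \<xi>))) has_vector_derivative - distr_of u (\<lambda>x. \<i> * of_real (N ?\<zeta> \<bullet> x) * E ?\<zeta> x)) (at t)"
    by (simp add: has_vector_derivative_def pE)
  have "(e \<xi> has_real_derivative - (\<mu> + k) * e \<xi> t) (at t)"
    unfolding e_def k_def
    using DERIV_fun_exp[OF DERIV_diff[OF DERIV_cmult_Id[of "- \<mu>"]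
          DERIV_cdivide[OF DERIV_diff[OF DERIV_const[of "\<xi> \<bullet> K \<xi>"] r_energy[of \<xi> t]], of 2]]]
    by (simp add: algebra_simps)
  then have d2: "((\<lambda>t. complex_of_real (e \<xi> t)) has_vector_derivative of_real (- (\<mu> + k) * e \<xi> t)) (at t)"
    by (intro bounded_linear.has_vector_derivative[OF bounded_linear_of_real])
      (simp add: has_real_derivative_iff_has_vector_derivative)
  have NL: "(\<lambda>x. \<i> * of_real (N ?\<zeta> \<bullet> x) * E ?\<zeta> x) \<in> L2"
  proof -
    have "(\<lambda>x. \<i> * of_real (N ?\<zeta> \<bullet> x) * E ?\<zeta> x) = (\<lambda>x. \<Sum>j\<in>UNIV. (\<i> * of_real (N ?\<zeta> $ j)) * (of_real (x $ j) * E ?\<zeta> x))"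
      by (simp add: inner_vec_def sum_distrib_left sum_distrib_right mult_ac)
    then show ?thesis
      by (simp only:) (intro L2_sum L2_scale poly_gauss_L2[OF G] poly_gauss_coord E_poly_gauss finite)
  qed
  have op: "diff_op a b c (E ?\<zeta>) = (\<lambda>x. of_real (\<mu> + k) * E ?\<zeta> x + 1 * (\<i> * of_real (N ?\<zeta> \<bullet> x) * E ?\<zeta> x))"
    unfolding E_gexp by (rule ext, subst diff_op_gexp[OF G], subst symbol) (simp add: k_def algebra_simps)
  have "((\<lambda>t. of_real (e \<xi> t) * distr_of u (E (r t \<xi>))) has_vector_derivative
     of_real (e \<xi> t) * - distr_of u (\<lambda>x. \<i> * of_real (N ?\<zeta> \<bullet> x) * E ?\<zeta> x)
      + of_real (- (\<mu> + k) * e \<xi> t) * distr_of u (E ?\<zeta>)) (at t)"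
    by (rule has_vector_derivative_mult[OF d2 d1])
  moreover have "distr_of u (diff_op a b c (E ?\<zeta>)) = of_real (\<mu> + k) * distr_of u (E ?\<zeta>)
      + 1 * distr_of u (\<lambda>x. \<i> * of_real (N ?\<zeta> \<bullet> x) * E ?\<zeta> x)"
    unfolding op by (rule distr_of_lincomb_right[OF E_L2 NL u])
  ultimately show ?thesis unfolding distr_of_scale_right by (simp add: algebra_simps)
qed

lemma T_0: "u \<in> L2 \<Longrightarrow> AE x in lborel. T 0 u x = u x"
proof (rule contraction_op_eqI[OF u0_L2 u0_nz T_contraction])
  show "contraction_op (\<lambda>u. u)" by (simp add: contraction_op_def)
  show "AE x in lborel. T 0 (\<lambda>y. u0 y * wave \<xi> y) x = u0 x * wave \<xi> x" for \<xi>
    using T_E[of 0 \<xi>] by (simp add: E_def)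
qed auto

lemma T_add:
  assumes "s \<ge> 0" "t \<ge> 0" "u \<in> L2"
  shows "AE x in lborel. T (s + t) u x = T s (T t u) x"
proof (rule contraction_op_eqI[OF u0_L2 u0_nz T_contraction contraction_op_compose[OF T_contraction T_contraction]])
  fix \<xi>
  have ae: "AE x in lborel. T s (\<lambda>x. of_real (e \<xi> t) * E (r t \<xi>) x + 0 * E (r t \<xi>) x) x = of_real (e \<xi> t) * T s (E (r t \<xi>)) x + 0 * T s (E (r t \<xi>)) x"
    by (rule contraction_opD(3)[OF T_contraction[OF assms(1)] E_L2 E_L2])
  have eq: "complex_of_real (e \<xi> (s + t)) = of_real (e \<xi> t) * of_real (e (r t \<xi>) s)"
    using r_add[OF assms(1), of t \<xi>] unfolding of_real_mult[symmetric] e_def exp_add[symmetric]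
    by (simp add: algebra_simps diff_divide_distrib)
  from ae have "AE x in lborel. T (s + t) (E \<xi>) x = T s (T t (E \<xi>)) x"
  proof eventually_elim
    case (elim x)
    then show ?case using eq assms r_add[OF assms(1), of t \<xi>] by (simp add: T_E mult.assoc)
  qed
  then show "AE x in lborel. T (s + t) (\<lambda>y. u0 y * wave \<xi> y) x = T s (T t (\<lambda>y. u0 y * wave \<xi> y)) x"
    by (simp add: E_def)
qed (use assms in auto)

lemma E_continuous: "((\<lambda>t. L2_norm (\<lambda>x. of_real (e \<xi> t) * E (r t \<xi>) x - E \<xi> x)) \<longlongrightarrow> 0) (at_right 0)"
  unfolding tendsto_at_iff_sequentially
proof (intro allI impI)
  fix X :: "nat \<Rightarrow> real" assume X: "\<forall>i. X i \<in> {0<..} - {0}" "X \<longlonglongrightarrow> 0"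
  have cr: "(\<lambda>i. r (X i) \<xi>) \<longlonglongrightarrow> r 0 \<xi>"
    by (rule isCont_tendsto_compose[OF has_vector_derivative_continuous[OF r_derivative] X(2)])
  have ce: "(\<lambda>i. e \<xi> (X i)) \<longlonglongrightarrow> e \<xi> 0"
    unfolding e_def by (intro tendsto_intros X cr bounded_linear.tendsto[OF pos_def_mapD(5)[OF K]]) simp
  \<comment> \<open>Beyond this index \<open>2 * u0\<close> dominates the whole sequence, so the
    sequence is shifted before dominated convergence is applied.\<close>
  have "eventually (\<lambda>i. e \<xi> (X i) < 2) sequentially" using order_tendstoD(2)[OF ce, of 2] by simp
  then obtain n where "\<forall>i\<ge>n. e \<xi> (X i) < 2" unfolding eventually_sequentially by blast
  then have n: "e \<xi> (X i) \<le> 2" if "i \<ge> n" for i using that less_imp_le by blast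
  have "(\<lambda>i. L2_norm (\<lambda>x. of_real (e \<xi> (X (i + n))) * E (r (X (i + n)) \<xi>) x - E \<xi> x)) \<longlonglongrightarrow> 0"
  proof (rule L2_norm_dominated_convergence[OF L2_scale[OF u0_L2, of 2]])
    fix x
    have "(\<lambda>i. wave (r (X i) \<xi>) x) \<longlonglongrightarrow> wave (r 0 \<xi>) x"
      unfolding wave_def cis_conv_exp by (intro tendsto_intros cr)
    then have "(\<lambda>i. of_real (e \<xi> (X i)) * E (r (X i) \<xi>) x) \<longlonglongrightarrow> of_real (e \<xi> 0) * E (r 0 \<xi>) x"
      unfolding E_def by (intro tendsto_intros ce)
    then have "(\<lambda>i. of_real (e \<xi> (X i)) * E (r (X i) \<xi>) x) \<longlonglongrightarrow> E \<xi> x" by simp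
    then show "(\<lambda>i. of_real (e \<xi> (X (i + n))) * E (r (X (i + n)) \<xi>) x) \<longlonglongrightarrow> E \<xi> x"
      by (rule LIMSEQ_ignore_initial_segment)
    show "norm (of_real (e \<xi> (X (i + n))) * E (r (X (i + n)) \<xi>) x) \<le> norm (2 * u0 x)" for i
      using n[of "i + n"] by (simp add: E_def norm_mult e_def mult_right_mono)
  qed (auto simp: E_def[abs_def])
  then show "((\<lambda>t. L2_norm (\<lambda>x. of_real (e \<xi> t) * E (r t \<xi>) x - E \<xi> x)) \<circ> X) \<longlonglongrightarrow> 0"
    unfolding o_def by (rule LIMSEQ_offset) 
qed

lemma T_tendsto: "u \<in> L2 \<Longrightarrow> ((\<lambda>t. L2_norm (\<lambda>x. T t u x - u x)) \<longlongrightarrow> 0) (at_right 0)"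
proof (rule contraction_op_tendsto_ident[OF u0_L2 u0_nz T_contraction])
  fix \<xi>
  have "eventually (\<lambda>t. L2_norm (\<lambda>x. of_real (e \<xi> t) * E (r t \<xi>) x - E \<xi> x) = L2_norm (\<lambda>x. T t (E \<xi>) x - E \<xi> x)) (at_right 0)"
    using eventually_at_right_less[of 0] by eventually_elim (simp add: T_E)
  from tendsto_cong[OF this, THEN iffD1, OF E_continuous]
  show "((\<lambda>t. L2_norm (\<lambda>x. T t (\<lambda>y. u0 y * wave \<xi> y) x - u0 x * wave \<xi> x)) \<longlongrightarrow> 0) (at_right 0)"
    by (simp add: E_def)
qed auto

lemma T_semigroup: "contraction_semigroup T"
  unfolding contraction_semigroup_def
proof (intro conjI allI impI ballI)
  fix t :: real and u v :: "real^'n \<Rightarrow> complex" and c d assume t: "t \<ge> 0" and u: "u \<in> L2" "v \<in> L2"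
  show "AE x in lborel. T t (\<lambda>y. c * u y + d * v y) x = c * T t u x + d * T t v x"
    by (rule contraction_opD(3)[OF T_contraction[OF t] u])
qed (use contraction_opD[OF T_contraction] T_0 T_add T_tendsto in auto)

end

text \<open>\<open>T\<close> is going to be the semigroup generated by minus
  \<open>max_op a b c\<close>. The expression acting on functions in that operator has
  \<open>- b\<close>, which explains the coefficients of the first copy. The second copy is its
  transpose, with \<open>N'\<close> the K-adjoint of \<open>N\<close>.\<close>

locale ou_pair = ou G N \<mu> a "\<lambda>j k. - b j k" c + dual: ou G N' \<mu> a b c
  for G :: "real^'n::finite \<Rightarrow> real^'n" and N N' \<mu> a b c +
  assumes transposed: "N \<xi> \<bullet> K \<eta> = \<xi> \<bullet> K (N' \<eta>)" and c_sym: "c j k = c k j"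
begin

text \<open>Running one flow for time \<open>s\<close> and the other for time \<open>t - s\<close>
  gives a pairing that is constant in \<open>s\<close>: the two derivatives cancel because
  \<open>N'\<close> is the K-adjoint of \<open>N\<close>.\<close>

lemma r_transposed:
  assumes t: "t \<ge> 0"
  shows "r t \<xi> \<bullet> K \<eta> = \<xi> \<bullet> K (dual.r t \<eta>)"
proof -
  define f where "f = (\<lambda>s. r s \<xi> \<bullet> K (dual.r (t - s) \<eta>))"
  have d: "(f has_real_derivative 0) (at s)" for s
  proof -
    have d1: "((\<lambda>t. r t \<xi>) has_derivative (\<lambda>h. h *\<^sub>R - N (r s \<xi>))) (at s)"
      using r_derivative[of \<xi> s] by (simp add: has_vector_derivative_def)
    have "((\<lambda>s. t - s) has_derivative (\<lambda>h. - h)) (at s)" by (auto intro!: derivative_eq_intros)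
    from has_derivative_compose[OF this dual.r_derivative[of \<eta> "t - s", unfolded has_vector_derivative_def]]
    have "((\<lambda>s. dual.r (t - s) \<eta>) has_derivative (\<lambda>h. - h *\<^sub>R - N' (dual.r (t - s) \<eta>))) (at s)" .
    from has_derivative_inner[OF d1 bounded_linear.has_derivative[OF pos_def_mapD(5)[OF K] this]]
    have "(f has_derivative (\<lambda>h. r s \<xi> \<bullet> K (- h *\<^sub>R - N' (dual.r (t - s) \<eta>)) + (h *\<^sub>R - N (r s \<xi>)) \<bullet> K (dual.r (t - s) \<eta>))) (at s)"
      unfolding f_def .
    then show ?thesis by (simp add: has_field_derivative_def K_simps transposed mult_zero_left[abs_def])
  qed
  have "f t = f 0"
    using DERIV_isconst_all[of f t 0] d by blast
  then show ?thesis by (simp add: f_def)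
qed

text \<open>On two waves the energy terms of the moved frequency cancel between the scalar factor
  and the Gaussian pairing. What remains is an exponential of
  \<open>- (r t \<xi> \<bullet> K \<eta>)\<close> times factors symmetric in the two sides, so the
  transposition of the flows is all that is required.\<close>

lemma T_transposed:
  assumes t: "t \<ge> 0" and u: "u \<in> L2" "v \<in> L2"
  shows "distr_of (T t u) v = distr_of u (dual.T t v)"
proof (rule contraction_op_transposeI[OF u0_L2 u0_nz dual.T_contraction[OF t] T_contraction[OF t] _ u])
  fix \<xi> \<eta>
  have pw: "distr_of (E \<xi>) (E \<eta>) = of_real (Z * gauss K (\<xi> + \<eta>))" for \<xi> \<eta>
    unfolding E_def by (rule pairing_wave)
  have g: "gauss K (\<xi> + \<eta>) = exp (- (\<xi> \<bullet> K \<xi>) / 2 - (\<eta> \<bullet> K \<eta>) / 2 - \<xi> \<bullet> K \<eta>)" for \<xi> \<eta>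
    using K_commute[of \<eta> \<xi>] by (simp add: gauss_def K_simps inner_add_left inner_add_right field_simps)
  have "distr_of (T t (E \<xi>)) (E \<eta>) = of_real (Z * (e \<xi> t * gauss K (r t \<xi> + \<eta>)))"
    by (simp add: T_E t distr_of_scale_left pw)
  also have "e \<xi> t * gauss K (r t \<xi> + \<eta>) = dual.e \<eta> t * gauss K (\<xi> + dual.r t \<eta>)"
    unfolding g e_def dual.e_def r_transposed[OF t] exp_add[symmetric] by (simp add: field_simps)
  also have "of_real (Z * (dual.e \<eta> t * gauss K (\<xi> + dual.r t \<eta>))) = distr_of (E \<xi>) (dual.T t (E \<eta>))"
    by (simp add: dual.T_E t distr_of_scale_right pw)
  finally show "distr_of (T t (\<lambda>y. u0 y * wave \<xi> y)) (\<lambda>y. u0 y * wave \<eta> y)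
      = distr_of (\<lambda>y. u0 y * wave \<xi> y) (dual.T t (\<lambda>y. u0 y * wave \<eta> y))"
    by (simp add: E_def)
qed

text \<open>For \<open>u\<close> in the maximal domain the orbit is differentiable when tested
  against waves. Transposing moves the evolution onto the wave, where it is explicit;
  \<open>max_op_gexp\<close> then moves the operator back onto \<open>u\<close>. The derivative is
  relative to the half-line, since \<open>T\<close> is controlled there only.\<close>

lemma T_pairing_derivative:
  assumes uv: "(u, v) \<in> max_op a b c" and \<psi>: "\<psi> \<in> trig_span u0" and s: "s \<ge> 0"
  shows "((\<lambda>s. distr_of (T s u) \<psi>) has_vector_derivative - distr_of (T s v) \<psi>) (at s within {0..})"
  using \<psi>
proof (induction rule: trig_span.induct)
  case (wave \<xi>)
  have u: "u \<in> L2" and v: "v \<in> L2" using uv by (auto simp: max_op_def)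
  have EE: "dual.E \<xi> = (\<lambda>x. u0 x * wave \<xi> x)" by (simp add: dual.E_def)
  have eq: "distr_of (T t w) (dual.E \<xi>) = distr_of w (\<lambda>x. of_real (dual.e \<xi> t) * dual.E (dual.r t \<xi>) x)" if "t \<ge> 0" "w \<in> L2" for t w
    using T_transposed[OF that dual.E_L2] that by (simp add: dual.T_E)
  have "distr_of u (\<lambda>x. of_real (dual.e \<xi> s) * diff_op a b c (dual.E (dual.r s \<xi>)) x) = distr_of (T s v) (dual.E \<xi>)"
    unfolding eq[OF s v] distr_of_scale_right using max_op_gexp[OF uv] by (simp add: dual.E_gexp)
  with has_vector_derivative_at_within[OF dual.pairing_path_derivative[OF u, of \<xi> s], of "{0..}"]
  have "((\<lambda>t. distr_of u (\<lambda>x. of_real (dual.e \<xi> t) * dual.E (dual.r t \<xi>) x)) has_vector_derivative - distr_of (T s v) (dual.E \<xi>)) (at s within {0..})"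
    by simp
  then have "((\<lambda>s. distr_of (T s u) (dual.E \<xi>)) has_vector_derivative - distr_of (T s v) (dual.E \<xi>)) (at s within {0..})"
    by (rule has_vector_derivative_transform[rotated 2]) (use s eq u in auto)
  then show ?case unfolding EE .
next
  case (lincomb f g \<alpha> \<beta>)
  have u: "u \<in> L2" and v: "v \<in> L2" using uv by (auto simp: max_op_def)
  have fg: "f \<in> L2" "g \<in> L2" using L2_denseD(1)[OF L2_dense_trig_span[OF u0_L2 u0_nz]] lincomb by auto
  have TL: "T t w \<in> L2" if "t \<ge> 0" "w \<in> L2" for t w using contraction_opD(1)[OF T_contraction] that by auto
  have "((\<lambda>s. \<alpha> * distr_of (T s u) f + \<beta> * distr_of (T s u) g) has_vector_derivative
     \<alpha> * - distr_of (T s v) f + \<beta> * - distr_of (T s v) g) (at s within {0..})"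
    by (intro has_vector_derivative_add has_vector_derivative_mult_right lincomb)
  then have "((\<lambda>s. distr_of (T s u) (\<lambda>x. \<alpha> * f x + \<beta> * g x)) has_vector_derivative \<alpha> * - distr_of (T s v) f + \<beta> * - distr_of (T s v) g) (at s within {0..})"
    by (rule has_vector_derivative_transform[rotated 2]) (use s in \<open>auto simp: distr_of_lincomb_right fg TL u\<close>)
  then show ?case by (simp add: distr_of_lincomb_right fg TL s v)
qed

text \<open>The difference quotient plus \<open>v\<close>, tested against \<psi>, is estimated by
  the mean value inequality. Strong continuity of the orbit of \<open>v\<close> makes the bound a
  small multiple of the norm of \<psi>, with a time step independent of \<psi>. Weak
  differentiability on a dense span thus becomes convergence in norm.\<close>

lemma max_op_generator:
  assumes uv: "(u, v) \<in> max_op a b c"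
  shows "(u, \<lambda>x. - v x) \<in> generator T"
proof -
  have u: "u \<in> L2" and v: "v \<in> L2" using uv by (auto simp: max_op_def)
  note D = L2_dense_trig_span[OF u0_L2 u0_nz]
  have TL: "T t w \<in> L2" if "t \<ge> 0" "w \<in> L2" for t w using contraction_opD(1)[OF T_contraction] that by auto
  have "((\<lambda>h. L2_norm (\<lambda>x. (T h u x - u x) / complex_of_real h - - v x)) \<longlongrightarrow> 0) (at_right 0)"
  proof (rule tendstoI)
    fix \<epsilon> :: real assume \<epsilon>: "\<epsilon> > 0"
    have "eventually (\<lambda>t. L2_norm (\<lambda>x. T t v x - v x) < \<epsilon> / 2) (at_right 0)"
      using order_tendstoD(2)[OF T_tendsto[OF v], of "\<epsilon>/2"] \<epsilon> by simp
    then obtain \<delta> where \<delta>: "\<delta> > 0" "\<And>t. 0 < t \<Longrightarrow> t < \<delta> \<Longrightarrow> L2_norm (\<lambda>x. T t v x - v x) < \<epsilon> / 2"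
      by (auto simp: eventually_at_right_field)
    have main: "L2_norm (\<lambda>x. (T h u x - u x) / complex_of_real h - - v x) \<le> \<epsilon> / 2" if h: "0 < h" "h < \<delta>" for h
    proof (rule L2_norm_le_of_pairing[OF D])
      show "(\<lambda>x. (T h u x - u x) / complex_of_real h - - v x) \<in> L2"
        by (intro L2_diff L2_divide L2_uminus TL u v) (use h in auto)
      fix \<psi> assume \<psi>: "\<psi> \<in> trig_span u0"
      have \<psi>L: "\<psi> \<in> L2" using L2_denseD(1)[OF D \<psi>] .
      \<comment> \<open>The linear term subtracts the expected derivative: the derivative of
        \<open>g\<close> is the pairing of \<open>v - T s v\<close> with \<psi>.\<close>
      define g where "g s = distr_of (T s u) \<psi> + of_real s * distr_of v \<psi>" for s
      have dg: "(g has_vector_derivative (- distr_of (T s v) \<psi> + distr_of v \<psi>)) (at s within {0..h})" if "s \<in> {0..h}" for s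
      proof -
        have "((\<lambda>s. complex_of_real s * distr_of v \<psi>) has_vector_derivative 1 * distr_of v \<psi>) (at s within {0..h})"
          by (auto intro!: derivative_eq_intros simp: has_vector_derivative_def scaleR_conv_of_real)
        moreover have "((\<lambda>s. distr_of (T s u) \<psi>) has_vector_derivative - distr_of (T s v) \<psi>) (at s within {0..h})"
          by (rule has_vector_derivative_within_subset[OF T_pairing_derivative[OF uv \<psi>]]) (use that in auto)
        ultimately show ?thesis unfolding g_def using has_vector_derivative_add by fastforce
      qed
      have "norm (g h - g 0) \<le> (\<epsilon> / 2 * L2_norm \<psi>) * norm (h - 0)"
      proof (rule differentiable_bound[where S="{0..h}" and f'="\<lambda>s t. t *\<^sub>R (- distr_of (T s v) \<psi> + distr_of v \<psi>)"])
        fix s assume s: "s \<in> {0..h}"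
        show "(g has_derivative (\<lambda>t. t *\<^sub>R (- distr_of (T s v) \<psi> + distr_of v \<psi>))) (at s within {0..h})"
          using dg[OF s] by (simp add: has_vector_derivative_def)
        have "L2_norm (\<lambda>x. T s v x - v x) \<le> \<epsilon> / 2"
        proof (cases "s = 0")
          case True
          have "L2_norm (\<lambda>x. T 0 v x - v x) = 0"
            using L2_norm_cong_AE[of "\<lambda>x. T 0 v x - v x" "\<lambda>x. 0"] T_0[OF v] L2D(1)[OF L2_diff[OF TL[of 0 v] v]] v by auto
          then show ?thesis using True \<epsilon> by simp
        qed (use \<delta>(2)[of s] s h in auto)
        then have "norm (distr_of (T s v) \<psi> - distr_of v \<psi>) \<le> \<epsilon> / 2 * L2_norm \<psi>"
          by (intro order_trans[OF distr_of_norm_diff] mult_right_mono TL v \<psi>L) (use s in auto)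
        then have "norm (- distr_of (T s v) \<psi> + distr_of v \<psi>) \<le> \<epsilon> / 2 * L2_norm \<psi>"
          by (metis add.commute norm_minus_commute uminus_add_conv_diff)
        then show "onorm (\<lambda>t. t *\<^sub>R (- distr_of (T s v) \<psi> + distr_of v \<psi>)) \<le> \<epsilon> / 2 * L2_norm \<psi>"
          by (simp add: onorm_scaleR_left onorm_id)
      qed (use h in auto)
      then have gb: "norm (g h - g 0) / h \<le> \<epsilon> / 2 * L2_norm \<psi>" using h by (simp add: divide_le_eq)
      have "distr_of (\<lambda>x. (T h u x - u x) / complex_of_real h - - v x) \<psi> = (g h - g 0) / of_real h"
      proof -
        have "(\<lambda>x. (T h u x - u x) / complex_of_real h - - v x) = (\<lambda>x. inverse (of_real h) * (T h u x - u x) + 1 * v x)"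
          by (simp add: divide_inverse mult.commute)
        moreover have "distr_of (T 0 u) \<psi> = distr_of u \<psi>"
          by (rule distr_of_cong_AE) (use T_0[OF u] TL[of 0 u] u \<psi>L in auto)
        ultimately show ?thesis using h
          by (simp only: distr_of_lincomb_left[OF L2_diff[OF TL[OF less_imp_le[OF h(1)] u] u] v \<psi>L]
              distr_of_diff_left[OF TL[OF less_imp_le[OF h(1)] u] u \<psi>L] g_def) (simp add: field_simps)
      qed
      from this show "norm (distr_of (\<lambda>x. (T h u x - u x) / complex_of_real h - - v x) \<psi>) \<le> \<epsilon> / 2 * L2_norm \<psi>"
        using h gb by (simp only: norm_divide norm_of_real abs_of_pos)
    qed (use \<epsilon> in simp)
    show "eventually (\<lambda>h. dist (L2_norm (\<lambda>x. (T h u x - u x) / complex_of_real h - - v x)) 0 < \<epsilon>) (at_right 0)"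
      unfolding eventually_at_right_field
      by (rule exI[of _ \<delta>]) (use main \<delta>(1) \<epsilon> in \<open>fastforce simp del: diff_minus_eq_add\<close>)
  qed
  then show ?thesis unfolding generator_def using u L2_uminus[OF v] by simp
qed

end

section \<open>Identification of the generator with the maximal operator\<close>

context ou_pair
begin

lemma swapped: "ou_pair G N' N \<mu> a (\<lambda>j k. - b j k) c"
proof -
  have "(\<lambda>j k. - (- b j k)) = b" by simp
  then show ?thesis
    using dual.ou_axioms ou_axioms
    by (auto intro!: ou_pair.intro ou_pair_axioms.intro c_sym simp: transposed[symmetric] K_commute)
qed

text \<open>A test function lies in the domain of the transposed maximal operator, so the dual
  semigroup is differentiable on it by the inclusion already proved, applied to the exchanged pair.
  The same difference quotient then has two limits, one through \<open>u\<close> and one through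
  \<phi>, and their equality is the distributional equation.\<close>

lemma generator_max_op:
  assumes uw: "(u, w) \<in> generator T"
  shows "(u, \<lambda>x. - w x) \<in> max_op a b c"
proof -
  have u: "u \<in> L2" and w: "w \<in> L2"
    and lim: "((\<lambda>h. L2_norm (\<lambda>x. (T h u x - u x) / complex_of_real h - w x)) \<longlongrightarrow> 0) (at_right 0)"
    using uw by (auto simp: generator_def)
  have TL: "T t v \<in> L2" "dual.T t v \<in> L2" if "t \<ge> 0" "v \<in> L2" for t v
    using contraction_opD(1)[OF T_contraction] contraction_opD(1)[OF dual.T_contraction] that by auto
  have "distr_of u (diff_op a b c \<phi>) = distr_of (\<lambda>x. - w x) \<phi>" if \<phi>: "test_fun \<phi>" for \<phi>
  proof -
    define p where "p = diff_op a b c \<phi>"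
    have \<phi>L: "\<phi> \<in> L2" and pL: "p \<in> L2" unfolding p_def by (intro test_fun_L2 test_diff_op \<phi>)+
    have "(\<phi>, p) \<in> max_op a (\<lambda>j k. - b j k) c"
      using test_fun_max_op[OF \<phi> c_sym, of a "\<lambda>j k. - b j k"] by (simp add: p_def)
    from ou_pair.max_op_generator[OF swapped this]
    have lim2: "((\<lambda>h. L2_norm (\<lambda>x. (dual.T h \<phi> x - \<phi> x) / complex_of_real h - - p x)) \<longlongrightarrow> 0) (at_right 0)"
      by (simp add: generator_def)
    let ?q = "\<lambda>h. distr_of (\<lambda>x. (T h u x - u x) / complex_of_real h) \<phi>"
    have q: "?q h = distr_of u (\<lambda>x. (dual.T h \<phi> x - \<phi> x) / complex_of_real h)" if h: "h > 0" for h
    proof -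
      have "?q h = distr_of (\<lambda>x. inverse (of_real h) * (T h u x - u x)) \<phi>" by (simp add: divide_inverse mult.commute)
      also have "\<dots> = inverse (of_real h) * (distr_of (T h u) \<phi> - distr_of u \<phi>)"
        unfolding distr_of_scale_left by (subst distr_of_diff_left) (auto intro!: TL u \<phi>L less_imp_le h)
      also have "\<dots> = inverse (of_real h) * (distr_of u (dual.T h \<phi>) - distr_of u \<phi>)"
        using T_transposed[OF less_imp_le[OF h] u \<phi>L] by simp
      also have "\<dots> = distr_of u (\<lambda>x. inverse (of_real h) * (dual.T h \<phi> x - \<phi> x))"
        unfolding distr_of_scale_right by (subst distr_of_diff_right) (auto intro!: TL u \<phi>L less_imp_le h)
      finally show ?thesis by (simp add: divide_inverse mult.commute)
    qed
    have "((\<lambda>h. ?q h - distr_of w \<phi>) \<longlongrightarrow> 0) (at_right 0)"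
    proof (rule Lim_null_comparison)
      show "eventually (\<lambda>h. norm (?q h - distr_of w \<phi>) \<le> L2_norm (\<lambda>x. (T h u x - u x) / complex_of_real h - w x) * L2_norm \<phi>) (at_right 0)"
        using eventually_at_right_less[of 0]
        by eventually_elim (intro distr_of_norm_diff L2_divide L2_diff TL u w \<phi>L less_imp_le)
      show "((\<lambda>h. L2_norm (\<lambda>x. (T h u x - u x) / complex_of_real h - w x) * L2_norm \<phi>) \<longlongrightarrow> 0) (at_right 0)"
        using tendsto_mult_right[OF lim, of "L2_norm \<phi>"] by simp
    qed
    then have 1: "(?q \<longlongrightarrow> distr_of w \<phi>) (at_right 0)" by (rule LIM_zero_cancel)
    have "((\<lambda>h. ?q h - distr_of u (\<lambda>x. - p x)) \<longlongrightarrow> 0) (at_right 0)"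
    proof (rule Lim_null_comparison)
      show "eventually (\<lambda>h. norm (?q h - distr_of u (\<lambda>x. - p x)) \<le> L2_norm (\<lambda>x. (dual.T h \<phi> x - \<phi> x) / complex_of_real h - - p x) * L2_norm u) (at_right 0)"
        using eventually_at_right_less[of 0]
      proof eventually_elim
        case (elim h)
        show ?case unfolding q[OF elim] distr_of_commute[of u]
          by (intro distr_of_norm_diff L2_divide L2_diff L2_uminus TL u pL \<phi>L less_imp_le elim)
      qed
      show "((\<lambda>h. L2_norm (\<lambda>x. (dual.T h \<phi> x - \<phi> x) / complex_of_real h - - p x) * L2_norm u) \<longlongrightarrow> 0) (at_right 0)"
        using tendsto_mult_right[OF lim2, of "L2_norm u"] by simp
    qed
    then have 2: "(?q \<longlongrightarrow> distr_of u (\<lambda>x. - p x)) (at_right 0)" by (rule LIM_zero_cancel)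
    have "distr_of w \<phi> = distr_of u (\<lambda>x. - p x)" by (rule tendsto_unique[OF _ 1 2]) simp
    then show ?thesis
      using distr_of_scale_left[of "-1" w \<phi>] distr_of_scale_right[of u "-1" p] by (simp add: p_def)
  qed
  then show ?thesis using u L2_uminus[OF w] by (simp add: max_op_def)
qed

theorem generator_eq: "generator T = {(u, \<lambda>x. - v x) |u v. (u, v) \<in> max_op a b c}"
proof (intro set_eqI iffI)
  fix p assume "p \<in> generator T"
  then obtain u w where p: "p = (u, w)" "(u, w) \<in> generator T" by (cases p) auto
  then show "p \<in> {(u, \<lambda>x. - v x) |u v. (u, v) \<in> max_op a b c}"
    using generator_max_op[OF p(2)] by (intro CollectI exI[of _ u] exI[of _ "\<lambda>x. - w x"]) auto
qed (use max_op_generator in auto)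

end

section \<open>Uniqueness of the semigroup with a given generator\<close>

text \<open>Generators only provide right derivatives. The estimate \<open>e * r\<close> is
  propagated along the interval by a supremum argument: left continuity carries it to the supremum,
  the right derivative beyond it.\<close>

lemma right_derivative_zero_const:
  fixes f :: "real \<Rightarrow> real"
  assumes right: "\<And>s e. 0 \<le> s \<Longrightarrow> s < t \<Longrightarrow> e > 0 \<Longrightarrow> \<exists>d>0. \<forall>h. 0 < h \<and> h < d \<and> s + h \<le> t \<longrightarrow> \<bar>f (s + h) - f s\<bar> \<le> e * h"
    and left: "\<And>s e. 0 < s \<Longrightarrow> s \<le> t \<Longrightarrow> e > 0 \<Longrightarrow> \<exists>d>0. \<forall>h. 0 < h \<and> h < d \<and> h \<le> s \<longrightarrow> \<bar>f s - f (s - h)\<bar> \<le> e"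
    and t: "t \<ge> 0"
  shows "f t = f 0"
proof -
  have main: "\<bar>f t - f 0\<bar> \<le> e * t" if e: "e > 0" for e
  proof -
    define A where "A = {s \<in> {0..t}. \<forall>r\<in>{0..s}. \<bar>f r - f 0\<bar> \<le> e * r}"
    have A0: "0 \<in> A" using t by (simp add: A_def)
    have bA: "bdd_above A" by (rule bdd_aboveI[of _ t]) (simp add: A_def)
    define m where "m = Sup A"
    have m: "0 \<le> m" "m \<le> t"
    proof -
      show "0 \<le> m" unfolding m_def by (rule cSup_upper[OF A0 bA])
      show "m \<le> t" unfolding m_def by (rule cSup_least) (use A0 in \<open>auto simp: A_def\<close>)
    qed
    have below: "\<bar>f r - f 0\<bar> \<le> e * r" if r: "0 \<le> r" "r < m" for r
    proof -
      obtain s where "s \<in> A" "r < s" using less_cSupD[of A r] A0 r by (auto simp: m_def)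
      then show ?thesis using r by (simp add: A_def)
    qed
    have at: "\<bar>f m - f 0\<bar> \<le> e * m"
    proof (cases "m = 0")
      case False
      then have mp: "m > 0" using m by simp
      show ?thesis
      proof (rule field_le_epsilon)
        fix \<epsilon> :: real assume "\<epsilon> > 0"
        from left[OF mp m(2) this] obtain d where d: "d > 0" "\<And>h. 0 < h \<Longrightarrow> h < d \<Longrightarrow> h \<le> m \<Longrightarrow> \<bar>f m - f (m - h)\<bar> \<le> \<epsilon>" by blast
        define h where "h = min (d / 2) m"
        have h: "0 < h" "h < d" "h \<le> m" using d mp by (auto simp: h_def)
        have "\<bar>f (m - h) - f 0\<bar> \<le> e * (m - h)" by (rule below) (use h in auto)
        also have "\<dots> \<le> e * m" using e h by (intro mult_left_mono) auto
        finally show "\<bar>f m - f 0\<bar> \<le> e * m + \<epsilon>" using d(2)[OF h] by linarith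
      qed
    qed simp
    have "m = t"
    proof (rule ccontr)
      assume "m \<noteq> t"
      then have mt: "m < t" using m by simp
      from right[OF m(1) mt e] obtain d where d: "d > 0" "\<And>h. 0 < h \<Longrightarrow> h < d \<Longrightarrow> m + h \<le> t \<Longrightarrow> \<bar>f (m + h) - f m\<bar> \<le> e * h" by blast
      define h where "h = min (d / 2) (t - m)"
      have h: "0 < h" "h < d" "m + h \<le> t" using d mt by (auto simp: h_def)
      have "\<bar>f r - f 0\<bar> \<le> e * r" if r: "r \<in> {0..m + h}" for r
      proof -
        consider "r < m" | "r = m" | "r > m" by linarith
        then show ?thesis
        proof cases
          case 3
          have "\<bar>f (m + (r - m)) - f m\<bar> \<le> e * (r - m)" by (rule d(2)) (use r 3 h in auto)
          then have "\<bar>f r - f 0\<bar> \<le> e * (r - m) + e * m" using at by simp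
          then show ?thesis by (simp add: algebra_simps)
        qed (use below r at in auto)
      qed
      then have "m + h \<in> A" using h m by (simp add: A_def)
      then have "m + h \<le> m" unfolding m_def using bA by (rule cSup_upper)
      then show False using h by simp
    qed
    then show ?thesis using at by simp
  qed
  have "\<bar>f t - f 0\<bar> \<le> 0"
  proof (rule field_le_epsilon)
    fix e :: real assume e: "e > 0"
    have "\<bar>f t - f 0\<bar> \<le> (e / (t + 1)) * t" using main[of "e / (t + 1)"] e t by simp
    also have "\<dots> \<le> e" using e t by (simp add: field_simps)
    finally show "\<bar>f t - f 0\<bar> \<le> 0 + e" by simp
  qed
  then show ?thesis by simp
qed

lemma contraction_semigroupD:
  assumes "contraction_semigroup T"
  shows "t \<ge> 0 \<Longrightarrow> contraction_op (T t)" "u \<in> L2 \<Longrightarrow> AE x in lborel. T 0 u x = u x"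
    "s \<ge> 0 \<Longrightarrow> t \<ge> 0 \<Longrightarrow> u \<in> L2 \<Longrightarrow> AE x in lborel. T (s + t) u x = T s (T t u) x"
    "u \<in> L2 \<Longrightarrow> ((\<lambda>t. L2_norm (\<lambda>x. T t u x - u x)) \<longlongrightarrow> 0) (at_right 0)"
  using assms unfolding contraction_semigroup_def contraction_op_def by blast+

lemma L2_norm_diff_cong_AE:
  assumes "AE x in lborel. u x = u' x" "AE x in lborel. v x = v' x" "u \<in> L2" "u' \<in> L2" "v \<in> L2" "v' \<in> L2"
  shows "L2_norm (\<lambda>x. u x - v x) = L2_norm (\<lambda>x. u' x - v' x)"
  by (rule L2_norm_cong_AE) (use assms in \<open>auto intro!: L2D(1) L2_diff\<close>)

lemma semigroup_increment:
  assumes S: "contraction_semigroup S" and s: "s \<ge> 0" and h: "h \<ge> 0" and u: "u \<in> L2"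
  shows "L2_norm (\<lambda>x. S (s + h) u x - S s u x) \<le> L2_norm (\<lambda>x. S h u x - u x)"
proof -
  note C = contraction_semigroupD(1)[OF S] and L = contraction_opD(1)[OF contraction_semigroupD(1)[OF S]]
  have "L2_norm (\<lambda>x. S (s + h) u x - S s u x) = L2_norm (\<lambda>x. S s (S h u) x - S s u x)"
    by (rule L2_norm_diff_cong_AE[OF contraction_semigroupD(3)[OF S s h u]]) (auto intro!: L s h u add_nonneg_nonneg)
  also have "\<dots> \<le> L2_norm (\<lambda>x. S h u x - u x)" by (rule contraction_op_diff[OF C[OF s] L[OF h u] u])
  finally show ?thesis .
qed

lemma generator_invariant:
  assumes S: "contraction_semigroup S" and uv: "(u, v) \<in> generator S" and s: "s \<ge> 0"
  shows "(S s u, S s v) \<in> generator S"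
proof -
  note C = contraction_semigroupD(1)[OF S] and L = contraction_opD(1)[OF contraction_semigroupD(1)[OF S]]
  have u: "u \<in> L2" and v: "v \<in> L2"
    and lim: "((\<lambda>h. L2_norm (\<lambda>x. (S h u x - u x) / complex_of_real h - v x)) \<longlongrightarrow> 0) (at_right 0)"
    using uv by (auto simp: generator_def)
  have "((\<lambda>h. L2_norm (\<lambda>x. (S h (S s u) x - S s u x) / complex_of_real h - S s v x)) \<longlongrightarrow> 0) (at_right 0)"
  proof (rule Lim_null_comparison[OF _ lim])
    show "eventually (\<lambda>h. norm (L2_norm (\<lambda>x. (S h (S s u) x - S s u x) / complex_of_real h - S s v x))
      \<le> L2_norm (\<lambda>x. (S h u x - u x) / complex_of_real h - v x)) (at_right 0)"
      using eventually_at_right_less[of 0]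
    proof eventually_elim
      case (elim h)
      then have h: "h \<ge> 0" by simp
      define w where "w = (\<lambda>x. inverse (complex_of_real h) * S h u x + (- inverse (of_real h)) * u x)"
      have w: "w \<in> L2" unfolding w_def by (intro L2_lincomb L h u)
      have we: "(\<lambda>x. (S h u x - u x) / complex_of_real h - v x) = (\<lambda>x. w x - v x)"
        by (simp add: w_def divide_inverse algebra_simps)
      have "AE x in lborel. S s w x = inverse (complex_of_real h) * S s (S h u) x + (- inverse (of_real h)) * S s u x"
        unfolding w_def by (rule contraction_opD(3)[OF C[OF s] L[OF h u] u])
      moreover have "AE x in lborel. S (h + s) u x = S h (S s u) x" by (rule contraction_semigroupD(3)[OF S h s u])
      moreover have "AE x in lborel. S (s + h) u x = S s (S h u) x" by (rule contraction_semigroupD(3)[OF S s h u])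
      ultimately have ae: "AE x in lborel. (S h (S s u) x - S s u x) / complex_of_real h = S s w x"
        by eventually_elim (simp add: divide_inverse algebra_simps)
      have "L2_norm (\<lambda>x. (S h (S s u) x - S s u x) / complex_of_real h - S s v x) = L2_norm (\<lambda>x. S s w x - S s v x)"
        by (rule L2_norm_diff_cong_AE[OF ae]) (auto intro!: L L2_divide L2_diff s h u v w)
      also have "\<dots> \<le> L2_norm (\<lambda>x. w x - v x)" by (rule contraction_op_diff[OF C[OF s] w v])
      finally show ?case by (simp add: we)
    qed
  qed
  then show ?thesis using L[OF s u] L[OF s v] by (simp add: generator_def)
qed

lemma eventually_at_right_0_obtain:
  assumes "((f :: real \<Rightarrow> real) \<longlongrightarrow> 0) (at_right 0)" "e > 0"
  obtains d where "d > 0" "\<And>h. 0 < h \<Longrightarrow> h < d \<Longrightarrow> f h < e"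
  using order_tendstoD(2)[OF assms] unfolding eventually_at_right_field by blast

text \<open>For \<open>u\<close> in the domain, \<open>W s = T (t - s) (S s u)\<close> joins the two
  candidates. Its right derivative vanishes because \<open>S s u\<close> stays in the domain, where
  both semigroups have the same derivative. The scalar function \<open>f\<close> measures the
  distance to \<open>W 0\<close>, so that a real-variable lemma applies.\<close>

theorem contraction_semigroup_unique:
  assumes S: "contraction_semigroup S" and T: "contraction_semigroup T"
    and gen: "generator T = generator S"
    and D: "L2_dense D" and dom: "\<And>u. u \<in> D \<Longrightarrow> \<exists>v. (u, v) \<in> generator S"
    and t: "t \<ge> 0" and u: "u \<in> L2"
  shows "AE x in lborel. T t u x = S t u x"
proof -
  note SC = contraction_semigroupD(1)[OF S] and SL = contraction_opD(1)[OF contraction_semigroupD(1)[OF S]]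
  note TC = contraction_semigroupD(1)[OF T] and TL = contraction_opD(1)[OF contraction_semigroupD(1)[OF T]]
  have core: "AE x in lborel. T t u x = S t u x" if uv: "(u, v) \<in> generator S" for u v
  proof -
    have u: "u \<in> L2" and v: "v \<in> L2" using uv by (auto simp: generator_def)
    define W where "W s = T (t - s) (S s u)" for s
    have WL: "W s \<in> L2" if "0 \<le> s" "s \<le> t" for s unfolding W_def by (intro TL SL u) (use that in auto)
    define f where "f s = L2_norm (\<lambda>x. W s x - W 0 x)" for s
    \<comment> \<open>\<open>W (s + h)\<close> and \<open>W s\<close> differ by the contraction
      \<open>T (t - (s + h))\<close> applied to the difference of \<open>S h\<close> and
      \<open>T h\<close> on \<open>S s u\<close>.\<close>
    have inc: "\<bar>f (s + h) - f s\<bar> \<le> L2_norm (\<lambda>x. S h (S s u) x - T h (S s u) x)" if s: "0 \<le> s" and h: "0 \<le> h" "s + h \<le> t" for s h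
    proof -
      have \<psi>: "S s u \<in> L2" by (rule SL[OF s u])
      have "\<bar>f (s + h) - f s\<bar> \<le> L2_norm (\<lambda>x. (W (s + h) x - W 0 x) - (W s x - W 0 x))"
        unfolding f_def by (rule L2_norm_triangle_rev) (intro L2_diff WL; use s h in simp)+
      also have "\<dots> = L2_norm (\<lambda>x. W (s + h) x - W s x)" by simp
      also have "\<dots> = L2_norm (\<lambda>x. T (t - (s + h)) (S h (S s u)) x - T (t - (s + h)) (T h (S s u)) x)"
      proof (rule L2_norm_diff_cong_AE)
        have "AE x in lborel. S (h + s) u x = S h (S s u) x" by (rule contraction_semigroupD(3)[OF S h(1) s u])
        then show "AE x in lborel. W (s + h) x = T (t - (s + h)) (S h (S s u)) x"
          unfolding W_def by (intro contraction_op_cong_AE[OF TC] SL u \<psi> h) (use s h in \<open>auto simp: add.commute\<close>)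
        have "AE x in lborel. T ((t - (s + h)) + h) (S s u) x = T (t - (s + h)) (T h (S s u)) x"
          by (rule contraction_semigroupD(3)[OF T _ h(1) \<psi>]) (use h in simp)
        then show "AE x in lborel. W s x = T (t - (s + h)) (T h (S s u)) x" by (simp add: W_def)
      qed (intro WL TL SL u; use s h in simp)+
      also have "\<dots> \<le> L2_norm (\<lambda>x. S h (S s u) x - T h (S s u) x)"
        by (rule contraction_op_diff[OF TC SL[OF h(1) \<psi>] TL[OF h(1) \<psi>]]) (use h in simp)
      finally show ?thesis .
    qed
    have "f t = f 0"
    proof (rule right_derivative_zero_const[OF _ _ t])
      fix s e :: real assume s: "0 \<le> s" "s < t" and e: "e > 0"
      define \<psi> w where "\<psi> = S s u" and "w = S s v"
      have \<psi>: "\<psi> \<in> L2" and w: "w \<in> L2" unfolding \<psi>_def w_def using SL s u v by auto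
      have gw: "(\<psi>, w) \<in> generator S" unfolding \<psi>_def w_def by (rule generator_invariant[OF S uv s(1)])
      then have limS: "((\<lambda>h. L2_norm (\<lambda>x. (S h \<psi> x - \<psi> x) / complex_of_real h - w x)) \<longlongrightarrow> 0) (at_right 0)"
        by (simp add: generator_def)
      from gw have limT: "((\<lambda>h. L2_norm (\<lambda>x. (T h \<psi> x - \<psi> x) / complex_of_real h - w x)) \<longlongrightarrow> 0) (at_right 0)"
        unfolding gen[symmetric] by (simp add: generator_def)
      obtain d1 where d1: "d1 > 0" "\<And>h. 0 < h \<Longrightarrow> h < d1 \<Longrightarrow> L2_norm (\<lambda>x. (S h \<psi> x - \<psi> x) / complex_of_real h - w x) < e / 2"
        using eventually_at_right_0_obtain[OF limS, of "e/2"] e by auto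
      obtain d2 where d2: "d2 > 0" "\<And>h. 0 < h \<Longrightarrow> h < d2 \<Longrightarrow> L2_norm (\<lambda>x. (T h \<psi> x - \<psi> x) / complex_of_real h - w x) < e / 2"
        using eventually_at_right_0_obtain[OF limT, of "e/2"] e by auto
      have "\<bar>f (s + h) - f s\<bar> \<le> e * h" if h: "0 < h" "h < min d1 d2" "s + h \<le> t" for h
      proof -
        have Lq: "S h \<psi> \<in> L2" "T h \<psi> \<in> L2" using SL TL \<psi> h by auto
        have "\<bar>f (s + h) - f s\<bar> \<le> L2_norm (\<lambda>x. S h \<psi> x - T h \<psi> x)"
          unfolding \<psi>_def by (rule inc) (use s h in auto)
        also have "(\<lambda>x. S h \<psi> x - T h \<psi> x)
          = (\<lambda>x. of_real h * (((S h \<psi> x - \<psi> x) / complex_of_real h - w x) - ((T h \<psi> x - \<psi> x) / complex_of_real h - w x)))"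
          using h by (simp add: fun_eq_iff field_simps)
        also have "L2_norm \<dots> \<le> h * (e / 2 + e / 2)"
        proof -
          have "L2_norm (\<lambda>x. ((S h \<psi> x - \<psi> x) / complex_of_real h - w x) - ((T h \<psi> x - \<psi> x) / complex_of_real h - w x))
            \<le> L2_norm (\<lambda>x. (S h \<psi> x - \<psi> x) / complex_of_real h - w x) + L2_norm (\<lambda>x. (T h \<psi> x - \<psi> x) / complex_of_real h - w x)"
            by (rule L2_norm_triangle_minus) (intro L2_diff L2_divide Lq \<psi> w)+
          also have "\<dots> \<le> e / 2 + e / 2" using d1(2)[of h] d2(2)[of h] h by (intro add_mono) auto
          finally show ?thesis unfolding L2_norm_scale using h by (simp add: mult_left_mono)
        qed
        finally show ?thesis by (simp add: mult.commute)
      qed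
      then show "\<exists>d>0. \<forall>h. 0 < h \<and> h < d \<and> s + h \<le> t \<longrightarrow> \<bar>f (s + h) - f s\<bar> \<le> e * h"
        using d1(1) d2(1) by (intro exI[of _ "min d1 d2"]) auto
    next
      fix s e :: real assume s: "0 < s" "s \<le> t" and e: "e > 0"
      define \<psi> where "\<psi> = S s u"
      have \<psi>: "\<psi> \<in> L2" unfolding \<psi>_def using SL s u by auto
      obtain d1 where d1: "d1 > 0" "\<And>h. 0 < h \<Longrightarrow> h < d1 \<Longrightarrow> L2_norm (\<lambda>x. S h u x - u x) < e / 4"
        using eventually_at_right_0_obtain[OF contraction_semigroupD(4)[OF S u], of "e/4"] e by auto
      obtain d2 where d2: "d2 > 0" "\<And>h. 0 < h \<Longrightarrow> h < d2 \<Longrightarrow> L2_norm (\<lambda>x. T h \<psi> x - \<psi> x) < e / 4"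
        using eventually_at_right_0_obtain[OF contraction_semigroupD(4)[OF T \<psi>], of "e/4"] e by auto
      have "\<bar>f s - f (s - h)\<bar> \<le> e" if h: "0 < h" "h < min d1 d2" "h \<le> s" for h
      proof -
        define \<phi> where "\<phi> = S (s - h) u"
        have \<phi>: "\<phi> \<in> L2" unfolding \<phi>_def using SL h u by auto
        have Lq: "S h \<phi> \<in> L2" "T h \<phi> \<in> L2" "T h \<psi> \<in> L2" using SL TL \<psi> \<phi> h by auto
        have h0: "h \<ge> 0" "s - h \<ge> 0" using h by auto
        have pp: "L2_norm (\<lambda>x. \<psi> x - \<phi> x) \<le> L2_norm (\<lambda>x. S h u x - u x)"
          using semigroup_increment[OF S h0(2,1) u] by (simp add: \<psi>_def \<phi>_def)
        have "AE x in lborel. S (h + (s - h)) u x = S h \<phi> x" unfolding \<phi>_def by (rule contraction_semigroupD(3)[OF S h0 u])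
        then have "L2_norm (\<lambda>x. S h \<phi> x - \<phi> x) = L2_norm (\<lambda>x. \<psi> x - \<phi> x)"
          by (intro L2_norm_diff_cong_AE Lq \<phi> \<psi>) (auto simp: \<psi>_def)
        then have 1: "L2_norm (\<lambda>x. S h \<phi> x - \<phi> x) < e / 4" using pp d1(2)[of h] h by simp
        have 2: "L2_norm (\<lambda>x. \<psi> x - \<phi> x) < e / 4" using pp d1(2)[of h] h by simp
        have 3: "L2_norm (\<lambda>x. T h \<phi> x - T h \<psi> x) < e / 4"
          using contraction_op_diff[OF TC[OF h0(1)] \<phi> \<psi>] 2 by (simp add: L2_norm_minus_commute[of \<phi>])
        have 4: "L2_norm (\<lambda>x. T h \<psi> x - \<psi> x) < e / 4" using d2(2)[of h] h by simp
        have "\<bar>f ((s - h) + h) - f (s - h)\<bar> \<le> L2_norm (\<lambda>x. S h \<phi> x - T h \<phi> x)"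
          unfolding \<phi>_def by (rule inc) (use s h in auto)
        also have "\<dots> \<le> L2_norm (\<lambda>x. S h \<phi> x - \<phi> x) + L2_norm (\<lambda>x. \<phi> x - T h \<phi> x)"
          by (intro L2_norm_triangle_diff Lq \<phi>)
        also have "L2_norm (\<lambda>x. \<phi> x - T h \<phi> x) \<le> L2_norm (\<lambda>x. \<phi> x - \<psi> x) + L2_norm (\<lambda>x. \<psi> x - T h \<phi> x)"
          by (intro L2_norm_triangle_diff Lq \<phi> \<psi>)
        also have "L2_norm (\<lambda>x. \<psi> x - T h \<phi> x) \<le> L2_norm (\<lambda>x. \<psi> x - T h \<psi> x) + L2_norm (\<lambda>x. T h \<psi> x - T h \<phi> x)"
          by (intro L2_norm_triangle_diff Lq \<phi> \<psi>)
        finally show ?thesis using 1 2 3 4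
          by (simp add: L2_norm_minus_commute[of \<phi> \<psi>] L2_norm_minus_commute[of \<psi> "T h \<psi>"] L2_norm_minus_commute[of "T h \<psi>" "T h \<phi>"])
      qed
      then show "\<exists>d>0. \<forall>h. 0 < h \<and> h < d \<and> h \<le> s \<longrightarrow> \<bar>f s - f (s - h)\<bar> \<le> e"
        using d1(1) d2(1) by (intro exI[of _ "min d1 d2"]) auto
    qed
    then have z: "L2_norm (\<lambda>x. W t x - W 0 x) = 0" by (simp add: f_def)
    have "AE x in lborel. W t x - W 0 x = 0"
      by (rule L2_norm_eq_0_AE[OF L2_diff z]) (use WL t in auto)
    moreover have "AE x in lborel. W t x = S t u x"
      using contraction_semigroupD(2)[OF T SL[OF t u]] by (simp add: W_def)
    moreover have "AE x in lborel. W 0 x = T t u x"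
      unfolding W_def using contraction_op_cong_AE[OF TC[OF t] SL[of 0 u] u contraction_semigroupD(2)[OF S u]] u by simp
    ultimately show ?thesis by eventually_elim simp
  qed
  show ?thesis
  proof (rule L2_contractions_eq_AE[OF D, of "T t" "S t", OF _ _ _ _ _ u])
    show "AE x in lborel. T t w x = S t w x" if "w \<in> D" for w using dom[OF that] core by blast
  qed (use t in \<open>auto intro!: TL SL contraction_op_diff[OF TC] contraction_op_diff[OF SC]\<close>)
qed

section \<open>Decay towards the ground state\<close>

context gauss_weight
begin

text \<open>The noises of the three operators are chosen independently of each other, so the
  composition is not compared pointwise but on waves, where the exponents telescope.\<close>

lemma mehler_compose:
  assumes r: "K_contraction r" and s: "K_contraction s" and u: "u \<in> L2"
  shows "AE x in lborel. mehler s (mehler r u) x = mehler (\<lambda>\<xi>. s (r \<xi>)) u x"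
proof -
  have sr: "K_contraction (\<lambda>\<xi>. s (r \<xi>))"
    using r s linear_compose[of r s] unfolding K_contraction_def o_def by (meson order_trans)
  note C = contraction_op_mehler
  show ?thesis
  proof (rule contraction_op_eqI[OF u0_L2 u0_nz contraction_op_compose[OF C[OF s] C[OF r]] C[OF sr] _ u])
    fix \<xi>
    let ?c = "complex_of_real (exp (- (\<xi> \<bullet> K \<xi> - r \<xi> \<bullet> K (r \<xi>)) / 2))"
    let ?w = "\<lambda>x. u0 x * wave (r \<xi>) x"
    have ae: "AE x in lborel. mehler s (\<lambda>x. ?c * ?w x + 0 * ?w x) x = ?c * mehler s ?w x + 0 * mehler s ?w x"
      by (rule contraction_opD(3)[OF C[OF s] wave_L2 wave_L2])
    have "exp (- (\<xi> \<bullet> K \<xi> - r \<xi> \<bullet> K (r \<xi>)) / 2) * exp (- (r \<xi> \<bullet> K (r \<xi>) - s (r \<xi>) \<bullet> K (s (r \<xi>))) / 2)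
        = exp (- (\<xi> \<bullet> K \<xi> - s (r \<xi>) \<bullet> K (s (r \<xi>))) / 2)"
      unfolding exp_add[symmetric] by (simp add: field_simps)
    then have eq: "?c * complex_of_real (exp (- (r \<xi> \<bullet> K (r \<xi>) - s (r \<xi>) \<bullet> K (s (r \<xi>))) / 2))
        = complex_of_real (exp (- (\<xi> \<bullet> K \<xi> - s (r \<xi>) \<bullet> K (s (r \<xi>))) / 2))"
      by (metis of_real_mult)
    from ae show "AE x in lborel. mehler s (mehler r (\<lambda>y. u0 y * wave \<xi> y)) x = mehler (\<lambda>\<xi>. s (r \<xi>)) (\<lambda>y. u0 y * wave \<xi> y) x"
      unfolding mehler_wave[OF r] mehler_wave[OF sr] mehler_wave[OF s]
      unfolding eq[symmetric] mult.assoc by eventually_elim simp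
  qed
qed

section \<open>Scalings and their sharp norm off the ground state\<close>

definition sc :: "real \<Rightarrow> real^'n \<Rightarrow> real^'n" where "sc \<rho> \<xi> = \<rho> *\<^sub>R \<xi>"

lemma K_nonneg: "\<xi> \<bullet> K \<xi> \<ge> 0" by (rule pos_def_mapD(4)[OF K])

lemma sc_form: "sc \<rho> \<xi> \<bullet> K (sc \<rho> \<eta>) = \<rho>\<^sup>2 * (\<xi> \<bullet> K \<eta>)"
  by (simp add: sc_def K_simps power2_eq_square)

lemma sc_contraction:
  assumes "0 \<le> \<rho>" "\<rho> \<le> 1"
  shows "K_contraction (sc \<rho>)"
proof -
  have "\<rho>\<^sup>2 \<le> 1" using assms by (simp add: power_le_one)
  then have "\<rho>\<^sup>2 * (\<xi> \<bullet> K \<xi>) \<le> 1 * (\<xi> \<bullet> K \<xi>)" for \<xi> by (rule mult_right_mono) (rule K_nonneg)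
  moreover have "linear (sc \<rho>)" unfolding sc_def[abs_def] by (rule linear_scale_self)
  ultimately show ?thesis by (simp add: K_contraction_def sc_form)
qed

text \<open>Since \<open>mehler (sc 0)\<close> is the projection onto \<open>u0\<close>, \<open>\<Delta> \<rho>\<close> is symmetric and multiplicative in \<open>\<rho>\<close>.\<close>

definition \<Delta> :: "real \<Rightarrow> (real^'n \<Rightarrow> complex) \<Rightarrow> real^'n \<Rightarrow> complex" where
  "\<Delta> \<rho> u = (\<lambda>x. mehler (sc \<rho>) u x - mehler (sc 0) u x)"

lemma mehler_sc_compose:
  assumes "0 \<le> \<rho>" "\<rho> \<le> 1" "0 \<le> \<sigma>" "\<sigma> \<le> 1" "u \<in> L2"
  shows "AE x in lborel. mehler (sc \<rho>) (mehler (sc \<sigma>) u) x = mehler (sc (\<rho> * \<sigma>)) u x"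
proof -
  have "(\<lambda>\<xi>. sc \<rho> (sc \<sigma> \<xi>)) = sc (\<rho> * \<sigma>)" by (simp add: sc_def fun_eq_iff)
  then show ?thesis using mehler_compose[OF sc_contraction[of \<sigma>] sc_contraction[of \<rho>] assms(5)] assms by simp
qed

lemma \<Delta>_L2: "0 \<le> \<rho> \<Longrightarrow> \<rho> \<le> 1 \<Longrightarrow> u \<in> L2 \<Longrightarrow> \<Delta> \<rho> u \<in> L2"
  unfolding \<Delta>_def by (intro L2_diff mehler_bound sc_contraction) auto

lemma \<Delta>_lincomb:
  assumes \<rho>: "0 \<le> \<rho>" "\<rho> \<le> 1" and u: "u \<in> L2" "v \<in> L2"
  shows "AE x in lborel. \<Delta> \<rho> (\<lambda>y. a * u y + b * v y) x = a * \<Delta> \<rho> u x + b * \<Delta> \<rho> v x"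
proof -
  have C0: "contraction_op (mehler (sc 0))" by (intro contraction_op_mehler sc_contraction) auto
  from contraction_opD(3)[OF contraction_op_mehler[OF sc_contraction[OF \<rho>]] u, of a b]
    contraction_opD(3)[OF C0 u, of a b]
  show ?thesis by eventually_elim (simp add: \<Delta>_def algebra_simps)
qed

lemma \<Delta>_diff_le:
  assumes \<rho>: "0 \<le> \<rho>" "\<rho> \<le> 1" and u: "u \<in> L2" "v \<in> L2"
  shows "L2_norm (\<lambda>x. \<Delta> \<rho> u x - \<Delta> \<rho> v x) \<le> 2 * L2_norm (\<lambda>x. u x - v x)"
proof -
  note C1 = contraction_op_mehler[OF sc_contraction[OF \<rho>]]
  have C0: "contraction_op (mehler (sc 0))" by (intro contraction_op_mehler sc_contraction) auto
  have eq: "(\<lambda>x. \<Delta> \<rho> u x - \<Delta> \<rho> v x) = (\<lambda>x. (mehler (sc \<rho>) u x - mehler (sc \<rho>) v x) - (mehler (sc 0) u x - mehler (sc 0) v x))"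
    by (simp add: \<Delta>_def fun_eq_iff)
  have "L2_norm (\<lambda>x. \<Delta> \<rho> u x - \<Delta> \<rho> v x) \<le> L2_norm (\<lambda>x. mehler (sc \<rho>) u x - mehler (sc \<rho>) v x) + L2_norm (\<lambda>x. mehler (sc 0) u x - mehler (sc 0) v x)"
    unfolding eq by (intro L2_norm_triangle_minus L2_diff contraction_opD(1)[OF C1] contraction_opD(1)[OF C0] u)
  also have "\<dots> \<le> 2 * L2_norm (\<lambda>x. u x - v x)"
    using contraction_op_diff[OF C1 u] contraction_op_diff[OF C0 u] by simp
  finally show ?thesis .
qed

lemma \<Delta>_compose:
  assumes \<rho>: "0 \<le> \<rho>" "\<rho> \<le> 1" and u: "u \<in> L2"
  shows "AE x in lborel. \<Delta> \<rho> (\<Delta> \<rho> u) x = \<Delta> (\<rho> * \<rho>) u x"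
proof -
  have L: "mehler (sc \<rho>) u \<in> L2" "mehler (sc 0) u \<in> L2" using mehler_bound(1)[OF sc_contraction] \<rho> u by auto
  have C0: "contraction_op (mehler (sc 0))" by (intro contraction_op_mehler sc_contraction) auto
  have d: "\<Delta> \<rho> u = (\<lambda>x. 1 * mehler (sc \<rho>) u x + (-1) * mehler (sc 0) u x)" by (simp add: \<Delta>_def)
  have "AE x in lborel. mehler (sc \<rho>) (mehler (sc 0) u) x = mehler (sc 0) u x"
    "AE x in lborel. mehler (sc 0) (mehler (sc \<rho>) u) x = mehler (sc 0) u x"
    "AE x in lborel. mehler (sc 0) (mehler (sc 0) u) x = mehler (sc 0) u x"
    using mehler_sc_compose[OF \<rho>, of 0 u] mehler_sc_compose[of 0, OF _ _ \<rho> u] mehler_sc_compose[of 0 0 u] u by auto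
  with contraction_opD(3)[OF contraction_op_mehler[OF sc_contraction[OF \<rho>]] L, of 1 "-1", folded d]
    contraction_opD(3)[OF C0 L, of 1 "-1", folded d] mehler_sc_compose[OF \<rho> \<rho> u]
  show ?thesis by eventually_elim (simp add: \<Delta>_def)
qed

lemma mehler_sc_symmetric:
  assumes \<rho>: "0 \<le> \<rho>" "\<rho> \<le> 1" and u: "u \<in> L2" "v \<in> L2"
  shows "distr_of (mehler (sc \<rho>) u) v = distr_of u (mehler (sc \<rho>) v)"
proof (rule contraction_op_transposeI[OF u0_L2 u0_nz _ _ _ u])
  note C = contraction_op_mehler[OF sc_contraction[OF \<rho>]]
  show "contraction_op (mehler (sc \<rho>))" "contraction_op (mehler (sc \<rho>))" by (rule C)+
  fix \<xi> \<eta>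
  have g: "gauss K (\<xi> + \<eta>) = exp (- (\<xi> \<bullet> K \<xi>) / 2 - (\<eta> \<bullet> K \<eta>) / 2 - \<xi> \<bullet> K \<eta>)" for \<xi> \<eta>
    using K_commute[of \<eta> \<xi>] by (simp add: gauss_def K_simps inner_add_left inner_add_right field_simps)
  have "exp (- (\<xi> \<bullet> K \<xi> - sc \<rho> \<xi> \<bullet> K (sc \<rho> \<xi>)) / 2) * gauss K (sc \<rho> \<xi> + \<eta>)
      = exp (- (\<eta> \<bullet> K \<eta> - sc \<rho> \<eta> \<bullet> K (sc \<rho> \<eta>)) / 2) * gauss K (\<xi> + sc \<rho> \<eta>)"
    unfolding g exp_add[symmetric] by (simp add: sc_def K_simps field_simps)
  then have "complex_of_real (exp (- (\<xi> \<bullet> K \<xi> - sc \<rho> \<xi> \<bullet> K (sc \<rho> \<xi>)) / 2) * gauss K (sc \<rho> \<xi> + \<eta>))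
      = complex_of_real (exp (- (\<eta> \<bullet> K \<eta> - sc \<rho> \<eta> \<bullet> K (sc \<rho> \<eta>)) / 2) * gauss K (\<xi> + sc \<rho> \<eta>))"
    by simp
  then show "distr_of (mehler (sc \<rho>) (\<lambda>y. u0 y * wave \<xi> y)) (\<lambda>y. u0 y * wave \<eta> y) =
    distr_of (\<lambda>y. u0 y * wave \<xi> y) (mehler (sc \<rho>) (\<lambda>y. u0 y * wave \<eta> y))"
    unfolding mehler_wave[OF sc_contraction[OF \<rho>]] distr_of_scale_left distr_of_scale_right pairing_wave of_real_mult
    by (simp add: mult.left_commute)
qed

text \<open>\<Delta> \<rho> is symmetric for the pairing and commutes with conjugation, so the
  squared norm equals the pairing of its square, which is \<Delta> at \<rho>^2, with the conjugate
  of \<open>u\<close>; Cauchy-Schwarz finishes.\<close>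

lemma \<Delta>_log_convex:
  assumes \<rho>: "0 \<le> \<rho>" "\<rho> \<le> 1" and u: "u \<in> L2"
  shows "(L2_norm (\<Delta> \<rho> u))\<^sup>2 \<le> L2_norm (\<Delta> (\<rho> * \<rho>) u) * L2_norm u"
proof -
  have M: "mehler (sc \<rho>) v \<in> L2" "mehler (sc 0) v \<in> L2" if "v \<in> L2" for v
    using mehler_bound(1)[OF sc_contraction] \<rho> that by auto
  have sym: "distr_of (\<Delta> \<rho> v) w = distr_of v (\<Delta> \<rho> w)" if "v \<in> L2" "w \<in> L2" for v w
    unfolding \<Delta>_def using mehler_sc_symmetric[OF \<rho> that] mehler_sc_symmetric[of 0 v w] that
    by (simp add: distr_of_diff_left distr_of_diff_right M)
  have \<rho>2: "0 \<le> \<rho> * \<rho>" "\<rho> * \<rho> \<le> 1" using \<rho> by (auto simp: mult_le_one)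
  have "of_real ((L2_norm (\<Delta> \<rho> u))\<^sup>2) = distr_of (\<Delta> \<rho> u) (\<lambda>x. cnj (\<Delta> \<rho> u x))"
    by (rule distr_of_cnj_self[symmetric])
  also have "(\<lambda>x. cnj (\<Delta> \<rho> u x)) = \<Delta> \<rho> (\<lambda>x. cnj (u x))" by (simp add: \<Delta>_def mehler_cnj)
  also have "distr_of (\<Delta> \<rho> u) (\<Delta> \<rho> (\<lambda>x. cnj (u x))) = distr_of (\<Delta> \<rho> (\<Delta> \<rho> u)) (\<lambda>x. cnj (u x))"
    by (rule sym[symmetric]) (intro \<Delta>_L2 \<rho> u L2_cnj)+
  also have "\<dots> = distr_of (\<Delta> (\<rho> * \<rho>) u) (\<lambda>x. cnj (u x))"
    by (rule distr_of_cong_AE[OF \<Delta>_compose[OF \<rho> u]]) (auto intro!: \<Delta>_L2 \<rho> \<rho>2 u L2_cnj)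
  finally have "(L2_norm (\<Delta> \<rho> u))\<^sup>2 = norm (distr_of (\<Delta> (\<rho> * \<rho>) u) (\<lambda>x. cnj (u x)))"
    by (metis norm_of_real abs_of_nonneg zero_le_power2)
  also have "\<dots> \<le> L2_norm (\<Delta> (\<rho> * \<rho>) u) * L2_norm (\<lambda>x. cnj (u x))"
    by (intro distr_of_bound \<Delta>_L2 \<rho>2 u L2_cnj)
  finally show ?thesis by simp
qed

text \<open>A crude bound with a constant depending on \<open>u\<close>. On a wave, \<Delta> \<rho>
  consists of the difference between a wave of frequency \<rho> \<xi> and 1, at most \<rho> times
  the norms of \<xi> and \<open>x\<close>, and of the difference between two Gaussian factors, which
  is of order \<rho>^2.\<close>

lemma \<Delta>_trig_bound:
  assumes "u \<in> trig_span u0"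
  shows "\<exists>C\<ge>0. \<forall>\<rho>. 0 \<le> \<rho> \<and> \<rho> \<le> 1 \<longrightarrow> L2_norm (\<Delta> \<rho> u) \<le> C * \<rho>"
  using assms
proof (induction rule: trig_span.induct)
  case (wave \<xi>)
  define q where "q = \<xi> \<bullet> K \<xi>"
  have q: "q \<ge> 0" unfolding q_def by (rule K_nonneg)
  have nxL: "(\<lambda>x. of_real (norm x) * u0 x) \<in> L2"
  proof (rule poly_gauss_L2[OF G], unfold poly_gauss_def, intro conjI exI allI)
    show "norm (of_real (norm x) * u0 x) \<le> 1 * (1 + norm x) ^ 1 * gauss G x" for x
      by (simp add: norm_mult norm_u0 mult_right_mono)
  qed measurable
  define C where "C = q * L2_norm u0 + norm \<xi> * L2_norm (\<lambda>x. of_real (norm x) * u0 x)"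
  have "L2_norm (\<Delta> \<rho> (\<lambda>x. u0 x * wave \<xi> x)) \<le> C * \<rho>" if \<rho>: "0 \<le> \<rho>" "\<rho> \<le> 1" for \<rho>
  proof -
    define A where "A = exp (- (q - \<rho>\<^sup>2 * q) / 2)"
    define B where "B = exp (- q / 2)"
    have A1: "0 \<le> A" "A \<le> 1"
      using q mult_right_mono[of "\<rho>\<^sup>2" 1 q] \<rho> by (auto simp: A_def power_le_one)
    have "B = A * exp (- (\<rho>\<^sup>2 * q / 2))" by (simp add: A_def B_def field_simps flip: exp_add)
    then have ABeq: "A - B = A * (1 - exp (- (\<rho>\<^sup>2 * q / 2)))" by (simp add: algebra_simps)
    have ex: "0 \<le> 1 - exp (- (\<rho>\<^sup>2 * q / 2))" "1 - exp (- (\<rho>\<^sup>2 * q / 2)) \<le> \<rho>\<^sup>2 * q / 2"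
      using exp_ge_add_one_self[of "- (\<rho>\<^sup>2 * q / 2)"] q by auto
    have "A * (1 - exp (- (\<rho>\<^sup>2 * q / 2))) \<le> 1 * (1 - exp (- (\<rho>\<^sup>2 * q / 2)))"
      by (rule mult_right_mono[OF A1(2) ex(1)])
    then have AB: "\<bar>A - B\<bar> \<le> \<rho>\<^sup>2 * q / 2"
      unfolding ABeq abs_of_nonneg[OF mult_nonneg_nonneg[OF A1(1) ex(1)]] mult_1 using ex(2) by (rule order_trans)
    have "\<rho>\<^sup>2 \<le> \<rho>" using \<rho> by (simp add: power2_eq_square mult_left_le)
    then have "\<rho>\<^sup>2 * q \<le> \<rho> * q" using q by (rule mult_right_mono)
    then have AB2: "\<bar>A - B\<bar> \<le> \<rho> * q" using AB q \<rho> by (smt (verit) field_sum_of_halves mult_nonneg_nonneg)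
    have eq: "\<Delta> \<rho> (\<lambda>x. u0 x * wave \<xi> x) = (\<lambda>x. of_real A * (u0 x * (wave (\<rho> *\<^sub>R \<xi>) x - 1)) + of_real (A - B) * u0 x)"
      unfolding \<Delta>_def mehler_wave[OF sc_contraction[OF \<rho>]] mehler_wave[OF sc_contraction[of 0, simplified]]
      by (simp add: sc_form A_def B_def q_def fun_eq_iff algebra_simps) (simp add: sc_def)
    have wL: "(\<lambda>x. u0 x * (wave (\<rho> *\<^sub>R \<xi>) x - 1)) \<in> L2" and wn: "L2_norm (\<lambda>x. u0 x * (wave (\<rho> *\<^sub>R \<xi>) x - 1)) \<le> (\<rho> * norm \<xi>) * L2_norm (\<lambda>x. of_real (norm x) * u0 x)"
    proof -
      have le: "norm (u0 x * (wave (\<rho> *\<^sub>R \<xi>) x - 1)) \<le> norm (of_real (\<rho> * norm \<xi>) * (of_real (norm x) * u0 x))" for x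
      proof -
        have "norm (wave (\<rho> *\<^sub>R \<xi>) x - 1) \<le> \<bar>(\<rho> *\<^sub>R \<xi>) \<bullet> x\<bar>"
          using iexp_approx1[of "(\<rho> *\<^sub>R \<xi>) \<bullet> x" 0] by (simp add: wave_def cis_conv_exp)
        also have "\<dots> \<le> norm (\<rho> *\<^sub>R \<xi>) * norm x" by (rule Cauchy_Schwarz_ineq2)
        also have "\<dots> = \<rho> * norm \<xi> * norm x" using \<rho> by simp
        finally have "gauss G x * norm (wave (\<rho> *\<^sub>R \<xi>) x - 1) \<le> gauss G x * (\<rho> * norm \<xi> * norm x)"
          by (rule mult_left_mono) simp
        then show ?thesis using \<rho> by (simp add: norm_mult norm_u0 mult_ac)
      qed
      note B = L2_bound[OF L2_scale[OF nxL, of "of_real (\<rho> * norm \<xi>)"] _ AE_I2[OF le]]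
      show "(\<lambda>x. u0 x * (wave (\<rho> *\<^sub>R \<xi>) x - 1)) \<in> L2" by (rule B(1)) measurable
      have "L2_norm (\<lambda>x. u0 x * (wave (\<rho> *\<^sub>R \<xi>) x - 1)) \<le> L2_norm (\<lambda>x. of_real (\<rho> * norm \<xi>) * (of_real (norm x) * u0 x))"
        by (rule B(2)) measurable
      then show "L2_norm (\<lambda>x. u0 x * (wave (\<rho> *\<^sub>R \<xi>) x - 1)) \<le> (\<rho> * norm \<xi>) * L2_norm (\<lambda>x. of_real (norm x) * u0 x)"
        unfolding L2_norm_scale norm_of_real using \<rho> by simp
    qed
    have "L2_norm (\<Delta> \<rho> (\<lambda>x. u0 x * wave \<xi> x)) \<le> norm (complex_of_real A) * L2_norm (\<lambda>x. u0 x * (wave (\<rho> *\<^sub>R \<xi>) x - 1)) + norm (complex_of_real (A - B)) * L2_norm u0"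
      unfolding eq by (rule L2_norm_lincomb[OF wL u0_L2])
    also have "\<dots> \<le> 1 * ((\<rho> * norm \<xi>) * L2_norm (\<lambda>x. of_real (norm x) * u0 x)) + (\<rho> * q) * L2_norm u0"
      by (intro add_mono mult_mono wn mult_right_mono) (use A1 AB2 \<rho> in \<open>auto simp del: of_real_diff\<close>)
    also have "\<dots> = C * \<rho>" by (simp add: C_def algebra_simps)
    finally show ?thesis .
  qed
  moreover have "C \<ge> 0" using q by (simp add: C_def)
  ultimately show ?case by blast
next
  case (lincomb f g a b)
  have fg: "f \<in> L2" "g \<in> L2" using L2_denseD(1)[OF L2_dense_trig_span[OF u0_L2 u0_nz]] lincomb by auto
  obtain C where C: "C \<ge> 0" "\<And>\<rho>. 0 \<le> \<rho> \<Longrightarrow> \<rho> \<le> 1 \<Longrightarrow> L2_norm (\<Delta> \<rho> f) \<le> C * \<rho>" using lincomb(3) by blast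
  obtain D where D: "D \<ge> 0" "\<And>\<rho>. 0 \<le> \<rho> \<Longrightarrow> \<rho> \<le> 1 \<Longrightarrow> L2_norm (\<Delta> \<rho> g) \<le> D * \<rho>" using lincomb(4) by blast
  have "L2_norm (\<Delta> \<rho> (\<lambda>x. a * f x + b * g x)) \<le> (norm a * C + norm b * D) * \<rho>" if \<rho>: "0 \<le> \<rho>" "\<rho> \<le> 1" for \<rho>
  proof -
    have "L2_norm (\<Delta> \<rho> (\<lambda>x. a * f x + b * g x)) = L2_norm (\<lambda>x. a * \<Delta> \<rho> f x + b * \<Delta> \<rho> g x)"
      by (rule L2_norm_cong_AE[OF \<Delta>_lincomb[OF \<rho> fg]]) (intro L2D(1) \<Delta>_L2 L2_lincomb \<rho> fg)+
    also have "\<dots> \<le> norm a * L2_norm (\<Delta> \<rho> f) + norm b * L2_norm (\<Delta> \<rho> g)"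
      by (intro L2_norm_lincomb \<Delta>_L2 \<rho> fg)
    also have "\<dots> \<le> norm a * (C * \<rho>) + norm b * (D * \<rho>)" by (intro add_mono mult_left_mono C D \<rho>) auto
    finally show ?thesis by (simp add: algebra_simps)
  qed
  moreover have "norm a * C + norm b * D \<ge> 0" using C D by simp
  ultimately show ?case by blast
qed

text \<open>Log-convexity along \<open>\<rho>, \<rho>\<^sup>2, \<rho>\<^sup>4, \<dots>\<close> turns the bound \<open>C \<rho>\<close> into the sharp bound \<open>\<rho>\<close>.\<close>

lemma \<Delta>_bound:
  assumes \<rho>: "0 < \<rho>" "\<rho> \<le> 1" and u: "u \<in> L2"
  shows "L2_norm (\<Delta> \<rho> u) \<le> \<rho> * L2_norm u"
proof -
  note D = L2_dense_trig_span[OF u0_L2 u0_nz]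
  have span: "L2_norm (\<Delta> \<rho> v) \<le> \<rho> * L2_norm v" if v: "v \<in> trig_span u0" for v
  proof -
    have vL: "v \<in> L2" by (rule L2_denseD(1)[OF D v])
    obtain C where C: "C \<ge> 0" "\<And>\<rho>. 0 \<le> \<rho> \<Longrightarrow> \<rho> \<le> 1 \<Longrightarrow> L2_norm (\<Delta> \<rho> v) \<le> C * \<rho>"
      using \<Delta>_trig_bound[OF v] by blast
    define n where "n k = L2_norm (\<Delta> (\<rho> ^ (2 ^ k)) v)" for k :: nat
    have pk: "0 \<le> \<rho> ^ (2 ^ k)" "\<rho> ^ (2 ^ k) \<le> 1" for k :: nat using \<rho> by (auto simp: power_le_one)
    have step: "(n k)\<^sup>2 \<le> n (Suc k) * L2_norm v" for k
    proof -
      have "\<rho> ^ (2 ^ k) * \<rho> ^ (2 ^ k) = \<rho> ^ (2 ^ Suc k)" by (simp add: power_add[symmetric] mult_2)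
      then show ?thesis using \<Delta>_log_convex[OF pk vL, of k] by (simp only: n_def)
    qed
    show ?thesis
    proof (cases "L2_norm v = 0")
      case True
      then have "(n 0)\<^sup>2 \<le> 0" using step[of 0] by simp
      then show ?thesis using True by (simp add: n_def)
    next
      case False
      then have V: "L2_norm v > 0" using L2_norm_nonneg[of v] by linarith
      define m where "m = n 0 / L2_norm v"
      have m0: "m \<ge> 0" using V by (simp add: m_def n_def)
      have mk: "m ^ (2 ^ k) \<le> n k / L2_norm v" for k
      proof (induction k)
        case 0 show ?case by (simp add: m_def)
      next
        case (Suc k)
        have "m ^ (2 ^ Suc k) = (m ^ (2 ^ k))\<^sup>2" by (simp add: power_mult[symmetric] mult.commute)
        also have "\<dots> \<le> (n k / L2_norm v)\<^sup>2" using Suc m0 by (intro power_mono) auto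
        also have "\<dots> \<le> n (Suc k) / L2_norm v" using step[of k] V by (simp add: power_divide power2_eq_square field_simps)
        finally show ?case .
      qed
      have "m \<le> \<rho>"
      proof (rule ccontr)
        assume "\<not> m \<le> \<rho>"
        then have gt: "m / \<rho> > 1" using \<rho> by simp
        have bd: "(m / \<rho>) ^ (2 ^ k) \<le> C / L2_norm v" for k
        proof -
          have "m ^ (2 ^ k) \<le> C * \<rho> ^ (2 ^ k) / L2_norm v"
            using mk[of k] C(2)[OF pk, of k] V by (simp add: n_def) (meson divide_right_mono less_imp_le order_trans)
          then show ?thesis using \<rho> by (simp add: power_divide field_simps)
        qed
        obtain l where l: "C / L2_norm v < (m / \<rho>) ^ l" using real_arch_pow[OF gt] by blast
        have "l \<le> 2 ^ l" by (simp add: less_imp_le)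
        then have "(m / \<rho>) ^ l \<le> (m / \<rho>) ^ (2 ^ l)" using gt by (intro power_increasing) auto
        then show False using l bd[of l] by linarith
      qed
      then show ?thesis using V by (simp add: m_def n_def field_simps)
    qed
  qed
  show ?thesis
  proof (rule field_le_epsilon)
    fix e :: real assume e: "e > 0"
    obtain v where v: "v \<in> trig_span u0" and d: "L2_norm (\<lambda>x. u x - v x) < e / 3"
      using L2_denseD(2)[OF D u, of "e/3"] e by auto
    have vL: "v \<in> L2" by (rule L2_denseD(1)[OF D v])
    have \<rho>0: "0 \<le> \<rho>" using \<rho> by simp
    have "L2_norm (\<Delta> \<rho> u) \<le> L2_norm (\<lambda>x. \<Delta> \<rho> u x - \<Delta> \<rho> v x) + L2_norm (\<Delta> \<rho> v)"
      using L2_norm_triangle[OF L2_diff[OF \<Delta>_L2[OF \<rho>0 \<rho>(2) u] \<Delta>_L2[OF \<rho>0 \<rho>(2) vL]] \<Delta>_L2[OF \<rho>0 \<rho>(2) vL]] by simp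
    also have "\<dots> \<le> 2 * L2_norm (\<lambda>x. u x - v x) + \<rho> * L2_norm v"
      by (intro add_mono \<Delta>_diff_le[OF \<rho>0 \<rho>(2) u vL] span v)
    also have "\<rho> * L2_norm v \<le> \<rho> * (L2_norm u + e / 3)"
      using L2_norm_triangle_rev[OF u vL] d \<rho> by (intro mult_left_mono) auto
    also have "\<dots> \<le> \<rho> * L2_norm u + e / 3"
      using \<rho> e by (simp add: algebra_simps mult_left_le)
    finally show "L2_norm (\<Delta> \<rho> u) \<le> \<rho> * L2_norm u + e" using d by linarith
  qed
qed

lemma mehler_decay:
  assumes r: "linear r" and \<rho>: "\<rho> > 0" and b: "\<And>\<xi>. r \<xi> \<bullet> K (r \<xi>) \<le> \<rho>\<^sup>2 * (\<xi> \<bullet> K \<xi>)"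
    and rc: "K_contraction r" and u: "u \<in> L2"
  shows "L2_norm (\<lambda>x. mehler r u x - mehler (sc 0) u x) \<le> 2 * \<rho> * L2_norm u"
proof (cases "\<rho> \<le> 1")
  case True
  define s where "s = (\<lambda>\<xi>. inverse \<rho> *\<^sub>R r \<xi>)"
  have "s \<xi> \<bullet> K (s \<xi>) = inverse (\<rho>\<^sup>2) * (r \<xi> \<bullet> K (r \<xi>))" for \<xi>
    by (simp add: s_def K_simps power2_eq_square)
  moreover have "inverse (\<rho>\<^sup>2) * (r \<xi> \<bullet> K (r \<xi>)) \<le> \<xi> \<bullet> K \<xi>" for \<xi>
    using b[of \<xi>] \<rho> by (simp add: field_simps)
  ultimately have s: "K_contraction s"
    using linear_compose_scale_right[OF r, of "inverse \<rho>"] by (simp add: K_contraction_def s_def)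
  have \<rho>0: "0 \<le> \<rho>" using \<rho> by simp
  have sL: "mehler s u \<in> L2" and sn: "L2_norm (mehler s u) \<le> L2_norm u" using mehler_bound[OF s u] by auto
  have "(\<lambda>\<xi>. sc \<rho> (s \<xi>)) = r" using \<rho> by (simp add: sc_def s_def fun_eq_iff)
  then have 1: "AE x in lborel. mehler (sc \<rho>) (mehler s u) x = mehler r u x"
    using mehler_compose[OF s sc_contraction[OF \<rho>0 True] u] by simp
  have "(\<lambda>\<xi>. sc 0 (s \<xi>)) = sc 0" by (simp add: sc_def fun_eq_iff)
  then have 2: "AE x in lborel. mehler (sc 0) (mehler s u) x = mehler (sc 0) u x"
    using mehler_compose[OF s sc_contraction[of 0] u] by simp
  have "L2_norm (\<lambda>x. mehler r u x - mehler (sc 0) u x) = L2_norm (\<Delta> \<rho> (mehler s u))"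
  proof (rule L2_norm_cong_AE)
    show "AE x in lborel. mehler r u x - mehler (sc 0) u x = \<Delta> \<rho> (mehler s u) x"
      using 1 2 by eventually_elim (simp add: \<Delta>_def)
    have "K_contraction (sc 0)" by (rule sc_contraction) auto
    then show "(\<lambda>x. mehler r u x - mehler (sc 0) u x) \<in> borel_measurable borel"
      by (intro L2D(1) L2_diff mehler_bound rc u)
    show "\<Delta> \<rho> (mehler s u) \<in> borel_measurable borel" by (intro L2D(1) \<Delta>_L2 sL \<rho>0 True)
  qed
  also have "\<dots> \<le> \<rho> * L2_norm (mehler s u)" by (rule \<Delta>_bound[OF \<rho> True sL])
  also have "\<dots> \<le> \<rho> * L2_norm u" using sn \<rho> by (intro mult_left_mono) auto
  also have "\<dots> \<le> 2 * \<rho> * L2_norm u" using \<rho> by (simp add: mult_right_mono)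
  finally show ?thesis .
next
  case False
  \<comment> \<open>For \<rho> > 1 there is no factorisation to use; two contractions give the bound
    2, and this is the origin of the factor 2 in the statement.\<close>
  have c0: "K_contraction (sc 0)" by (rule sc_contraction) auto
  have "L2_norm (\<lambda>x. mehler r u x - mehler (sc 0) u x) \<le> L2_norm (mehler r u) + L2_norm (mehler (sc 0) u)"
    by (intro L2_norm_triangle_minus mehler_bound rc c0 u)
  also have "\<dots> \<le> 2 * 1 * L2_norm u" using mehler_bound(2)[OF rc u] mehler_bound(2)[OF c0 u] by simp
  also have "\<dots> \<le> 2 * \<rho> * L2_norm u" using False by (intro mult_right_mono) auto
  finally show ?thesis .
qed

lemma L2_norm_u0: "(L2_norm u0)\<^sup>2 = Z"
  unfolding L2_norm_power2 norm_u0 gauss_square Z_def ..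

lemma mehler_projection:
  assumes u: "u \<in> L2"
  shows "AE x in lborel. mehler (sc 0) u x = L2_inner u u0 / of_real ((L2_norm u0)\<^sup>2) * u0 x"
proof -
  have P: "contraction_op (\<lambda>u x. distr_of u u0 / of_real Z * u0 x)"
    unfolding contraction_op_def
  proof (intro conjI ballI allI)
    fix u :: "real^'n \<Rightarrow> complex" assume u: "u \<in> L2"
    show "(\<lambda>x. distr_of u u0 / of_real Z * u0 x) \<in> L2" by (rule L2_scale[OF u0_L2])
    have "L2_norm (\<lambda>x. distr_of u u0 / of_real Z * u0 x) = norm (distr_of u u0) / Z * L2_norm u0"
      unfolding L2_norm_scale using Z_pos by (simp add: norm_divide)
    also have "\<dots> \<le> (L2_norm u * L2_norm u0) / Z * L2_norm u0"
      using Z_pos by (intro mult_right_mono divide_right_mono distr_of_bound u u0_L2) auto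
    also have "\<dots> = L2_norm u * (L2_norm u0)\<^sup>2 / Z" by (simp add: power2_eq_square)
    also have "\<dots> = L2_norm u" unfolding L2_norm_u0 using Z_pos by simp
    finally show "L2_norm (\<lambda>x. distr_of u u0 / of_real Z * u0 x) \<le> L2_norm u" .
    fix v :: "real^'n \<Rightarrow> complex" and a b assume v: "v \<in> L2"
    show "AE x in lborel. distr_of (\<lambda>y. a * u y + b * v y) u0 / of_real Z * u0 x
        = a * (distr_of u u0 / of_real Z * u0 x) + b * (distr_of v u0 / of_real Z * u0 x)"
      by (simp add: distr_of_lincomb_left u v u0_L2 field_simps add_divide_distrib)
  qed
  have c0: "K_contraction (sc 0)" by (rule sc_contraction) auto
  have "AE x in lborel. mehler (sc 0) u x = distr_of u u0 / of_real Z * u0 x"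
  proof (rule contraction_op_eqI[OF u0_L2 u0_nz contraction_op_mehler[OF c0] P _ u])
    fix \<xi>
    have "distr_of (\<lambda>x. u0 x * wave \<xi> x) u0 = of_real (Z * gauss K \<xi>)" using pairing_wave[of \<xi> 0] by simp
    then show "AE x in lborel. mehler (sc 0) (\<lambda>y. u0 y * wave \<xi> y) x = distr_of (\<lambda>y. u0 y * wave \<xi> y) u0 / of_real Z * u0 x"
      using Z_pos unfolding mehler_wave[OF c0] by (simp add: sc_def gauss_def)
  qed
  then show ?thesis by (simp add: L2_inner_eq_distr_of L2_norm_u0)
qed

lemma K_norm_equiv: "\<exists>c>0. \<exists>B>0. \<forall>\<xi>. c * (norm \<xi>)\<^sup>2 \<le> \<xi> \<bullet> K \<xi> \<and> \<xi> \<bullet> K \<xi> \<le> B * (norm \<xi>)\<^sup>2"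
proof -
  obtain c where c: "c > 0" "\<And>\<xi>. c * (norm \<xi>)\<^sup>2 \<le> \<xi> \<bullet> K \<xi>" using pos_def_map_coercive[OF K] by blast
  obtain B where B: "B > 0" "\<And>x. norm (K x) \<le> B * norm x" using linear_bounded_pos[OF pos_def_mapD(1)[OF K]] by blast
  have "\<xi> \<bullet> K \<xi> \<le> B * (norm \<xi>)\<^sup>2" for \<xi>
  proof -
    have "\<xi> \<bullet> K \<xi> \<le> norm \<xi> * norm (K \<xi>)" by (rule norm_cauchy_schwarz)
    also have "\<dots> \<le> norm \<xi> * (B * norm \<xi>)" by (intro mult_left_mono B) simp
    finally show ?thesis by (simp add: power2_eq_square mult_ac)
  qed
  then show ?thesis using c B by blast
qed

end

context ou
begin

theorem T_decay:
  assumes C: "C > 0" and dec: "\<And>t \<xi>. t \<ge> 0 \<Longrightarrow> norm (r t \<xi>) \<le> C * exp (- \<tau> * t) * norm \<xi>"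
  shows "\<exists>D>0. \<forall>t\<ge>0. \<forall>u\<in>L2. L2_norm (\<lambda>x. exp (of_real \<mu> * of_real t) * T t u x
      - L2_inner u u0 / of_real ((L2_norm u0)\<^sup>2) * u0 x) \<le> D * exp (- \<tau> * t) * L2_norm u"
proof -
  obtain c B where cB: "c > 0" "B > 0" "\<And>\<xi>. c * (norm \<xi>)\<^sup>2 \<le> \<xi> \<bullet> K \<xi>" "\<And>\<xi>. \<xi> \<bullet> K \<xi> \<le> B * (norm \<xi>)\<^sup>2"
    using K_norm_equiv by blast
  \<comment> \<open>The square root converts the Euclidean decay of the flow into decay in the
    metric \<open>K\<close>.\<close>
  define D where "D = C * sqrt (B / c)"
  have D: "D > 0" using C cB by (simp add: D_def)
  have "L2_norm (\<lambda>x. exp (of_real \<mu> * of_real t) * T t u x - L2_inner u u0 / of_real ((L2_norm u0)\<^sup>2) * u0 x)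
      \<le> (2 * D) * exp (- \<tau> * t) * L2_norm u" if t: "t \<ge> 0" and u: "u \<in> L2" for t u
  proof -
    define \<rho> where "\<rho> = D * exp (- \<tau> * t)"
    have \<rho>: "\<rho> > 0" using D by (simp add: \<rho>_def)
    have b: "r t \<xi> \<bullet> K (r t \<xi>) \<le> \<rho>\<^sup>2 * (\<xi> \<bullet> K \<xi>)" for \<xi>
    proof -
      have "r t \<xi> \<bullet> K (r t \<xi>) \<le> B * (norm (r t \<xi>))\<^sup>2" by (rule cB)
      also have "\<dots> \<le> B * (C * exp (- \<tau> * t) * norm \<xi>)\<^sup>2"
        using cB by (intro mult_left_mono power_mono dec t) auto
      also have "\<dots> = (B / c) * (C * exp (- \<tau> * t))\<^sup>2 * (c * (norm \<xi>)\<^sup>2)"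
        using cB by (simp add: power_mult_distrib)
      also have "\<dots> \<le> (B / c) * (C * exp (- \<tau> * t))\<^sup>2 * (\<xi> \<bullet> K \<xi>)"
        using cB by (intro mult_left_mono cB) auto
      also have "(B / c) * (C * exp (- \<tau> * t))\<^sup>2 = \<rho>\<^sup>2"
        using cB by (simp add: \<rho>_def D_def power_mult_distrib)
      finally show ?thesis .
    qed
    note rc = r_K_contraction[OF t]
    have c0: "K_contraction (sc 0)" by (rule sc_contraction) auto
    have e1: "exp (of_real \<mu> * of_real t) * T t u x = mehler (r t) u x" for x
    proof -
      have "exp (of_real \<mu> * of_real t :: complex) * of_real (exp (- \<mu> * t)) = 1"
        by (simp add: exp_of_real[symmetric] exp_minus del: of_real_minus)
      then show ?thesis unfolding T_def mult.assoc[symmetric] by simp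
    qed
    have "L2_norm (\<lambda>x. exp (of_real \<mu> * of_real t) * T t u x - L2_inner u u0 / of_real ((L2_norm u0)\<^sup>2) * u0 x)
      = L2_norm (\<lambda>x. mehler (r t) u x - mehler (sc 0) u x)"
      unfolding e1
    proof (rule L2_norm_diff_cong_AE)
      show "AE x in lborel. L2_inner u u0 / of_real ((L2_norm u0)\<^sup>2) * u0 x = mehler (sc 0) u x"
        using mehler_projection[OF u] by eventually_elim simp
    qed (simp, (intro mehler_bound rc c0 u L2_scale u0_L2)+)
    also have "\<dots> \<le> 2 * \<rho> * L2_norm u" by (rule mehler_decay[OF r_linear \<rho> b rc u])
    finally show ?thesis by (simp add: \<rho>_def mult.assoc)
  qed
  then show ?thesis using D by (intro exI[of _ "2 * D"]) auto
qed

end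

section \<open>From the hypotheses on the operator to its coefficients\<close>

lemma quadratic_form_pos_def_map:
  fixes a :: "real^'n::finite \<Rightarrow> real"
  assumes "quadratic_form a" and pos: "\<And>x. x \<noteq> 0 \<Longrightarrow> a x > 0"
  shows "\<exists>G. pos_def_map G \<and> (\<forall>x. a x = (x \<bullet> G x) / 2)"
proof -
  obtain B where B: "bilinear B" "\<And>x y. B x y = B y x" "\<And>x. a x = B x x"
    using assms(1) by (auto simp: quadratic_form_def)
  have l: "linear (\<lambda>x. B x y)" "linear (B x)" for x y using B(1) by (auto simp: bilinear_def)
  \<comment> \<open>The factor 2 makes \<open>exp (- a x)\<close> equal to
    \<open>gauss G x\<close>.\<close>
  define G where "G x = (\<chi> i. 2 * B x (axis i 1))" for x
  have exp: "B x y = (\<Sum>i\<in>UNIV. y $ i * B x (axis i 1))" for x y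
  proof -
    have "B x y = B x (\<Sum>i\<in>UNIV. y $ i *\<^sub>R axis i 1)" by (simp add: basis_expansion flip: scalar_mult_eq_scaleR)
    also have "\<dots> = (\<Sum>i\<in>UNIV. y $ i * B x (axis i 1))" by (simp add: linear_sum[OF l(2)] linear_scale[OF l(2)])
    finally show ?thesis .
  qed
  have Gf: "y \<bullet> G x = 2 * B x y" for x y
    unfolding exp[of x y] by (simp add: inner_vec_def G_def sum_distrib_left mult_ac)
  have "linear G"
    by (rule linearI) (simp_all add: G_def vec_eq_iff linear_add[OF l(1)] linear_scale[OF l(1)] distrib_left)
  moreover have "G x \<bullet> y = x \<bullet> G y" for x y using Gf[of y x] Gf[of x y] B(2)[of x y] by (simp add: inner_commute)
  moreover have "x \<bullet> G x > 0" if "x \<noteq> 0" for x using pos[OF that] B(3)[of x] Gf[of x x] by simp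
  ultimately show ?thesis using B(3) Gf by (intro exI[of _ G]) (auto simp: pos_def_map_def)
qed

lemma quadratic_form_polar:
  fixes q :: "'a::real_vector \<Rightarrow> complex"
  assumes "quadratic_form q"
  shows "bilinear (polar q)" "polar q X X = q X"
proof -
  obtain B where B: "bilinear B" "\<And>x y. B x y = B y x" "\<And>x. q x = B x x"
    using assms(1) by (auto simp: quadratic_form_def)
  have "polar q X Y = B X Y" for X Y
    unfolding polar_def B(3) using B(2)[of X Y] by (simp add: bilinear_ladd[OF B(1)] bilinear_radd[OF B(1)])
  then have "polar q = B" by (simp add: fun_eq_iff)
  then show "bilinear (polar q)" "polar q X X = q X" using B by auto
qed

lemma smooth_eqI_bump:
  assumes g: "smooth_fun g" and z: "\<And>c y. c > 0 \<Longrightarrow> (LINT x|lborel. bump 0 c y x * g x) = 0"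
  shows "g y = 0"
proof -
  have int: "integrable lborel (\<lambda>x. bump 0 c y x * g x)" if "c > 0" for c y
    by (intro test_fun_integrable test_fun_mult test_fun_bump g that)
  have cg: "continuous_on UNIV g" by (rule smooth_fun_continuous[OF g])
  have parts: "(LINT x|lborel. bump 0 c y x * of_real (Re (g x))) = of_real (Re (LINT x|lborel. bump 0 c y x * g x))"
    "(LINT x|lborel. bump 0 c y x * of_real (Im (g x))) = of_real (Im (LINT x|lborel. bump 0 c y x * g x))" if "c > 0" for c y
  proof -
    have "(LINT x|lborel. bump 0 c y x * of_real (Re (g x))) = (LINT x|lborel. complex_of_real (Re (bump 0 c y x * g x)))"
      by (simp add: bump_def)
    also have "\<dots> = of_real (LINT x|lborel. Re (bump 0 c y x * g x))" by (rule integral_complex_of_real)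
    also have "(LINT x|lborel. Re (bump 0 c y x * g x)) = Re (LINT x|lborel. bump 0 c y x * g x)"
      by (rule integral_Re[OF int[OF that]])
    finally show "(LINT x|lborel. bump 0 c y x * of_real (Re (g x))) = of_real (Re (LINT x|lborel. bump 0 c y x * g x))" .
    have "(LINT x|lborel. bump 0 c y x * of_real (Im (g x))) = (LINT x|lborel. complex_of_real (Im (bump 0 c y x * g x)))"
      by (simp add: bump_def)
    also have "\<dots> = of_real (LINT x|lborel. Im (bump 0 c y x * g x))" by (rule integral_complex_of_real)
    also have "(LINT x|lborel. Im (bump 0 c y x * g x)) = Im (LINT x|lborel. bump 0 c y x * g x)"
      by (rule integral_Im[OF int[OF that]])
    finally show "(LINT x|lborel. bump 0 c y x * of_real (Im (g x))) = of_real (Im (LINT x|lborel. bump 0 c y x * g x))" .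
  qed
  have "Re (g y) = 0" by (rule continuous_eq_0_of_bump) (use parts(1) z cg in \<open>auto intro!: continuous_intros\<close>)
  moreover have "Im (g y) = 0" by (rule continuous_eq_0_of_bump) (use parts(2) z cg in \<open>auto intro!: continuous_intros\<close>)
  ultimately show ?thesis by (simp add: complex_eq_iff)
qed

text \<open>The reality hypothesis concerns square integrable functions, and is applied to real
  bumps. Transposing carries it over to the transposed expression on an arbitrary real smooth
  function, which may grow at infinity.\<close>

lemma real_op_diff_op_real:
  fixes a b c :: "'n::finite \<Rightarrow> 'n \<Rightarrow> complex"
  assumes re: "real_op (max_op a b c)" and c: "\<And>j k. c j k = c k j"
    and f: "smooth_fun f" and fr: "\<And>x. Im (f x) = 0"
  shows "Im (diff_op a b c f y) = 0"
proof -
  define p where "p = diff_op a b c f"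
  have sp: "smooth_fun p" unfolding p_def by (rule smooth_diff_op[OF f])
  have "Im (p y) = 0"
  proof (rule continuous_eq_0_of_bump)
    show "continuous_on UNIV (\<lambda>x. Im (p x))" by (intro continuous_intros smooth_fun_continuous sp)
    fix s :: real and y assume s: "s > 0"
    define \<phi> where "\<phi> = (bump 0 s y :: real^'n \<Rightarrow> complex)"
    have \<phi>: "test_fun \<phi>" unfolding \<phi>_def by (rule test_fun_bump[OF s])
    have \<phi>r: "\<phi> x \<in> \<real>" for x by (simp add: \<phi>_def bump_def)
    define \<psi> where "\<psi> = diff_op a (\<lambda>j k. - b j k) c \<phi>"
    have "(\<phi>, \<psi>) \<in> max_op a b c" unfolding \<psi>_def by (rule test_fun_max_op[OF \<phi> c])
    then have ae: "AE x in lborel. \<psi> x \<in> \<real>" using re \<phi>r unfolding real_op_def by fastforce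
    have t\<psi>: "test_fun \<psi>" unfolding \<psi>_def by (rule test_diff_op[OF \<phi>])
    have i1: "integrable lborel (\<lambda>x. \<psi> x * f x)" "integrable lborel (\<lambda>x. \<phi> x * p x)"
      by (intro test_fun_integrable test_fun_mult t\<psi> \<phi> f sp)+
    have "(LINT x|lborel. \<psi> x * f x) = (LINT x|lborel. \<phi> x * p x)"
      using diff_op_transpose[OF \<phi> f c, of a "\<lambda>j k. - b j k"] by (simp add: \<psi>_def p_def)
    then have "(LINT x|lborel. Im (\<psi> x * f x)) = (LINT x|lborel. Im (\<phi> x * p x))"
      by (simp only: integral_Im[OF i1(1)] integral_Im[OF i1(2)])
    moreover have "(LINT x|lborel. Im (\<psi> x * f x)) = (LINT x::real^'n|lborel. 0)"
    proof (rule integral_cong_AE)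
      show "(\<lambda>x. Im (\<psi> x * f x)) \<in> borel_measurable lborel"
        by (rule borel_measurable_integrable[OF integrable_Im[OF i1(1)]])
      show "AE x in lborel. Im (\<psi> x * f x) = 0"
        using ae by eventually_elim (simp add: complex_is_Real_iff fr)
    qed simp
    ultimately have "(LINT x|lborel. complex_of_real (Im (\<phi> x * p x))) = 0"
      unfolding integral_complex_of_real by simp
    then show "(LINT x|lborel. bump 0 s y x * of_real (Im (p x))) = 0"
      by (simp add: \<phi>_def bump_def)
  qed
  then show ?thesis by (simp add: p_def)
qed

text \<open>The eigenvalue equation holds in the sense of distributions. Both sides are smooth, so
  it holds pointwise, and dividing by the Gaussian leaves the symbol at \<zeta> = 0. The operator
  itself carries \<open>- b\<close>.\<close>

lemma kernel_symbol:
  fixes a b c :: "'n::finite \<Rightarrow> 'n \<Rightarrow> complex"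
  assumes G: "pos_def_map G" and c: "\<And>j k. c j k = c k j"
    and ker: "(gexp G 0, \<lambda>x. \<mu> * gexp G 0 x) \<in> max_op a b c"
  shows "gexp_symbol G a (\<lambda>j k. - b j k) c 0 x = \<mu>"
proof -
  define g where "g = (\<lambda>x. diff_op a (\<lambda>j k. - b j k) c (gexp G 0) x - \<mu> * gexp G 0 x)"
  note sE = smooth_gexp[OF G, of 0]
  have "g x = 0"
  proof (rule smooth_eqI_bump)
    show "smooth_fun g" unfolding g_def by (intro smooth_intros smooth_diff_op sE)
    fix s :: real and y :: "real^'n" assume s: "s > 0"
    have \<phi>: "test_fun (bump 0 s y)" by (rule test_fun_bump[OF s])
    have "(LINT x|lborel. bump 0 s y x * diff_op a (\<lambda>j k. - b j k) c (gexp G 0) x) = distr_of (gexp G 0) (diff_op a b c (bump 0 s y))"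
      using diff_op_transpose[OF \<phi> sE c, of a b] by (simp add: distr_of_def mult.commute)
    also have "\<dots> = distr_of (\<lambda>x. \<mu> * gexp G 0 x) (bump 0 s y)" using ker \<phi> by (simp add: max_op_def)
    also have "\<dots> = (LINT x|lborel. bump 0 s y x * (\<mu> * gexp G 0 x))" by (simp add: distr_of_def mult.commute)
    finally have "(LINT x|lborel. bump 0 s y x * diff_op a (\<lambda>j k. - b j k) c (gexp G 0) x - bump 0 s y x * (\<mu> * gexp G 0 x)) = 0"
      by (subst Bochner_Integration.integral_diff) (auto intro!: test_fun_integrable test_fun_mult \<phi> smooth_diff_op sE smooth_fun_scale)
    then show "(LINT x|lborel. bump 0 s y x * g x) = 0" by (simp add: g_def right_diff_distrib)
  qed
  then have "gexp_symbol G a (\<lambda>j k. - b j k) c 0 x * gexp G 0 x = \<mu> * gexp G 0 x"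
    by (simp add: g_def diff_op_gexp[OF G])
  moreover have "gexp G 0 x \<noteq> 0" by (simp add: gexp_def)
  ultimately show ?thesis by simp
qed

text \<open>The adjoint is tested on test functions alone. Since the Gaussian is real, moving the
  conjugation of the scalar product onto the eigenvalue shows that the Gaussian solves the
  transposed equation with the conjugate eigenvalue.\<close>

lemma adjoint_kernel_symbol:
  fixes a b c :: "'n::finite \<Rightarrow> 'n \<Rightarrow> complex"
  assumes G: "pos_def_map G" and c: "\<And>j k. c j k = c k j"
    and ker: "(gexp G 0, \<lambda>x. \<mu> * gexp G 0 x) \<in> adjoint_op (max_op a b c)"
  shows "gexp_symbol G a b c 0 x = cnj \<mu>"
proof -
  have cr: "cnj (gexp G 0 x) = gexp G 0 x" for x
    by (simp add: gexp_def cdot_def)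
  have L: "gexp G 0 \<in> L2" using ker by (simp add: adjoint_op_def)
  have "(gexp G 0, \<lambda>x. cnj \<mu> * gexp G 0 x) \<in> max_op a (\<lambda>j k. - b j k) c"
    unfolding max_op_def
  proof (intro CollectI case_prodI conjI allI impI L L2_scale)
    fix \<phi> :: "real^'n \<Rightarrow> complex" assume \<phi>: "test_fun \<phi>"
    have "L2_inner (diff_op a (\<lambda>j k. - b j k) c \<phi>) (gexp G 0) = L2_inner \<phi> (\<lambda>x. \<mu> * gexp G 0 x)"
      using ker test_fun_max_op[OF \<phi>, of c a b, OF c] by (auto simp: adjoint_op_def)
    then show "distr_of (gexp G 0) (diff_op a (\<lambda>j k. - b j k) c \<phi>) = distr_of (\<lambda>x. cnj \<mu> * gexp G 0 x) \<phi>"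
      by (simp add: L2_inner_def distr_of_def cr mult_ac)
  qed
  from kernel_symbol[OF G c this] show ?thesis by simp
qed

section \<open>The Hamilton map\<close>

lemma sum_UNIV_Plus: "(\<Sum>i\<in>(UNIV::('a::finite + 'b::finite) set). f i) = (\<Sum>j\<in>UNIV. f (Inl j)) + (\<Sum>j\<in>UNIV. f (Inr j))"
  unfolding UNIV_Plus_UNIV[symmetric] by (subst sum.Plus) (auto simp: o_def)

text \<open>The Hamilton map in blocks. The upper row carries the transpose of \<open>b\<close> and
  the lower row the minus signs, as \<open>symp\<close> pairs momenta with positions.\<close>

definition ham :: "('n::finite \<Rightarrow> 'n \<Rightarrow> complex) \<Rightarrow> ('n \<Rightarrow> 'n \<Rightarrow> complex) \<Rightarrow> ('n \<Rightarrow> 'n \<Rightarrow> complex) \<Rightarrow> complex^('n + 'n)^('n + 'n)" where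
  "ham a b c = (\<chi> i l. case i of
      Inl j \<Rightarrow> (case l of Inl k \<Rightarrow> b k j | Inr k \<Rightarrow> c j k)
    | Inr j \<Rightarrow> (case l of Inl k \<Rightarrow> - a j k | Inr k \<Rightarrow> - b j k))"

lemma ham_mult:
  "(ham a b c *v Y) $ Inl j = (\<Sum>k\<in>UNIV. b k j * Y $ Inl k) + (\<Sum>k\<in>UNIV. c j k * Y $ Inr k)"
  "(ham a b c *v Y) $ Inr j = - (\<Sum>k\<in>UNIV. a j k * Y $ Inl k) - (\<Sum>k\<in>UNIV. b j k * Y $ Inr k)"
  by (simp_all add: matrix_vector_mult_def sum_UNIV_Plus ham_def sum_negf)

lemma polar_ham:
  fixes q :: "real ^ ('n::finite + 'n) \<Rightarrow> complex"
  assumes "quadratic_form q"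
  shows "polar q X Y = symp (cvec X) (ham (coef_xx q) (coef_xd q) (coef_dd q) *v cvec Y)"
proof -
  note P = quadratic_form_polar(1)[OF assms]
  have l: "linear (\<lambda>x. polar q x y)" "linear (polar q x)" for x y using P by (auto simp: bilinear_def)
  have "polar q X Y = polar q (\<Sum>i\<in>UNIV. X $ i *\<^sub>R axis i 1) (\<Sum>l\<in>UNIV. Y $ l *\<^sub>R axis l 1)"
    by (simp add: basis_expansion flip: scalar_mult_eq_scaleR)
  also have "\<dots> = (\<Sum>i\<in>UNIV. X $ i *\<^sub>R (\<Sum>l\<in>UNIV. Y $ l *\<^sub>R polar q (axis i 1) (axis l 1)))"
  proof -
    have "polar q (\<Sum>i\<in>UNIV. X $ i *\<^sub>R axis i 1) V = (\<Sum>i\<in>UNIV. X $ i *\<^sub>R polar q (axis i 1) V)" for V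
      by (simp add: linear_sum[OF l(1)] linear_scale[OF l(1)])
    note eq = this
    show ?thesis unfolding eq by (simp add: linear_sum[OF l(2)] linear_scale[OF l(2)])
  qed
  also have "\<dots> = symp (cvec X) (ham (coef_xx q) (coef_xd q) (coef_dd q) *v cvec Y)"
    unfolding symp_def sum_subtractf ham_mult sum_UNIV_Plus
    by (simp add: cvec_def coef_xx_def coef_xd_def coef_dd_def polar_commute[of q "axis (Inr _) 1" "axis (Inl _) 1"]
        scaleR_conv_of_real[where 'a=complex] sum.distrib distrib_left right_diff_distrib sum_subtractf sum_negf mult_ac)
  finally show ?thesis .
qed

lemma hamilton_map_eq:
  fixes q :: "real ^ ('n::finite + 'n) \<Rightarrow> complex"
  assumes q: "quadratic_form q"
  shows "hamilton_map q = ham (coef_xx q) (coef_xd q) (coef_dd q)"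
  unfolding hamilton_map_def
proof (rule the_equality)
  show "\<forall>X Y. polar q X Y = symp (cvec X) (ham (coef_xx q) (coef_xd q) (coef_dd q) *v cvec Y)"
    using polar_ham[OF q] by blast
  fix F assume F: "\<forall>X Y. polar q X Y = symp (cvec X) (F *v cvec Y)"
  let ?H = "ham (coef_xx q) (coef_xd q) (coef_dd q)"
  have sy: "symp (cvec X) (F *v cvec Y) = symp (cvec X) (?H *v cvec Y)" for X Y using F polar_ham[OF q] by metis
  \<comment> \<open>Pairing with a momentum basis vector reads off a position entry and conversely,
    so real vectors already determine the matrix.\<close>
  have s1: "symp (cvec (axis (Inr j) 1)) V = V $ Inl j" and s2: "symp (cvec (axis (Inl j) 1)) V = - V $ Inr j" for j :: 'n and V
  proof -
    have "symp (cvec (axis (Inr j) 1)) V = (\<Sum>i\<in>UNIV. if i = j then V $ Inl i else 0)"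
      unfolding symp_def by (intro sum.cong) (auto simp: cvec_def axis_def)
    then show "symp (cvec (axis (Inr j) 1)) V = V $ Inl j" by simp
    have "symp (cvec (axis (Inl j) 1)) V = (\<Sum>i\<in>UNIV. if i = j then - V $ Inr i else 0)"
      unfolding symp_def by (intro sum.cong) (auto simp: cvec_def axis_def)
    then show "symp (cvec (axis (Inl j) 1)) V = - V $ Inr j" by simp
  qed
  have col: "F *v cvec Y = ?H *v cvec Y" for Y
    unfolding vec_eq_iff
  proof
    fix i show "(F *v cvec Y) $ i = (?H *v cvec Y) $ i"
      using sy[of "axis (Inr (projl i)) 1" Y] sy[of "axis (Inl (projr i)) 1" Y] by (cases i) (auto simp: s1 s2)
  qed
  show "F = ?H"
    unfolding vec_eq_iff
  proof (intro allI)
    fix i l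
    have c: "(M *v cvec (axis l 1)) $ i = M $ i $ l" for M :: "complex^('n + 'n)^('n + 'n)"
    proof -
      have "(M *v cvec (axis l 1)) $ i = (\<Sum>m\<in>UNIV. if m = l then M $ i $ m else 0)"
        unfolding matrix_vector_mult_def vec_lambda_beta by (intro sum.cong) (auto simp: cvec_def axis_def)
      then show ?thesis by simp
    qed
    show "F $ i $ l = ?H $ i $ l" using c[of F] c[of ?H] col by simp
  qed
qed

section \<open>Finiteness of the spectrum\<close>

lemma root_apply_swap: "root_apply W zs (root_apply W ys v) = root_apply W ys (root_apply W zs v)"
proof (induction ys)
  case (Cons y ys)
  have "root_apply W zs (root_apply W (y # ys) v) = root_apply W zs (W *v root_apply W ys v - y *s root_apply W ys v)"
    by (simp add: root_apply_def)
  also have "\<dots> = W *v root_apply W ys (root_apply W zs v) - y *s root_apply W ys (root_apply W zs v)"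
    by (simp add: root_apply_commute Cons)
  finally show ?case by (simp add: root_apply_def)
qed (simp add: root_apply_def)

lemma root_apply_append: "root_apply W (zs @ ys) v = root_apply W zs (root_apply W ys v)"
  by (simp add: root_apply_def)

lemma root_apply_0 [simp]: "root_apply W zs 0 = 0"
  by (induction zs) (simp_all add: root_apply_def)

lemma root_apply_lin: "root_apply W zs (\<Sum>i\<in>I. a i *s v i) = (\<Sum>i\<in>I. a i *s root_apply W zs (v i))"
proof (induction zs)
  case (Cons z zs)
  have "root_apply W (z # zs) (\<Sum>i\<in>I. a i *s v i) = W *v (\<Sum>i\<in>I. a i *s root_apply W zs (v i)) - z *s (\<Sum>i\<in>I. a i *s root_apply W zs (v i))"
    using Cons by (simp add: root_apply_def)
  also have "\<dots> = (\<Sum>i\<in>I. a i *s root_apply W (z # zs) (v i))"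
    by (simp add: root_apply_def matrix_vector_mult_sum_right vector_scalar_commute vec.scale_sum_right sum_subtractf[symmetric]
        vec.scale_right_diff_distrib vector_smult_assoc mult.commute)
  finally show ?case .
qed (simp add: root_apply_def)

text \<open>\<open>Min\<close> is meaningful on finite sets only. Concatenating the annihilating
  lists of the basis vectors gives one list that kills every vector; on an eigenvector it acts by
  the product of the differences to the eigenvalue, so each eigenvalue occurs in the list.\<close>

lemma finite_spectrum:
  fixes W :: "complex^'n::finite^'n"
  shows "finite (spectrum W)"
proof -
  obtain Z where Z: "\<And>v. root_apply W (Z v) v = 0" using matrix_annihilating_roots by metis
  obtain idx :: "'n list" where idx: "set idx = UNIV" using finite_list[OF finite] by blast
  define zs where "zs = concat (map (\<lambda>i. Z (axis i 1)) idx)"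
  have ann: "root_apply W (concat (map (\<lambda>i. Z (axis i 1)) js)) (axis i 1) = 0" if "i \<in> set js" for js i
    using that
  proof (induction js)
    case (Cons j js)
    show ?case
    proof (cases "i = j")
      case True
      then show ?thesis by (simp add: root_apply_append root_apply_swap[of W "Z _"] Z)
    next
      case False
      then show ?thesis using Cons by (simp add: root_apply_append)
    qed
  qed simp
  have all0: "root_apply W zs v = 0" for v
  proof -
    have "root_apply W zs v = root_apply W zs (\<Sum>i\<in>UNIV. v $ i *s axis i 1)" by (simp add: basis_expansion)
    also have "\<dots> = 0" unfolding root_apply_lin using ann idx by (simp add: zs_def)
    finally show ?thesis .
  qed
  have "spectrum W \<subseteq> set zs"
  proof
    fix z assume "z \<in> spectrum W"
    then obtain v where v: "v \<noteq> 0" "W *v v = z *s v" by (auto simp: spectrum_def)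
    have "root_apply W ys v = (\<Prod>y\<leftarrow>ys. z - y) *s v" for ys
    proof (induction ys)
      case (Cons y ys)
      have "root_apply W (y # ys) v = W *v ((\<Prod>y\<leftarrow>ys. z - y) *s v) - y *s ((\<Prod>y\<leftarrow>ys. z - y) *s v)"
        using Cons by (simp add: root_apply_def)
      also have "\<dots> = (((\<Prod>y\<leftarrow>ys. z - y) * z) - y * (\<Prod>y\<leftarrow>ys. z - y)) *s v"
        by (simp only: vector_scalar_commute v(2) vector_smult_assoc vector_sub_rdistrib)
      finally show ?case by (simp add: algebra_simps)
    qed (simp add: root_apply_def)
    then have "(\<Prod>y\<leftarrow>zs. z - y) = 0" using all0[of v] v(1) by (simp add: vec.scale_eq_0_iff)
    then show "z \<in> set zs" by (auto simp: prod_list_zero_iff)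
  qed
  then show ?thesis by (rule finite_subset) simp
qed

section \<open>The coefficients of a real operator with a Gaussian ground state\<close>

definition cmap :: "('n::finite \<Rightarrow> 'n \<Rightarrow> real) \<Rightarrow> real^'n \<Rightarrow> real^'n" where
  "cmap m x = (\<chi> j. \<Sum>k\<in>UNIV. m j k * x $ k)"

lemma cmap_linear: "linear (cmap m)"
  by (rule linearI) (simp_all add: cmap_def vec_eq_iff sum.distrib distrib_left sum_distrib_left mult_ac)

lemma cmap_form: "x \<bullet> cmap m y = (\<Sum>j\<in>UNIV. \<Sum>k\<in>UNIV. m j k * (x $ j * y $ k))"
  by (simp add: inner_vec_def cmap_def sum_distrib_left mult_ac)

lemma cmap_axis: "cmap m (axis k 1) $ j = m j k"
proof -
  have "cmap m (axis k 1) $ j = (\<Sum>i\<in>UNIV. if i = k then m j i else 0)"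
    unfolding cmap_def vec_lambda_beta by (intro sum.cong) (auto simp: axis_def)
  then show ?thesis by simp
qed

lemma cmap_entry: "axis j 1 \<bullet> cmap m (axis k 1) = m j k"
  by (simp add: inner_axis' cmap_axis)

lemma cmap_commute: "(\<And>j k. m j k = m k j) \<Longrightarrow> cmap m x \<bullet> y = x \<bullet> cmap m y"
proof -
  assume s: "\<And>j k. m j k = m k j"
  have "y \<bullet> cmap m x = (\<Sum>j\<in>UNIV. \<Sum>k\<in>UNIV. m j k * (y $ j * x $ k))" by (rule cmap_form)
  also have "\<dots> = (\<Sum>k\<in>UNIV. \<Sum>j\<in>UNIV. m j k * (y $ j * x $ k))" by (rule sum.swap)
  also have "\<dots> = x \<bullet> cmap m y" unfolding cmap_form by (intro sum.cong refl) (simp add: s[of _ "_::'a"] mult_ac)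
  finally show ?thesis by (simp add: inner_commute)
qed

definition trace_with :: "('n::finite \<Rightarrow> 'n \<Rightarrow> real) \<Rightarrow> (real^'n \<Rightarrow> real^'n) \<Rightarrow> real" where
  "trace_with c G = (\<Sum>j\<in>UNIV. \<Sum>k\<in>UNIV. c j k * G (axis k 1) $ j)"

text \<open>For a real frequency the Gaussian exponential is real, so a real operator forces this
  expression to vanish. It is written in terms of \<open>x\<close> and \<open>\<eta> - G x\<close>,
  which vary independently.\<close>

lemma Re_gexp_symbol:
  "Im (gexp_symbol G a b c (cvec \<eta>) x) =
     x \<bullet> cmap (\<lambda>j k. Im (a j k)) x
   + (\<Sum>j\<in>UNIV. \<Sum>k\<in>UNIV. Re (b j k) * (if j = k then 1 else 0))
   + 2 * (x \<bullet> cmap (\<lambda>j k. Re (b j k)) (\<eta> - G x))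
   - (\<eta> - G x) \<bullet> cmap (\<lambda>j k. Im (c j k)) (\<eta> - G x)
   + trace_with (\<lambda>j k. Im (c j k)) G"
  unfolding gexp_symbol_def cmap_form trace_with_def sum_distrib_left sum.distrib[symmetric] sum_subtractf[symmetric] Im_sum
  by (intro sum.cong refl) (simp add: cvec_def algebra_simps)

lemma gexp_symbol_ivec:
  fixes a \<beta> c :: "'n::finite \<Rightarrow> 'n \<Rightarrow> real"
  shows "gexp_symbol G (\<lambda>j k. of_real (a j k)) (\<lambda>j k. \<i> * of_real (\<beta> j k)) (\<lambda>j k. of_real (c j k)) (\<chi> j. \<i> * of_real (\<zeta> $ j)) x
   = of_real (x \<bullet> cmap a x - (\<Sum>j\<in>UNIV. \<Sum>k\<in>UNIV. \<beta> j k * (if j = k then 1 else 0)) + 2 * (x \<bullet> cmap \<beta> (G x))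
      + \<zeta> \<bullet> cmap c \<zeta> - G x \<bullet> cmap c (G x) + trace_with c G)
    + \<i> * of_real (\<zeta> \<bullet> cmap c (G x) + G x \<bullet> cmap c \<zeta> - 2 * (x \<bullet> cmap \<beta> \<zeta>))"
proof -
  let ?L = "gexp_symbol G (\<lambda>j k. of_real (a j k)) (\<lambda>j k. \<i> * of_real (\<beta> j k)) (\<lambda>j k. of_real (c j k)) (\<chi> j. \<i> * of_real (\<zeta> $ j)) x"
  have "Re ?L = x \<bullet> cmap a x - (\<Sum>j\<in>UNIV. \<Sum>k\<in>UNIV. \<beta> j k * (if j = k then 1 else 0)) + 2 * (x \<bullet> cmap \<beta> (G x))
      + \<zeta> \<bullet> cmap c \<zeta> - G x \<bullet> cmap c (G x) + trace_with c G"
    unfolding gexp_symbol_def cmap_form trace_with_def sum_distrib_left sum.distrib[symmetric] sum_subtractf[symmetric] Re_sum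
    by (intro sum.cong refl) (simp add: algebra_simps)
  moreover have "Im ?L = \<zeta> \<bullet> cmap c (G x) + G x \<bullet> cmap c \<zeta> - 2 * (x \<bullet> cmap \<beta> \<zeta>)"
    unfolding gexp_symbol_def cmap_form trace_with_def sum_distrib_left sum.distrib[symmetric] sum_subtractf[symmetric] Im_sum
    by (intro sum.cong refl) (simp add: algebra_simps)
  ultimately show ?thesis by (intro complex_eqI) simp_all
qed

lemma symmetric_form_zero:
  assumes s: "\<And>j k. m j k = m k j" and z: "\<And>x. x \<bullet> cmap m x = 0"
  shows "m j k = 0"
proof -
  note l = linear_add[OF cmap_linear]
  have "(axis j 1 + axis k 1) \<bullet> cmap m (axis j 1 + axis k 1) = m j j + m j k + (m k j + m k k)"
    by (simp add: l inner_add_left inner_add_right cmap_entry)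
  then show ?thesis using z[of "axis j 1 + axis k 1"] z[of "axis j 1"] z[of "axis k 1"] s[of j k]
    by (simp add: cmap_entry)
qed

text \<open>Substituting \<open>w = \<eta> - G x\<close> makes the vanishing imaginary part a
  polynomial in the free vectors \<open>x\<close> and \<open>w\<close>. Its pure parts give
  \<open>Im a = 0\<close> and \<open>Im c = 0\<close> by polarization; the mixed part gives
  \<open>Re b = 0\<close> entry by entry, as \<open>b\<close> has no symmetry.\<close>

lemma real_coefficients:
  fixes G :: "real^'n::finite \<Rightarrow> real^'n" and a b c :: "'n \<Rightarrow> 'n \<Rightarrow> complex"
  assumes G: "pos_def_map G" and re: "real_op (max_op a b c)"
    and a: "\<And>j k. a j k = a k j" and c: "\<And>j k. c j k = c k j"
  shows "Im (a j k) = 0" "Re (b j k) = 0" "Im (c j k) = 0"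
proof -
  have gr: "gexp G (cvec \<eta>) x = of_real (gauss G x * exp (\<eta> \<bullet> x))" for \<eta> x
    by (simp add: gexp_def cdot_def cvec_def inner_vec_def exp_of_real flip: of_real_mult of_real_sum)
  have "Im (gexp_symbol G a b c (cvec \<eta>) x * gexp G (cvec \<eta>) x) = 0" for \<eta> x
    unfolding diff_op_gexp[OF G, symmetric]
    by (rule real_op_diff_op_real[OF re c smooth_gexp[OF G]]) (simp add: gr)
  then have z: "Im (gexp_symbol G a b c (cvec \<eta>) x) = 0" for \<eta> x by (simp add: gr)
  define t where "t = (\<Sum>j\<in>UNIV. \<Sum>k\<in>UNIV. Re (b j k) * (if j = k then 1 else 0))"
  define s where "s = trace_with (\<lambda>j k. Im (c j k)) G"
  have h: "x \<bullet> cmap (\<lambda>j k. Im (a j k)) x + t + 2 * (x \<bullet> cmap (\<lambda>j k. Re (b j k)) w) - w \<bullet> cmap (\<lambda>j k. Im (c j k)) w + s = 0" for x w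
    using z[of "w + G x" x] unfolding Re_gexp_symbol t_def s_def by simp
  note l0 = linear_0[OF cmap_linear]
  have ts: "t + s = 0" using h[of 0 0] by (simp add: l0)
  have "w \<bullet> cmap (\<lambda>j k. Im (c j k)) w = 0" for w using h[of 0 w] ts by simp
  then show c0: "Im (c j k) = 0" for j k by (rule symmetric_form_zero[rotated]) (simp add: c[of _ "_::'n"])
  have a0': "x \<bullet> cmap (\<lambda>j k. Im (a j k)) x = 0" for x using h[of x 0] ts by (simp add: l0)
  then show "Im (a j k) = 0" by (rule symmetric_form_zero[rotated]) (simp add: a[of _ "_::'n"])
  have "axis j 1 \<bullet> cmap (\<lambda>j k. Re (b j k)) (axis k 1) = 0"
    using h[of "axis j 1" "axis k 1"] ts a0'[of "axis j 1"] c0 by (simp add: cmap_entry)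
  then show "Re (b j k) = 0" by (simp add: cmap_entry)
qed

text \<open>Writing \<open>G\<close> as a sum of squares of linear forms turns the trace of the
  product into a sum of values of the form \<open>c\<close>.\<close>

lemma trace_with_nonneg:
  assumes G: "pos_def_map G" and c: "\<And>x. x \<bullet> cmap c x \<ge> 0"
  shows "trace_with c G \<ge> 0"
proof -
  have "\<exists>v. \<forall>x. x \<bullet> G x = (\<Sum>i\<in>(UNIV::'a set). (v i \<bullet> x)\<^sup>2)"
    using pos_def_mapD[OF G] by (intro psd_sum_of_squares) auto
  then obtain v where v: "\<And>x. x \<bullet> G x = (\<Sum>i\<in>(UNIV::'a set). (v i \<bullet> x)\<^sup>2)" by blast
  have ent: "G (axis k 1) $ j = (\<Sum>i\<in>UNIV. v i $ j * v i $ k)" for j k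
  proof -
    let ?x = "axis j 1 :: real^'a" and ?y = "axis k 1 :: real^'a"
    have "2 * (?x \<bullet> G ?y) = (?x + ?y) \<bullet> G (?x + ?y) - ?x \<bullet> G ?x - ?y \<bullet> G ?y"
      using pos_def_mapD(2)[OF G, of ?x ?y]
      by (simp add: linear_add[OF pos_def_mapD(1)[OF G]] inner_add_left inner_add_right inner_commute)
    also have "\<dots> = (\<Sum>i\<in>UNIV. 2 * (v i $ j * v i $ k))"
      unfolding v sum_subtractf[symmetric]
      by (intro sum.cong refl) (simp add: inner_add_right inner_axis power2_sum)
    finally show ?thesis by (simp add: inner_axis' sum_distrib_left[symmetric])
  qed
  have "trace_with c G = (\<Sum>j\<in>UNIV. \<Sum>k\<in>UNIV. \<Sum>i\<in>UNIV. c j k * (v i $ j * v i $ k))"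
    unfolding trace_with_def ent sum_distrib_left ..
  also have "\<dots> = (\<Sum>j\<in>UNIV. \<Sum>i\<in>UNIV. \<Sum>k\<in>UNIV. c j k * (v i $ j * v i $ k))"
    by (intro sum.cong refl sum.swap)
  also have "\<dots> = (\<Sum>i\<in>UNIV. v i \<bullet> cmap c (v i))" unfolding cmap_form by (rule sum.swap)
  also have "\<dots> \<ge> 0" by (intro sum_nonneg c)
  finally show ?thesis .
qed

text \<open>The Weyl symbol of the operator is \<open>x \<bullet> a x + 2 \<i> x \<bullet> \<beta> \<xi> + \<xi> \<bullet> c \<xi>\<close>; its ground state and that of
  its adjoint are the Gaussian of covariance \<open>(2 G)\<^sup>-\<^sup>1\<close>.\<close>

locale ground_state =
  fixes G :: "real^'n::finite \<Rightarrow> real^'n" and a \<beta> c :: "'n \<Rightarrow> 'n \<Rightarrow> real" and \<mu> :: complex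
  assumes G: "pos_def_map G" and a_sym: "a j k = a k j" and c_sym: "c j k = c k j"
    and a_nonneg: "x \<bullet> cmap a x \<ge> 0" and c_nonneg: "x \<bullet> cmap c x \<ge> 0"
    and ker: "gexp_symbol G (\<lambda>j k. of_real (a j k)) (\<lambda>j k. \<i> * of_real (- \<beta> j k)) (\<lambda>j k. of_real (c j k)) 0 x = \<mu>"
    and adj: "gexp_symbol G (\<lambda>j k. of_real (a j k)) (\<lambda>j k. \<i> * of_real (\<beta> j k)) (\<lambda>j k. of_real (c j k)) 0 x = cnj \<mu>"
begin

sublocale gauss_weight G by unfold_locales (rule G)

definition A where "A = cmap c"
definition B where "B = cmap \<beta>"
definition C where "C = cmap a"
definition m where "m = trace_with c G"

lemma lin: "linear A" "linear B" "linear C" by (simp_all add: A_def B_def C_def cmap_linear)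
lemmas lins = linear_add[OF lin(1)] linear_scale[OF lin(1)] linear_0[OF lin(1)]
  linear_add[OF lin(2)] linear_scale[OF lin(2)] linear_0[OF lin(2)]
  linear_add[OF pos_def_mapD(1)[OF G]] linear_scale[OF pos_def_mapD(1)[OF G]]

lemma A_sym: "A x \<bullet> y = x \<bullet> A y" unfolding A_def by (rule cmap_commute[OF c_sym])
lemma C_sym: "C x \<bullet> y = x \<bullet> C y" unfolding C_def by (rule cmap_commute[OF a_sym])

lemma zero_vec_ivec: "(0 :: complex^'n) = (\<chi> j. \<i> * of_real ((0::real^'n) $ j))"
  by (simp add: vec_eq_iff)

lemma cmap_uminus: "cmap (\<lambda>j k. - f j k) x = - cmap f x" for f :: "'n \<Rightarrow> 'n \<Rightarrow> real"
  by (simp add: cmap_def vec_eq_iff sum_negf)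

text \<open>The two kernel equations differ in the sign of \<beta> only. At \<open>x = 0\<close>
  they show that the eigenvalue is real and that the trace of \<beta> vanishes; their difference
  then gives the odd identity for \<open>B (G x)\<close>, their sum the even identity relating
  \<open>C\<close> and \<open>A\<close>.\<close>

lemma equations: "\<mu> = of_real m" "x \<bullet> B (G x) = 0" "x \<bullet> C x = G x \<bullet> A (G x)"
  "(\<Sum>j\<in>UNIV. \<Sum>k\<in>UNIV. \<beta> j k * (if j = k then 1 else 0)) = 0"
proof -
  define t where "t = (\<Sum>j\<in>UNIV. \<Sum>k\<in>UNIV. \<beta> j k * (if j = k then 1 else 0))"
  have z: "cmap f (0::real^'n) = 0" for f by (rule linear_0[OF cmap_linear])
  have tn: "(\<Sum>j\<in>UNIV. \<Sum>k\<in>UNIV. - \<beta> j k * (if j = k then 1 else 0)) = - t"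
    unfolding t_def by (simp only: mult_minus_left sum_negf)
  have k: "\<mu> = of_real (x \<bullet> C x + t - 2 * (x \<bullet> B (G x)) - G x \<bullet> A (G x) + m)" for x
    using ker[of x] unfolding zero_vec_ivec gexp_symbol_ivec tn cmap_uminus
    by (simp add: z A_def B_def C_def m_def)
  have ad: "cnj \<mu> = of_real (x \<bullet> C x - t + 2 * (x \<bullet> B (G x)) - G x \<bullet> A (G x) + m)" for x
    using adj[of x] unfolding zero_vec_ivec gexp_symbol_ivec t_def[symmetric]
    by (simp add: z A_def B_def C_def m_def)
  have Gz: "G 0 = 0" by (rule linear_0[OF pos_def_mapD(1)[OF G]])
  have k0: "\<mu> = of_real (t + m)" using k[of 0] by (simp add: Gz lins)
  have "cnj \<mu> = of_real (- t + m)" using ad[of 0] by (simp add: Gz lins)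
  then have t0: "t = 0" using k0 by (simp add: complex_eq_iff)
  then show "(\<Sum>j\<in>UNIV. \<Sum>k\<in>UNIV. \<beta> j k * (if j = k then 1 else 0)) = 0" by (simp add: t_def)
  show mu: "\<mu> = of_real m" using k0 t0 by simp
  have 1: "x \<bullet> C x - 2 * (x \<bullet> B (G x)) - G x \<bullet> A (G x) = 0" using k[of x] mu t0 by (simp only: of_real_eq_iff)
  have "complex_of_real m = of_real (x \<bullet> C x - t + 2 * (x \<bullet> B (G x)) - G x \<bullet> A (G x) + m)" using ad[of x] mu by simp
  then have 2: "x \<bullet> C x + 2 * (x \<bullet> B (G x)) - G x \<bullet> A (G x) = 0" using t0 by (simp only: of_real_eq_iff)
  show "x \<bullet> B (G x) = 0" "x \<bullet> C x = G x \<bullet> A (G x)" using 1 2 by linarith+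
qed

lemma m_nonneg: "m \<ge> 0" unfolding m_def by (rule trace_with_nonneg[OF G c_nonneg])

lemma B_G_antisym: "x \<bullet> B (G y) = - (y \<bullet> B (G x))"
  using equations(2)[of "x + y"] equations(2)[of x] equations(2)[of y]
  by (simp add: lins inner_add_left inner_add_right)

lemma C_eq: "C x = G (A (G x))"
proof -
  have "y \<bullet> C x = y \<bullet> G (A (G x))" for y
  proof -
    have p1: "(x + y) \<bullet> C (x + y) = x \<bullet> C x + y \<bullet> C y + 2 * (y \<bullet> C x)"
      using C_sym[of x y] by (simp add: linear_add[OF lin(3)] inner_add_left inner_add_right inner_commute)
    have p2: "G (x + y) \<bullet> A (G (x + y)) = G x \<bullet> A (G x) + G y \<bullet> A (G y) + 2 * (G y \<bullet> A (G x))"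
      using A_sym[of "G x" "G y"] by (simp add: lins inner_add_left inner_add_right inner_commute)
    have "y \<bullet> C x = G y \<bullet> A (G x)" using p1 p2 equations(3)[of "x + y"] equations(3)[of x] equations(3)[of y] by linarith
    then show ?thesis using pos_def_mapD(2)[OF G, of y "A (G x)"] by simp
  qed
  then have "(C x - G (A (G x))) \<bullet> (C x - G (A (G x))) = 0" by (simp add: inner_diff_right)
  then show ?thesis by simp
qed

text \<open>The sign \<sigma> selects the operator or its transpose: \<open>N (- \<sigma>)\<close>
  is the K-adjoint of \<open>N \<sigma>\<close>. Its part \<open>G A\<close> is self-adjoint and its
  part \<open>B\<close> antisymmetric in the metric \<open>K\<close>.\<close>

definition N where "N \<sigma> \<zeta> = 2 *\<^sub>R G (A \<zeta>) + (2 * \<sigma>) *\<^sub>R B \<zeta>" for \<sigma> :: real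

lemma N_linear: "linear (N \<sigma>)"
  by (rule linearI) (simp_all add: N_def lins algebra_simps)

lemma G_K: "G (K \<zeta>) = (1/2) *\<^sub>R \<zeta>" using G2_K[of \<zeta>] by (simp add: G2_def) (metis scaleR_half_double scaleR_2 scaleR_right_distrib scaleR_half_double)

lemma K_G: "K (G \<zeta>) = (1/2) *\<^sub>R \<zeta>" using K_G2[of \<zeta>] by (simp add: G2_def K_simps) (metis scaleR_half_double scaleR_2 scaleR_right_distrib)

lemma K_B_antisym: "\<xi> \<bullet> K (B \<eta>) = - (\<eta> \<bullet> K (B \<xi>))"
proof -
  have e: "B \<eta> = 2 *\<^sub>R B (G (K \<eta>))" for \<eta> by (simp add: G_K lins)
  have "\<xi> \<bullet> K (B \<eta>) = 2 * (K \<xi> \<bullet> B (G (K \<eta>)))" for \<xi> \<eta>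
    using pos_def_mapD(2)[OF K, of \<xi> "B \<eta>"] by (simp add: e[of \<eta>])
  then show ?thesis using B_G_antisym[of "K \<xi>" "K \<eta>"] by simp
qed

lemma K_N: "\<zeta> \<bullet> K (N \<sigma> \<eta>) = \<zeta> \<bullet> A \<eta> + 2 * \<sigma> * (\<zeta> \<bullet> K (B \<eta>))"
  by (simp add: N_def K_simps K_G inner_add_right)

lemma K_B_diag: "\<zeta> \<bullet> K (B \<zeta>) = 0" using K_B_antisym[of \<zeta> \<zeta>] by simp

lemma N_transposed: "N \<sigma> \<xi> \<bullet> K \<eta> = \<xi> \<bullet> K (N (- \<sigma>) \<eta>)"
  using K_N[of \<eta> \<sigma> \<xi>] K_N[of \<xi> "- \<sigma>" \<eta>] A_sym[of \<xi> \<eta>] K_B_antisym[of \<eta> \<xi>] K_commute[of "N \<sigma> \<xi>" \<eta>]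
  by (simp add: inner_commute)

lemma ou_N:
  assumes \<sigma>: "\<sigma> = 1 \<or> \<sigma> = - 1"
  shows "ou G (N \<sigma>) m (\<lambda>j k. of_real (a j k)) (\<lambda>j k. \<i> * of_real (- \<sigma> * \<beta> j k)) (\<lambda>j k. of_real (c j k))"
proof (intro ou.intro ou_axioms.intro gauss_weight_axioms)
  show "linear (N \<sigma>)" by (rule N_linear)
  show "0 \<le> m" by (rule m_nonneg)
  show "0 \<le> \<zeta> \<bullet> K (N \<sigma> \<zeta>)" for \<zeta> using c_nonneg[of \<zeta>] by (simp add: K_N K_B_diag A_def)
  fix \<zeta> x
  have cs: "cmap (\<lambda>j k. - \<sigma> * \<beta> j k) y = - \<sigma> *\<^sub>R B y" for y
    unfolding B_def by (simp add: cmap_def vec_eq_iff sum_distrib_left mult.assoc mult.left_commute mult.commute flip: sum_negf)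
  have ts: "(\<Sum>j\<in>UNIV. \<Sum>k\<in>UNIV. - \<sigma> * \<beta> j k * (if j = k then 1 else 0)) = 0"
    using equations(4) by (simp only: mult.assoc sum_distrib_left[symmetric] mult_zero_right)
  have "gexp_symbol G (\<lambda>j k. of_real (a j k)) (\<lambda>j k. \<i> * of_real (- \<sigma> * \<beta> j k)) (\<lambda>j k. of_real (c j k)) (ivec \<zeta>) x
   = of_real (x \<bullet> C x - 0 + 2 * (x \<bullet> (- \<sigma> *\<^sub>R B (G x))) + \<zeta> \<bullet> A \<zeta> - G x \<bullet> A (G x) + m)
    + \<i> * of_real (\<zeta> \<bullet> A (G x) + G x \<bullet> A \<zeta> - 2 * (x \<bullet> (- \<sigma> *\<^sub>R B \<zeta>)))"
    unfolding gexp_symbol_ivec ts cs by (simp add: A_def C_def m_def)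
  \<comment> \<open>The terms quadratic in \<open>x\<close> cancel by \<open>equations\<close>,
    which leaves an Ornstein--Uhlenbeck symbol.\<close>
  also have "x \<bullet> C x - 0 + 2 * (x \<bullet> (- \<sigma> *\<^sub>R B (G x))) + \<zeta> \<bullet> A \<zeta> - G x \<bullet> A (G x) + m = m + \<zeta> \<bullet> K (N \<sigma> \<zeta>)"
    using equations(2,3)[of x] by (simp add: K_N K_B_diag)
  also have "\<zeta> \<bullet> A (G x) + G x \<bullet> A \<zeta> - 2 * (x \<bullet> (- \<sigma> *\<^sub>R B \<zeta>)) = N \<sigma> \<zeta> \<bullet> x"
    using A_sym[of \<zeta> "G x"] pos_def_mapD(2)[OF G, of x "A \<zeta>"]
    by (simp add: N_def inner_add_left inner_add_right inner_commute)
  finally show "gexp_symbol G (\<lambda>j k. of_real (a j k)) (\<lambda>j k. \<i> * of_real (- \<sigma> * \<beta> j k)) (\<lambda>j k. of_real (c j k)) (ivec \<zeta>) x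
    = of_real (m + \<zeta> \<bullet> K (N \<sigma> \<zeta>)) + \<i> * of_real (N \<sigma> \<zeta> \<bullet> x)" .
qed

lemma pair: "ou_pair G (N 1) (N (- 1)) m (\<lambda>j k. of_real (a j k)) (\<lambda>j k. \<i> * of_real (\<beta> j k)) (\<lambda>j k. of_real (c j k))"
proof (intro ou_pair.intro ou_pair_axioms.intro)
  show "ou G (N 1) m (\<lambda>j k. of_real (a j k)) (\<lambda>j k. - (\<i> * of_real (\<beta> j k))) (\<lambda>j k. of_real (c j k))"
    using ou_N[of 1] by simp
  show "ou G (N (- 1)) m (\<lambda>j k. of_real (a j k)) (\<lambda>j k. \<i> * of_real (\<beta> j k)) (\<lambda>j k. of_real (c j k))"
    using ou_N[of "- 1"] by simp
qed (auto simp: N_transposed c_sym)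

end

section \<open>The spectrum of the Hamilton map\<close>

lemma complexify_eigenvector:
  fixes B :: "real^'n::finite \<Rightarrow> real^'n"
  assumes B: "linear B" and z: "z \<in> spectrum (complexify B)"
  shows "\<exists>p q. (p \<noteq> 0 \<or> q \<noteq> 0) \<and> B p = Re z *\<^sub>R p - Im z *\<^sub>R q \<and> B q = Im z *\<^sub>R p + Re z *\<^sub>R q"
proof -
  obtain v where v: "v \<noteq> 0" "complexify B *v v = z *s v" using z by (auto simp: spectrum_def)
  define p q :: "real^'n" where "p = (\<chi> j. Re (v $ j))" and "q = (\<chi> j. Im (v $ j))"
  have e: "(\<Sum>j\<in>UNIV. of_real (B (axis j 1) $ i) * v $ j) = z * v $ i" for i
    using v(2) by (simp add: vec_eq_iff complexify_def matrix_vector_mult_def)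
  have "B p $ i = Re (z * v $ i)" "B q $ i = Im (z * v $ i)" for i
    unfolding e[symmetric] linear_coord_expansion[OF B, of p] linear_coord_expansion[OF B, of q]
    by (simp_all add: p_def q_def mult.commute)
  then have "B p = Re z *\<^sub>R p - Im z *\<^sub>R q" "B q = Im z *\<^sub>R p + Re z *\<^sub>R q"
    by (simp_all add: vec_eq_iff p_def q_def)
  moreover have "p \<noteq> 0 \<or> q \<noteq> 0" using v(1) by (auto simp: vec_eq_iff p_def q_def complex_eq_iff)
  ultimately show ?thesis by blast
qed

text \<open>A square root \<open>L\<close> of the form kills \<open>x\<close>. Evaluating the form
  at \<open>Q x + x\<close> once through \<open>L\<close> and once by expansion leaves twice the
  squared norm of \<open>Q x\<close> equal to 0.\<close>

lemma psd_kernel: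
  fixes Q :: "real^'n::finite \<Rightarrow> real^'n"
  assumes Q: "linear Q" "\<And>x y. Q x \<bullet> y = x \<bullet> Q y" "\<And>x. x \<bullet> Q x \<ge> 0" and x: "x \<bullet> Q x = 0"
  shows "Q x = 0"
proof -
  obtain L :: "real^'n \<Rightarrow> real^'n" where L: "linear L" "\<And>x. L x \<bullet> L x = x \<bullet> Q x" using psd_factor[OF Q] by blast
  have Lx: "L x = 0" using L(2)[of x] x by simp
  have "(Q x + x) \<bullet> Q (Q x + x) = Q x \<bullet> Q (Q x)"
    unfolding L(2)[symmetric] by (simp add: linear_add[OF L(1)] Lx)
  moreover have "x \<bullet> Q (Q x) = Q x \<bullet> Q x" using Q(2)[of x "Q x"] by simp
  ultimately have "Q x \<bullet> Q x = 0" using x by (simp add: linear_add[OF Q(1)] inner_add_left inner_add_right)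
  then show ?thesis by simp
qed

definition momentum :: "real^'n::finite \<Rightarrow> real^('n + 'n)" where
  "momentum w = (\<chi> i. case i of Inl j \<Rightarrow> 0 | Inr j \<Rightarrow> w $ j)"

context ground_state
begin

definition F where "F = ham (\<lambda>j k. of_real (a j k)) (\<lambda>j k. \<i> * of_real (\<beta> j k)) (\<lambda>j k. of_real (c j k))"

lemma re_F_momentum: "A w = 0 \<Longrightarrow> re_matrix F *v cvec (momentum w) = 0"
proof -
  assume "A w = 0"
  then have A0: "(\<Sum>k\<in>UNIV. complex_of_real (c j k) * of_real (w $ k)) = 0" for j
    by (simp add: A_def cmap_def vec_eq_iff flip: of_real_mult of_real_sum)
  have "re_matrix F = ham (\<lambda>j k. of_real (a j k)) (\<lambda>j k. 0) (\<lambda>j k. of_real (c j k))"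
    by (simp add: vec_eq_iff re_matrix_def F_def ham_def split: sum.split)
  then have "(re_matrix F *v cvec (momentum w)) $ i = 0" for i
    by (cases i) (simp_all add: ham_mult cvec_def momentum_def A0)
  then show ?thesis by (simp add: vec_eq_iff)
qed

lemma im_F_momentum: "im_matrix F *v cvec (momentum w) = cvec (momentum (- B w))"
proof -
  have "im_matrix F = ham (\<lambda>j k. 0) (\<lambda>j k. of_real (\<beta> j k)) (\<lambda>j k. 0)"
    by (simp add: vec_eq_iff im_matrix_def F_def ham_def split: sum.split)
  then have "(im_matrix F *v cvec (momentum w)) $ i = cvec (momentum (- B w)) $ i" for i
    by (cases i) (simp_all add: ham_mult cvec_def momentum_def B_def cmap_def)
  then show ?thesis by (simp add: vec_eq_iff)
qed

lemma \<beta>_K: "(\<Sum>k\<in>UNIV. \<beta> k j * K x $ k) = - (K (B x) $ j)"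
proof -
  have "K (B x) $ j = axis j 1 \<bullet> K (B x)" by (simp add: inner_axis')
  also have "\<dots> = - (K x \<bullet> B (axis j 1))" using K_B_antisym[of "axis j 1" x] pos_def_mapD(2)[OF K] by simp
  also have "K x \<bullet> B (axis j 1) = (\<Sum>k\<in>UNIV. \<beta> k j * K x $ k)"
    by (simp add: inner_vec_def B_def cmap_axis mult.commute)
  finally show ?thesis by simp
qed

text \<open>The condition is imposed for all \<open>j\<close>, without a bound on the exponent: the
  vectors satisfying it lie in the singular space, so it follows from the vanishing of that space,
  and iterates need not be counted.\<close>

context
  assumes singular: "\<And>X. (\<And>j. re_matrix F *v (((*v) (im_matrix F) ^^ j) (cvec X)) = 0) \<Longrightarrow> X = 0"
begin

text \<open>On pure momenta the imaginary part of \<open>F\<close> acts as \<open>- B\<close> and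
  the real part kills the kernel of \<open>A\<close>. A plane in this kernel that is invariant under
  \<open>B\<close> therefore stays in it under all iterates and lies in the singular space.\<close>

lemma no_B_invariant_kernel:
  assumes p: "A p = 0" "A q = 0" and B: "B p = s *\<^sub>R q" "B q = t *\<^sub>R p"
  shows "p = 0"
proof -
  have "\<exists>x y. ((*v) (im_matrix F) ^^ j) (cvec (momentum p)) = cvec (momentum (x *\<^sub>R p + y *\<^sub>R q))" for j
  proof (induction j)
    case 0
    show ?case by (intro exI[of _ 1] exI[of _ 0]) simp
  next
    case (Suc j)
    then obtain x y where xy: "((*v) (im_matrix F) ^^ j) (cvec (momentum p)) = cvec (momentum (x *\<^sub>R p + y *\<^sub>R q))" by blast
    have "- B (x *\<^sub>R p + y *\<^sub>R q) = (- y * t) *\<^sub>R p + (- x * s) *\<^sub>R q" by (simp add: lins B)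
    then show ?case by (intro exI[of _ "- y * t"] exI[of _ "- x * s"]) (simp add: xy im_F_momentum)
  qed
  then have "re_matrix F *v (((*v) (im_matrix F) ^^ j) (cvec (momentum p))) = 0" for j
    using re_F_momentum by (metis lins(1,2) p scaleR_zero_right add_0)
  from singular[OF this] have "momentum p $ Inr j = 0" for j by simp
  then show ?thesis by (simp add: momentum_def vec_eq_iff)
qed

text \<open>Evaluating the form \<open>K (N \<zeta>)\<close> on the real and imaginary parts of an
  eigenvector leaves only \<open>A\<close>, as \<open>B\<close> is antisymmetric in the metric
  \<open>K\<close>; so \<open>Re z\<close> is a quotient of a nonnegative by a positive number. If
  it vanished, both parts would lie in the kernel of \<open>A\<close> and span a subspace invariant
  under \<open>B\<close>.\<close>

lemma spectrum_N:
  assumes z: "z \<in> spectrum (complexify (N (- 1)))"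
  shows "Re z > 0" "\<i> * z / 2 \<in> spectrum F"
proof -
  obtain p q where nz: "p \<noteq> 0 \<or> q \<noteq> 0" and Np: "N (- 1) p = Re z *\<^sub>R p - Im z *\<^sub>R q"
    and Nq: "N (- 1) q = Im z *\<^sub>R p + Re z *\<^sub>R q"
    using complexify_eigenvector[OF N_linear z] by blast
  have Kpos: "\<zeta> \<bullet> K \<zeta> > 0" if "\<zeta> \<noteq> 0" for \<zeta> using pos_def_mapD(3)[OF K that] .
  have Knn: "\<zeta> \<bullet> K \<zeta> \<ge> 0" for \<zeta> using Kpos[of \<zeta>] by (cases "\<zeta> = 0") auto
  have An: "\<zeta> \<bullet> A \<zeta> \<ge> 0" for \<zeta> using c_nonneg by (simp add: A_def)
  have "p \<bullet> K (N (- 1) p) + q \<bullet> K (N (- 1) q) = p \<bullet> A p + q \<bullet> A q" by (simp add: K_N K_B_diag)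
  moreover have "p \<bullet> K (N (- 1) p) + q \<bullet> K (N (- 1) q) = Re z * (p \<bullet> K p + q \<bullet> K q)"
    unfolding Np Nq using K_commute[of p q]
    by (simp add: K_simps inner_add_right inner_diff_right algebra_simps)
  ultimately have form: "p \<bullet> A p + q \<bullet> A q = Re z * (p \<bullet> K p + q \<bullet> K q)" by simp
  have pq: "p \<bullet> K p + q \<bullet> K q > 0" using nz Kpos[of p] Kpos[of q] Knn[of p] Knn[of q] by fastforce
  have "Re z \<noteq> 0"
  proof
    assume 0: "Re z = 0"
    have "p \<bullet> A p = 0" "q \<bullet> A q = 0" using form An[of p] An[of q] unfolding 0 by auto
    then have Apq: "A p = 0" "A q = 0" using psd_kernel[OF lin(1) A_sym An] by auto
    have "2 *\<^sub>R B p = Im z *\<^sub>R q" and "- (2 *\<^sub>R B q) = Im z *\<^sub>R p"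
      using Np Nq Apq 0 linear_0[OF pos_def_mapD(1)[OF G]] by (simp_all add: N_def)
    then have "2 *\<^sub>R B p = Im z *\<^sub>R q" "2 *\<^sub>R B q = - Im z *\<^sub>R p" by (metis minus_minus scaleR_minus_left)+
    then have "(1/2) *\<^sub>R 2 *\<^sub>R B p = (1/2) *\<^sub>R Im z *\<^sub>R q" "(1/2) *\<^sub>R 2 *\<^sub>R B q = (1/2) *\<^sub>R - Im z *\<^sub>R p" by simp_all
    then have "B p = (Im z / 2) *\<^sub>R q" "B q = (- Im z / 2) *\<^sub>R p" by simp_all
    then have "p = 0" "q = 0" using no_B_invariant_kernel Apq by blast+
    then show False using nz by simp
  qed
  moreover have "Re z \<ge> 0"
    using form An[of p] An[of q] pq by (metis add_nonneg_nonneg zero_le_mult_iff not_le)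
  ultimately show "Re z > 0" by simp
  \<comment> \<open>With \<open>v = p + \<i> q\<close> this is \<open>(y, \<i> G y)\<close> for
    \<open>y = 2 K v\<close>, since \<open>G (K v) = v / 2\<close>: a point of the Lagrangian plane
    attached to the Gaussian \<open>u0\<close>. On this plane, in the coordinate \<open>v\<close>,
    the Hamilton map acts as \<open>\<i> / 2\<close> times \<open>N (- 1)\<close>.\<close>
  define Y :: "complex^('n + 'n)" where "Y = (\<chi> i. case i of
      Inl j \<Rightarrow> 2 * (of_real (K p $ j) + \<i> * of_real (K q $ j))
    | Inr j \<Rightarrow> \<i> * of_real (p $ j) - of_real (q $ j))"
  have KN: "K (N (- 1) \<zeta>) = A \<zeta> - 2 *\<^sub>R K (B \<zeta>)" for \<zeta> by (simp add: N_def K_simps K_G)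
  have KB: "2 * K (B p) $ j = A p $ j - (Re z * K p $ j - Im z * K q $ j)"
    "2 * K (B q) $ j = A q $ j - (Im z * K p $ j + Re z * K q $ j)" for j
    using arg_cong[OF KN[of p], of "\<lambda>v. v $ j"] arg_cong[OF KN[of q], of "\<lambda>v. v $ j"]
    unfolding Np Nq by (simp_all add: K_simps)
  have GA: "C (K \<zeta>) = (1/2) *\<^sub>R G (A \<zeta>)" for \<zeta> by (simp add: C_eq G_K lins)
  have CK: "4 * C (K p) $ j = Re z * p $ j - Im z * q $ j + 2 * B p $ j"
    "4 * C (K q) $ j = Im z * p $ j + Re z * q $ j + 2 * B q $ j" for j
    using arg_cong[OF Np, of "\<lambda>v. v $ j"] arg_cong[OF Nq, of "\<lambda>v. v $ j"] by (simp_all add: N_def GA)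
  have s: "(\<Sum>k\<in>UNIV. a j k * x $ k) = C x $ j" "(\<Sum>k\<in>UNIV. \<beta> j k * x $ k) = B x $ j"
    "(\<Sum>k\<in>UNIV. c j k * x $ k) = A x $ j" for j x by (simp_all add: A_def B_def C_def cmap_def)
  have "(F *v Y) $ i = ((\<i> * z / 2) *s Y) $ i" for i
  proof (cases i)
    case (Inl j)
    have 1: "(\<Sum>k\<in>UNIV. \<i> * of_real (\<beta> k j) * Y $ Inl k) = of_real (2 * K (B q) $ j) - \<i> * of_real (2 * K (B p) $ j)"
      using \<beta>_K[of j p] \<beta>_K[of j q]
      by (simp add: Y_def complex_eq_iff algebra_simps sum_negf sum_distrib_left[symmetric])
    have 2: "(\<Sum>k\<in>UNIV. of_real (c j k) * Y $ Inr k) = \<i> * of_real (A p $ j) - of_real (A q $ j)"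
      using s(3)[of j p] s(3)[of j q] by (simp add: Y_def complex_eq_iff sum_negf)
    show ?thesis unfolding Inl F_def ham_mult 1 2 KB by (simp add: Y_def complex_eq_iff)
  next
    case (Inr j)
    have 1: "(\<Sum>k\<in>UNIV. \<i> * of_real (\<beta> j k) * Y $ Inr k) = - of_real (B p $ j) - \<i> * of_real (B q $ j)"
      using s(2)[of j p] s(2)[of j q] by (simp add: Y_def complex_eq_iff sum_negf)
    have 2: "(\<Sum>k\<in>UNIV. of_real (a j k) * Y $ Inl k) = of_real (2 * C (K p) $ j) + \<i> * of_real (2 * C (K q) $ j)"
      using s(1)[of j "K p"] s(1)[of j "K q"]
      by (simp add: Y_def complex_eq_iff algebra_simps sum_distrib_left[symmetric])
    show ?thesis unfolding Inr F_def ham_mult 1 2 using CK[of j] by (simp add: Y_def complex_eq_iff)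
  qed
  then have "F *v Y = (\<i> * z / 2) *s Y" by (simp add: vec_eq_iff)
  moreover have "Y \<noteq> 0"
  proof
    assume "Y = 0"
    then have "Y $ Inr j = 0" for j by simp
    then have "\<i> * of_real (p $ j) - of_real (q $ j) = (0::complex)" for j by (simp add: Y_def)
    then have "p $ j = 0 \<and> q $ j = 0" for j by (simp add: complex_eq_iff)
    then show False using nz by (simp add: vec_eq_iff)
  qed
  ultimately show "\<i> * z / 2 \<in> spectrum F" by (auto simp: spectrum_def)
qed


end

end

section \<open>Convergence to equilibrium\<close>

lemma max_op_lincomb:
  assumes "(u, v) \<in> max_op a b c" "(u', v') \<in> max_op a b c"
  shows "(\<lambda>x. \<kappa> * u x + \<kappa>' * u' x, \<lambda>x. \<kappa> * v x + \<kappa>' * v' x) \<in> max_op a b c"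
proof -
  have L: "u \<in> L2" "v \<in> L2" "u' \<in> L2" "v' \<in> L2" using assms by (auto simp: max_op_def)
  show ?thesis
    using assms unfolding max_op_def
    by (auto intro!: L2_lincomb L simp: distr_of_lincomb_left L test_fun_L2 test_diff_op)
qed

text \<open>Supplies the dense part of the domain that uniqueness of the semigroup asks for.\<close>

lemma (in gauss_weight) trig_span_max_op:
  assumes c: "\<And>j k. c j k = c k j" and u: "u \<in> trig_span u0"
  shows "\<exists>v. (u, v) \<in> max_op a b c"
  using u
proof (induction rule: trig_span.induct)
  case (wave \<xi>)
  let ?E = "gexp G (ivec \<xi>)" and ?v = "diff_op a (\<lambda>j k. - b j k) c (gexp G (ivec \<xi>))"
  have "(?E, ?v) \<in> max_op a b c"
    unfolding max_op_def
  proof (intro CollectI case_prodI conjI allI impI)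
    show "?E \<in> L2" "?v \<in> L2" by (intro poly_gauss_L2[OF G] poly_gauss_wave poly_gauss_diff_op)+
    fix \<phi> :: "real^'n \<Rightarrow> complex" assume "test_fun \<phi>"
    from diff_op_transpose[OF this smooth_gexp[OF G], of c a b "ivec \<xi>"] c
    show "distr_of ?E (diff_op a b c \<phi>) = distr_of ?v \<phi>" by (simp add: distr_of_def mult.commute)
  qed
  moreover have "?E = (\<lambda>x. u0 x * wave \<xi> x)" by (simp add: fun_eq_iff gexp_ivec)
  ultimately show ?case by auto
next
  case (lincomb f g \<kappa> \<kappa>')
  then show ?case using max_op_lincomb by blast
qed

context ground_state
begin

lemma exp_minus_decay:
  assumes singular: "\<And>X. (\<And>j. re_matrix F *v (((*v) (im_matrix F) ^^ j) (cvec X)) = 0) \<Longrightarrow> X = 0"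
    and \<tau>: "\<tau> < 2 * Min (Im ` {z \<in> spectrum F. Im z > 0})"
  shows "\<exists>C>0. \<forall>t\<ge>0. \<forall>u\<in>L2. L2_norm (\<lambda>x. exp (\<mu> * of_real t)
        * exp_minus (max_op (\<lambda>j k. of_real (a j k)) (\<lambda>j k. \<i> * of_real (\<beta> j k)) (\<lambda>j k. of_real (c j k))) t u x
      - L2_inner u u0 / of_real ((L2_norm u0)\<^sup>2) * u0 x) \<le> C * exp (- \<tau> * t) * L2_norm u"
proof -
  interpret op: ou_pair G "N 1" "N (- 1)" m "\<lambda>j k. of_real (a j k)" "\<lambda>j k. \<i> * of_real (\<beta> j k)" "\<lambda>j k. of_real (c j k)"
    by (rule pair)
  let ?M = "max_op (\<lambda>j k. of_real (a j k)) (\<lambda>j k. \<i> * of_real (\<beta> j k)) (\<lambda>j k. of_real (c j k))"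
  have eig: "Re z > \<tau>" if z: "z \<in> spectrum (complexify (N (- 1)))" for z
  proof -
    note zF = spectrum_N[OF singular z]
    \<comment> \<open>The eigenvalue attached to \<open>z\<close> is \<open>\<i> * z / 2\<close>, so
      \<open>Re z\<close> is twice its imaginary part; this is the factor 2 in the rate.\<close>
    have "Min (Im ` {z \<in> spectrum F. Im z > 0}) \<le> Im (\<i> * z / 2)"
      by (rule Min_le) (use finite_spectrum[of F] zF in \<open>auto intro!: image_eqI[of _ _ "\<i> * z / 2"]\<close>)
    then show ?thesis using \<tau> by simp
  qed
  obtain C where C: "C > 0" "\<And>t x. t \<ge> 0 \<Longrightarrow> norm (op.dual.r t x) \<le> C * exp (- \<tau> * t) * norm x"
    using real_flow_decay[OF N_linear eig] unfolding op.dual.r_def by blast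
  obtain D where D: "D > 0" "\<And>x. norm (G2 x) \<le> D * norm x"
    using linear_bounded_pos[OF pos_def_mapD(1)[OF G2]] by blast
  obtain L where L: "L > 0" "\<And>x. norm (K x) \<le> L * norm x"
    using linear_bounded_pos[OF pos_def_mapD(1)[OF K]] by blast
  \<comment> \<open>The spectrum is known for \<open>N (- 1)\<close>, the generator of the dual
    flow. Since \<open>G2\<close> inverts \<open>K\<close>, the squared norm of \<open>?y\<close> is
    a K-pairing of \<open>?y\<close> with \<open>G2 ?y\<close>, and transposing the flow passes the
    decay on.\<close>
  have r: "norm (op.r t \<xi>) \<le> (L * C * D) * exp (- \<tau> * t) * norm \<xi>" if t: "t \<ge> 0" for t \<xi>
  proof -
    let ?y = "op.r t \<xi>"
    have "?y \<bullet> ?y = \<xi> \<bullet> K (op.dual.r t (G2 ?y))" using op.r_transposed[OF t, of \<xi> "G2 ?y"] by (simp add: K_G2)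
    also have "\<dots> \<le> norm \<xi> * norm (K (op.dual.r t (G2 ?y)))" by (rule norm_cauchy_schwarz)
    also have "\<dots> \<le> norm \<xi> * (L * norm (op.dual.r t (G2 ?y)))" by (intro mult_left_mono L) simp
    also have "\<dots> \<le> norm \<xi> * (L * (C * exp (- \<tau> * t) * norm (G2 ?y)))"
      using L(1) C(2)[OF t, of "G2 ?y"] by (intro mult_left_mono) auto
    also have "\<dots> \<le> norm \<xi> * (L * (C * exp (- \<tau> * t) * (D * norm ?y)))"
      using L(1) C(1) D(2)[of ?y] by (intro mult_left_mono) auto
    finally have "norm ?y * norm ?y \<le> ((L * C * D) * exp (- \<tau> * t) * norm \<xi>) * norm ?y"
      by (simp add: power2_norm_eq_inner[symmetric] power2_eq_square mult_ac)
    then show ?thesis using C(1) D(1) L(1) by (cases "?y = 0") auto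
  qed
  have LCD: "L * C * D > 0" using L C D by simp
  obtain B where B: "B > 0" "\<And>t u. t \<ge> 0 \<Longrightarrow> u \<in> L2 \<Longrightarrow> L2_norm (\<lambda>x. exp (of_real m * of_real t) * op.T t u x
      - L2_inner u u0 / of_real ((L2_norm u0)\<^sup>2) * u0 x) \<le> B * exp (- \<tau> * t) * L2_norm u"
    using op.T_decay[OF LCD r] by blast
  \<comment> \<open>The choice in \<open>exp_minus\<close> needs a witness, which is
    \<open>op.T\<close>; uniqueness then says that whatever is chosen agrees with
    \<open>op.T\<close> up to null sets.\<close>
  have "contraction_semigroup (exp_minus ?M) \<and> generator (exp_minus ?M) = {(u, \<lambda>x. - v x) |u v. (u, v) \<in> ?M}"
    unfolding exp_minus_def by (rule someI[of _ op.T]) (use op.T_semigroup op.generator_eq in blast)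
  then have S: "contraction_semigroup (exp_minus ?M)" "generator (exp_minus ?M) = generator op.T"
    using op.generator_eq by auto
  have ae: "AE x in lborel. exp_minus ?M t u x = op.T t u x" if "t \<ge> 0" "u \<in> L2" for t u
  proof (rule contraction_semigroup_unique[OF op.T_semigroup S(1,2) L2_dense_trig_span[OF u0_L2 u0_nz] _ that])
    fix u assume "u \<in> trig_span u0"
    then obtain v where "(u, v) \<in> ?M"
      using trig_span_max_op[of "\<lambda>j k. of_real (c j k)" u "\<lambda>j k. of_real (a j k)" "\<lambda>j k. \<i> * of_real (\<beta> j k)"] c_sym by auto
    then show "\<exists>v. (u, v) \<in> generator op.T" using op.max_op_generator by blast
  qed
  have "L2_norm (\<lambda>x. exp (\<mu> * of_real t) * exp_minus ?M t u x - L2_inner u u0 / of_real ((L2_norm u0)\<^sup>2) * u0 x)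
      \<le> B * exp (- \<tau> * t) * L2_norm u" if t: "t \<ge> 0" and u: "u \<in> L2" for t u
  proof -
    have m1: "exp_minus ?M t u \<in> borel_measurable borel" and m2: "op.T t u \<in> borel_measurable borel"
      and m3: "u0 \<in> borel_measurable borel"
      using contraction_opD(1)[OF contraction_semigroupD(1)[OF S(1) t] u]
        contraction_opD(1)[OF op.T_contraction[OF t] u] u0_L2 by (simp_all add: L2_def)
    have "L2_norm (\<lambda>x. exp (\<mu> * of_real t) * exp_minus ?M t u x - L2_inner u u0 / of_real ((L2_norm u0)\<^sup>2) * u0 x)
      = L2_norm (\<lambda>x. exp (of_real m * of_real t) * op.T t u x - L2_inner u u0 / of_real ((L2_norm u0)\<^sup>2) * u0 x)"
      by (rule L2_norm_cong_AE) (use ae[OF t u] m1 m2 m3 in \<open>auto simp: equations(1)\<close>)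
    then show ?thesis using B(2)[OF t u] by simp
  qed
  then show ?thesis using B(1) by blast
qed

end

theorem theorem2p3:
  fixes q :: "real ^ ('n::finite + 'n) \<Rightarrow> complex"
    and a :: "real ^ 'n \<Rightarrow> real"
    and u\<^sub>0 :: "real ^ 'n \<Rightarrow> complex"
  assumes "quadratic_form q"
    and "\<forall>X. Re (q X) \<ge> 0"
    and "singular_space q = {0}"
    and "real_op (weyl_op q)"
    and "quadratic_form a"
    and "\<forall>x. x \<noteq> 0 \<longrightarrow> a x > 0"
    and "u\<^sub>0 = (\<lambda>x. complex_of_real (exp (- a x)))"
    and "ker_op_minus (weyl_op q) (mu0 q) = L2_line u\<^sub>0"
    and "ker_op_minus (adjoint_op (weyl_op q)) (mu0 q) = L2_line u\<^sub>0"
    and "\<forall>c. schwartz (\<lambda>x. c * u\<^sub>0 x)"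
  shows "\<forall>\<tau>. 0 \<le> \<tau> \<and> \<tau> < tau0 q \<longrightarrow>
    (\<exists>C>0. \<forall>t\<ge>0. \<forall>u\<in>L2.
      L2_norm (\<lambda>x. exp (mu0 q * complex_of_real t) * exp_minus (weyl_op q) t u x
                 - L2_inner u u\<^sub>0 / complex_of_real ((L2_norm u\<^sub>0)\<^sup>2) * u\<^sub>0 x)
      \<le> C * exp (- \<tau> * t) * L2_norm u)"
proof -
  obtain G where G: "pos_def_map G" and aG: "\<And>x. a x = (x \<bullet> G x) / 2"
    using quadratic_form_pos_def_map[of a] assms(5,6) by blast
  interpret gauss_weight G by unfold_locales (rule G)
  have uG: "u\<^sub>0 = gexp G 0" and u0: "u\<^sub>0 = u0"
    by (simp_all add: assms(7) fun_eq_iff gexp_def cdot_def u0_def gauss_def aG)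
  have line: "u\<^sub>0 \<in> L2_line u\<^sub>0"
    unfolding L2_line_def u0 using u0_L2 by (auto intro!: exI[of _ 1])
  note W = weyl_op_eq_max_op[of q]
  have sym: "coef_xx q j k = coef_xx q k j" "coef_dd q j k = coef_dd q k j" for j k
    unfolding coef_xx_def coef_dd_def by (rule polar_commute)+
  have ker: "(gexp G 0, \<lambda>x. mu0 q * gexp G 0 x) \<in> max_op (coef_xx q) (coef_xd q) (coef_dd q)"
    and adj: "(gexp G 0, \<lambda>x. mu0 q * gexp G 0 x) \<in> adjoint_op (max_op (coef_xx q) (coef_xd q) (coef_dd q))"
    using line assms(8,9) by (auto simp: ker_op_minus_def uG W)
  define al be ce where "al j k = Re (coef_xx q j k)" and "be j k = Im (coef_xd q j k)" and "ce j k = Re (coef_dd q j k)" for j k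
  note re = real_coefficients[OF G assms(4)[unfolded W] sym]
  have coef: "coef_xx q = (\<lambda>j k. of_real (al j k))" "coef_xd q = (\<lambda>j k. \<i> * of_real (be j k))"
    "coef_dd q = (\<lambda>j k. of_real (ce j k))"
    by (simp_all add: fun_eq_iff al_def be_def ce_def complex_eq_iff re)
  have form: "Re (symp (cvec X) (ham (coef_xx q) (coef_xd q) (coef_dd q) *v cvec X)) \<ge> 0" for X
    using assms(2) by (simp only: polar_ham[OF assms(1), symmetric] quadratic_form_polar(2)[OF assms(1)])
  interpret ground_state G al be ce "mu0 q"
  proof (intro ground_state.intro G)
    show "al j k = al k j" "ce j k = ce k j" for j k using sym[of j k] by (simp_all add: al_def ce_def)
    fix x :: "real^'n"
    \<comment> \<open>Evaluating the real part of \<open>q\<close> at pure positions, and below at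
      pure momenta, isolates the two diagonal blocks.\<close>
    show "x \<bullet> cmap al x \<ge> 0"
      using form[of "\<chi> i. case i of Inl j \<Rightarrow> x $ j | Inr j \<Rightarrow> 0"]
      by (simp add: symp_def cvec_def ham_mult coef cmap_def inner_vec_def)
    show "x \<bullet> cmap ce x \<ge> 0"
      using form[of "momentum x"]
      by (simp add: symp_def cvec_def momentum_def ham_mult coef cmap_def inner_vec_def)
    show "gexp_symbol G (\<lambda>j k. of_real (al j k)) (\<lambda>j k. \<i> * of_real (- be j k)) (\<lambda>j k. of_real (ce j k)) 0 x = mu0 q"
      using kernel_symbol[OF G sym(2) ker] by (simp add: coef)
    show "gexp_symbol G (\<lambda>j k. of_real (al j k)) (\<lambda>j k. \<i> * of_real (be j k)) (\<lambda>j k. of_real (ce j k)) 0 x = cnj (mu0 q)"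
      using adjoint_kernel_symbol[OF G sym(2) adj] by (simp add: coef)
  qed
  have F: "hamilton_map q = F" unfolding hamilton_map_eq[OF assms(1)] F_def coef ..
  have singular: "X = 0" if "\<And>j. re_matrix F *v (((*v) (im_matrix F) ^^ j) (cvec X)) = 0" for X
    using assms(3) that unfolding singular_space_def Let_def F by blast
  have "\<exists>C>0. \<forall>t\<ge>0. \<forall>u\<in>L2.
      L2_norm (\<lambda>x. exp (mu0 q * complex_of_real t) * exp_minus (weyl_op q) t u x
                 - L2_inner u u\<^sub>0 / complex_of_real ((L2_norm u\<^sub>0)\<^sup>2) * u\<^sub>0 x)
      \<le> C * exp (- \<tau> * t) * L2_norm u" if "\<tau> < tau0 q" for \<tau>
    unfolding W coef u0 using exp_minus_decay[OF singular, of \<tau>] that by (simp add: tau0_def F)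
  then show ?thesis by blast
qed

end
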